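(* For each $\gamma > 0$, there exists a constant $C(\gamma) > 0$ such that the following holds. Let $\lambda$ and $\varepsilon$ be real numbers with $2 + \gamma \le \lambda \le 3$ and $\varepsilon > 0$. There exists $n_0 = n_0(\gamma,\lambda,\varepsilon)$ such that, for all integers $n \ge n_0$ and all $k \in \mathbb{N}$ with $k \ge (\log n)^4$ and $\lambda k/2 \in \mathbb{Z}$ for which the family of sets $A \subset [n]$ with $|A| = k$ and $|A+A| \le \lambda k$ is non-empty: if $A$ is chosen uniformly at random from this family, then, with probability at least $1 - 2\varepsilon$, there exists an arithmetic progression $P$ with $$A \subset P \qquad\text{and}\qquad |P| \le \frac{\lambda k}{2} + C(\gamma)\log(1/\varepsilon).$$
   Context: $[n] = \{1,\ldots,n\}$; $A + A = \{a+a' : a,a' \in A\}$; $\log$ is the natural logarithm. An arithmetic progression is a finite set of integers of the form $\{a, a+d, \ldots, a+(\ell-1)d\}$ with $d \ge 1$, and $|P|$ denotes its number of elements. *)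

theory Defs
  imports "HOL-Probability.Probability" "HOL-Library.Set_Algebras"
begin

text \<open>
  Progressions are sets of integers, so they may leave \<open>[n]\<close>; they are non-empty, the length
  \<open>l\<close> being at least 1.
\<close>

definition arith_progression :: "int set \<Rightarrow> bool" where
  "arith_progression P \<longleftrightarrow>
     (\<exists>(a::int) (d::int) (l::nat). d \<ge> 1 \<and> l \<ge> 1 \<and> P = (\<lambda>i. a + int i * d) ` {..<l})"

text \<open>In the following, \<open>A + A\<close> is the elementwise sum of sets from \<^theory>\<open>HOL-Library.Set_Algebras\<close>.\<close>

definition small_sumset_family :: "nat \<Rightarrow> nat \<Rightarrow> real \<Rightarrow> int set set" where
  "small_sumset_family n k lam =
     {A. A \<subseteq> {1..int n} \<and> card A = k \<and> real (card (A + A)) \<le> lam * real k}"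

end

theory Submission imports Defs "HOL-Real_Asymp.Real_Asymp" begin

text \<open>Normalise \<open>A\<close> to \<open>A' \<subseteq> {0..M}\<close> with \<open>0, M \<in> A'\<close> and \<open>Gcd A' = 1\<close>, and put \<open>N = \<lambda> k / 2\<close>,
  \<open>p = k / N\<close>, \<open>q = 1 - p\<close>, \<open>s = M + 1 - N\<close>.  The number of progressions of length \<open>M + 1\<close> inside \<open>[n]\<close>
  decreases with \<open>M\<close>, and every \<open>k\<close>-subset of a progression of length \<open>N\<close> is in the family, so it
  suffices that the numbers of such \<open>A'\<close>, summed over \<open>s > C log (1 / \<epsilon>)\<close>, are a small fraction
  of \<open>N choose k\<close>.

  Let \<open>S = A' + M \<int>\<close>.  If \<open>S + S\<close> misses many residues modulo \<open>M\<close>, an atom in the sense of Hamidoune's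
  isoperimetric method is either spread out, and then a few of its elements generate a large
  subgroup along which \<open>S\<close> has small boundary, so that few bits describe \<open>S\<close>; or it is a coset of a
  large subgroup that captures \<open>A'\<close> in few classes.  Otherwise \<open>A' + A'\<close> misses about \<open>2 s\<close> sums near
  the two ends of \<open>[0, 2 M]\<close>.  For a random set of density \<open>p\<close>, each missing sum costs a factor
  slightly less than \<open>sqrt q\<close>, hence \<open>2 s\<close> of them cost \<open>q ^ s c ^ s\<close> with \<open>c < 1\<close>, whereas lengthening the interval
  from \<open>N\<close> to \<open>N + s\<close> only gains \<open>(1 / q) ^ s\<close>.\<close>

text \<open>The saving c < 1 comes from a tilt. Since 0 and M belong to A', a missing sum is also a
  non-element of A', whose weight q is split as \<open>g * \<theta>\<close>: \<theta> pays for the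
  missing sum, g stays in the weight. With weights p and g the sum over all subsets grows
  exponentially, but two missing sums l and l - e forbid all edges of e interleaved paths, and the
  weight of the independent sets of a path grows like the positive root of x^2 = g x + p g, which is
  at most 1 exactly when g (1 + p) \<le> 1. So one close pair of missing sums at each end keeps the
  g-weight bounded. For q \<le> 1/3, that is \<lambda> \<le> 3, the choice g = 1.03 sqrt q is
  allowed, whence \<theta> = q / g < sqrt q.

  The other obstacle: one non-element can be missing both as x and as x + M. This happens exactly at
  residues missed modulo M, so sets that miss many residues are counted separately. The exponent 4
  of log n makes room for the parameters of that count. An error term log (1 / \<epsilon>) further
  demands that for small s no factor growing with k is lost.\<close>

section \<open>Weighted sums over subsets\<close>

text \<open>For \<open>g = 1 - p\<close> this is the probability that a random subset of \<open>V\<close> of density \<open>p\<close> satisfies \<open>P\<close>;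
  other values of \<open>g\<close> tilt the weight by the number of non-elements.\<close>

definition wsum :: "real \<Rightarrow> real \<Rightarrow> 'a set \<Rightarrow> ('a set \<Rightarrow> bool) \<Rightarrow> real" where
  "wsum p g V P = (\<Sum>S | S \<subseteq> V \<and> P S. p ^ card S * g ^ card (V - S))"

lemma wsum_nonneg: "p \<ge> 0 \<Longrightarrow> g \<ge> 0 \<Longrightarrow> wsum p g V P \<ge> 0"
  unfolding wsum_def by (intro sum_nonneg) auto

lemma wsum_mono:
  assumes "finite V" "p \<ge> 0" "g \<ge> 0" "\<And>S. S \<subseteq> V \<Longrightarrow> P S \<Longrightarrow> Q S"
  shows "wsum p g V P \<le> wsum p g V Q"
  unfolding wsum_def using assms by (intro sum_mono2) auto

lemma wsum_cong:
  assumes "\<And>S. S \<subseteq> V \<Longrightarrow> P S \<longleftrightarrow> Q S"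
  shows "wsum p g V P = wsum p g V Q"
proof -
  have "{S. S \<subseteq> V \<and> P S} = {S. S \<subseteq> V \<and> Q S}"
    using assms by auto
  then show ?thesis by (simp add: wsum_def)
qed

lemma wsum_empty: "wsum p g {} P = (if P {} then 1 else 0)"
proof -
  have "{S. S \<subseteq> {} \<and> P S} = (if P {} then {{}} else {})" by auto
  then show ?thesis by (simp add: wsum_def)
qed

text \<open>Independence of what is seen on disjoint sets. It holds for all weights, so it also
  serves the tilted ones, where \<open>p + g\<close> is not 1.\<close>

lemma wsum_union:
  assumes "finite V" "finite W" "V \<inter> W = {}"
  shows "wsum p g (V \<union> W) (\<lambda>S. P (S \<inter> V) \<and> Q (S \<inter> W)) = wsum p g V P * wsum p g W Q"
proof -
  let ?A = "{S. S \<subseteq> V \<and> P S}" and ?B = "{S. S \<subseteq> W \<and> Q S}"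
  have fin: "finite ?A" "finite ?B" using assms by auto
  have "wsum p g (V \<union> W) (\<lambda>S. P (S \<inter> V) \<and> Q (S \<inter> W))
      = (\<Sum>(S,T)\<in>?A \<times> ?B. (p ^ card S * g ^ card (V - S)) * (p ^ card T * g ^ card (W - T)))"
    unfolding wsum_def
  proof (rule sum.reindex_bij_witness[where i = "\<lambda>(S,T). S \<union> T" and j = "\<lambda>S. (S \<inter> V, S \<inter> W)"])
    fix S assume "S \<in> {S. S \<subseteq> V \<union> W \<and> P (S \<inter> V) \<and> Q (S \<inter> W)}"
    then have S: "S \<subseteq> V \<union> W" by auto
    have c1: "card S = card (S \<inter> V) + card (S \<inter> W)"
    proof -
      have "S = (S \<inter> V) \<union> (S \<inter> W)" using S by auto
      moreover have "card ((S \<inter> V) \<union> (S \<inter> W)) = card (S \<inter> V) + card (S \<inter> W)"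
        using assms by (intro card_Un_disjoint) auto
      ultimately show ?thesis by simp
    qed
    have c2: "card (V \<union> W - S) = card (V - S \<inter> V) + card (W - S \<inter> W)"
    proof -
      have "V \<union> W - S = (V - S \<inter> V) \<union> (W - S \<inter> W)" by auto
      moreover have "card ((V - S \<inter> V) \<union> (W - S \<inter> W)) = card (V - S \<inter> V) + card (W - S \<inter> W)"
        using assms by (intro card_Un_disjoint) auto
      ultimately show ?thesis by simp
    qed
    show "(case (S \<inter> V, S \<inter> W) of (S, T) \<Rightarrow>
         p ^ card S * g ^ card (V - S) * (p ^ card T * g ^ card (W - T))) = p ^ card S * g ^ card (V \<union> W - S)"
      by (simp add: c1 c2 power_add algebra_simps)
  next
    fix b assume "b \<in> ?A \<times> ?B"
    then obtain S T where b: "b = (S,T)" "S \<subseteq> V" "T \<subseteq> W" "P S" "Q T" by auto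
    have "(S \<union> T) \<inter> V = S" "(S \<union> T) \<inter> W = T" using b assms by auto
    then show "(\<lambda>S. (S \<inter> V, S \<inter> W)) ((\<lambda>(S,T). S \<union> T) b) = b"
      "(\<lambda>(S,T). S \<union> T) b \<in> {S. S \<subseteq> V \<union> W \<and> P (S \<inter> V) \<and> Q (S \<inter> W)}"
      using b by auto
  qed (auto)
  also have "\<dots> = wsum p g V P * wsum p g W Q"
    unfolding wsum_def by (simp add: sum_product sum.cartesian_product)
  finally show ?thesis .
qed

lemma wsum_insert:
  assumes "finite V" "x \<notin> V"
  shows "wsum p g (insert x V) P = g * wsum p g V P + p * wsum p g V (\<lambda>S. P (insert x S))"
proof -
  let ?A = "{S. S \<subseteq> V \<and> P S}" and ?B = "{S. S \<subseteq> V \<and> P (insert x S)}"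
  have eq: "{S. S \<subseteq> insert x V \<and> P S} = ?A \<union> insert x ` ?B"
  proof (intro equalityI subsetI)
    fix S assume S: "S \<in> {S. S \<subseteq> insert x V \<and> P S}"
    show "S \<in> ?A \<union> insert x ` ?B"
    proof (cases "x \<in> S")
      case True
      then have "S = insert x (S - {x})" by auto
      moreover have "S - {x} \<in> ?B" using S True by (auto simp: insert_absorb)
      ultimately show ?thesis by blast
    qed (use S in auto)
  qed auto
  have inj: "inj_on (insert x) ?B"
    using assms by (intro inj_onI) (metis (no_types, lifting) Diff_insert_absorb mem_Collect_eq subsetD)
  have "wsum p g (insert x V) P
     = (\<Sum>S\<in>?A. p ^ card S * g ^ card (insert x V - S))
      + (\<Sum>S\<in>insert x ` ?B. p ^ card S * g ^ card (insert x V - S))"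
    unfolding wsum_def eq using assms by (intro sum.union_disjoint) auto
  also have "(\<Sum>S\<in>?A. p ^ card S * g ^ card (insert x V - S)) = g * wsum p g V P"
    unfolding wsum_def sum_distrib_left
  proof (intro sum.cong refl)
    fix S assume S: "S \<in> ?A"
    then have "insert x V - S = insert x (V - S)" using assms by auto
    then show "p ^ card S * g ^ card (insert x V - S) = g * (p ^ card S * g ^ card (V - S))"
      using assms by simp
  qed
  also have "(\<Sum>S\<in>insert x ` ?B. p ^ card S * g ^ card (insert x V - S))
      = p * wsum p g V (\<lambda>S. P (insert x S))"
    unfolding wsum_def sum_distrib_left sum.reindex[OF inj] o_def
  proof (intro sum.cong refl)
    fix S assume S: "S \<in> ?B"
    then have "insert x V - insert x S = V - S" using assms by auto
    moreover have "card (insert x S) = Suc (card S)"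
      using S assms by (intro card_insert_disjoint) (auto intro: finite_subset)
    ultimately show "p ^ card (insert x S) * g ^ card (insert x V - insert x S)
       = p * (p ^ card S * g ^ card (V - S))" by simp
  qed
  finally show ?thesis .
qed

lemma wsum_total: "finite V \<Longrightarrow> wsum p g V (\<lambda>_. True) = (p + g) ^ card V"
proof (induction V rule: finite_induct)
  case (insert x F)
  then show ?case by (simp add: wsum_insert algebra_simps)
qed (simp add: wsum_empty)

text \<open>Each point outside \<open>V\<close> is summed out and contributes \<open>p + g\<close>,
  which is 1 for a genuine probability.\<close>

lemma wsum_restrict:
  assumes "finite U" "V \<subseteq> U"
  shows "wsum p g U (\<lambda>S. P (S \<inter> V)) = wsum p g V P * (p + g) ^ card (U - V)"
proof -
  have "finite V" using assms finite_subset by blast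
  then have "wsum p g (V \<union> (U - V)) (\<lambda>S. P (S \<inter> V) \<and> True) = wsum p g V P * wsum p g (U - V) (\<lambda>_. True)"
    using assms by (intro wsum_union) auto
  then show ?thesis using assms by (simp add: wsum_total Un_absorb1)
qed

lemma wsum_union_bound:
  assumes "finite V" "finite I" "p \<ge> 0" "g \<ge> 0"
    and "\<And>S. S \<subseteq> V \<Longrightarrow> P S \<Longrightarrow> \<exists>i\<in>I. R i S"
  shows "wsum p g V P \<le> (\<Sum>i\<in>I. wsum p g V (R i))"
proof -
  let ?f = "\<lambda>S. p ^ card S * g ^ card (V - S)"
  have "wsum p g V P \<le> (\<Sum>S\<in>(\<Union>i\<in>I. {S. S \<subseteq> V \<and> R i S}). ?f S)"
    unfolding wsum_def using assms by (intro sum_mono2) auto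
  also have "\<dots> \<le> (\<Sum>i\<in>I. wsum p g V (R i))"
    unfolding wsum_def using assms(2)
  proof (induction I rule: finite_induct)
    case (insert i I)
    have "sum ?f ({S. S \<subseteq> V \<and> R i S} \<union> (\<Union>i\<in>I. {S. S \<subseteq> V \<and> R i S}))
       \<le> sum ?f {S. S \<subseteq> V \<and> R i S} + sum ?f (\<Union>i\<in>I. {S. S \<subseteq> V \<and> R i S})"
      using assms insert.hyps sum_nonneg[of "{S. S \<subseteq> V \<and> R i S} \<inter> (\<Union>i\<in>I. {S. S \<subseteq> V \<and> R i S})" ?f]
        sum.union_inter[of "{S. S \<subseteq> V \<and> R i S}" "\<Union>i\<in>I. {S. S \<subseteq> V \<and> R i S}" ?f] by auto
    then show ?case using insert by auto
  qed simp
  finally show ?thesis .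
qed

lemma wsum_image:
  assumes "inj_on f V"
  shows "wsum p g (f ` V) P = wsum p g V (\<lambda>S. P (f ` S))"
  unfolding wsum_def
proof (rule sum.reindex_bij_witness[where i = "\<lambda>S. f ` S" and j = "\<lambda>T. V \<inter> f -` T"])
  fix T assume T: "T \<in> {S. S \<subseteq> f ` V \<and> P S}"
  show 1: "f ` (V \<inter> f -` T) = T" using T by auto
  show "V \<inter> f -` T \<in> {S. S \<subseteq> V \<and> P (f ` S)}" using T 1 by auto
  have "card (V \<inter> f -` T) = card T"
    using 1 assms by (metis card_image inf_le1 inj_on_subset)
  moreover have "f ` (V - V \<inter> f -` T) = f ` V - T" using T by auto
  then have "card (V - V \<inter> f -` T) = card (f ` V - T)"
    using assms by (metis Diff_subset card_image inj_on_subset)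
  ultimately show "p ^ card (V \<inter> f -` T) * g ^ card (V - V \<inter> f -` T) = p ^ card T * g ^ card (f ` V - T)"
    by simp
next
  fix S assume S: "S \<in> {S. S \<subseteq> V \<and> P (f ` S)}"
  show "V \<inter> f -` f ` S = S" using S assms by (auto dest: inj_onD)
  show "f ` S \<in> {S. S \<subseteq> f ` V \<and> P S}" using S by auto
qed

text \<open>The tilt: of the weight \<open>g * \<theta>\<close> of a non-element, the part \<theta>
  is spent on the holes, of which there are at least \<open>Z\<close>, and \<open>P\<close> is left
  to be estimated with the weight \<open>g\<close>.\<close>

lemma wsum_holes:
  assumes "finite V" "0 \<le> p" "0 \<le> g" "0 \<le> \<theta>" "\<theta> \<le> 1"
  shows "wsum p (g * \<theta>) V (\<lambda>S. P S \<and> Z \<le> card (V - S)) \<le> \<theta> ^ Z * wsum p g V P"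
proof -
  have "wsum p (g * \<theta>) V (\<lambda>S. P S \<and> Z \<le> card (V - S))
     \<le> (\<Sum>S | S \<subseteq> V \<and> P S \<and> Z \<le> card (V - S). \<theta> ^ Z * (p ^ card S * g ^ card (V - S)))"
    unfolding wsum_def
  proof (rule sum_mono)
    fix S assume "S \<in> {S. S \<subseteq> V \<and> P S \<and> Z \<le> card (V - S)}"
    then have "\<theta> ^ card (V - S) \<le> \<theta> ^ Z" using assms by (intro power_decreasing) auto
    then have "(p ^ card S * g ^ card (V - S)) * \<theta> ^ card (V - S) \<le> (p ^ card S * g ^ card (V - S)) * \<theta> ^ Z"
      using assms by (intro mult_left_mono) auto
    then show "p ^ card S * (g * \<theta>) ^ card (V - S) \<le> \<theta> ^ Z * (p ^ card S * g ^ card (V - S))"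
      by (simp add: power_mult_distrib mult_ac)
  qed
  also have "\<dots> \<le> (\<Sum>S | S \<subseteq> V \<and> P S. \<theta> ^ Z * (p ^ card S * g ^ card (V - S)))"
    using assms by (intro sum_mono2) auto
  finally show ?thesis by (simp add: wsum_def sum_distrib_left)
qed

text \<open>The pairs \<open>u i\<close>, \<open>v i\<close> are disjoint, so the events are
  independent, and each pair fails to be selected entirely with probability
  \<open>1 - p\<^sup>2\<close>.\<close>

lemma wsum_matching:
  assumes "finite U" "p + q = 1" "p \<ge> 0" "q \<ge> 0"
    and "inj_on u {..<n}" "inj_on v {..<n}" "u ` {..<n} \<inter> v ` {..<n} = {}"
    and "u ` {..<n} \<subseteq> U" "v ` {..<n} \<subseteq> U"
  shows "wsum p q U (\<lambda>S. \<forall>i<n. \<not> (u i \<in> S \<and> v i \<in> S)) = (1 - p\<^sup>2) ^ n"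
  using assms
proof (induction n arbitrary: U)
  case 0
  then show ?case by (simp add: wsum_total)
next
  case (Suc n)
  define W where "W = U - {u n, v n}"
  have ne: "u n \<noteq> v n" using Suc.prems(7) by auto
  have uv: "u i \<noteq> v j" if "i < Suc n" "j < Suc n" for i j
    using that Suc.prems(7) by fastforce
  have uW: "u i \<in> W" if "i < n" for i
    using that Suc.prems uv[of i n] unfolding W_def by (auto dest: inj_onD)
  have vW: "v i \<in> W" if "i < n" for i
    using that Suc.prems uv[of n i] unfolding W_def by (auto dest: inj_onD)
  let ?P = "\<lambda>S. \<forall>i<n. \<not> (u i \<in> S \<and> v i \<in> S)"
  have un: "u n \<in> U" "v n \<in> U" using Suc.prems by auto
  have U: "U = W \<union> {u n, v n}" using un by (auto simp: W_def)
  have "wsum p q U (\<lambda>S. \<forall>i<Suc n. \<not> (u i \<in> S \<and> v i \<in> S))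
     = wsum p q (W \<union> {u n, v n}) (\<lambda>S. ?P (S \<inter> W) \<and> (\<lambda>S. \<not> (u n \<in> S \<and> v n \<in> S)) (S \<inter> {u n, v n}))"
    unfolding U[symmetric] using uW vW by (intro wsum_cong) (auto simp: less_Suc_eq)
  also have "\<dots> = wsum p q W ?P * wsum p q {u n, v n} (\<lambda>S. \<not> (u n \<in> S \<and> v n \<in> S))"
    using Suc.prems by (intro wsum_union) (auto simp: W_def)
  also have "wsum p q W ?P = (1 - p\<^sup>2) ^ n"
  proof (rule Suc.IH)
    show "u ` {..<n} \<inter> v ` {..<n} = {}" using Suc.prems(7) by (auto simp: lessThan_Suc)
  qed (use Suc.prems uW vW in \<open>auto simp: W_def inj_on_def\<close>)
  also have "wsum p q {u n, v n} (\<lambda>S. \<not> (u n \<in> S \<and> v n \<in> S)) = 1 - p\<^sup>2"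
  proof -
    have q: "q = 1 - p" using Suc.prems by simp
    show ?thesis using ne unfolding q
      by (simp add: wsum_insert wsum_empty power2_eq_square algebra_simps)
  qed
  finally show ?case by simp
qed

text \<open>The potential \<open>g ^ c\<close>, with \<open>c\<close> the number of selected vertices among the last \<open>e\<close>,
  does not increase when a vertex is appended; this is where \<open>g * (1 + p) \<le> 1\<close> enters.\<close>

lemma wsum_chain:
  fixes v :: "nat \<Rightarrow> 'a"
  assumes "inj_on v {..<n}" "0 \<le> p" "0 < g" "g * (1 + p) \<le> 1" "1 \<le> e"
  shows "wsum p g (v ` {..<n}) (\<lambda>S. \<forall>i. i + e < n \<longrightarrow> \<not> (v i \<in> S \<and> v (i + e) \<in> S)) \<le> (1 / g) ^ e"
proof -
  define T where "T m S = card {i. i < m \<and> m \<le> i + e \<and> v i \<in> S}" for m S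
  define ok where "ok m S \<longleftrightarrow> (\<forall>i. i + e < m \<longrightarrow> \<not> (v i \<in> S \<and> v (i + e) \<in> S))" for m S
  define F where "F m S = p ^ card S * g ^ card (v ` {..<m} - S)" for m S
  have "g * 1 \<le> g * (1 + p)" using assms by (intro mult_left_mono) auto
  then have g1: "g \<le> 1" using assms(4) by linarith
  have main: "m \<le> n \<Longrightarrow> (\<Sum>S | S \<subseteq> v ` {..<m} \<and> ok m S. F m S * g ^ T m S) \<le> 1" for m
  proof (induction m)
    case 0
    have "{S. S \<subseteq> v ` {..<0} \<and> ok 0 S} = {{}}" by (auto simp: ok_def)
    then show ?case by (simp add: F_def T_def)
  next
    case (Suc m)
    let ?V = "v ` {..<m}"
    have vm: "v m \<notin> ?V" using assms(1) Suc.prems by (auto dest: inj_onD)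
    have inj: "inj_on v {..<Suc m}" using assms(1) Suc.prems by (auto intro: inj_on_subset)
    have V: "v ` {..<Suc m} = insert (v m) ?V" by (simp add: lessThan_Suc)
    let ?A = "{S. S \<subseteq> ?V \<and> ok m S}"
    have eq: "{S. S \<subseteq> v ` {..<Suc m} \<and> ok (Suc m) S}
        \<subseteq> ?A \<union> insert (v m) ` {S \<in> ?A. e \<le> m \<longrightarrow> v (m - e) \<notin> S}"
    proof
      fix S assume S: "S \<in> {S. S \<subseteq> v ` {..<Suc m} \<and> ok (Suc m) S}"
      have SV: "S \<subseteq> insert (v m) ?V" using S unfolding V by simp
      have okS: "ok (Suc m) S" using S by simp
      then have okm: "ok m S" unfolding ok_def by (meson less_SucI)
      show "S \<in> ?A \<union> insert (v m) ` {S \<in> ?A. e \<le> m \<longrightarrow> v (m - e) \<notin> S}"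
      proof (cases "v m \<in> S")
        case False
        then have "S \<subseteq> ?V" using SV by (simp add: subset_insert)
        then show ?thesis using okm by simp
      next
        case True
        have a: "v (m - e) \<notin> S" if "e \<le> m"
        proof -
          have "m - e + e < Suc m \<longrightarrow> \<not> (v (m - e) \<in> S \<and> v (m - e + e) \<in> S)"
            using okS unfolding ok_def by blast
          then show ?thesis using that True by simp
        qed
        have "ok m (S - {v m})" using okm unfolding ok_def by (meson Diff_iff)
        moreover have "S - {v m} \<subseteq> ?V" using SV by (simp add: subset_insert_iff Diff_subset_conv)
        ultimately have "S - {v m} \<in> {S \<in> ?A. e \<le> m \<longrightarrow> v (m - e) \<notin> S}" using a by simp
        then have "insert (v m) (S - {v m}) \<in> insert (v m) ` {S \<in> ?A. e \<le> m \<longrightarrow> v (m - e) \<notin> S}"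
          by (rule imageI)
        then show ?thesis unfolding insert_Diff[OF True] by (rule UnI2)
      qed
    qed
    have T0: "T (Suc m) S + (if e \<le> m \<and> v (m - e) \<in> S then 1 else 0) = T m S" if "S \<subseteq> ?V" for S
    proof (cases "e \<le> m \<and> v (m - e) \<in> S")
      case True
      have "v m \<notin> S" using vm that by blast
      have "{i. i < m \<and> m \<le> i + e \<and> v i \<in> S} = insert (m - e) {i. i < Suc m \<and> Suc m \<le> i + e \<and> v i \<in> S}"
      proof (rule set_eqI)
        fix i
        show "i \<in> {i. i < m \<and> m \<le> i + e \<and> v i \<in> S} \<longleftrightarrow> i \<in> insert (m - e) {i. i < Suc m \<and> Suc m \<le> i + e \<and> v i \<in> S}"
          using True \<open>v m \<notin> S\<close> assms(5) by (cases "i = m"; cases "i = m - e") auto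
      qed
      moreover have "m - e \<notin> {i. i < Suc m \<and> Suc m \<le> i + e \<and> v i \<in> S}" using True by simp
      moreover have "finite {i. i < Suc m \<and> Suc m \<le> i + e \<and> v i \<in> S}" by simp
      ultimately show ?thesis using True unfolding T_def by simp
    next
      case False
      have "v m \<notin> S" using vm that by blast
      have "{i. i < m \<and> m \<le> i + e \<and> v i \<in> S} = {i. i < Suc m \<and> Suc m \<le> i + e \<and> v i \<in> S}"
      proof (rule set_eqI)
        fix i
        have "\<not> (v i \<in> S \<and> i = m - e \<and> e \<le> m)" using False by auto
        then show "i \<in> {i. i < m \<and> m \<le> i + e \<and> v i \<in> S} \<longleftrightarrow> i \<in> {i. i < Suc m \<and> Suc m \<le> i + e \<and> v i \<in> S}"
          using \<open>v m \<notin> S\<close> by (cases "i = m"; cases "v i \<in> S") auto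
      qed
      then show ?thesis using False unfolding T_def by simp
    qed
    have T1: "T (Suc m) (insert (v m) S) = T (Suc m) S + 1" if "S \<subseteq> ?V" for S
    proof -
      have "v m \<notin> S" using vm that by blast
      have vi: "v i = v m \<longleftrightarrow> i = m" if "i < Suc m" for i using inj that by (auto dest: inj_onD)
      have "{i. i < Suc m \<and> Suc m \<le> i + e \<and> v i \<in> insert (v m) S}
          = insert m {i. i < Suc m \<and> Suc m \<le> i + e \<and> v i \<in> S}"
      proof (rule set_eqI)
        fix i
        show "i \<in> {i. i < Suc m \<and> Suc m \<le> i + e \<and> v i \<in> insert (v m) S}
          \<longleftrightarrow> i \<in> insert m {i. i < Suc m \<and> Suc m \<le> i + e \<and> v i \<in> S}"
          using assms(5) vi[of i] by (cases "i = m") auto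
      qed
      then show ?thesis using \<open>v m \<notin> S\<close> unfolding T_def by simp
    qed
    have F0: "F (Suc m) S = g * F m S" if "S \<subseteq> ?V" for S
    proof -
      have "v ` {..<Suc m} - S = insert (v m) (?V - S)" using vm that V by auto
      then show ?thesis using vm by (simp add: F_def)
    qed
    have F1: "F (Suc m) (insert (v m) S) = p * F m S" if "S \<subseteq> ?V" for S
    proof -
      have "v ` {..<Suc m} - insert (v m) S = ?V - S" using vm that V by auto
      moreover have "card (insert (v m) S) = Suc (card S)"
        using that vm by (intro card_insert_disjoint) (auto intro: finite_subset)
      ultimately show ?thesis by (simp add: F_def)
    qed
    have Fp: "F m S \<ge> 0" for m S using assms by (simp add: F_def)
    let ?B = "{S \<in> ?A. e \<le> m \<longrightarrow> v (m - e) \<notin> S}"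
    have injB: "inj_on (insert (v m)) ?B"
      using vm by (intro inj_onI) (metis (no_types, lifting) Diff_insert_absorb mem_Collect_eq subsetD)
    let ?G = "\<lambda>S. F (Suc m) S * g ^ T (Suc m) S"
    have "(\<Sum>S | S \<subseteq> v ` {..<Suc m} \<and> ok (Suc m) S. ?G S)
       \<le> (\<Sum>S\<in>?A \<union> insert (v m) ` ?B. ?G S)"
      using eq Fp assms by (intro sum_mono2) auto
    also have "\<dots> = (\<Sum>S\<in>?A. ?G S) + (\<Sum>S\<in>insert (v m) ` ?B. ?G S)"
      using vm by (intro sum.union_disjoint) auto
    also have "(\<Sum>S\<in>insert (v m) ` ?B. ?G S) = (\<Sum>S\<in>?B. ?G (insert (v m) S))"
      by (subst sum.reindex[OF injB]) (simp add: o_def)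
    also have "(\<Sum>S\<in>?B. ?G (insert (v m) S))
        = (\<Sum>S\<in>?A. if e \<le> m \<longrightarrow> v (m - e) \<notin> S then ?G (insert (v m) S) else 0)"
      by (subst sum.inter_filter[symmetric]) auto
    also have "(\<Sum>S\<in>?A. ?G S) + \<dots> = (\<Sum>S\<in>?A. ?G S + (if e \<le> m \<longrightarrow> v (m - e) \<notin> S then ?G (insert (v m) S) else 0))"
      by (simp add: sum.distrib)
    also have "\<dots> \<le> (\<Sum>S\<in>?A. F m S * g ^ T m S)"
    proof (rule sum_mono)
      fix S assume "S \<in> ?A"
      then have S: "S \<subseteq> ?V" by auto
      show "?G S + (if e \<le> m \<longrightarrow> v (m - e) \<notin> S then ?G (insert (v m) S) else 0) \<le> F m S * g ^ T m S"
      \<comment> \<open>If \<open>v (m - e)\<close> is selected, \<open>v m\<close> cannot be: its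
        factor \<open>g\<close> is balanced by the drop of the count by one. Otherwise both choices
        are open and contribute g + p * g \<le> 1.\<close>
      proof (cases "e \<le> m \<and> v (m - e) \<in> S")
        case True
        then have "T m S = Suc (T (Suc m) S)" using T0[OF S] by simp
        then show ?thesis using True F0[OF S] by simp
      next
        case False
        then have "T (Suc m) S = T m S" using T0[OF S] unfolding if_not_P[OF False] by simp
        then have "?G S + ?G (insert (v m) S) = (F m S * g ^ T m S) * (g * (1 + p))"
          using F0[OF S] F1[OF S] T1[OF S] by (simp add: algebra_simps)
        also have "\<dots> \<le> (F m S * g ^ T m S) * 1" using Fp assms by (intro mult_left_mono) auto
        finally show ?thesis using False by auto
      qed
    qed
    also have "\<dots> \<le> 1" using Suc by simp
    finally show ?case .
  qed
  have "g ^ e * wsum p g (v ` {..<n}) (ok n) = (\<Sum>S | S \<subseteq> v ` {..<n} \<and> ok n S. F n S * g ^ e)"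
    by (simp add: wsum_def F_def sum_distrib_left mult_ac)
  also have "\<dots> \<le> (\<Sum>S | S \<subseteq> v ` {..<n} \<and> ok n S. F n S * g ^ T n S)"
  proof (intro sum_mono mult_left_mono)
    fix S
    have "{i. i < n \<and> n \<le> i + e \<and> v i \<in> S} \<subseteq> {n - e..<n}" by auto
    then have "T n S \<le> card {n - e..<n}" unfolding T_def by (intro card_mono) auto
    then have "T n S \<le> e" by simp
    then show "g ^ e \<le> g ^ T n S" using assms g1 by (intro power_decreasing) auto
    show "F n S \<ge> 0" using assms by (simp add: F_def)
  qed
  also have "\<dots> \<le> 1" using main by simp
  finally have "g ^ e * wsum p g (v ` {..<n}) (ok n) \<le> 1" .
  then have "wsum p g (v ` {..<n}) (ok n) \<le> (1 / g) ^ e"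
    using assms by (simp add: power_one_over field_simps)
  then show ?thesis by (simp add: ok_def[abs_def])
qed

section \<open>Missing sums of random sets\<close>

definition missing :: "int set \<Rightarrow> int \<Rightarrow> int set" where
  "missing S m = {x \<in> {0..m}. x \<notin> S + S}"

lemma finite_missing [simp]: "finite (missing S m)"
  unfolding missing_def by (rule finite_subset[of _ "{0..m}"]) auto

lemma wsum_missing_one:
  assumes "0 \<le> p" "0 \<le> q" "p + q = 1" "int x \<le> R"
  shows "wsum p q {0..R} (\<lambda>S. int x \<notin> S + S) \<le> (1 - p\<^sup>2) ^ ((x + 1) div 2)"
proof -
  \<comment> \<open>For even \<open>x\<close> the diagonal x / 2 + x / 2 is left out, since it is
    not a pair of distinct points.\<close>
  define n where "n = (x + 1) div 2"
  have "wsum p q {0..R} (\<lambda>S. int x \<notin> S + S)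
     \<le> wsum p q {0..R} (\<lambda>S. \<forall>i<n. \<not> (int i \<in> S \<and> int x - int i \<in> S))"
  proof (rule wsum_mono)
    fix S :: "int set"
    assume "int x \<notin> S + S"
    then show "\<forall>i<n. \<not> (int i \<in> S \<and> int x - int i \<in> S)"
      by (metis add_diff_cancel_left' diff_add_cancel set_plus_intro add.commute)
  qed (use assms in auto)
  also have "\<dots> = (1 - p\<^sup>2) ^ n"
  proof (rule wsum_matching)
    show "int ` {..<n} \<inter> (\<lambda>i. int x - int i) ` {..<n} = {}"
      by (auto simp: n_def)
    show "int ` {..<n} \<subseteq> {0..R}" "(\<lambda>i. int x - int i) ` {..<n} \<subseteq> {0..R}"
      using assms by (auto simp: n_def)
  qed (use assms in \<open>auto simp: inj_on_def\<close>)
  finally show ?thesis by (simp add: n_def)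
qed

text \<open>The edges \<open>{y, l - y}\<close> and \<open>{y, l - e - y}\<close> form interleaved paths, which the enumeration
  \<open>v\<close> below traverses with step \<open>e\<close>.\<close>

lemma wsum_missing_two:
  assumes "0 \<le> p" "0 < g" "g * (1 + p) \<le> 1" "p + g \<le> 2" "1 \<le> e" "e \<le> l"
  shows "wsum p g {0..int l} (\<lambda>S. int l \<notin> S + S \<and> int l - int e \<notin> S + S) \<le> (2 / g) ^ e"
proof -
  \<comment> \<open>Blocks of length \<open>e\<close> alternate between l - w and w, and w advances
    by \<open>e\<close> after every second block. Hence \<open>v i + v (i + e)\<close> is
    alternately \<open>l\<close> and \<open>l - e\<close>.\<close>
  define v where "v i = (if even (i div e) then int l - int (i div e div 2 * e + i mod e)
     else int (i div e div 2 * e + i mod e))" for i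
  \<comment> \<open>Only full blocks are enumerated. Fewer than \<open>e\<close> points of {0..l}
    stay outside, each contributing p + g \<le> 2; this is the 2 in the bound.\<close>
  define n where "n = ((l + 1) div e) * e"
  have nl: "n \<le> l + 1" "l + 1 - n < e"
    using assms by (simp_all add: n_def minus_div_mult_eq_mod)
  define w where "w i = i div e div 2 * e + i mod e" for i
  have vw: "v i = (if even (i div e) then int l - int (w i) else int (w i))" for i
    by (simp add: v_def w_def)
  have bound: "i div e + 1 \<le> (l + 1) div e" if "i < n" for i
    using that assms unfolding n_def by (simp add: less_mult_imp_div_less Suc_le_eq)
  have w2: "2 * w i \<le> i + i mod e" for i
  proof -
    have "2 * (i div e div 2) * e \<le> i div e * e" by (intro mult_right_mono) auto
    then have "2 * (i div e div 2 * e) \<le> i div e * e" by simp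
    then show ?thesis using div_mult_mod_eq[of i e] unfolding w_def distrib_left by linarith
  qed
  have wodd: "2 * w i + e = i + i mod e" if "odd (i div e)" for i
  proof -
    have "2 * (i div e div 2) + 1 = i div e" using that odd_two_times_div_two_succ by blast
    then have "(2 * (i div e div 2) + 1) * e = i div e * e" by simp
    then have "2 * (i div e div 2 * e) + e = i div e * e" by (simp add: algebra_simps)
    then show ?thesis using div_mult_mod_eq[of i e] unfolding w_def distrib_left by linarith
  qed
  have weven: "2 * w i = i + i mod e" if "even (i div e)" for i
  proof -
    have "2 * (i div e div 2) = i div e" using that by simp
    then have "(2 * (i div e div 2)) * e = i div e * e" by simp
    then have "2 * (i div e div 2 * e) = i div e * e" by (simp add: algebra_simps)
    then show ?thesis using div_mult_mod_eq[of i e] unfolding w_def distrib_left by linarith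
  qed
  have imod: "i mod e < e" for i using assms by simp
  have ilt: "i + e - i mod e \<le> n" if "i < n" for i
  proof -
    have "(i div e + 1) * e \<le> n" unfolding n_def using bound[OF that] by (intro mult_right_mono) auto
    then have "i div e * e + e \<le> n" by simp
    then show ?thesis using div_mult_mod_eq[of i e] by linarith
  qed
  have eqi: "i = j" if "even (i div e) = even (j div e)" "w i = w j" for i j
  proof -
    have m: "w i mod e = i mod e" "w j mod e = j mod e" by (simp_all add: w_def)
    have d: "w i div e = i div e div 2" "w j div e = j div e div 2" using assms by (simp_all add: w_def)
    have "i div e = j div e" using d that by (metis dvd_div_mult_self odd_two_times_div_two_succ even_two_times_div_two)
    then show ?thesis using m that by (metis div_mult_mod_eq)
  qed
  \<comment> \<open>A clash between an even and an odd block means w i + w j = l; the blocks that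
    fit below n \<le> l + 1 do not reach that far.\<close>
  have cross: False if "i < n" "j < n" "even (i div e)" "odd (j div e)" "int l - int (w i) = int (w j)" for i j
  proof -
    have a: "2 * w i + 2 * w j + e = i + i mod e + j + j mod e" using weven[OF that(3)] wodd[OF that(4)] by simp
    have "i div e \<noteq> j div e" using that by metis
    then consider "i div e < j div e" | "j div e < i div e" by linarith
    then have "i + j + 2 * e - i mod e - j mod e + e \<le> 2 * n"
    proof cases
      case 1
      then have "(i div e + 1) * e \<le> j div e * e" by (intro mult_right_mono) auto
      then have "i - i mod e + e \<le> j - j mod e" by (simp add: minus_mod_eq_div_mult)
      then show ?thesis using ilt[OF that(2)] imod[of i] imod[of j] mod_less_eq_dividend[of i e] mod_less_eq_dividend[of j e] by linarith
    next
      case 2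
      then have "(j div e + 1) * e \<le> i div e * e" by (intro mult_right_mono) auto
      then have "j - j mod e + e \<le> i - i mod e" by (simp add: minus_mod_eq_div_mult)
      then show ?thesis using ilt[OF that(1)] imod[of i] imod[of j] mod_less_eq_dividend[of i e] mod_less_eq_dividend[of j e] by linarith
    qed
    then show False using a that(5) imod[of i] imod[of j] nl by linarith
  qed
  have inj: "inj_on v {..<n}"
  proof (rule inj_onI)
    fix i j assume ij: "i \<in> {..<n}" "j \<in> {..<n}" "v i = v j"
    have "even (i div e) = even (j div e)"
      using ij cross[of i j] cross[of j i] by (auto simp: vw split: if_splits)
    moreover have "w i = w j" using ij calculation by (auto simp: vw split: if_splits)
    ultimately show "i = j" using eqi by blast
  qed
  have wl: "w i \<le> l" if "i < n" for i
    using w2[of i] ilt[OF that] imod[of i] nl that mod_less_eq_dividend[of i e] assms by linarith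
  have ran: "v ` {..<n} \<subseteq> {0..int l}" using wl by (auto simp: vw)
  have fin: "finite (v ` {..<n})" by simp
  have sums: "v i + v (i + e) = int l \<or> v i + v (i + e) = int l - int e" for i
  proof -
    have 1: "(i + e) div e = i div e + 1" "(i + e) mod e = i mod e" using assms by simp_all
    show ?thesis
    proof (cases "even (i div e)")
      case True
      then have "w (i + e) = w i" using weven[of i] wodd[of "i + e"] 1 by simp
      then show ?thesis using True 1 by (simp add: vw)
    next
      case False
      then have "w (i + e) = w i + e" using wodd[of i] weven[of "i + e"] 1 by simp
      then show ?thesis using False 1 by (simp add: vw)
    qed
  qed
  let ?C = "\<lambda>S. \<forall>i. i + e < n \<longrightarrow> \<not> (v i \<in> S \<and> v (i + e) \<in> S)"
  have "wsum p g {0..int l} (\<lambda>S. int l \<notin> S + S \<and> int l - int e \<notin> S + S)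
      \<le> wsum p g {0..int l} (\<lambda>S. ?C (S \<inter> v ` {..<n}))"
  proof (rule wsum_mono)
    fix S :: "int set"
    assume S: "int l \<notin> S + S \<and> int l - int e \<notin> S + S"
    show "?C (S \<inter> v ` {..<n})" using S sums by (metis IntD1 set_plus_intro)
  qed (use assms in auto)
  also have "\<dots> = wsum p g (v ` {..<n}) ?C * (p + g) ^ card ({0..int l} - v ` {..<n})"
    using ran by (intro wsum_restrict) auto
  also have "card ({0..int l} - v ` {..<n}) = l + 1 - n"
    using ran inj by (simp add: card_Diff_subset card_image nat_add_distrib)
  also have "wsum p g (v ` {..<n}) ?C * (p + g) ^ (l + 1 - n) \<le> (1 / g) ^ e * 2 ^ e"
  proof (rule mult_mono)
    show "wsum p g (v ` {..<n}) ?C \<le> (1 / g) ^ e"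
      using inj assms by (intro wsum_chain) auto
  next
    show "(p + g) ^ (l + 1 - n) \<le> 2 ^ e"
  proof -
    have "(p + g) ^ (l + 1 - n) \<le> 2 ^ (l + 1 - n)" using assms by (intro power_mono) auto
    also have "\<dots> \<le> (2::real) ^ e" using nl by (intro power_increasing) auto
    finally show ?thesis .
    qed
  qed (use assms in auto)
  finally show ?thesis by (simp add: power_divide)
qed

section \<open>Cutting off a sparse tail\<close>

lemma card_separated:
  fixes T :: "int set"
  assumes "T \<subseteq> {0..int B}" "E > 0" "\<And>x y. x \<in> T \<Longrightarrow> y \<in> T \<Longrightarrow> x < y \<Longrightarrow> y - x > int E"
  shows "card T \<le> B div E + 1"
proof -
  have "inj_on (\<lambda>x. x div int E) T"
  proof (rule linorder_inj_onI')
    fix x y assume xy: "x \<in> T" "y \<in> T" "x < y"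
    then have "x + int E \<le> y" using assms(3) by force
    then have "(x + int E) div int E \<le> y div int E" using assms(2) by (intro zdiv_mono1) auto
    then show "x div int E \<noteq> y div int E" using assms(2) by simp
  qed
  moreover have "(\<lambda>x. x div int E) ` T \<subseteq> {0..int (B div E)}"
    using assms(1,2) by (auto simp: zdiv_int zdiv_mono1 pos_imp_zdiv_nonneg_iff)
  ultimately have "card T \<le> card {0..int (B div E)}" by (metis card_inj_on_le finite_atLeastAtMost_int)
  then show ?thesis by simp
qed

text \<open>Take for \<open>l\<close> the largest element of \<open>L\<close> that has another
  element of \<open>L\<close> at most \<open>E\<close> below it. Elements above \<open>l\<close> are
  then more than \<open>E\<close> apart, so there are few of them. If no such pair exists, l = -1
  and all of \<open>L\<close> is sparse.\<close>

lemma sparse_tail: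
  fixes L :: "int set"
  assumes "L \<subseteq> {0..int B}" "E > 0"
  shows "\<exists>l e. -1 \<le> l \<and> l \<le> int B \<and> e \<in> {1..E} \<and> (l \<ge> 0 \<longrightarrow> l \<in> L \<and> l - int e \<in> L) \<and>
    card {x \<in> L. l < x} \<le> B div E + 1"
proof -
  define X where "X = {l \<in> L. \<exists>e\<in>{1..E}. l - int e \<in> L}"
  have finL: "finite L" using assms finite_subset by blast
  have finX: "finite X" using finL by (simp add: X_def)
  show ?thesis
  proof (cases "X = {}")
    case True
    have "card L \<le> B div E + 1"
    proof (rule card_separated[OF assms])
      fix x y assume xy: "x \<in> L" "y \<in> L" "x < y"
      show "y - x > int E"
      proof (rule ccontr)
        assume "\<not> y - x > int E"
        then have "y \<in> X" unfolding X_def using xy by (auto intro!: bexI[of _ "nat (y - x)"])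
        then show False using True by simp
      qed
    qed
    moreover have "{x \<in> L. -1 < x} = L" using assms by auto
    ultimately show ?thesis using assms by (intro exI[of _ "-1"] exI[of _ 1]) auto
  next
    case False
    define l where "l = Max X"
    have "l \<in> X" using False finX by (simp add: l_def)
    then obtain e where e: "e \<in> {1..E}" "l \<in> L" "l - int e \<in> L" by (auto simp: X_def)
    have "card {x \<in> L. l < x} \<le> B div E + 1"
    proof (rule card_separated[OF _ assms(2)])
      fix x y assume xy: "x \<in> {x \<in> L. l < x}" "y \<in> {x \<in> L. l < x}" "x < y"
      show "y - x > int E"
      proof (rule ccontr)
        assume "\<not> y - x > int E"
        then have "y \<in> X" unfolding X_def using xy by (auto intro!: bexI[of _ "nat (y - x)"])
        then show False using xy finX unfolding l_def by (metis (no_types, lifting) Max_ge leD mem_Collect_eq)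
      qed
    qed (use assms in auto)
    moreover have "0 \<le> l" "l \<le> int B" using e(2) assms(1) by auto
    ultimately show ?thesis using e by (intro exI[of _ l] exI[of _ e]) auto
  qed
qed

text \<open>The alternative \<open>l < 0\<close> matches the value -1 of \<open>sparse_tail\<close>,
  for which there is no pair and the condition is void.\<close>

definition lowpair :: "int \<Rightarrow> nat \<Rightarrow> int set \<Rightarrow> bool" where
  "lowpair l e S \<longleftrightarrow> l < 0 \<or> (l \<notin> S + S \<and> l - int e \<notin> S + S)"

lemma wsum_lowpair:
  assumes "0 \<le> p" "0 < g" "g * (1 + p) \<le> 1" "p + g \<le> 2" "1 \<le> e" "l \<ge> 0 \<Longrightarrow> int e \<le> l"
  shows "wsum p g {0..l} (lowpair l e) \<le> (2 / g) ^ e"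
proof (cases "l < 0")
  case True
  have "g * 1 \<le> g * (1 + p)" using assms by (intro mult_left_mono) auto
  then have "1 \<le> 2 / g" using assms(2,3) by (simp add: field_simps)
  then show ?thesis using True by (simp add: wsum_empty lowpair_def)
next
  case False
  then have l: "l = int (nat l)" by simp
  have "wsum p g {0..int (nat l)} (\<lambda>S. int (nat l) \<notin> S + S \<and> int (nat l) - int e \<notin> S + S) \<le> (2 / g) ^ e"
    using assms False by (intro wsum_missing_two) auto
  moreover have "lowpair l e = (\<lambda>S. l \<notin> S + S \<and> l - int e \<notin> S + S)"
    using False by (auto simp: lowpair_def)
  ultimately show ?thesis using l by simp
qed

lemma lowpair_subset: "T \<subseteq> S \<Longrightarrow> lowpair l e S \<Longrightarrow> lowpair l e T"
  unfolding lowpair_def by (meson set_plus_mono2 subsetD)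

section \<open>Choice of the tilt\<close>

lemma cubic_bound:
  fixes q :: real
  assumes "0 \<le> q" "q \<le> 1 / 3"
  shows "q * (2 - q)\<^sup>2 \<le> 25 / 27"
proof -
  have "25 / 27 - q * (2 - q)\<^sup>2 = (1 / 3 - q) * (q\<^sup>2 + (25 / 9 - 11 / 3 * q))"
    by (simp add: power2_eq_square field_simps)
  also have "\<dots> \<ge> 0" using assms by (intro mult_nonneg_nonneg) auto
  finally show ?thesis by simp
qed

text \<open>\<open>g\<close> should exceed sqrt q by a fixed factor while \<open>g * (1 + p)\<close>
  stays at most 1. By \<open>cubic_bound\<close>, sharp at q = 1/3, every factor up to sqrt (27/25)
  is allowed, and 103/100 is one. Then q / g falls below sqrt q by the same factor.\<close>

lemma g_bound:
  assumes "0 < q" "q \<le> 1 / 3" "g = sqrt q * (103 / 100)"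
  shows "0 < g" "g * (1 + (1 - q)) \<le> 1" "(1 - q) + g \<le> 2" "g * (q / g) = q" "q / g = sqrt q * (100 / 103)"
proof -
  show g0: "0 < g" using assms(1) unfolding assms(3) by simp
  have "(g * (2 - q))\<^sup>2 = (103 / 100)\<^sup>2 * (q * (2 - q)\<^sup>2)"
    using assms(1) unfolding assms(3) by (simp only: power_mult_distrib real_sqrt_pow2 less_imp_le mult_ac)
  also have "\<dots> \<le> (103 / 100)\<^sup>2 * (25 / 27)" using assms cubic_bound[of q] by (intro mult_left_mono) auto
  also have "\<dots> \<le> 1\<^sup>2" by (simp add: power2_eq_square)
  finally have "(g * (2 - q))\<^sup>2 \<le> 1\<^sup>2" .
  then have "g * (2 - q) \<le> 1" by (rule power2_le_imp_le) simp
  then show "g * (1 + (1 - q)) \<le> 1" by (simp add: algebra_simps)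
  have "g * 1 \<le> g * (2 - q)" using g0 assms(2) by (intro mult_left_mono) linarith+
  then have "g \<le> 1" using \<open>g * (2 - q) \<le> 1\<close> by simp
  then show "(1 - q) + g \<le> 2" using assms by simp
  show "g * (q / g) = q" using g0 by simp
  have "q = g * (sqrt q * (100 / 103))" using assms(1) unfolding assms(3) by simp
  then show "q / g = sqrt q * (100 / 103)" using g0 by (metis less_irrefl nonzero_mult_div_cancel_left)
qed

lemma linear_times_power_bounded:
  assumes "0 \<le> r" "r < (1::real)"
  obtains C where "C > 0" "\<And>u::nat. (a * real u + b) * r ^ u \<le> C"
proof -
  have "(\<lambda>u. real u * r ^ u) \<longlonglongrightarrow> 0" using assms by (intro powser_times_n_limit_0) auto
  moreover have "(\<lambda>u. r ^ u) \<longlonglongrightarrow> 0" using assms by (intro LIMSEQ_power_zero) auto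
  ultimately have "(\<lambda>u. a * (real u * r ^ u) + b * r ^ u) \<longlonglongrightarrow> a * 0 + b * 0"
    by (intro tendsto_add tendsto_mult tendsto_const)
  then have "Bseq (\<lambda>u. a * (real u * r ^ u) + b * r ^ u)" by (metis convergentI convergent_imp_Bseq)
  then obtain C where "C > 0" "\<And>u. norm (a * (real u * r ^ u) + b * r ^ u) \<le> C" by (auto elim: BseqE)
  then show ?thesis using that[of C] by (force simp: algebra_simps abs_le_iff)
qed

lemma zero_mem_sum: "0 \<in> S \<Longrightarrow> x \<in> S \<Longrightarrow> x \<in> S + (S :: int set)"
  using set_plus_intro[of 0 S x S] by simp

text \<open>A missing sum beyond \<open>B = D * u\<close> is rare enough by itself. If there is
  none, cut at the \<open>l\<close> of \<open>sparse_tail\<close>: the missing sums up to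
  \<open>l\<close> are holes and pay \<theta> each, the pair at \<open>l\<close> bounds the g-weight
  of {0..l}, and the sparse sums above \<open>l\<close>, which pay nothing, are so few that
  weakening 100/103 to 100/102 makes up for them.\<close>

lemma wsum_missing_tail:
  assumes q0: "0 < q0"
  obtains K where "K > 0"
    "\<And>q u R. q0 \<le> q \<Longrightarrow> q \<le> 1 / 3 \<Longrightarrow>
       wsum (1 - q) q {0..R} (\<lambda>S. 0 \<in> S \<and> u \<le> card (missing S R)) \<le> K * (sqrt q * (100 / 102)) ^ u"
proof -
  \<comment> \<open>A lower bound for both \<open>g\<close> and \<theta>, uniform in q \<ge>
    q0.\<close>
  define t where "t = sqrt q0 * (100 / 103)"
  have t: "t > 0" using q0 by (simp add: t_def)
  \<comment> \<open>With this \<open>D\<close>, one missing sum beyond \<open>D * u\<close> has a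
    smaller probability than the bound aimed at for \<open>u\<close> missing sums.\<close>
  have "\<exists>D. (3 / 4 :: real) ^ D < t" using t by (intro real_arch_pow_inv) auto
  then obtain D0 where D0: "(3 / 4 :: real) ^ D0 < t" by blast
  define D where "D = Suc D0"
  have "(3 / 4 :: real) ^ D \<le> (3 / 4) ^ D0" unfolding D_def by (intro power_decreasing) auto
  then have D: "D \<ge> 1" "(3 / 4 :: real) ^ D \<le> t" using D0 by (simp add: D_def, linarith)
  \<comment> \<open>About u / E' of the missing sums are not charged. Each would have paid at least
    \<open>t\<close>, so the loss is of order (201/200)^u.\<close>
  have "\<exists>E'. 1 / t < (201 / 200 :: real) ^ E'" by (intro real_arch_pow) auto
  then obtain E0 where E0: "1 / t < (201 / 200 :: real) ^ E0" by blast
  define E' where "E' = Suc E0"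
  have "(201 / 200 :: real) ^ E0 \<le> (201 / 200) ^ E'" unfolding E'_def by (intro power_increasing) auto
  then have E': "E' \<ge> 1" "1 / t \<le> (201 / 200 :: real) ^ E'" using E0 by (simp add: E'_def, linarith)
  \<comment> \<open>The product makes \<open>B div E\<close> equal to
    \<open>u div E'\<close>.\<close>
  define E where "E = D * E'"
  have E: "E \<ge> 1" using D E' by (simp add: E_def)
  \<comment> \<open>The number of choices of (l, e) is linear in \<open>u\<close>; it is absorbed
    because 102/103 * 201/200 < 1.\<close>
  obtain C where C: "C > 0" "\<And>u. (real D * real u + 2) * (102 / 103 * (201 / 200)) ^ u \<le> C"
    using linear_times_power_bounded[of "102 / 103 * (201 / 200)" "real D" 2] by auto
  define K where "K = 4 + C * real E * (2 / t) ^ E * (1 / t)"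
  have "K > 0" using C t by (simp add: K_def add_pos_nonneg)
  moreover have "wsum (1 - q) q {0..R} (\<lambda>S. 0 \<in> S \<and> u \<le> card (missing S R)) \<le> K * (sqrt q * (100 / 102)) ^ u"
    if q: "q0 \<le> q" "q \<le> 1 / 3" for q u R
  proof -
    define g where "g = sqrt q * (103 / 100)"
    define \<theta> where "\<theta> = q / g"
    define p where "p = 1 - q"
    have qp: "0 < q" using q q0 by simp
    note gb = g_bound[OF qp q(2) g_def]
    have th: "\<theta> = sqrt q * (100 / 103)" using gb by (simp add: \<theta>_def)
    have tth: "t \<le> \<theta>" using q by (simp add: t_def th)
    have th1: "\<theta> \<le> 1"
    proof -
      have "sqrt q \<le> 1" using q by simp
      then show ?thesis unfolding th by linarith
    qed
    have tg: "t \<le> g"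
    proof -
      have "sqrt q \<ge> 0" using qp by simp
      then show ?thesis using tth unfolding th g_def by linarith
    qed
    have p: "0 \<le> p" "p + q = 1" "g * (1 + p) \<le> 1" "p + g \<le> 2" using q gb by (simp_all add: p_def)
    define B where "B = D * u"
    define Z where "Z = u - (u div E' + 1)"
    let ?L = "{-1..int B} \<inter> {..R}"
    define Q where "Q l e T \<longleftrightarrow> lowpair l e T \<and> Z \<le> card ({0..l} - T)" for l e T
    let ?ok = "{(l,e). l \<in> ?L \<and> e \<in> {1..E} \<and> (l \<ge> 0 \<longrightarrow> int e \<le> l)}"
    have finok: "finite ?ok" by (rule finite_subset[of _ "?L \<times> {1..E}"]) auto
    let ?R1 = "\<lambda>x S. int x \<notin> S + S"
    let ?R2 = "\<lambda>(l,e) S. Q l e (S \<inter> {0..l})"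
    let ?I = "Inl ` {x. B < x \<and> int x \<le> R} \<union> Inr ` ?ok"
    have finx: "finite {x. B < x \<and> int x \<le> R}" by (rule finite_subset[of _ "{..nat R}"]) auto
    have "wsum p q {0..R} (\<lambda>S. 0 \<in> S \<and> u \<le> card (missing S R))
       \<le> (\<Sum>i\<in>?I. wsum p q {0..R} (case_sum ?R1 ?R2 i))"
    proof (rule wsum_union_bound)
      show "finite ?I" using finok finx by simp
      fix S assume S: "S \<subseteq> {0..R}" "0 \<in> S \<and> u \<le> card (missing S R)"
      show "\<exists>i\<in>?I. case_sum ?R1 ?R2 i S"
      proof (cases "\<exists>x\<in>missing S R. x > int B")
        case True
        then obtain x where x: "x \<in> missing S R" "x > int B" by blast
        then have "Inl (nat x) \<in> ?I" by (auto simp: missing_def)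
        moreover have "case_sum ?R1 ?R2 (Inl (nat x)) S" using x by (auto simp: missing_def)
        ultimately show ?thesis by blast
      next
        case False
        then have sub: "missing S R \<subseteq> {0..int B}" by (auto simp: missing_def)
        have "E > 0" using E by simp
        then obtain l e where le: "-1 \<le> l" "l \<le> int B" "e \<in> {1..E}"
          "l \<ge> 0 \<Longrightarrow> l \<in> missing S R \<and> l - int e \<in> missing S R"
          "card {x \<in> missing S R. l < x} \<le> B div E + 1"
          using sparse_tail[OF sub \<open>E > 0\<close>] by blast
        have "R \<ge> 0" using S by auto
        then have "l \<le> R" using le(1,4) by (cases "l \<ge> 0") (auto simp: missing_def)
        then have inok: "(l,e) \<in> ?ok" using le by (auto simp: missing_def)
        have "lowpair l e S" using le by (auto simp: lowpair_def missing_def)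
        then have lp: "lowpair l e (S \<inter> {0..l})" by (rule lowpair_subset[rotated]) auto
        have "B div E = u div E'" using D by (simp add: B_def E_def)
        then have c: "card {x \<in> missing S R. l < x} \<le> u div E' + 1" using le by simp
        have "card (missing S R) \<le> card {x \<in> missing S R. x \<le> l} + card {x \<in> missing S R. l < x}"
        proof -
          have "missing S R = {x \<in> missing S R. x \<le> l} \<union> {x \<in> missing S R. l < x}" by auto
          then show ?thesis by (metis card_Un_le)
        qed
        \<comment> \<open>Here 0 in \<open>S\<close> is needed: every element of \<open>S\<close> is
          then a sum, so a missing sum is a hole.\<close>
        moreover have "card {x \<in> missing S R. x \<le> l} \<le> card ({0..l} - S \<inter> {0..l})"
          using S zero_mem_sum[of S] by (intro card_mono) (auto simp: missing_def)
        ultimately have "Z \<le> card ({0..l} - S \<inter> {0..l})" using c S(2) unfolding Z_def by linarith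
        then have "?R2 (l,e) S" using lp by (simp add: Q_def)
        then show ?thesis using inok by (intro bexI[of _ "Inr (l,e)"]) auto
      qed
    qed (use p qp in auto)
    also have "\<dots> = (\<Sum>x | B < x \<and> int x \<le> R. wsum p q {0..R} (?R1 x)) + (\<Sum>i\<in>?ok. wsum p q {0..R} (?R2 i))"
      using finok finx by (subst sum.union_disjoint) (auto simp: sum.reindex)
    also have "(\<Sum>x | B < x \<and> int x \<le> R. wsum p q {0..R} (?R1 x)) \<le> 4 * (3 / 4) ^ B"
    proof -
      have "wsum p q {0..R} (?R1 x) \<le> (3 / 4) ^ x" if "int x \<le> R" for x
      proof -
        have "1 - p\<^sup>2 = q * (2 - q)" by (simp add: p_def power2_eq_square algebra_simps)
        also have "\<dots> \<le> (3 / 4)\<^sup>2"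
        proof -
          have "(3 / 4)\<^sup>2 - q * (2 - q) = (1 / 3 - q) * (5 / 3 - q) + (9 / 16 - 5 / 9)"
            by (simp add: power2_eq_square field_simps)
          also have "\<dots> \<ge> 0" using q by (intro add_nonneg_nonneg mult_nonneg_nonneg) auto
          finally show ?thesis by simp
        qed
        finally have a: "1 - p\<^sup>2 \<le> (3 / 4)\<^sup>2" .
        have "0 \<le> 1 - p\<^sup>2" using p qp by (simp add: power_le_one)
        then have "(1 - p\<^sup>2) ^ ((x + 1) div 2) \<le> ((3 / 4)\<^sup>2) ^ ((x + 1) div 2)" using a by (intro power_mono) auto
        also have "\<dots> = (3 / 4) ^ (2 * ((x + 1) div 2))" by (simp add: power_mult)
        also have "\<dots> \<le> (3 / 4) ^ x" by (intro power_decreasing) auto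
        finally show ?thesis using wsum_missing_one[of p q x R] that p qp by simp
      qed
      then have "(\<Sum>x | B < x \<and> int x \<le> R. wsum p q {0..R} (?R1 x)) \<le> (\<Sum>x | B < x \<and> int x \<le> R. (3 / 4) ^ x)"
        by (intro sum_mono) auto
      also have "\<dots> \<le> (\<Sum>x\<in>{B..<B + Suc (nat R)}. (3 / 4) ^ x)" by (intro sum_mono2) auto
      also have "\<dots> = (\<Sum>x<Suc (nat R). (3 / 4) ^ (B + x))"
        by (rule sum.reindex_bij_witness[where i = "\<lambda>x. B + x" and j = "\<lambda>x. x - B"]) auto
      also have "\<dots> = (3 / 4) ^ B * (\<Sum>x<Suc (nat R). (3 / 4) ^ x)" unfolding power_add sum_distrib_left ..
      also have "(\<Sum>x<Suc (nat R). (3 / 4 :: real) ^ x) \<le> 4"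
        unfolding sum_gp_strict by simp
      finally show ?thesis by (simp add: mult.commute)
    qed
    also have "(\<Sum>i\<in>?ok. wsum p q {0..R} (?R2 i)) \<le> (\<Sum>i\<in>?ok. \<theta> ^ Z * (2 / t) ^ E)"
    proof (rule sum_mono)
      fix i assume "i \<in> ?ok"
      then obtain l e where i: "i = (l,e)" "l \<le> R" "e \<in> {1..E}" "l \<ge> 0 \<longrightarrow> int e \<le> l" by auto
      have "wsum p q {0..R} (?R2 i) = wsum p q {0..l} (Q l e) * (p + q) ^ card ({0..R} - {0..l})"
        using i unfolding i(1) prod.case by (intro wsum_restrict) auto
      also have "\<dots> = wsum p (g * \<theta>) {0..l} (\<lambda>T. lowpair l e T \<and> Z \<le> card ({0..l} - T))"
        using p gb by (simp add: Q_def[abs_def] \<theta>_def)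
      also have "\<dots> \<le> \<theta> ^ Z * wsum p g {0..l} (lowpair l e)"
        using p gb th1 tth t by (intro wsum_holes) auto
      also have "\<dots> \<le> \<theta> ^ Z * (2 / g) ^ e"
        using p gb i tth t by (intro mult_left_mono wsum_lowpair) auto
      also have "(2 / g) ^ e \<le> (2 / t) ^ E"
      proof -
        have "g * 1 \<le> g * (1 + p)" using p gb by (intro mult_left_mono) auto
        then have "2 / g \<ge> 1" using p(3) gb(1) by (simp add: field_simps)
        then have "(2 / g) ^ e \<le> (2 / g) ^ E" using i by (intro power_increasing) auto
        also have "\<dots> \<le> (2 / t) ^ E" using tg t by (intro power_mono divide_left_mono) auto
        finally show ?thesis .
      qed
      finally show "wsum p q {0..R} (?R2 i) \<le> \<theta> ^ Z * (2 / t) ^ E" using tth t by (simp add: mult_left_mono)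
    qed
    also have "\<dots> = real (card ?ok) * (\<theta> ^ Z * (2 / t) ^ E)" by simp
    also have "\<dots> \<le> ((real D * real u + 2) * real E) * (\<theta> ^ Z * (2 / t) ^ E)"
    proof (rule mult_right_mono)
      have "card ?ok \<le> card ({-1..int B} \<times> {1..E})" by (intro card_mono) auto
      also have "\<dots> = (B + 2) * E" by (simp add: card_cartesian_product nat_add_distrib)
      finally have "real (card ?ok) \<le> real ((B + 2) * E)" by linarith
      also have "real ((B + 2) * E) = (real D * real u + 2) * real E" by (simp add: B_def algebra_simps)
      finally show "real (card ?ok) \<le> (real D * real u + 2) * real E" .
    qed (use tth t in auto)
    also have "4 * (3 / 4) ^ B \<le> 4 * (sqrt q * (100 / 102)) ^ u"
    proof -
      have "(3 / 4 :: real) ^ B = ((3 / 4) ^ D) ^ u" by (simp add: B_def power_mult)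
      also have "\<dots> \<le> (sqrt q * (100 / 102)) ^ u"
      proof (rule power_mono)
        have "\<theta> \<le> sqrt q * (100 / 102)" using qp by (simp add: th)
        then show "(3 / 4) ^ D \<le> sqrt q * (100 / 102)" using D tth by linarith
      qed auto
      finally show ?thesis by simp
    qed
    also have "((real D * real u + 2) * real E) * (\<theta> ^ Z * (2 / t) ^ E)
       \<le> (C * real E * (2 / t) ^ E * (1 / t)) * (sqrt q * (100 / 102)) ^ u"
    proof -
      have "\<theta> ^ Z * t ^ (u div E' + 1) \<le> \<theta> ^ Z * \<theta> ^ (u div E' + 1)"
        using tth t by (intro mult_left_mono power_mono) auto
      also have "\<dots> = \<theta> ^ (Z + (u div E' + 1))" by (simp add: power_add)
      also have "\<dots> \<le> \<theta> ^ u" using tth t th1 by (intro power_decreasing) (auto simp: Z_def)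
      finally have a1: "\<theta> ^ Z \<le> \<theta> ^ u * (1 / t) ^ (u div E' + 1)"
        using t by (simp add: field_simps)
      have "(1 / t) ^ (u div E') \<le> ((201 / 200) ^ E') ^ (u div E')" using E' t by (intro power_mono) auto
      also have "\<dots> = (201 / 200 :: real) ^ (E' * (u div E'))" by (simp add: power_mult)
      also have "\<dots> \<le> (201 / 200 :: real) ^ u" by (intro power_increasing) auto
      finally have a2: "(1 / t) ^ (u div E') \<le> (201 / 200) ^ u" .
      have "\<theta> ^ u * (1 / t) ^ (u div E' + 1) = \<theta> ^ u * ((1 / t) ^ (u div E') * (1 / t))"
        by (simp only: power_add power_one_right)
      also have "\<dots> \<le> \<theta> ^ u * ((201 / 200) ^ u * (1 / t))"
        using a2 tth t by (intro mult_left_mono mult_right_mono) auto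
      finally have *: "\<theta> ^ Z \<le> \<theta> ^ u * ((201 / 200) ^ u * (1 / t))" using a1 by linarith
      have "\<theta> = (sqrt q * (100 / 102)) * (102 / 103)" by (simp add: th)
      then have **: "\<theta> ^ u * ((201 / 200) ^ u * (1 / t))
         = (sqrt q * (100 / 102)) ^ u * (102 / 103 * (201 / 200)) ^ u * (1 / t)"
        by (simp only: power_mult_distrib mult_ac)
      have "((real D * real u + 2) * real E) * (\<theta> ^ Z * (2 / t) ^ E)
        \<le> ((real D * real u + 2) * real E) * ((sqrt q * (100 / 102)) ^ u * (102 / 103 * (201 / 200)) ^ u * (1 / t) * (2 / t) ^ E)"
        using * ** t by (intro mult_left_mono mult_right_mono) auto
      also have "\<dots> = ((real D * real u + 2) * (102 / 103 * (201 / 200)) ^ u) * (real E * (2 / t) ^ E * (1 / t) * (sqrt q * (100 / 102)) ^ u)"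
        by (simp only: mult_ac)
      also have "\<dots> \<le> C * (real E * (2 / t) ^ E * (1 / t) * (sqrt q * (100 / 102)) ^ u)"
        using C t qp by (intro mult_right_mono) auto
      finally show ?thesis by (simp only: mult_ac)
    qed
    finally show ?thesis by (simp add: K_def p_def algebra_simps)
  qed
  ultimately show ?thesis using that by blast
qed

section \<open>Binomial probabilities\<close>

definition bpmf :: "real \<Rightarrow> nat \<Rightarrow> nat \<Rightarrow> real" where
  "bpmf p n j = real (n choose j) * p ^ j * (1 - p) ^ (n - j)"

lemma bpmf_nonneg: "0 \<le> p \<Longrightarrow> p \<le> 1 \<Longrightarrow> 0 \<le> bpmf p n j"
  by (simp add: bpmf_def)

lemma bpmf_same:
  assumes "j \<le> n"
  shows "bpmf p (Suc n) j * real (Suc n - j) = bpmf p n j * ((1 - p) * real (Suc n))"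
proof -
  have "(Suc n choose j) * (Suc n - j) = Suc n * (n choose j)"
    using binomial_absorb_comp[of "Suc n" j] by (simp add: mult.commute)
  then have key: "real (Suc n choose j) * real (Suc n - j) = real (Suc n) * real (n choose j)"
    by (metis of_nat_mult)
  have "bpmf p (Suc n) j * real (Suc n - j)
     = (real (Suc n choose j) * real (Suc n - j)) * (p ^ j * (1 - p) ^ (Suc n - j))"
    by (simp only: bpmf_def mult_ac)
  also have "\<dots> = (real (Suc n) * real (n choose j)) * (p ^ j * (1 - p) ^ Suc (n - j))"
    unfolding key by (simp only: Suc_diff_le[OF assms])
  finally show ?thesis by (simp only: bpmf_def power_Suc mult_ac)
qed

lemma bpmf_Suc: "bpmf p (Suc n) (Suc j) * real (Suc j) = bpmf p n j * (p * real (Suc n))"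
proof -
  have "Suc j * (Suc n choose Suc j) = Suc n * (n choose j)" by (rule Suc_times_binomial)
  then have key: "real (Suc j) * real (Suc n choose Suc j) = real (Suc n) * real (n choose j)"
    by (metis of_nat_mult)
  have "bpmf p (Suc n) (Suc j) * real (Suc j)
     = (real (Suc j) * real (Suc n choose Suc j)) * (p ^ Suc j * (1 - p) ^ (n - j))"
    by (simp only: bpmf_def mult_ac diff_Suc_Suc)
  then show ?thesis by (simp only: key bpmf_def power_Suc mult_ac)
qed

text \<open>Compare with the same count \<open>j\<close> when j + 1 is at least the mean of
  \<open>n + 1\<close> trials, and with j + 1 otherwise. Only the first choice costs a factor above
  1.\<close>

lemma bpmf_step:
  assumes "0 < p" "p < 1"
  shows "\<exists>j'. bpmf p n j \<le> (1 + 1 / ((1 - p) * real (Suc n))) * bpmf p (Suc n) j'"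
proof -
  let ?q = "1 - p"
  have q: "?q > 0" using assms by simp
  show ?thesis
  proof (cases "j \<le> n")
    case False
    then have "bpmf p n j = 0" by (simp add: bpmf_def)
    then show ?thesis using bpmf_nonneg[of p "Suc n" 0] q assms
      by (intro exI[of _ 0]) (auto intro!: mult_nonneg_nonneg add_nonneg_nonneg)
  next
    case True
    show ?thesis
    proof (cases "real (Suc j) \<ge> p * real (Suc n)")
      case big: True
      have "real (Suc n - j) = real (Suc n) - real j" using True by simp
      also have "\<dots> \<le> ?q * real (Suc n) + 1" using big by (simp add: algebra_simps)
      finally have "bpmf p n j * (?q * real (Suc n)) \<le> bpmf p (Suc n) j * (?q * real (Suc n) + 1)"
        unfolding bpmf_same[OF True, symmetric] using bpmf_nonneg[of p "Suc n" j] assms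
        by (intro mult_left_mono) auto
      then have "bpmf p n j \<le> bpmf p (Suc n) j * (?q * real (Suc n) + 1) / (?q * real (Suc n))"
        using q by (subst pos_le_divide_eq) auto
      also have "\<dots> = (1 + 1 / (?q * real (Suc n))) * bpmf p (Suc n) j"
      proof -
        have "b * (z + 1) / z = (1 + 1 / z) * b" if "z \<noteq> 0" for b z :: real
          using that by (simp add: field_simps)
        then show ?thesis using q by simp
      qed
      finally show ?thesis by blast
    next
      case False
      have "bpmf p n j * (p * real (Suc n)) \<le> bpmf p (Suc n) (Suc j) * (p * real (Suc n))"
        unfolding bpmf_Suc[symmetric] using False bpmf_nonneg[of p "Suc n" "Suc j"] assms
        by (intro mult_left_mono) auto
      then have a: "bpmf p n j \<le> bpmf p (Suc n) (Suc j)"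
        using assms by (simp only: mult_le_cancel_right) (auto simp: zero_less_mult_iff)
      have "1 * bpmf p (Suc n) (Suc j) \<le> (1 + 1 / (?q * real (Suc n))) * bpmf p (Suc n) (Suc j)"
        using q bpmf_nonneg[of p "Suc n" "Suc j"] assms by (intro mult_right_mono) auto
      then show ?thesis using a by (intro exI[of _ "Suc j"]) linarith
    qed
  qed
qed

text \<open>By Bernoulli's inequality the factor of one step is at most (1 + 1 / (N + 1))^c, and
  these factors telescope.\<close>

lemma bpmf_iterate:
  assumes "0 < p" "p < 1" "1 / (1 - p) \<le> real c" "n \<le> N"
  shows "\<exists>j'. bpmf p n j \<le> (real (N + 1) / real (n + 1)) ^ c * bpmf p N j'"
  using assms(4)
proof (induction N rule: dec_induct)
  case base
  show ?case by (intro exI[of _ j]) simp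
next
  case (step N)
  obtain j' where j': "bpmf p n j \<le> (real (N + 1) / real (n + 1)) ^ c * bpmf p N j'" using step by blast
  obtain j'' where j'': "bpmf p N j' \<le> (1 + 1 / ((1 - p) * real (Suc N))) * bpmf p (Suc N) j''"
    using bpmf_step[OF assms(1,2)] by blast
  have "1 / ((1 - p) * real (Suc N)) = (1 / (1 - p)) * (1 / real (Suc N))" by simp
  also have "\<dots> \<le> real c * (1 / real (Suc N))" using assms(3) by (intro mult_right_mono) auto
  finally have "1 + 1 / ((1 - p) * real (Suc N)) \<le> 1 + real c * (1 / real (Suc N))" by simp
  also have "\<dots> \<le> (1 + 1 / real (Suc N)) ^ c"
  proof (rule Bernoulli_inequality)
    have "0 \<le> 1 / real (Suc N)" by simp
    then show "-1 \<le> 1 / real (Suc N)" by linarith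
  qed
  also have "1 + 1 / real (Suc N) = real (Suc N + 1) / real (N + 1)" by (simp add: field_simps)
  finally have f: "1 + 1 / ((1 - p) * real (Suc N)) \<le> (real (Suc N + 1) / real (N + 1)) ^ c" .
  have "bpmf p N j' \<le> (real (Suc N + 1) / real (N + 1)) ^ c * bpmf p (Suc N) j''"
    using j'' mult_right_mono[OF f bpmf_nonneg[of p "Suc N" j'']] assms by linarith
  then have "(real (N + 1) / real (n + 1)) ^ c * bpmf p N j'
    \<le> (real (N + 1) / real (n + 1)) ^ c * ((real (Suc N + 1) / real (N + 1)) ^ c * bpmf p (Suc N) j'')"
    by (intro mult_left_mono) auto
  also have "\<dots> = (real (Suc N + 1) / real (n + 1)) ^ c * bpmf p (Suc N) j''"
  proof -
    have "(real (N + 1) / real (n + 1)) ^ c * (real (Suc N + 1) / real (N + 1)) ^ c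
      = (real (N + 1) / real (n + 1) * (real (Suc N + 1) / real (N + 1))) ^ c"
      by (rule power_mult_distrib[symmetric])
    also have "real (N + 1) / real (n + 1) * (real (Suc N + 1) / real (N + 1)) = real (Suc N + 1) / real (n + 1)"
      by simp
    finally show ?thesis by (simp only: mult.assoc[symmetric])
  qed
  finally show ?case using j' by (intro exI[of _ j'']) linarith
qed

lemma bpmf_neighbours:
  assumes "j < N"
  shows "bpmf p N (Suc j) * (real (Suc j) * (1 - p)) = bpmf p N j * (real (N - j) * p)"
proof -
  have N: "N = Suc (N - 1)" using assms by simp
  have "Suc j * (N choose Suc j) = N * (N - 1 choose j)"
    using Suc_times_binomial[of j "N - 1"] N by simp
  also have "\<dots> = (N - j) * (N choose j)" using binomial_absorb_comp[of N j] by simp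
  finally have key: "real (Suc j) * real (N choose Suc j) = real (N - j) * real (N choose j)"
    by (metis of_nat_mult)
  have "bpmf p N (Suc j) * (real (Suc j) * (1 - p))
     = (real (Suc j) * real (N choose Suc j)) * (p ^ Suc j * ((1 - p) * (1 - p) ^ (N - Suc j)))"
    by (simp only: bpmf_def mult_ac)
  also have "(1 - p) * (1 - p) ^ (N - Suc j) = (1 - p) ^ (N - j)"
    using assms by (simp add: Suc_diff_Suc flip: power_Suc)
  finally show ?thesis by (simp only: key bpmf_def power_Suc mult_ac)
qed

lemma scaled_le:
  assumes "p < 1" "real k = p * real N"
  shows "k \<le> N"
proof -
  have "p * real N \<le> 1 * real N" using assms by (intro mult_right_mono) auto
  then show ?thesis using assms by simp
qed

lemma bpmf_mode:
  assumes "0 < p" "p < 1" "real k = p * real N"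
  shows "bpmf p N j \<le> bpmf p N k"
proof -
  have kN: "k \<le> N" by (rule scaled_le) fact+
  have up: "bpmf p N i \<le> bpmf p N (Suc i)" if "i < k" for i
  proof -
    have "i < N" using that kN by simp
    have "real (Suc i) \<le> p * real N" using that assms(3) by simp
    then have c: "real (Suc i) * (1 - p) \<le> real (N - i) * p"
      using \<open>i < N\<close> assms(1,2) by (simp add: algebra_simps of_nat_diff)
    have "bpmf p N i * (real (Suc i) * (1 - p)) \<le> bpmf p N i * (real (N - i) * p)"
      using c bpmf_nonneg[of p N i] assms by (intro mult_left_mono) auto
    also have "\<dots> = bpmf p N (Suc i) * (real (Suc i) * (1 - p))" using bpmf_neighbours[OF \<open>i < N\<close>] by simp
    finally show ?thesis using assms(2) by (simp only: mult_le_cancel_right) auto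
  qed
  have down: "bpmf p N (Suc i) \<le> bpmf p N i" if "k \<le> i" for i
  proof (cases "i < N")
    case False
    then have "N choose Suc i = 0" by (intro binomial_eq_0) simp
    then have "bpmf p N (Suc i) = 0" unfolding bpmf_def by simp
    then show ?thesis using bpmf_nonneg[of p N i] assms by simp
  next
    case True
    have "p * real N \<le> real i" using that assms(3) by simp
    then have c: "real (N - i) * p \<le> real (Suc i) * (1 - p)"
      using True assms(1,2) by (simp add: algebra_simps of_nat_diff)
    have "bpmf p N (Suc i) * (real (Suc i) * (1 - p)) = bpmf p N i * (real (N - i) * p)"
      using bpmf_neighbours[OF True] by simp
    also have "\<dots> \<le> bpmf p N i * (real (Suc i) * (1 - p))"
      using c bpmf_nonneg[of p N i] assms by (intro mult_left_mono) auto
    finally show ?thesis using assms(2) by (simp only: mult_le_cancel_right) auto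
  qed
  show ?thesis
  proof (cases "j \<le> k")
    case True
    then show ?thesis
    proof (induction j rule: inc_induct)
      case (step i) then show ?case using up[of i] by simp
    qed simp
  next
    case False
    then have "k \<le> j" by simp
    then show ?thesis
    proof (induction j rule: dec_induct)
      case (step i) then show ?case using down[of i] by simp
    qed simp
  qed
qed

lemma bpmf_lower:
  assumes "0 < p" "p < 1" "real k = p * real N"
  shows "1 \<le> real (N + 1) * bpmf p N k"
proof -
  have "1 = (p + (1 - p)) ^ N" by simp
  also have "\<dots> = (\<Sum>j\<le>N. bpmf p N j)" by (simp only: binomial_ring bpmf_def)
  also have "\<dots> \<le> (\<Sum>j\<le>N. bpmf p N k)" using bpmf_mode[OF assms] by (intro sum_mono)
  finally show ?thesis by simp
qed

lemma bpmf_ratio: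
  assumes "0 < p" "p < 1" "real k = p * real N" "1 / (1 - p) \<le> real c" "n \<le> N"
  shows "bpmf p n j \<le> (real (N + 1) / real (n + 1)) ^ c * bpmf p N k"
proof -
  obtain j' where "bpmf p n j \<le> (real (N + 1) / real (n + 1)) ^ c * bpmf p N j'"
    using bpmf_iterate[OF assms(1,2,4,5)] by blast
  also have "\<dots> \<le> (real (N + 1) / real (n + 1)) ^ c * bpmf p N k"
    using bpmf_mode[OF assms(1-3)] by (intro mult_left_mono) auto
  finally show ?thesis .
qed

text \<open>All \<open>k\<close>-subsets of \<open>V\<close> have the same weight, which is compared
  with \<open>bpmf p N k\<close>, the largest of N + 1 probabilities of sum 1. The resulting loss of
  N + 1 is tolerable against exponentially small events only. Every point of \<open>V\<close> beyond
  \<open>N\<close> costs a factor 1 / (1 - p).\<close>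

lemma card_le_wsum:
  assumes "finite V" "0 < p" "p < 1" "real k = p * real N"
  shows "real (card {A. A \<subseteq> V \<and> card A = k \<and> P A})
    \<le> wsum p (1 - p) V P * (real (N + 1) * real (N choose k)) * (1 / (1 - p)) ^ (card V - N)"
proof (cases "k \<le> card V")
  case False
  have "card A \<noteq> k" if "A \<subseteq> V" for A using card_mono[OF assms(1) that] False by simp
  then have e: "{A. A \<subseteq> V \<and> card A = k \<and> P A} = {}" by auto
  have "wsum p (1 - p) V P \<ge> 0" using assms by (intro wsum_nonneg) auto
  then show ?thesis unfolding e using assms by (intro order.trans[OF _ mult_nonneg_nonneg]) auto
next
  case True
  let ?q = "1 - p" and ?F = "{A. A \<subseteq> V \<and> card A = k \<and> P A}"
  have q: "0 < ?q" "?q < 1" using assms by auto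
  have kN: "k \<le> N" by (rule scaled_le) fact+
  let ?D = "p ^ k * ?q ^ (N - k) * ?q ^ (card V - N)"
  have D: "?D > 0" using assms q by simp
  have "real (card ?F) * ?D = (\<Sum>A\<in>?F. ?D)" by simp
  also have "\<dots> \<le> (\<Sum>A\<in>?F. p ^ card A * ?q ^ card (V - A))"
  proof (rule sum_mono)
    fix A assume A: "A \<in> ?F"
    then have "card (V - A) = card V - k" using assms(1) by (metis (mono_tags, lifting) card_Diff_subset finite_subset mem_Collect_eq)
    moreover have "card V - k \<le> (N - k) + (card V - N)" by simp
    then have "?q ^ ((N - k) + (card V - N)) \<le> ?q ^ (card V - k)" using q by (intro power_decreasing) auto
    ultimately show "?D \<le> p ^ card A * ?q ^ card (V - A)" using A assms
      by (simp add: power_add mult.assoc)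
  qed
  also have "\<dots> \<le> wsum p ?q V P" unfolding wsum_def using assms q by (intro sum_mono2) auto
  also have "\<dots> \<le> wsum p ?q V P * (real (N + 1) * bpmf p N k)"
    using mult_left_mono[OF bpmf_lower[OF assms(2-4)] wsum_nonneg[of p ?q V P]] assms by simp
  also have "\<dots> = (wsum p ?q V P * (real (N + 1) * real (N choose k)) * (1 / ?q) ^ (card V - N)) * ?D"
    using q by (simp add: bpmf_def power_one_over)
  finally show ?thesis by (rule mult_right_le_imp_le[OF _ D])
qed

text \<open>A variant whose loss is bounded when \<open>W\<close> has a positive proportion of
  \<open>N\<close> points. The event concerns \<open>U\<close> alone, so the part in
  \<open>W\<close> is free up to its size; the number of completions is a binomial probability for
  \<open>card W\<close> trials, which \<open>bpmf_ratio\<close> compares with the mode for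
  \<open>N\<close> trials.\<close>

lemma card_le_wsum_split:
  assumes "finite U" "finite W" "U \<inter> W = {}" "0 < p" "p < 1" "real k = p * real N"
    and "1 / (1 - p) \<le> real c" "card W \<le> N" "N \<le> card U + card W"
  shows "real (card {A. A \<subseteq> U \<union> W \<and> card A = k \<and> P (A \<inter> U)})
    \<le> wsum p (1 - p) U P * ((real (N + 1) / real (card W + 1)) ^ c * real (N choose k))
       * (1 / (1 - p)) ^ (card U + card W - N)"
proof -
  let ?q = "1 - p" and ?F = "{A. A \<subseteq> U \<union> W \<and> card A = k \<and> P (A \<inter> U)}"
  let ?B = "(real (N + 1) / real (card W + 1)) ^ c"
  have q: "0 < ?q" "?q < 1" using assms by auto
  have kN: "k \<le> N" by (rule scaled_le) fact+
  let ?v = "card U + card W"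
  let ?D = "p ^ k * ?q ^ (?v - k)"
  have D: "?D > 0" using assms q by simp
  let ?G = "SIGMA S:{S. S \<subseteq> U \<and> P S}. {T. T \<subseteq> W \<and> card S + card T = k}"
  have "card ?F = card ?G"
  proof (rule bij_betw_same_card[of "\<lambda>A. (A \<inter> U, A \<inter> W)"], rule bij_betw_byWitness[where f' = "\<lambda>(S,T). S \<union> T"])
    show "(\<lambda>A. (A \<inter> U, A \<inter> W)) ` ?F \<subseteq> ?G"
    proof
      fix x assume "x \<in> (\<lambda>A. (A \<inter> U, A \<inter> W)) ` ?F"
      then obtain A where A: "A \<subseteq> U \<union> W" "card A = k" "P (A \<inter> U)" "x = (A \<inter> U, A \<inter> W)" by auto
      have "A = (A \<inter> U) \<union> (A \<inter> W)" using A by auto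
      moreover have "card ((A \<inter> U) \<union> (A \<inter> W)) = card (A \<inter> U) + card (A \<inter> W)"
        using assms by (intro card_Un_disjoint) auto
      ultimately show "x \<in> ?G" using A by auto
    qed
    show "(\<lambda>(S,T). S \<union> T) ` ?G \<subseteq> ?F"
    proof
      fix x assume "x \<in> (\<lambda>(S,T). S \<union> T) ` ?G"
      then obtain S T where S: "S \<subseteq> U" "P S" "T \<subseteq> W" "card S + card T = k" "x = S \<union> T" by auto
      have "card (S \<union> T) = card S + card T"
        using S assms by (intro card_Un_disjoint) (auto intro: finite_subset)
      moreover have "(S \<union> T) \<inter> U = S" using S assms by auto
      ultimately show "x \<in> ?F" using S by auto
    qed
    show "\<forall>a\<in>?F. (\<lambda>(S,T). S \<union> T) ((\<lambda>A. (A \<inter> U, A \<inter> W)) a) = a" by auto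
    show "\<forall>a\<in>?G. (\<lambda>A. (A \<inter> U, A \<inter> W)) ((\<lambda>(S,T). S \<union> T) a) = a" using assms by auto
  qed
  also have "\<dots> = (\<Sum>S | S \<subseteq> U \<and> P S. card {T. T \<subseteq> W \<and> card S + card T = k})"
    using assms by (intro card_SigmaI) (auto intro: finite_subset[of _ "Pow W"])
  finally have "real (card ?F) * ?D = (\<Sum>S | S \<subseteq> U \<and> P S. real (card {T. T \<subseteq> W \<and> card S + card T = k}) * ?D)"
    by (simp add: sum_distrib_right)
  also have "\<dots> \<le> (\<Sum>S | S \<subseteq> U \<and> P S. (p ^ card S * ?q ^ card (U - S)) * (?B * bpmf p N k))"
  proof (rule sum_mono)
    fix S assume "S \<in> {S. S \<subseteq> U \<and> P S}"
    then have S: "S \<subseteq> U" by auto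
    have cS: "card S \<le> card U" using card_mono[OF assms(1) S] .
    have cUS: "card (U - S) = card U - card S" using S assms(1) by (meson card_Diff_subset finite_subset)
    let ?j = "k - card S"
    show "real (card {T. T \<subseteq> W \<and> card S + card T = k}) * ?D
      \<le> (p ^ card S * ?q ^ card (U - S)) * (?B * bpmf p N k)"
    proof (cases "card S \<le> k \<and> ?j \<le> card W")
      case False
      have e: "{T. T \<subseteq> W \<and> card S + card T = k} = {}"
      proof -
        have "\<not> (T \<subseteq> W \<and> card S + card T = k)" for T
          using False card_mono[OF assms(2), of T] by auto
        then show ?thesis by auto
      qed
      show ?thesis unfolding e using q assms bpmf_nonneg[of p N k] by simp
    next
      case True
      then have "{T. T \<subseteq> W \<and> card S + card T = k} = {T. T \<subseteq> W \<and> card T = ?j}" by auto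
      then have "card {T. T \<subseteq> W \<and> card S + card T = k} = card W choose ?j"
        using n_subsets[OF assms(2)] by simp
      moreover have "?D = (p ^ card S * ?q ^ card (U - S)) * (p ^ ?j * ?q ^ (card W - ?j))"
      proof -
        have "card (U - S) + (card W - ?j) = ?v - k" using True cS cUS by linarith
        then have "?q ^ (?v - k) = ?q ^ card (U - S) * ?q ^ (card W - ?j)" by (metis power_add)
        moreover have "p ^ k = p ^ card S * p ^ ?j" using True by (simp flip: power_add)
        ultimately show ?thesis by (simp only: mult_ac)
      qed
      ultimately have "real (card {T. T \<subseteq> W \<and> card S + card T = k}) * ?D
         = (p ^ card S * ?q ^ card (U - S)) * bpmf p (card W) ?j"
        by (simp add: bpmf_def mult_ac)
      also have "\<dots> \<le> (p ^ card S * ?q ^ card (U - S)) * (?B * bpmf p N k)"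
        using bpmf_ratio[OF assms(4-8)] assms q by (intro mult_left_mono) auto
      finally show ?thesis .
    qed
  qed
  also have "\<dots> = wsum p ?q U P * (?B * bpmf p N k)" by (simp add: wsum_def sum_distrib_right)
  also have "\<dots> = (wsum p ?q U P * (?B * real (N choose k)) * (1 / ?q) ^ (?v - N)) * ?D"
  proof -
    have "?v - k = (?v - N) + (N - k)" using assms(9) kN by simp
    then have "?q ^ (?v - k) = ?q ^ (?v - N) * ?q ^ (N - k)" by (metis power_add)
    then have "bpmf p N k = (real (N choose k) * (1 / ?q) ^ (?v - N)) * ?D"
      using q by (simp add: bpmf_def power_one_over)
    then show ?thesis by (simp only: mult_ac)
  qed
  finally show ?thesis by (rule mult_right_le_imp_le[OF _ D])
qed

lemma binomial_shift:
  assumes "k \<le> N" "u \<le> N" "0 < N"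
  shows "real (N - u choose k) \<le> (1 - real k / real N) ^ u * real (N choose k)"
  using assms(2)
proof (induction u)
  case (Suc u)
  let ?m = "N - Suc u"
  have m: "N - u = Suc ?m" using Suc.prems by simp
  have r: "0 \<le> 1 - real k / real N" using assms by simp
  have "real (?m choose k) \<le> (1 - real k / real N) * real (Suc ?m choose k)"
  proof (cases "k \<le> Suc ?m")
    case False
    then have e: "?m choose k = 0" by (intro binomial_eq_0) simp
    show ?thesis unfolding e using r by simp
  next
    case True
    have "(Suc ?m - k) * (Suc ?m choose k) = Suc ?m * (?m choose k)"
      using binomial_absorb_comp[of "Suc ?m" k] by simp
    then have "real (Suc ?m - k) * real (Suc ?m choose k) = real (Suc ?m) * real (?m choose k)"
      by (metis of_nat_mult)
    then have "real (?m choose k) = (1 - real k / real (Suc ?m)) * real (Suc ?m choose k)"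
      using True by (simp add: field_simps of_nat_diff)
    also have "\<dots> \<le> (1 - real k / real N) * real (Suc ?m choose k)"
      using m assms by (intro mult_right_mono diff_left_mono divide_left_mono) auto
    finally show ?thesis .
  qed
  also have "\<dots> \<le> (1 - real k / real N) * ((1 - real k / real N) ^ u * real (N choose k))"
    using Suc m r by (intro mult_left_mono) auto
  finally show ?case by simp
qed simp

section \<open>The isoperimetric method for periodic sets\<close>

text \<open>Subsets of the cyclic group of order \<open>M\<close> are represented by their preimages
  in the integers. Translates and sumsets are then the ordinary ones, and no quotient type is
  needed.\<close>

definition periodic :: "int \<Rightarrow> int set \<Rightarrow> bool" where
  "periodic M X \<longleftrightarrow> (\<forall>x. x + M \<in> X \<longleftrightarrow> x \<in> X)"

definition psize :: "int \<Rightarrow> int set \<Rightarrow> nat" where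
  "psize M X = card (X \<inter> {0..<M})"

lemma mem_translate: "y \<in> (+) t ` X \<longleftrightarrow> y - t \<in> (X :: int set)"
  by (auto simp: image_iff) (metis add.commute diff_add_cancel)

lemma mem_sumset: "y \<in> X + B \<longleftrightarrow> (\<exists>b\<in>B. y - b \<in> (X :: int set))"
  unfolding set_plus_def by force

lemma periodic_multiple: "periodic M X \<Longrightarrow> x + c * M \<in> X \<longleftrightarrow> x \<in> X"
proof (induction c arbitrary: x rule: int_induct[where k = 0])
  case (step1 i)
  have "x + (i + 1) * M = (x + i * M) + M" by (simp add: algebra_simps)
  then show ?case using step1 by (metis periodic_def)
next
  case (step2 i)
  have "x + i * M = (x + (i - 1) * M) + M" by (simp add: algebra_simps)
  then show ?case using step2 by (metis periodic_def)
qed simp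

lemma periodic_mod: "periodic M X \<Longrightarrow> x mod M \<in> X \<longleftrightarrow> x \<in> X"
  by (metis periodic_multiple mod_mult_div_eq mult.commute)

lemma periodic_cong:
  assumes "periodic M X" "M dvd x - y"
  shows "x \<in> X \<longleftrightarrow> y \<in> X"
proof -
  obtain c where "x - y = M * c" using assms(2) by blast
  then have "x = y + c * M" by (simp add: algebra_simps)
  then show ?thesis using periodic_multiple[OF assms(1)] by blast
qed

lemma periodic_Un: "periodic M X \<Longrightarrow> periodic M Y \<Longrightarrow> periodic M (X \<union> Y)"
  and periodic_Int: "periodic M X \<Longrightarrow> periodic M Y \<Longrightarrow> periodic M (X \<inter> Y)"
  and periodic_Compl: "periodic M X \<Longrightarrow> periodic M (- X)"
  by (simp_all add: periodic_def)

lemma periodic_translate: "periodic M X \<Longrightarrow> periodic M ((+) t ` X)"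
  unfolding periodic_def mem_translate by (metis add.commute add_diff_eq diff_add_eq)

lemma periodic_uminus:
  assumes "periodic M X"
  shows "periodic M (uminus ` X)"
proof -
  have "y \<in> uminus ` X \<longleftrightarrow> - y \<in> X" for y by (auto simp: image_iff) (metis minus_minus)
  moreover have "- (y + M) \<in> X \<longleftrightarrow> - y \<in> X" for y
    using assms unfolding periodic_def by (metis add.commute add_minus_cancel minus_add)
  ultimately show ?thesis by (simp add: periodic_def)
qed

lemma periodic_sumset: "periodic M X \<Longrightarrow> periodic M (X + B)"
  unfolding periodic_def mem_sumset by (metis add.commute add_diff_eq diff_add_eq)

lemma psize_mono: "X \<subseteq> Y \<Longrightarrow> psize M X \<le> psize M Y"
  unfolding psize_def by (intro card_mono) auto

lemma psize_le: "psize M X \<le> nat M"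
proof -
  have "card (X \<inter> {0..<M}) \<le> card {0..<M}" by (intro card_mono) auto
  then show ?thesis by (simp add: psize_def)
qed

lemma psize_Un_Int: "psize M (X \<union> Y) + psize M (X \<inter> Y) = psize M X + psize M Y"
proof -
  have "card (X \<inter> {0..<M}) + card (Y \<inter> {0..<M})
     = card (X \<inter> {0..<M} \<union> Y \<inter> {0..<M}) + card (X \<inter> {0..<M} \<inter> (Y \<inter> {0..<M}))"
    by (intro card_Un_Int) auto
  moreover have "X \<inter> {0..<M} \<union> Y \<inter> {0..<M} = (X \<union> Y) \<inter> {0..<M}" by auto
  moreover have "X \<inter> {0..<M} \<inter> (Y \<inter> {0..<M}) = X \<inter> Y \<inter> {0..<M}" by auto
  ultimately show ?thesis by (simp add: psize_def)
qed

lemma psize_Compl: "M > 0 \<Longrightarrow> psize M X + psize M (- X) = nat M"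
  using psize_Un_Int[of M X "- X"] by (simp add: psize_def)

lemma psize_translate:
  assumes "M > 0" "periodic M X"
  shows "psize M ((+) t ` X) = psize M X"
proof -
  have "bij_betw (\<lambda>x. (t + x) mod M) (X \<inter> {0..<M}) ((+) t ` X \<inter> {0..<M})"
  proof (rule bij_betw_byWitness[where f' = "\<lambda>x. (x - t) mod M"])
    show "\<forall>a\<in>X \<inter> {0..<M}. ((t + a) mod M - t) mod M = a"
      by (simp add: mod_diff_left_eq)
    show "\<forall>a\<in>(+) t ` X \<inter> {0..<M}. (t + (a - t) mod M) mod M = a"
      by (simp add: mod_add_right_eq)
    show "(\<lambda>x. (t + x) mod M) ` (X \<inter> {0..<M}) \<subseteq> (+) t ` X \<inter> {0..<M}"
      using assms periodic_translate[OF assms(2), of t] by (auto simp: periodic_mod)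
    show "(\<lambda>x. (x - t) mod M) ` ((+) t ` X \<inter> {0..<M}) \<subseteq> X \<inter> {0..<M}"
      using assms by (auto simp: periodic_mod)
  qed
  then show ?thesis unfolding psize_def by (metis bij_betw_same_card)
qed

lemma psize_uminus:
  assumes "M > 0" "periodic M X"
  shows "psize M (uminus ` X) = psize M X"
proof -
  have "bij_betw (\<lambda>x. (- x) mod M) (X \<inter> {0..<M}) (uminus ` X \<inter> {0..<M})"
  proof (rule bij_betw_byWitness[where f' = "\<lambda>x. (- x) mod M"])
    show "\<forall>a\<in>X \<inter> {0..<M}. (- ((- a) mod M)) mod M = a"
      "\<forall>a\<in>uminus ` X \<inter> {0..<M}. (- ((- a) mod M)) mod M = a"
      by (simp_all add: mod_minus_eq)
    show "(\<lambda>x. (- x) mod M) ` (X \<inter> {0..<M}) \<subseteq> uminus ` X \<inter> {0..<M}"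
      using assms periodic_uminus[OF assms(2)] by (auto simp: periodic_mod)
    show "(\<lambda>x. (- x) mod M) ` (uminus ` X \<inter> {0..<M}) \<subseteq> X \<inter> {0..<M}"
      using assms by (auto simp: periodic_mod)
  qed
  then show ?thesis unfolding psize_def by (metis bij_betw_same_card)
qed

lemma periodic_eq_iff:
  assumes "M > 0" "periodic M X" "periodic M Y" "X \<inter> {0..<M} = Y \<inter> {0..<M}"
  shows "X = Y"
proof (rule set_eqI)
  fix x
  have "x mod M \<in> {0..<M}" using assms(1) by simp
  then show "x \<in> X \<longleftrightarrow> x \<in> Y"
    using assms periodic_mod by (metis IntD1 IntI)
qed

lemma psize_less:
  assumes "M > 0" "periodic M X" "periodic M Y" "X \<subseteq> Y" "X \<noteq> Y"
  shows "psize M X < psize M Y"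
proof -
  have "X \<inter> {0..<M} \<noteq> Y \<inter> {0..<M}" using periodic_eq_iff[OF assms(1-3)] assms(5) by blast
  then have "X \<inter> {0..<M} \<subset> Y \<inter> {0..<M}" using assms(4) by auto
  then show ?thesis unfolding psize_def by (intro psubset_card_mono) auto
qed

text \<open>The sets that compete for the j-th isoperimetric number of \<open>B\<close> modulo
  \<open>M\<close>: neither \<open>X\<close> nor the complement of \<open>X + B\<close> may be
  small.\<close>

definition sep :: "int \<Rightarrow> nat \<Rightarrow> int set \<Rightarrow> int set \<Rightarrow> bool" where
  "sep M j B X \<longleftrightarrow> periodic M X \<and> j \<le> psize M X \<and> j \<le> psize M (- (X + B))"

definition boundary :: "int \<Rightarrow> int set \<Rightarrow> int set \<Rightarrow> int" where
  "boundary M B X = int (psize M (X + B)) - int (psize M X)"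

text \<open>A point outside \<open>X + B\<close>, moved back by an element of \<open>B\<close>,
  cannot lie in \<open>X\<close>. So the complement of \<open>X + B\<close> plays for
  \<open>- B\<close> the role of \<open>X\<close> for \<open>B\<close>.\<close>

lemma sep_dual:
  assumes "M > 0" "sep M j B X"
  shows "sep M j (uminus ` B) (- (X + B))" "boundary M (uminus ` B) (- (X + B)) \<le> boundary M B X"
proof -
  let ?Y = "- (X + B)"
  have sub: "?Y + uminus ` B \<subseteq> - X"
  proof
    fix y assume "y \<in> ?Y + uminus ` B"
    then obtain b where "b \<in> B" "y + b \<in> ?Y" by (auto simp: mem_sumset)
    then show "y \<in> - X" by (auto simp: mem_sumset)
  qed
  have pX: "periodic M X" using assms by (simp add: sep_def)
  have "X \<subseteq> - (?Y + uminus ` B)" using sub by auto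
  then have "psize M X \<le> psize M (- (?Y + uminus ` B))" by (rule psize_mono)
  then show "sep M j (uminus ` B) ?Y"
    using assms periodic_sumset[OF pX] by (auto simp: sep_def intro: periodic_Compl)
  have "psize M (?Y + uminus ` B) \<le> psize M (- X)" using sub by (rule psize_mono)
  moreover have "psize M X + psize M (- X) = nat M" "psize M (X + B) + psize M ?Y = nat M"
    using assms by (auto intro: psize_Compl)
  ultimately show "boundary M (uminus ` B) ?Y \<le> boundary M B X" by (simp add: boundary_def)
qed

lemma uminus_sumset: "uminus ` (X + B) = uminus ` X + uminus ` (B :: int set)"
proof (intro equalityI subsetI)
  fix y assume "y \<in> uminus ` (X + B)"
  then obtain x b where xb: "x \<in> X" "b \<in> B" "y = - (x + b)" by (auto elim!: set_plus_elim)
  have "- x + - b \<in> uminus ` X + uminus ` B" using xb by (intro set_plus_intro imageI)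
  then show "y \<in> uminus ` X + uminus ` B" using xb(3) by simp
next
  fix y assume "y \<in> uminus ` X + uminus ` B"
  then obtain x b where xb: "x \<in> X" "b \<in> B" "y = - x + - b" by (auto elim!: set_plus_elim)
  have "- (x + b) \<in> uminus ` (X + B)" using xb by (intro set_plus_intro imageI)
  then show "y \<in> uminus ` (X + B)" using xb(3) by simp
qed

lemma translate_sumset: "(+) x ` (X + B) = (+) x ` X + (B :: int set)"
proof (rule set_eqI)
  fix y
  have eq: "y - x - b = y - b - x" for b by simp
  show "y \<in> (+) x ` (X + B) \<longleftrightarrow> y \<in> (+) x ` X + B"
    unfolding mem_translate mem_sumset eq ..
qed

lemma uminus_uminus_image: "uminus ` uminus ` (X :: int set) = X"
  by (simp add: image_image)

lemma translate_eq_self_card: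
  assumes "M > 0" "periodic M F" "F \<subseteq> (+) x ` F"
  shows "(+) x ` F = F"
proof (rule ccontr)
  assume "(+) x ` F \<noteq> F"
  then have "psize M F < psize M ((+) x ` F)"
    using psize_less[OF assms(1,2) periodic_translate[OF assms(2)] assms(3)] by simp
  then show False using psize_translate[OF assms(1,2), of x] by simp
qed

text \<open>\<open>F\<close> is an atom in the sense of the isoperimetric method: among the separated sets of least
  boundary, for \<open>A\<close> and for \<open>- A\<close> together, one of least size.  Taking both signs into account
  yields \<open>psize M F \<le> psize M (- (F + A))\<close>, by duality.\<close>

lemma atom_exists:
  assumes M: "M > 0" and j: "j \<ge> 1" and X0: "sep M j A X0"
  obtains F where "sep M j A F" "0 \<in> F" "boundary M A F \<le> boundary M A X0"
    "\<And>x. (+) x ` F \<noteq> F \<Longrightarrow> psize M (F \<inter> (+) x ` F) < j"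
proof -
  define cand where "cand = {(B, X). (B = A \<or> B = uminus ` A) \<and> sep M j B X}"
  \<comment> \<open>Lexicographic order in one natural number: adding \<open>M\<close> makes the
    boundary non-negative, and \<open>psize\<close> never reaches the base
    \<open>nat M + 1\<close>.\<close>
  define f where "f = (\<lambda>(B,X). nat (boundary M B X + M) * (nat M + 1) + psize M X)"
  have "(A, X0) \<in> cand" using X0 by (simp add: cand_def)
  then obtain z where z: "z \<in> cand" "\<And>w. w \<in> cand \<Longrightarrow> f z \<le> f w"
    using ex_has_least_nat[of "\<lambda>z. z \<in> cand" "(A, X0)" f] by blast
  obtain B F where BF: "z = (B, F)" by (cases z)
  have B: "B = A \<or> B = uminus ` A" and F: "sep M j B F" using z BF by (auto simp: cand_def)
  have bd0: "boundary M B X + M \<ge> 0" for B X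
    using psize_le[of M X] M by (simp add: boundary_def)
  have lex: "boundary M B F < boundary M B' X \<or> (boundary M B F = boundary M B' X \<and> psize M F \<le> psize M X)"
    if "B' = A \<or> B' = uminus ` A" "sep M j B' X" for B' X
  proof -
    have le: "nat (boundary M B F + M) * (nat M + 1) + psize M F \<le> nat (boundary M B' X + M) * (nat M + 1) + psize M X"
      using z(2)[of "(B', X)"] that by (simp add: cand_def f_def BF)
    have "nat (boundary M B F + M) \<le> nat (boundary M B' X + M)"
    proof (rule ccontr)
      assume "\<not> ?thesis"
      then have "(nat (boundary M B' X + M) + 1) * (nat M + 1) \<le> nat (boundary M B F + M) * (nat M + 1)"
        by (intro mult_right_mono) auto
      then show False using le psize_le[of M X] by (simp add: algebra_simps)
    qed
    then consider "nat (boundary M B F + M) < nat (boundary M B' X + M)" | "nat (boundary M B F + M) = nat (boundary M B' X + M)"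
      by linarith
    then show ?thesis
      using le bd0[of B F] bd0[of B' X] by cases auto
  qed
  have pF: "periodic M F" using F by (simp add: sep_def)
  have dual_sep: "sep M j (uminus ` B) (- (F + B))" by (rule sep_dual(1)[OF M F])
  have dual_bd: "boundary M (uminus ` B) (- (F + B)) \<le> boundary M B F" by (rule sep_dual(2)[OF M F])
  have "uminus ` B = A \<or> uminus ` B = uminus ` A" using B uminus_uminus_image by auto
  then have small: "psize M F \<le> psize M (- (F + B))"
    using lex[OF _ dual_sep] dual_bd by linarith
  \<comment> \<open>Submodularity. If \<open>F\<close> met a different translate in at least
    \<open>j\<close> residues, the intersection would be separated and smaller than
    \<open>F\<close>, hence of strictly larger boundary. The union would then have strictly smaller
    boundary, and \<open>small\<close> leaves enough room outside it for it to be separated, against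
    minimality.\<close>
  have inter: "psize M (F \<inter> (+) x ` F) < j" if ne: "(+) x ` F \<noteq> F" for x
  proof (rule ccontr)
    let ?F' = "(+) x ` F"
    assume "\<not> psize M (F \<inter> ?F') < j"
    then have ge: "j \<le> psize M (F \<inter> ?F')" by simp
    have pF': "periodic M ?F'" and pI: "periodic M (F \<inter> ?F')" and pU: "periodic M (F \<union> ?F')"
      using pF by (auto intro: periodic_translate periodic_Int periodic_Un)
    have "\<not> F \<subseteq> ?F'" using translate_eq_self_card[OF M pF] ne by blast
    then have lt: "psize M (F \<inter> ?F') < psize M F" using psize_less[OF M pI pF] by blast
    have "(F \<inter> ?F') + B \<subseteq> F + B" by (intro set_plus_mono2) auto
    then have "psize M (- (F + B)) \<le> psize M (- ((F \<inter> ?F') + B))" by (intro psize_mono) auto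
    then have sI: "sep M j B (F \<inter> ?F')" using F ge pI by (simp add: sep_def)
    have b1: "boundary M B F < boundary M B (F \<inter> ?F')" using lex[OF B sI] lt by linarith
    have szF': "psize M ?F' = psize M F" "psize M (?F' + B) = psize M (F + B)"
      using psize_translate[OF M] pF periodic_sumset[OF pF] by (auto simp flip: translate_sumset)
    have UB: "(F \<union> ?F') + B = (F + B) \<union> (?F' + B)"
      by (rule set_eqI) (simp only: mem_sumset Un_iff, blast)
    have IB: "(F \<inter> ?F') + B \<subseteq> (F + B) \<inter> (?F' + B)"
      by (intro Int_greatest set_plus_mono2) auto
    have sub: "psize M ((F \<union> ?F') + B) + psize M ((F \<inter> ?F') + B) \<le> 2 * psize M (F + B)"
      using psize_Un_Int[of M "F + B" "?F' + B"] psize_mono[OF IB, of M] szF' UB by simp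
    have UI: "psize M (F \<union> ?F') + psize M (F \<inter> ?F') = 2 * psize M F"
      using psize_Un_Int[of M F ?F'] szF' by simp
    have c1: "psize M (F + B) + psize M (- (F + B)) = nat M"
      and c2: "psize M ((F \<union> ?F') + B) + psize M (- ((F \<union> ?F') + B)) = nat M"
      using psize_Compl[OF M] by blast+
    have "j \<le> psize M (- ((F \<union> ?F') + B))"
      using sub b1 c1 c2 small ge unfolding boundary_def by linarith
    moreover have "j \<le> psize M (F \<union> ?F')" using F psize_mono[of F "F \<union> ?F'" M] by (simp add: sep_def)
    ultimately have sU: "sep M j B (F \<union> ?F')" using pU by (simp add: sep_def)
    have "boundary M B (F \<union> ?F') < boundary M B F"
      using sub b1 UI unfolding boundary_def by linarith
    then show False using lex[OF B sU] by linarith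
  qed
  have bdX0: "boundary M B F \<le> boundary M A X0" using lex[of A X0] X0 by auto
  have "\<exists>G. sep M j A G \<and> boundary M A G \<le> boundary M A X0 \<and> (\<forall>x. (+) x ` G \<noteq> G \<longrightarrow> psize M (G \<inter> (+) x ` G) < j)"
    using B
  proof
    assume "B = A"
    then show ?thesis using F bdX0 inter by blast
  next
    assume B': "B = uminus ` A"
    let ?G = "uminus ` F"
    have GA: "?G + A = uminus ` (F + B)" using B' by (simp add: uminus_sumset uminus_uminus_image)
    have compl: "- (?G + A) = uminus ` (- (F + B))"
      unfolding GA by (metis bij_image_Compl_eq bij_uminus)
    have pFB: "periodic M (F + B)" by (rule periodic_sumset[OF pF])
    have "sep M j A ?G"
      using F pF unfolding sep_def compl
      by (auto simp: psize_uminus[OF M] periodic_uminus periodic_Compl[OF pFB])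
    moreover have "boundary M A ?G = boundary M B F"
      unfolding boundary_def GA using pF pFB by (simp add: psize_uminus[OF M])
    moreover have "psize M (?G \<inter> (+) x ` ?G) < j" if ne: "(+) x ` ?G \<noteq> ?G" for x
    proof -
      have eq: "(+) x ` ?G = uminus ` ((+) (- x) ` F)" by (auto simp: image_image)
      then have "(+) (- x) ` F \<noteq> F" using ne by auto
      then have "psize M (F \<inter> (+) (- x) ` F) < j" by (rule inter)
      moreover have "?G \<inter> (+) x ` ?G = uminus ` (F \<inter> (+) (- x) ` F)"
        unfolding eq by (simp add: image_Int)
      moreover have "periodic M (F \<inter> (+) (- x) ` F)"
        using pF by (intro periodic_Int periodic_translate)
      ultimately show ?thesis by (simp only: psize_uminus[OF M])
    qed
    ultimately show ?thesis using bdX0 by metis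
  qed
  then obtain G where G: "sep M j A G" "boundary M A G \<le> boundary M A X0"
    "\<And>x. (+) x ` G \<noteq> G \<Longrightarrow> psize M (G \<inter> (+) x ` G) < j" by blast
  have pG: "periodic M G" using G by (simp add: sep_def)
  have "psize M G > 0" using G j by (simp add: sep_def)
  then obtain g where g: "g \<in> G" unfolding psize_def by (metis IntE card_gt_0_iff ex_in_conv)
  define h where "h = - g"
  define H where "H = (+) h ` G"
  have "0 \<in> H" using g by (simp add: H_def h_def mem_translate)
  have HA: "H + A = (+) h ` (G + A)" by (simp add: H_def translate_sumset)
  have compl: "- (H + A) = (+) h ` (- (G + A))" unfolding HA by (auto simp: mem_translate)
  have pGA: "periodic M (G + A)" by (rule periodic_sumset[OF pG])
  have "sep M j A H"
    using G(1) pG unfolding sep_def compl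
    by (auto simp: H_def psize_translate[OF M] periodic_translate periodic_Compl[OF pGA])
  moreover have "boundary M A H = boundary M A G"
    unfolding boundary_def HA using pG pGA by (simp add: psize_translate[OF M] H_def)
  moreover have "psize M (H \<inter> (+) x ` H) < j" if ne: "(+) x ` H \<noteq> H" for x
  proof -
    have eq: "(+) x ` H = (+) h ` ((+) x ` G)" by (auto simp: H_def image_image algebra_simps)
    then have "(+) x ` G \<noteq> G" using ne by (auto simp: H_def)
    then have "psize M (G \<inter> (+) x ` G) < j" by (rule G(3))
    moreover have "H \<inter> (+) x ` H = (+) h ` (G \<inter> (+) x ` G)"
      unfolding eq by (auto simp: H_def mem_translate)
    ultimately show ?thesis
      using pG by (simp add: psize_translate[OF M] periodic_Int periodic_translate)
  qed
  ultimately show ?thesis using that[of H] \<open>0 \<in> H\<close> G(2) by simp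
qed

lemma int_subgroup_principal:
  fixes H :: "int set"
  assumes "M \<in> H" "M > 0" "\<And>x y. x \<in> H \<Longrightarrow> y \<in> H \<Longrightarrow> x - y \<in> H"
  obtains d where "d > 0" "d dvd M" "H = {x. d dvd x}"
proof -
  have z: "0 \<in> H" using assms(3)[OF assms(1,1)] by simp
  have neg: "- x \<in> H" if "x \<in> H" for x using assms(3)[OF z that] by simp
  have add: "x + y \<in> H" if "x \<in> H" "y \<in> H" for x y using assms(3)[OF that(1) neg[OF that(2)]] by simp
  have mul: "c * x \<in> H" if "x \<in> H" for c x
  proof (induction c rule: int_induct[where k = 0])
    case (step1 i)
    have "(i + 1) * x = i * x + x" by (simp add: algebra_simps)
    then show ?case using add[OF step1(2) that] by metis
  next
    case (step2 i)
    have "(i - 1) * x = i * x - x" by (simp add: algebra_simps)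
    then show ?case using assms(3)[OF step2(2) that] by metis
  qed (simp add: z)
  define d where "d = int (LEAST n. n > 0 \<and> int n \<in> H)"
  have ex: "nat M > 0 \<and> int (nat M) \<in> H" using assms by simp
  have d: "d > 0" "d \<in> H" using LeastI[of "\<lambda>n. n > 0 \<and> int n \<in> H", OF ex] by (auto simp: d_def)
  have least: "\<not> (0 < x \<and> x < d)" if "x \<in> H" for x
  proof
    assume x: "0 < x \<and> x < d"
    then have "(LEAST n. n > 0 \<and> int n \<in> H) \<le> nat x" using that by (intro Least_le) auto
    then have "d \<le> x" unfolding d_def using x by (metis le_nat_iff less_imp_le)
    then show False using x by simp
  qed
  have "H = {x. d dvd x}"
  proof (intro equalityI subsetI)
    fix x assume x: "x \<in> H"
    have "x mod d = x - (x div d) * d" by (simp add: minus_div_mult_eq_mod)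
    then have "x mod d \<in> H" using assms(3)[OF x mul[OF d(2)]] by simp
    then have "x mod d = 0" using least[of "x mod d"] d(1) by (metis pos_mod_bound pos_mod_sign order_le_less)
    then show "x \<in> {x. d dvd x}" by auto
  next
    fix x assume "x \<in> {x. d dvd x}"
    then show "x \<in> H" using mul[OF d(2)] by (auto simp: mult.commute)
  qed
  then show ?thesis using that[of d] d assms(1) by blast
qed

lemma psize_multiples:
  assumes "M > 0" "d > 0" "d dvd M"
  shows "psize M {x. d dvd x} = nat (M div d)"
proof -
  obtain c where c: "M = d * c" using assms(3) by blast
  have "{x. d dvd x} \<inter> {0..<M} = (\<lambda>i. d * i) ` {0..<c}"
  proof (intro equalityI subsetI)
    fix x assume "x \<in> {x. d dvd x} \<inter> {0..<M}"
    then obtain i where i: "x = d * i" "0 \<le> d * i" "d * i < d * c" using c by auto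
    then have "0 \<le> i" "i < c" using assms(2) by (simp_all add: zero_le_mult_iff)
    then show "x \<in> (\<lambda>i. d * i) ` {0..<c}" using i(1) by (intro image_eqI[of _ _ i]) auto
  next
    fix x assume "x \<in> (\<lambda>i. d * i) ` {0..<c}"
    then obtain i where i': "i \<in> {0..<c}" "x = d * i" by blast
    then have i: "x = d * i" "0 \<le> i" "i < c" by simp_all
    then have "0 \<le> x" "x < d * c" using assms(2) by simp_all
    then show "x \<in> {x. d dvd x} \<inter> {0..<M}" using i c by simp
  qed
  then have "psize M {x. d dvd x} = card {0..<c}"
    unfolding psize_def using assms(2) by (simp add: card_image inj_on_def)
  then show ?thesis using c assms(2) by simp
qed

text \<open>A Bonferroni inequality: each new set loses at most \<open>j\<close> to every earlier
  one.\<close>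

lemma psize_Union_lower:
  assumes "finite T" "\<And>X. X \<in> T \<Longrightarrow> psize M X = f"
    "\<And>X Y. X \<in> T \<Longrightarrow> Y \<in> T \<Longrightarrow> X \<noteq> Y \<Longrightarrow> psize M (X \<inter> Y) \<le> j"
  shows "card T * f \<le> psize M (\<Union>T) + card T * card T * j"
  using assms
proof (induction T rule: finite_induct)
  case (insert X T)
  have "psize M (X \<inter> \<Union>T) \<le> (\<Sum>Y\<in>T. psize M (X \<inter> Y))"
  proof -
    have "X \<inter> \<Union>T \<inter> {0..<M} = (\<Union>Y\<in>T. X \<inter> Y \<inter> {0..<M})" by auto
    then show ?thesis unfolding psize_def using card_UN_le[OF insert.hyps(1)] by metis
  qed
  also have "\<dots> \<le> (\<Sum>Y\<in>T. j)" using insert by (intro sum_mono) auto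
  finally have a: "psize M (X \<inter> \<Union>T) \<le> card T * j" by simp
  have "card T * f \<le> psize M (\<Union>T) + card T * card T * j" using insert by simp
  moreover have "psize M (X \<union> \<Union>T) + psize M (X \<inter> \<Union>T) = f + psize M (\<Union>T)"
    using psize_Un_Int[of M X "\<Union>T"] insert.prems(1)[of X] by simp
  ultimately have "Suc (card T) * f \<le> psize M (X \<union> \<Union>T) + card T * j + card T * card T * j"
    using a by simp
  also have "\<dots> \<le> psize M (X \<union> \<Union>T) + Suc (card T) * Suc (card T) * j" by (simp add: algebra_simps)
  finally show ?case using insert.hyps by simp
qed simp

text \<open>Let \<open>Q\<close> be the stabiliser of an atom \<open>F\<close>. If \<open>Q\<close>
  has at least \<open>j\<close> residues, then for y in \<open>F\<close> the sets \<open>F\<close>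
  and y + F share y + Q, so they coincide; hence F = Q is a subgroup. Otherwise at most
  \<open>j\<close> elements of \<open>A\<close> give the same translate of \<open>F\<close>, so
  \<open>A\<close> yields many distinct translates. They meet pairwise in few residues and all lie
  in \<open>F + A\<close>, so \<open>F\<close> must be small.\<close>

lemma atom_dichotomy:
  assumes M: "M > 0" and j: "j \<ge> 1" and A: "finite A" and X0: "sep M j A X0"
    and c: "boundary M A X0 \<le> int c"
  obtains F where "sep M j A F" "0 \<in> F" "psize M (F + A) \<le> psize M F + c"
    "(\<exists>d>0. d dvd M \<and> F = {x. d dvd x}) \<or>
     (\<forall>i. i * j \<le> card (A \<inter> {0..<M}) \<longrightarrow> i * psize M F \<le> psize M F + c + i * i * j)"
proof -
  obtain F where F: "sep M j A F" "0 \<in> F" "boundary M A F \<le> boundary M A X0"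
    "\<And>x. (+) x ` F \<noteq> F \<Longrightarrow> psize M (F \<inter> (+) x ` F) < j"
    using atom_exists[OF M j X0] by blast
  have pF: "periodic M F" and szF: "j \<le> psize M F" using F(1) by (auto simp: sep_def)
  have bd: "psize M (F + A) \<le> psize M F + c" using F(3) c by (simp add: boundary_def)
  define Q where "Q = {x. (+) x ` F = F}"
  have Q: "x \<in> Q \<longleftrightarrow> (\<forall>y. y - x \<in> F \<longleftrightarrow> y \<in> F)" for x by (auto simp: Q_def set_eq_iff mem_translate)
  have "y - M \<in> F \<longleftrightarrow> y \<in> F" for y
    using pF[unfolded periodic_def, THEN spec, of "y - M"] by simp
  then have "M \<in> Q" unfolding Q by blast
  moreover have "x - y \<in> Q" if "x \<in> Q" "y \<in> Q" for x y
  proof -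
    have "z - (x - y) \<in> F \<longleftrightarrow> z \<in> F" for z
      using that(1)[unfolded Q, THEN spec, of "z + y"] that(2)[unfolded Q, THEN spec, of "z + y"]
      by (simp add: algebra_simps)
    then show ?thesis by (simp add: Q)
  qed
  ultimately obtain d where d: "d > 0" "d dvd M" "Q = {x. d dvd x}"
    using int_subgroup_principal[of M Q] M by metis
  have pQ: "periodic M Q" using d by (simp add: periodic_def dvd_add_left_iff)
  have QF: "x \<in> F" if "x \<in> Q" for x
    using that[unfolded Q, THEN spec, of x] F(2) by simp
  show ?thesis
  proof (cases "j \<le> psize M Q")
    case True
    have "F \<subseteq> Q"
    proof
      fix y assume y: "y \<in> F"
      have "(+) y ` Q \<subseteq> F \<inter> (+) y ` F"
      proof
        fix z assume "z \<in> (+) y ` Q"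
        then have q: "z - y \<in> Q" by (simp add: mem_translate)
        have "z \<in> F" using q[unfolded Q, THEN spec, of z] y by simp
        then show "z \<in> F \<inter> (+) y ` F" using QF[OF q] by (simp add: mem_translate)
      qed
      then have "psize M ((+) y ` Q) \<le> psize M (F \<inter> (+) y ` F)" by (rule psize_mono)
      then have "\<not> psize M (F \<inter> (+) y ` F) < j" using True psize_translate[OF M pQ] by simp
      then show "y \<in> Q" using F(4)[of y] by (auto simp: Q_def)
    qed
    then have "F = Q" using QF by auto
    then have "\<exists>d>0. d dvd M \<and> F = {x. d dvd x}" using d by auto
    then show ?thesis by (rule that[OF F(1,2) bd disjI1])
  next
    case False
    have "i * psize M F \<le> psize M F + c + i * i * j" if i: "i * j \<le> card (A \<inter> {0..<M})" for i
    proof -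
      let ?A = "A \<inter> {0..<M}" and ?t = "\<lambda>a. (+) a ` F"
      have fib: "card {a \<in> ?A. ?t a = Y} \<le> j" if Y: "Y \<in> ?t ` ?A" for Y
      proof -
        obtain b where b: "b \<in> ?A" "Y = ?t b" using Y by blast
        have "{a \<in> ?A. ?t a = Y} \<subseteq> (+) b ` Q \<inter> {0..<M}"
        proof
          fix a assume "a \<in> {a \<in> ?A. ?t a = Y}"
          then have a: "a \<in> {0..<M}" "?t a = ?t b" using b by auto
          have "y - (a - b) \<in> F \<longleftrightarrow> y \<in> F" for y
          proof -
            have "y + b \<in> ?t a \<longleftrightarrow> y + b \<in> ?t b" using a by simp
            then show ?thesis by (simp only: mem_translate) (simp add: algebra_simps)
          qed
          then show "a \<in> (+) b ` Q \<inter> {0..<M}" using a by (simp add: Q mem_translate)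
        qed
        then have "card {a \<in> ?A. ?t a = Y} \<le> psize M ((+) b ` Q)" unfolding psize_def by (intro card_mono) auto
        then show ?thesis using False psize_translate[OF M pQ] by simp
      qed
      have finA: "finite ?A" by simp
      have "?A = (\<Union>Y\<in>?t ` ?A. {a \<in> ?A. ?t a = Y})" by auto
      then have "card ?A \<le> (\<Sum>Y\<in>?t ` ?A. card {a \<in> ?A. ?t a = Y})"
        using card_UN_le[of "?t ` ?A" "\<lambda>Y. {a \<in> ?A. ?t a = Y}"] by simp
      also have "\<dots> \<le> (\<Sum>Y\<in>?t ` ?A. j)" using fib by (intro sum_mono)
      finally have "card ?A \<le> card (?t ` ?A) * j" by simp
      then have "i * j \<le> card (?t ` ?A) * j" using i by (rule order.trans[rotated])
      then have "i \<le> card (?t ` ?A)" using j by (simp only: mult_le_cancel2)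
      then obtain T where T: "T \<subseteq> ?t ` ?A" "card T = i" "finite T"
        by (metis obtain_subset_with_card_n)
      have "card T * psize M F \<le> psize M (\<Union>T) + card T * card T * j"
      proof (rule psize_Union_lower[OF T(3)])
        fix X assume "X \<in> T"
        then obtain a where "X = ?t a" using T by blast
        then show "psize M X = psize M F" using psize_translate[OF M pF] by simp
      next
        fix X Y assume XY: "X \<in> T" "Y \<in> T" "X \<noteq> Y"
        have "X \<in> ?t ` ?A" "Y \<in> ?t ` ?A" using XY(1,2) T(1) by auto
        then obtain a b where ab: "X = ?t a" "Y = ?t b" by (elim imageE)
        have "(+) (b - a) ` F \<noteq> F"
        proof
          assume "(+) (b - a) ` F = F"
          then have "(+) a ` ((+) (b - a) ` F) = (+) a ` F" by simp
          then show False using ab XY by (simp add: image_image)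
        qed
        then have "psize M (F \<inter> (+) (b - a) ` F) < j" by (rule F(4))
        moreover have "X \<inter> Y = (+) a ` (F \<inter> (+) (b - a) ` F)"
        proof (rule set_eqI)
          fix y
          have "y - a - (b - a) = y - b" by simp
          then show "y \<in> X \<inter> Y \<longleftrightarrow> y \<in> (+) a ` (F \<inter> (+) (b - a) ` F)"
            unfolding ab by (simp only: Int_iff mem_translate)
        qed
        ultimately show "psize M (X \<inter> Y) \<le> j"
          using psize_translate[OF M, of "F \<inter> (+) (b - a) ` F" a] pF
          by (simp add: periodic_Int periodic_translate)
      qed
      moreover have "\<Union>T \<subseteq> F + A"
      proof
        fix y assume "y \<in> \<Union>T"
        then obtain a where a: "a \<in> ?A" "y \<in> ?t a" using T(1) by blast
        then show "y \<in> F + A" unfolding mem_sumset mem_translate by blast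
      qed
      then have "psize M (\<Union>T) \<le> psize M (F + A)" by (rule psize_mono)
      ultimately show ?thesis using T(2) bd by simp
    qed
    then have "\<forall>i. i * j \<le> card (A \<inter> {0..<M}) \<longrightarrow> i * psize M F \<le> psize M F + c + i * i * j"
      by simp
    then show ?thesis by (rule that[OF F(1,2) bd disjI2])
  qed
qed

section \<open>Describing a set by its boundary\<close>

lemma card_small_subsets:
  assumes "finite V"
  shows "card {X. X \<subseteq> V \<and> card X \<le> t} \<le> (card V + 1) ^ t"
proof (induction t)
  case 0
  have "{X. X \<subseteq> V \<and> card X \<le> 0} = {{}}" using assms by (auto dest: finite_subset)
  then show ?case by simp
next
  case (Suc t)
  let ?P = "{X. X \<subseteq> V \<and> card X \<le> t} \<times> insert None (Some ` V)"
  let ?f = "\<lambda>(X, v). case v of None \<Rightarrow> X | Some v \<Rightarrow> insert v X"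
  have fin: "finite ?P" using assms by simp
  have "{X. X \<subseteq> V \<and> card X \<le> Suc t} \<subseteq> ?f ` ?P"
  proof
    fix X assume X: "X \<in> {X. X \<subseteq> V \<and> card X \<le> Suc t}"
    show "X \<in> ?f ` ?P"
    proof (cases "card X \<le> t")
      case True
      then show ?thesis using X by (intro image_eqI[of _ _ "(X, None)"]) auto
    next
      case False
      then obtain v where v: "v \<in> X" by fastforce
      have "finite X" using X assms finite_subset by blast
      have "card (X - {v}) = card X - 1" using v \<open>finite X\<close> by simp
      moreover have "card X \<le> Suc t" using X by simp
      ultimately have "card (X - {v}) \<le> t" by linarith
      then show ?thesis using X v by (intro image_eqI[of _ _ "(X - {v}, Some v)"]) auto
    qed
  qed
  then have "card {X. X \<subseteq> V \<and> card X \<le> Suc t} \<le> card ?P"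
    using fin by (meson card_image_le card_mono finite_imageI le_trans)
  also have "\<dots> = card {X. X \<subseteq> V \<and> card X \<le> t} * (card V + 1)"
    using assms by (simp add: card_cartesian_product card_image)
  also have "\<dots> \<le> (card V + 1) ^ t * (card V + 1)" using Suc by (intro mult_right_mono) auto
  finally show ?case by (simp add: algebra_simps)
qed

text \<open>As long as the subgroup generated by \<open>M\<close> and the chosen elements has fewer
  than \<open>j\<close> residues, it cannot contain \<open>F\<close>. Adding an element of
  \<open>F\<close> outside it at least doubles its order, so \<open>r\<close> elements are
  enough.\<close>

lemma gcd_chain:
  assumes M: "M > 0" and "j \<le> psize M F" "j \<le> 2 ^ r"
  obtains D where "D \<subseteq> F \<inter> {0..<M}" "card D \<le> r" "j \<le> nat (M div Gcd (insert M D))"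
proof -
  have "\<exists>D\<subseteq>F \<inter> {0..<M}. card D \<le> r \<and> (j \<le> nat (M div Gcd (insert M D)) \<or> 2 ^ r \<le> nat (M div Gcd (insert M D)))"
    for r
  proof (induction r)
    case 0
    show ?case using M by (intro exI[of _ "{}"]) simp
  next
    case (Suc r)
    then obtain D where D: "D \<subseteq> F \<inter> {0..<M}" "card D \<le> r"
      "j \<le> nat (M div Gcd (insert M D)) \<or> 2 ^ r \<le> nat (M div Gcd (insert M D))" by blast
    define g where "g = Gcd (insert M D)"
    have g: "g dvd M" by (simp add: g_def)
    then have g0: "g > 0" using M unfolding g_def by (metis Gcd_int_greater_eq_0 dvd_0_left_iff less_irrefl order_le_less)
    show ?case
    proof (cases "j \<le> nat (M div g)")
      case True
      then show ?thesis using D unfolding g_def by (intro exI[of _ D]) auto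
    next
      case False
      have "\<not> F \<inter> {0..<M} \<subseteq> {x. g dvd x}"
      proof
        assume "F \<inter> {0..<M} \<subseteq> {x. g dvd x}"
        then have "psize M F \<le> psize M {x. g dvd x}" unfolding psize_def by (intro card_mono) auto
        then show False using False psize_multiples[OF M g0 g] assms(2) by simp
      qed
      then obtain d where d: "d \<in> F \<inter> {0..<M}" "\<not> g dvd d" by blast
      define g' where "g' = Gcd (insert M (insert d D))"
      have g': "g' = gcd d g" unfolding g'_def g_def by (simp add: gcd.left_commute)
      then have "g' dvd g" by simp
      then obtain c where c: "g = g' * c" by blast
      have g'0: "g' > 0" using g0 g' by (simp add: gcd_pos_int)
      have "c > 0" using c g0 g'0 by (simp add: zero_less_mult_iff)
      moreover have "c \<noteq> 1" using c g' d(2) by (metis gcd_dvd1 mult.right_neutral)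
      ultimately have c2: "c \<ge> 2" by simp
      obtain m where m: "M = g * m" using g by blast
      have m0: "m > 0" using m g0 M by (simp add: zero_less_mult_iff)
      have "M div g = m" "M div g' = c * m" using m c g0 g'0 by auto
      moreover have "2 ^ r \<le> nat m" using D(3) False \<open>M div g = m\<close> unfolding g_def by simp
      moreover have "2 * m \<le> c * m" using c2 m0 by (intro mult_right_mono) auto
      moreover have "int (2 ^ r) \<le> m" using \<open>2 ^ r \<le> nat m\<close> m0 by linarith
      ultimately have "int (2 ^ Suc r) \<le> M div g'" unfolding power_Suc by linarith
      then have "2 ^ Suc r \<le> nat (M div g')" by linarith
      moreover have "card (insert d D) \<le> Suc r"
        using D(2) finite_subset[OF D(1)] by (simp add: card_insert_if)
      ultimately show ?thesis using D d unfolding g'_def by (intro exI[of _ "insert d D"]) auto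
    qed
  qed
  then obtain D where D: "D \<subseteq> F \<inter> {0..<M}" "card D \<le> r"
      "j \<le> nat (M div Gcd (insert M D)) \<or> 2 ^ r \<le> nat (M div Gcd (insert M D))" by blast
  have "j \<le> nat (M div Gcd (insert M D))" using D(3) assms(3) by linarith
  then show ?thesis by (rule that[OF D(1,2)])
qed

section \<open>Components of a set under a few steps, and their seeds\<close>

definition conn :: "int \<Rightarrow> int set \<Rightarrow> int set \<Rightarrow> (int \<times> int) set" where
  "conn M D S = {(x, y). x \<in> S \<and> y \<in> S \<and> (M dvd x - y \<or> (\<exists>d\<in>D. y = x + d \<or> x = y + d))}"

lemma sym_conn: "sym (conn M D S)"
  unfolding sym_def conn_def by (auto simp: dvd_diff_commute)

text \<open>For \<open>- S\<close> in place of \<open>S\<close> this lists the steps that enter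
  \<open>S\<close>.\<close>

definition exits :: "int \<Rightarrow> int set \<Rightarrow> int set \<Rightarrow> (int \<times> int) set" where
  "exits M D S = {(x, d). x \<in> {0..<M} \<and> d \<in> D \<and> x \<in> S \<and> x + d \<notin> S}"

text \<open>Every component of \<open>S\<close> is visible: either \<open>R\<close> contains one of
  its points, or some step leaves \<open>S\<close> from it and is recorded in
  \<open>exits\<close>.\<close>

definition seeded :: "int \<Rightarrow> int set \<Rightarrow> int set \<Rightarrow> int set \<Rightarrow> bool" where
  "seeded M D R S \<longleftrightarrow> (\<forall>s\<in>S. \<exists>z\<in>S. (z, s) \<in> (conn M D S)\<^sup>* \<and> (z \<in> R \<or> (\<exists>d\<in>D. z + d \<notin> S)))"

lemma exits_iff:
  assumes "M > 0" "periodic M S"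
  shows "(x mod M, d) \<in> exits M D S \<longleftrightarrow> d \<in> D \<and> x \<in> S \<and> x + d \<notin> S"
    and "(x mod M, d) \<in> exits M D (- S) \<longleftrightarrow> d \<in> D \<and> x \<notin> S \<and> x + d \<in> S"
proof -
  have "x mod M + d \<in> S \<longleftrightarrow> x + d \<in> S"
    using periodic_cong[OF assms(2), of "x mod M + d" "x + d"]
    by (simp add: mod_eq_dvd_iff[symmetric])
  then show "(x mod M, d) \<in> exits M D S \<longleftrightarrow> d \<in> D \<and> x \<in> S \<and> x + d \<notin> S"
    and "(x mod M, d) \<in> exits M D (- S) \<longleftrightarrow> d \<in> D \<and> x \<notin> S \<and> x + d \<in> S"
    using assms periodic_mod[OF assms(2), of x] by (auto simp: exits_def)
qed

text \<open>Start from a visible point, which lies in \<open>S'\<close> as well, and walk inside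
  \<open>S\<close>. An edge of the walk that left \<open>S'\<close> would be an exit or an entry of
  \<open>S'\<close>, hence of \<open>S\<close>, although both its ends lie in
  \<open>S\<close>.\<close>

lemma seeded_determines:
  assumes M: "M > 0" and p: "periodic M S" "periodic M S'" and R: "R \<subseteq> S'"
    and eq: "exits M D S = exits M D S'" "exits M D (- S) = exits M D (- S')"
    and seed: "seeded M D R S"
  shows "S \<subseteq> S'"
proof
  fix s assume "s \<in> S"
  then obtain z where z: "z \<in> S" "(z, s) \<in> (conn M D S)\<^sup>*" "z \<in> R \<or> (\<exists>d\<in>D. z + d \<notin> S)"
    using seed unfolding seeded_def by blast
  have zS': "z \<in> S'"
  proof (cases "z \<in> R")
    case False
    then obtain d where "d \<in> D" "z + d \<notin> S" using z by blast
    then have "(z mod M, d) \<in> exits M D S'" unfolding eq(1)[symmetric] using exits_iff(1)[OF M p(1)] z(1) by blast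
    then show ?thesis using exits_iff(1)[OF M p(2)] by blast
  qed (use R in blast)
  show "s \<in> S'" using z(2)
  proof (induction rule: rtrancl_induct)
    case (step x y)
    then have xy: "x \<in> S" "y \<in> S" "x \<in> S'" "M dvd x - y \<or> (\<exists>d\<in>D. y = x + d \<or> x = y + d)"
      by (auto simp: conn_def)
    show ?case
    proof (rule ccontr)
      assume y: "y \<notin> S'"
      then have "\<not> M dvd x - y" using periodic_cong[OF p(2)] xy(3) by blast
      then obtain d where d: "d \<in> D" "y = x + d \<or> x = y + d" using xy(4) by blast
      from d(2) show False
      proof
        assume "y = x + d"
        then have "(x mod M, d) \<in> exits M D S'" using exits_iff(1)[OF M p(2)] xy(3) y d(1) by blast
        then have "(x mod M, d) \<in> exits M D S" by (simp add: eq(1))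
        then have "x + d \<notin> S" using exits_iff(1)[OF M p(1)] by blast
        then show False using xy(2) \<open>y = x + d\<close> by simp
      next
        assume "x = y + d"
        then have "(y mod M, d) \<in> exits M D (- S')" using exits_iff(2)[OF M p(2)] xy(3) y d(1) by blast
        then have "(y mod M, d) \<in> exits M D (- S)" by (simp add: eq(2))
        then have "y \<notin> S" using exits_iff(2)[OF M p(1)] by blast
        then show False using xy(2) by simp
      qed
    qed
  qed (rule zS')
qed

text \<open>A component that no step leaves is closed under adding elements of \<open>D\<close> and
  multiples of \<open>M\<close>. Modulo \<open>M\<close> negatives come for free, by -x = (M - 1) x
  - M x, so it contains a coset of the subgroup generated by \<open>M\<close> and
  \<open>D\<close>.\<close>

lemma component_large:
  assumes M: "M > 0" and p: "periodic M S" and t: "t \<in> S"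
    and closed: "\<And>x d. (t, x) \<in> (conn M D S)\<^sup>* \<Longrightarrow> d \<in> D \<Longrightarrow> x + d \<in> S"
  shows "nat (M div Gcd (insert M D)) \<le> psize M {x. (t, x) \<in> (conn M D S)\<^sup>*}"
proof -
  define C where "C = {x. (t, x) \<in> (conn M D S)\<^sup>*}"
  have tC: "t \<in> C" by (simp add: C_def)
  have CS: "x \<in> S" if "x \<in> C" for x
  proof -
    have "(t, x) \<in> (conn M D S)\<^sup>*" using that by (simp add: C_def)
    then show ?thesis using t by (cases rule: rtranclE) (auto simp: conn_def)
  qed
  have CM: "y \<in> C" if "x \<in> C" "M dvd x - y" for x y
  proof -
    have "y \<in> S" using CS[OF that(1)] periodic_cong[OF p that(2)] by blast
    then have "(x, y) \<in> conn M D S" using CS[OF that(1)] that(2) by (simp add: conn_def)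
    then show ?thesis using that(1) by (auto simp: C_def intro: rtrancl_into_rtrancl)
  qed
  have CD: "x + d \<in> C" if "x \<in> C" "d \<in> D" for x d
  proof -
    have "x + d \<in> S" using closed that by (simp add: C_def)
    then have "(x, x + d) \<in> conn M D S" using CS[OF that(1)] that(2) by (auto simp: conn_def)
    then show ?thesis using that(1) by (auto simp: C_def intro: rtrancl_into_rtrancl)
  qed
  define K where "K = {x. \<forall>y\<in>C. y + x \<in> C}"
  have KM: "M * c \<in> K" for c
  proof -
    have "y + M * c \<in> C" if "y \<in> C" for y by (rule CM[OF that]) simp
    then show ?thesis by (simp add: K_def)
  qed
  have Kadd: "x + y \<in> K" if "x \<in> K" "y \<in> K" for x y
  proof -
    have "z + (x + y) \<in> C" if "z \<in> C" for z
    proof -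
      have "z + x \<in> C" using \<open>x \<in> K\<close> that by (simp add: K_def)
      then have "z + x + y \<in> C" using \<open>y \<in> K\<close> by (simp add: K_def)
      then show ?thesis by (simp add: add.assoc)
    qed
    then show ?thesis by (simp add: K_def)
  qed
  have Kmul: "int n * x \<in> K" if "x \<in> K" for n x
  proof (induction n)
    case 0 then show ?case by (simp add: K_def)
  next
    case (Suc n)
    have "int (Suc n) * x = int n * x + x" by (simp add: algebra_simps)
    then show ?case using Kadd[OF Suc that] by simp
  qed
  have Kneg: "- x \<in> K" if "x \<in> K" for x
  proof -
    have "- x = int (nat (M - 1)) * x + M * (- x)" using M by (simp add: algebra_simps)
    then show ?thesis using Kadd[OF Kmul[OF that] KM] by metis
  qed
  have Kdiff: "x - y \<in> K" if "x \<in> K" "y \<in> K" for x y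
    using Kadd[OF that(1) Kneg[OF that(2)]] by simp
  have MK: "M \<in> K" using KM[of 1] by simp
  obtain k where k: "k > 0" "k dvd M" "K = {x. k dvd x}"
    using int_subgroup_principal[OF MK M Kdiff] by metis
  let ?g = "Gcd (insert M D)"
  have gM: "?g dvd M" by simp
  have g0: "?g > 0" using M gM by (metis Gcd_int_greater_eq_0 dvd_0_left_iff less_irrefl order_le_less)
  have "d \<in> K" if "d \<in> D" for d using CD that by (simp add: K_def)
  then have kg: "k dvd ?g" using k by (intro Gcd_greatest) auto
  have sub: "(+) t ` {x. ?g dvd x} \<subseteq> C"
  proof
    fix y assume "y \<in> (+) t ` {x. ?g dvd x}"
    then obtain x where x: "?g dvd x" "y = t + x" by blast
    have "x \<in> K" using dvd_trans[OF kg x(1)] k(3) by blast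
    then show "y \<in> C" using tC x(2) by (simp add: K_def)
  qed
  have "periodic M {x. ?g dvd x}" using gM by (simp add: periodic_def dvd_add_left_iff)
  then have "nat (M div ?g) = psize M ((+) t ` {x. ?g dvd x})"
    using psize_translate[OF M] psize_multiples[OF M g0 gM] by simp
  also have "\<dots> \<le> psize M C" using sub by (rule psize_mono)
  finally show ?thesis by (simp add: C_def)
qed

text \<open>One representative for each component without exits is enough. These components are
  disjoint and have at least \<open>j\<close> residues each, by
  \<open>component_large\<close>.\<close>

lemma seeds_exist:
  assumes M: "M > 0" and p: "periodic M S" and j: "j \<le> nat (M div Gcd (insert M D))"
  obtains R where "R \<subseteq> S \<inter> {0..<M}" "card R * j \<le> psize M S" "seeded M D R S"
proof -
  let ?E = "(conn M D S)\<^sup>*"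
  define C where "C s = {x. (s, x) \<in> ?E}" for s
  have symE: "sym ?E" by (rule sym_rtrancl[OF sym_conn])
  have CE: "C x = C y" if "(x, y) \<in> ?E" for x y
  proof (rule set_eqI)
    fix z
    have "(y, x) \<in> ?E" by (rule symD[OF symE that])
    then show "z \<in> C x \<longleftrightarrow> z \<in> C y"
      using rtrancl_trans[OF that, of z] rtrancl_trans[of y x "conn M D S" z] by (auto simp only: C_def mem_Collect_eq)
  qed
  define T where "T = {s \<in> S \<inter> {0..<M}. \<forall>x\<in>C s. \<forall>d\<in>D. x + d \<in> S}"
  have finT: "finite T" by (rule finite_subset[of _ "{0..<M}"]) (auto simp: T_def)
  define rep where "rep X = (SOME x. x \<in> X \<inter> {0..<M})" for X :: "int set"
  have rep: "rep (C t) \<in> C t \<inter> {0..<M}" if "t \<in> T" for t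
  proof -
    have "t \<in> C t \<inter> {0..<M}" using that by (simp add: T_def C_def)
    then show ?thesis unfolding rep_def by (rule someI)
  qed
  have CS: "C t \<subseteq> S" if "t \<in> T" for t
  proof
    fix x assume "x \<in> C t"
    then have "(t, x) \<in> ?E" by (simp add: C_def)
    then show "x \<in> S" using that by (cases rule: rtranclE) (auto simp: conn_def T_def)
  qed
  let ?R = "rep ` C ` T"
  have "?R \<subseteq> S \<inter> {0..<M}" using rep CS by blast
  moreover have "card ?R * j \<le> psize M S"
  proof -
    have "card ?R \<le> card (C ` T)" using finT by (intro card_image_le) auto
    then have "card ?R * j \<le> (\<Sum>X\<in>C ` T. j)" by simp
    also have "\<dots> \<le> (\<Sum>X\<in>C ` T. card (X \<inter> {0..<M}))"
    proof (rule sum_mono)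
      fix X assume "X \<in> C ` T"
      then obtain t where t: "t \<in> T" "X = C t" by blast
      have "nat (M div Gcd (insert M D)) \<le> psize M {x. (t, x) \<in> ?E}"
        using t by (intro component_large[OF M p]) (auto simp: T_def C_def)
      then show "j \<le> card (X \<inter> {0..<M})" using j t by (simp add: psize_def C_def)
    qed
    also have "\<dots> = card (\<Union>X\<in>C ` T. X \<inter> {0..<M})"
    proof (rule card_UN_disjoint[symmetric])
      show "\<forall>X\<in>C ` T. \<forall>Y\<in>C ` T. X \<noteq> Y \<longrightarrow> X \<inter> {0..<M} \<inter> (Y \<inter> {0..<M}) = {}"
      proof (intro ballI impI)
        fix X Y assume "X \<in> C ` T" "Y \<in> C ` T" and ne: "X \<noteq> Y"
        then obtain s t where st: "X = C s" "Y = C t" by blast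
        have "C s = C t" if "(s, x) \<in> ?E" "(t, x) \<in> ?E" for x using CE[OF that(1)] CE[OF that(2)] by simp
        then show "X \<inter> {0..<M} \<inter> (Y \<inter> {0..<M}) = {}" using ne st by (auto simp: C_def)
      qed
    qed (use finT in auto)
    also have "\<dots> \<le> psize M S" unfolding psize_def using CS by (intro card_mono) auto
    finally show ?thesis .
  qed
  moreover have "seeded M D ?R S"
    unfolding seeded_def
  proof
    fix s assume s: "s \<in> S"
    define s' where "s' = s mod M"
    have s': "s' \<in> S \<inter> {0..<M}" using s M periodic_mod[OF p] by (simp add: s'_def)
    have "(s', s) \<in> conn M D S" using s s' by (simp add: conn_def s'_def mod_eq_dvd_iff[symmetric])
    then have ss: "(s', s) \<in> ?E" by blast
    show "\<exists>z\<in>S. (z, s) \<in> ?E \<and> (z \<in> ?R \<or> (\<exists>d\<in>D. z + d \<notin> S))"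
    proof (cases "s' \<in> T")
      case True
      have "rep (C s') \<in> C s' \<inter> {0..<M}" by (rule rep[OF True])
      then have "(s', rep (C s')) \<in> ?E" by (simp add: C_def)
      then have "(rep (C s'), s') \<in> ?E" by (rule symD[OF symE])
      then have "(rep (C s'), s) \<in> ?E" using ss by (rule rtrancl_trans)
      moreover have "rep (C s') \<in> S" using rep[OF True] CS[OF True] by blast
      ultimately show ?thesis using True by blast
    next
      case False
      then obtain x d where x: "(s', x) \<in> ?E" "d \<in> D" "x + d \<notin> S" using s' by (auto simp: T_def C_def)
      have "(x, s) \<in> ?E" using symD[OF symE x(1)] ss by (rule rtrancl_trans)
      moreover have "x \<in> S" using x(1) s' by (cases rule: rtranclE) (auto simp: conn_def)
      ultimately show ?thesis using x by blast
    qed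
  qed
  ultimately show ?thesis by (rule that)
qed

text \<open>\<open>S\<close> and its translate by - d have equally many residues, so a step
  \<open>d\<close> enters \<open>S\<close> as often as it leaves it; the bound \<open>t\<close>
  covers both.\<close>

lemma card_exits_le:
  assumes M: "M > 0" and p: "periodic M S" and D: "finite D" "card D \<le> r"
    and t: "\<And>d. d \<in> D \<Longrightarrow> psize M {x \<in> S. x + d \<notin> S} \<le> t"
  shows "card (exits M D S) \<le> r * t" "card (exits M D (- S)) \<le> r * t"
proof -
  have gen: "card (exits M D S') \<le> r * t" if "\<And>d. d \<in> D \<Longrightarrow> psize M {x \<in> S'. x + d \<notin> S'} \<le> t" for S'
  proof -
    let ?G = "SIGMA d:D. {x \<in> S'. x + d \<notin> S'} \<inter> {0..<M}"
    have finG: "finite ?G" using D(1) by (intro finite_SigmaI) auto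
    have "exits M D S' \<subseteq> prod.swap ` ?G"
    proof
      fix z assume z: "z \<in> exits M D S'"
      have "prod.swap z \<in> ?G" using z by (cases z) (simp add: exits_def)
      then have "prod.swap (prod.swap z) \<in> prod.swap ` ?G" by (rule imageI)
      then show "z \<in> prod.swap ` ?G" by simp
    qed
    then have "card (exits M D S') \<le> card ?G"
      using finG by (meson card_image_le card_mono finite_imageI le_trans)
    also have "\<dots> = (\<Sum>d\<in>D. psize M {x \<in> S'. x + d \<notin> S'})"
      unfolding psize_def using D(1) by (intro card_SigmaI) auto
    also have "\<dots> \<le> (\<Sum>d\<in>D. t)" using that by (rule sum_mono)
    also have "\<dots> \<le> r * t" using D by simp
    finally show ?thesis .
  qed
  show "card (exits M D S) \<le> r * t" using t by (rule gen)
  show "card (exits M D (- S)) \<le> r * t"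
  proof (rule gen)
    fix d assume d: "d \<in> D"
    let ?Y = "(+) (- d) ` S"
    have memY: "x \<in> ?Y \<longleftrightarrow> x + d \<in> S" for x unfolding mem_translate by simp
    have Y: "psize M ?Y = psize M S" by (rule psize_translate[OF M p])
    have 1: "{x \<in> - S. x + d \<notin> - S} = ?Y - S" "{x \<in> S. x + d \<notin> S} = S - ?Y"
      using memY by blast+
    have 2: "psize M (S \<union> ?Y) = psize M S + psize M (?Y - S)"
      using psize_Un_Int[of M S "?Y - S"] by (simp add: psize_def Un_commute)
    have 3: "psize M (S \<union> ?Y) = psize M ?Y + psize M (S - ?Y)"
      using psize_Un_Int[of M ?Y "S - ?Y"] by (simp add: psize_def Un_commute)
    have "psize M (S - ?Y) \<le> t" using t[OF d] unfolding 1(2) .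
    then show "psize M {x \<in> - S. x + d \<notin> - S} \<le> t" unfolding 1(1) using 2 3 Y by linarith
  qed
qed

definition walkable :: "int \<Rightarrow> nat \<Rightarrow> nat \<Rightarrow> nat \<Rightarrow> int set \<Rightarrow> bool" where
  "walkable M j r t S \<longleftrightarrow> (\<exists>D\<subseteq>{0..<M}. card D \<le> r \<and> j \<le> nat (M div Gcd (insert M D)) \<and>
     (\<forall>d\<in>D. psize M {x \<in> S. x + d \<notin> S} \<le> t))"

text \<open>A walkable set is determined by the steps \<open>D\<close>, the places where a step leaves or enters it,
  and one seed in each component that no step leaves.\<close>

lemma card_walkable:
  fixes k r t :: nat
  assumes M: "M > 0" and j: "j \<ge> 1"
  defines "\<S> \<equiv> {S. periodic M S \<and> psize M S \<le> k \<and> walkable M j r t S}"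
  shows "finite \<S>" "card \<S> \<le> (nat M + 1) ^ r * ((nat M * nat M + 1) ^ (r * t) * (nat M * nat M + 1) ^ (r * t)) * (nat M + 1) ^ (k div j)"
proof -
  let ?I = "{0..<M}"
  define X where "X = ({X. X \<subseteq> ?I \<and> card X \<le> r} \<times> ({X. X \<subseteq> ?I \<times> ?I \<and> card X \<le> r * t} \<times> {X. X \<subseteq> ?I \<times> ?I \<and> card X \<le> r * t}))
     \<times> {X. X \<subseteq> ?I \<and> card X \<le> k div j}"
  define good where "good S w = (case w of ((D, e, e'), R) \<Rightarrow> w \<in> X \<and> e = exits M D S \<and> e' = exits M D (- S)
      \<and> R \<subseteq> S \<and> seeded M D R S)" for S w
  have ex: "\<exists>w. good S w" if S: "S \<in> \<S>" for S
  proof -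
    obtain D where D: "D \<subseteq> ?I" "card D \<le> r" "j \<le> nat (M div Gcd (insert M D))"
      "\<And>d. d \<in> D \<Longrightarrow> psize M {x \<in> S. x + d \<notin> S} \<le> t"
      using S unfolding \<S>_def walkable_def by blast
    have pS: "periodic M S" and kS: "psize M S \<le> k" using S by (auto simp: \<S>_def)
    obtain R where R: "R \<subseteq> S \<inter> ?I" "card R * j \<le> psize M S" "seeded M D R S"
      using seeds_exist[OF M pS D(3)] by blast
    have finD: "finite D" using D(1) finite_subset by blast
    have "card R * j \<le> k" using R(2) kS by linarith
    then have "card R \<le> k div j" using j by (simp add: less_eq_div_iff_mult_less_eq)
    moreover have "exits M D S \<subseteq> ?I \<times> ?I" "exits M D (- S) \<subseteq> ?I \<times> ?I" using D(1) by (auto simp: exits_def)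
    ultimately have "good S ((D, exits M D S, exits M D (- S)), R)"
      unfolding good_def X_def using D R card_exits_le[OF M pS finD D(2,4)] by auto
    then show ?thesis by blast
  qed
  define w where "w S = (SOME w. good S w)" for S
  have w: "good S (w S)" if "S \<in> \<S>" for S unfolding w_def using ex[OF that] by (rule someI_ex)
  have "inj_on w \<S>"
  proof (rule inj_onI)
    fix S S' assume S: "S \<in> \<S>" "S' \<in> \<S>" "w S = w S'"
    obtain D e e' R where W: "w S = ((D, e, e'), R)" by (metis surj_pair)
    have g: "good S ((D, e, e'), R)" "good S' ((D, e, e'), R)" using w[OF S(1)] w[OF S(2)] W S(3) by simp_all
    have p: "periodic M S" "periodic M S'" using S by (auto simp: \<S>_def)
    have "S \<subseteq> S'" by (rule seeded_determines[OF M p, of R D]) (use g in \<open>auto simp: good_def\<close>)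
    moreover have "S' \<subseteq> S" by (rule seeded_determines[OF M p(2,1), of R D]) (use g in \<open>auto simp: good_def\<close>)
    ultimately show "S = S'" by blast
  qed
  moreover have sub: "w ` \<S> \<subseteq> X"
  proof
    fix z assume "z \<in> w ` \<S>"
    then obtain S where "S \<in> \<S>" "z = w S" by blast
    then have "good S z" using w by simp
    then show "z \<in> X" unfolding good_def by (auto split: prod.splits)
  qed
  moreover have finX: "finite X" by (simp add: X_def)
  ultimately show "finite \<S>" by (meson finite_imageD finite_subset)
  have "card \<S> \<le> card X" using \<open>inj_on w \<S>\<close> sub finX by (rule card_inj_on_le)
  also have "\<dots> = card {X. X \<subseteq> ?I \<and> card X \<le> r} * (card {X. X \<subseteq> ?I \<times> ?I \<and> card X \<le> r * t}
      * card {X. X \<subseteq> ?I \<times> ?I \<and> card X \<le> r * t}) * card {X. X \<subseteq> ?I \<and> card X \<le> k div j}"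
    by (simp only: X_def card_cartesian_product)
  also have "\<dots> \<le> (card ?I + 1) ^ r * ((card (?I \<times> ?I) + 1) ^ (r * t) * (card (?I \<times> ?I) + 1) ^ (r * t)) * (card ?I + 1) ^ (k div j)"
    by (intro mult_mono card_small_subsets) auto
  finally show "card \<S> \<le> (nat M + 1) ^ r * ((nat M * nat M + 1) ^ (r * t) * (nat M * nat M + 1) ^ (r * t)) * (nat M + 1) ^ (k div j)"
    by (simp add: card_cartesian_product)
qed

section \<open>Sets of small doubling\<close>

lemma finite_sumset: "finite A \<Longrightarrow> finite B \<Longrightarrow> finite (A + B :: int set)"
  by (rule finite_set_plus)

text \<open>The translates of \<open>A\<close> by the minimum of \<open>B\<close> and of
  \<open>B\<close> by the maximum of \<open>A\<close> share at most one point.\<close>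

lemma card_sumset_ge:
  fixes A B :: "int set"
  assumes "finite A" "finite B" "A \<noteq> {}" "B \<noteq> {}"
  shows "card A + card B \<le> card (A + B) + 1"
proof -
  define a b where "a = Max A" and "b = Min B"
  have a: "a \<in> A" "\<And>x. x \<in> A \<Longrightarrow> x \<le> a" using assms by (auto simp: a_def)
  have b: "b \<in> B" "\<And>x. x \<in> B \<Longrightarrow> b \<le> x" using assms by (auto simp: b_def)
  let ?X = "(\<lambda>x. x + b) ` A" and ?Y = "(\<lambda>y. a + y) ` B"
  have "?X \<inter> ?Y \<subseteq> {a + b}" using a b by force
  then have "card (?X \<inter> ?Y) \<le> card {a + b}" by (intro card_mono) auto
  moreover have "card ?X + card ?Y = card (?X \<union> ?Y) + card (?X \<inter> ?Y)"
    using assms by (intro card_Un_Int) auto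
  moreover have "card ?X = card A" "card ?Y = card B" by (simp_all add: card_image inj_on_def)
  moreover have "card (?X \<union> ?Y) \<le> card (A + B)"
    using assms a b by (intro card_mono finite_sumset) (auto intro: set_plus_intro)
  ultimately show ?thesis by simp
qed

text \<open>Sums without the largest element \<open>b\<close> are 2 * b1 or at most b1 + b2. So 2 *
  b and b + b1 are always new, and b + b2 is new unless it equals 2 * b1.\<close>

lemma remove_max_sumset:
  fixes B :: "int set"
  assumes "finite B" "card B \<ge> 3"
  defines "b \<equiv> Max B" defines "b1 \<equiv> Max (B - {b})" defines "b2 \<equiv> Max (B - {b} - {b1})"
  shows "card ((B - {b}) + (B - {b})) + (if b = 2 * b1 - b2 then 2 else 3) \<le> card (B + B)"
proof -
  let ?C = "B - {b}"
  have ne: "B \<noteq> {}" using assms(2) by auto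
  have b: "b \<in> B" "\<And>x. x \<in> B \<Longrightarrow> x \<le> b" using assms(1) ne by (auto simp: b_def)
  have cC: "card ?C \<ge> 2" using assms(1,2) b by simp
  then have neC: "?C \<noteq> {}" by (metis card.empty not_numeral_le_zero)
  have b1: "b1 \<in> ?C" unfolding b1_def using assms(1) neC by (intro Max_in) auto
  have b1': "x \<le> b1" if "x \<in> ?C" for x unfolding b1_def using assms(1) that by (intro Max_ge) auto
  have "card (?C - {b1}) \<ge> 1" using cC assms(1) b1 by simp
  then have neD: "?C - {b1} \<noteq> {}" by (metis card.empty not_one_le_zero)
  have b2: "b2 \<in> ?C - {b1}" unfolding b2_def using assms(1) neD by (intro Max_in) auto
  have b2': "x \<le> b2" if "x \<in> ?C - {b1}" for x unfolding b2_def using assms(1) that by (intro Max_ge) auto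
  have lt: "b1 < b" "b2 < b1" using b(2)[of b1] b1 b1'[of b2] b2 by auto
  have top: "x = 2 * b1 \<or> x \<le> b1 + b2" if "x \<in> ?C + ?C" for x
  proof -
    obtain u v where uv: "u \<in> ?C" "v \<in> ?C" "x = u + v" using \<open>x \<in> ?C + ?C\<close> by (rule set_plus_elim)
    show ?thesis
    proof (cases "u = b1 \<and> v = b1")
      case False
      then have "u \<le> b2 \<or> v \<le> b2" using b2' uv by blast
      then show ?thesis using b1'[OF uv(1)] b1'[OF uv(2)] uv(3) by linarith
    qed (use uv in simp)
  qed
  define N where "N = (if b = 2 * b1 - b2 then {b + b, b + b1} else {b + b, b + b1, b + b2})"
  have disj: "(?C + ?C) \<inter> N = {}"
  proof -
    have "x \<noteq> 2 * b1 \<and> \<not> x \<le> b1 + b2" if "x \<in> N" for x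
      using that lt unfolding N_def by (auto split: if_splits)
    then show ?thesis using top by blast
  qed
  have sub: "(?C + ?C) \<union> N \<subseteq> B + B"
  proof -
    have "?C + ?C \<subseteq> B + B" by (intro set_plus_mono2) auto
    moreover have "b1 \<in> B" "b2 \<in> B" using b1 b2 by auto
    then have "b + b \<in> B + B" "b + b1 \<in> B + B" "b + b2 \<in> B + B"
      using b(1) by (blast intro: set_plus_intro)+
    moreover have "N \<subseteq> {b + b, b + b1, b + b2}" by (auto simp: N_def)
    ultimately show ?thesis by blast
  qed
  have "card N = (if b = 2 * b1 - b2 then 2 else 3)" using lt by (auto simp: N_def)
  moreover have "card ((?C + ?C) \<union> N) = card (?C + ?C) + card N"
    using disj assms(1) by (intro card_Un_disjoint finite_sumset) (auto simp: N_def)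
  moreover have "card ((?C + ?C) \<union> N) \<le> card (B + B)"
    using sub assms(1) by (intro card_mono finite_sumset) auto
  ultimately show ?thesis by simp
qed

text \<open>Rebuild \<open>B\<close> from two elements by adding a new maximum each time. It is
  either forced, continuing the progression of the last two elements, or free. A free step uses up
  one unit of the excess \<open>c\<close> of \<open>card (B + B)\<close> over 2 * card B - 1, and by
  \<open>card_sumset_ge\<close> this excess never becomes negative.\<close>

lemma card_small_doubling:
  fixes U :: "int set"
  assumes "finite U"
  shows "card {B. B \<subseteq> U \<and> card B = r + 2 \<and> card (B + B) + 1 \<le> 2 * (r + 2) + c}
    \<le> (card U)\<^sup>2 * (1 + (r + 2) * card U) ^ c"
proof (induction r arbitrary: c)
  case 0
  have "card {B. B \<subseteq> U \<and> card B = 0 + 2 \<and> card (B + B) + 1 \<le> 2 * (0 + 2) + c} \<le> card {B. B \<subseteq> U \<and> card B = 2}"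
    using assms by (intro card_mono) auto
  also have "\<dots> = card U choose 2" using assms by (rule n_subsets)
  also have "\<dots> \<le> card U * (card U - 1)" by (simp add: choose_two)
  also have "\<dots> \<le> (card U)\<^sup>2" by (simp add: power2_eq_square)
  also have "\<dots> \<le> (card U)\<^sup>2 * (1 + (0 + 2) * card U) ^ c" by simp
  finally show ?case .
next
  case (Suc r)
  define F where "F r c = {B. B \<subseteq> U \<and> card B = r + 2 \<and> card (B + B) + 1 \<le> 2 * (r + 2) + c}" for r c
  have finF: "finite (F r c)" for r c using assms by (simp add: F_def)
  let ?nx = "\<lambda>C. 2 * Max C - Max (C - {Max C})"
  have split: "F (Suc r) c \<subseteq> (\<lambda>C. insert (?nx C) C) ` F r c \<union>
      (if c = 0 then {} else (\<lambda>(C, x). insert x C) ` (F r (c - 1) \<times> U))"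
  proof
    fix B assume "B \<in> F (Suc r) c"
    then have B: "B \<subseteq> U" "card B = r + 3" "card (B + B) + 1 \<le> 2 * (r + 3) + c" by (auto simp: F_def)
    have finB: "finite B" using B(1) assms finite_subset by blast
    define b where "b = Max B"
    let ?C = "B - {b}"
    have bB: "b \<in> B" unfolding b_def using finB B(2) by (intro Max_in) auto
    have C: "?C \<subseteq> U" "card ?C = r + 2" using B bB finB by auto
    have neC: "?C \<noteq> {}" using C(2) by (metis card.empty add_is_0 zero_neq_numeral)
    have low: "card ?C + card ?C \<le> card (?C + ?C) + 1"
      using finB neC by (intro card_sumset_ge) auto
    have rm: "card (?C + ?C) + (if b = ?nx ?C then 2 else 3) \<le> card (B + B)"
      using remove_max_sumset[OF finB] B(2) unfolding b_def by simp
    have ins: "insert b ?C = B" using bB by blast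
    show "B \<in> (\<lambda>C. insert (?nx C) C) ` F r c \<union>
      (if c = 0 then {} else (\<lambda>(C, x). insert x C) ` (F r (c - 1) \<times> U))"
    proof (cases "b = ?nx ?C")
      case True
      then have "card (?C + ?C) + 2 \<le> card (B + B)" using rm by presburger
      then have "?C \<in> F r c" using C B(3) by (simp add: F_def)
      moreover have "B = insert (?nx ?C) ?C" using True ins by metis
      ultimately show ?thesis by blast
    next
      case False
      then have "card (?C + ?C) + 3 \<le> card (B + B)" using rm by presburger
      then have "c \<noteq> 0" "?C \<in> F r (c - 1)" using C B(3) low by (auto simp: F_def)
      moreover have "b \<in> U" using bB B(1) by blast
      ultimately have "B \<in> (\<lambda>(C, x). insert x C) ` (F r (c - 1) \<times> U)"
        using ins by (intro image_eqI[of _ _ "(?C, b)"]) auto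
      then show ?thesis using \<open>c \<noteq> 0\<close> by simp
    qed
  qed
  let ?u = "card U"
  have IH: "card (F r c') \<le> ?u\<^sup>2 * (1 + (r + 2) * ?u) ^ c'" for c' using Suc[of c'] by (simp add: F_def)
  have im1: "card ((\<lambda>C. insert (?nx C) C) ` F r c) \<le> ?u\<^sup>2 * (1 + (r + 2) * ?u) ^ c"
    using card_image_le[OF finF] IH le_trans by blast
  show ?case
  proof (cases c)
    case 0
    have "card (F (Suc r) c) \<le> card ((\<lambda>C. insert (?nx C) C) ` F r c)"
      using split finF 0 by (intro card_mono) auto
    then show ?thesis using im1 0 by (simp add: F_def)
  next
    case (Suc c')
    have "card ((\<lambda>(C, x). insert x C) ` (F r c' \<times> U)) \<le> card (F r c' \<times> U)"
      using finF assms by (intro card_image_le) auto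
    also have "card (F r c' \<times> U) = card (F r c') * ?u" by (rule card_cartesian_product)
    also have "\<dots> \<le> ?u\<^sup>2 * (1 + (r + 2) * ?u) ^ c' * ?u" using IH by (intro mult_right_mono) auto
    finally have im2: "card ((\<lambda>(C, x). insert x C) ` (F r c' \<times> U)) \<le> ?u\<^sup>2 * (1 + (r + 2) * ?u) ^ c' * ?u" .
    have "card (F (Suc r) c) \<le> card ((\<lambda>C. insert (?nx C) C) ` F r c \<union> (\<lambda>(C, x). insert x C) ` (F r c' \<times> U))"
      using split finF assms Suc by (intro card_mono) auto
    also have "\<dots> \<le> card ((\<lambda>C. insert (?nx C) C) ` F r c) + card ((\<lambda>(C, x). insert x C) ` (F r c' \<times> U))"
      by (rule card_Un_le)
    also have "\<dots> \<le> ?u\<^sup>2 * (1 + (r + 2) * ?u) ^ c + ?u\<^sup>2 * (1 + (r + 2) * ?u) ^ c' * ?u"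
      using im1 im2 by (rule add_mono)
    also have "?u\<^sup>2 * (1 + (r + 2) * ?u) ^ c + ?u\<^sup>2 * (1 + (r + 2) * ?u) ^ c' * ?u
        = ?u\<^sup>2 * (1 + (r + 2) * ?u) ^ c' * (1 + (r + 3) * ?u)"
      by (simp add: Suc algebra_simps)
    also have "\<dots> \<le> ?u\<^sup>2 * (1 + (r + 3) * ?u) ^ c' * (1 + (r + 3) * ?u)"
    proof -
      have "(r + 2) * ?u \<le> (r + 3) * ?u" by (intro mult_right_mono) auto
      then show ?thesis by (intro mult_right_mono mult_left_mono power_mono) auto
    qed
    finally have fin: "card (F (Suc r) c) \<le> ?u\<^sup>2 * (1 + (r + 3) * ?u) ^ c' * (1 + (r + 3) * ?u)" .
    have e: "Suc r + 2 = r + 3" by simp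
    show ?thesis using fin unfolding F_def e Suc power_Suc by (simp only: mult_ac)
  qed
qed

section \<open>Reduction modulo the length\<close>

definition config :: "nat \<Rightarrow> nat \<Rightarrow> int \<Rightarrow> int set \<Rightarrow> bool" where
  "config k N M A \<longleftrightarrow> A \<subseteq> {0..M} \<and> 0 \<in> A \<and> M \<in> A \<and> card A = k \<and> card (A + A) \<le> 2 * N"

text \<open>The periodic set \<open>A + M \<int>\<close>.\<close>

definition wrap :: "int \<Rightarrow> int set \<Rightarrow> int set" where
  "wrap M A = {x. \<exists>a\<in>A. M dvd x - a}"

text \<open>The sums missing below \<open>M\<close> and, in \<open>high\<close>, those from
  \<open>M\<close> to 2 M - 1, both indexed by their residue. A residue missed modulo
  \<open>M\<close> is one that lies in both sets.\<close>

definition low :: "int \<Rightarrow> int set \<Rightarrow> int set" where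
  "low M A = {x \<in> {0..<M}. x \<notin> A + A}"

definition high :: "int \<Rightarrow> int set \<Rightarrow> int set" where
  "high M A = {x \<in> {0..<M}. x + M \<notin> A + A}"

lemma periodic_wrap: "periodic M (wrap M A)"
proof -
  have "M dvd x + M - a \<longleftrightarrow> M dvd x - a" for x a :: int
    by (metis add_diff_eq diff_add_eq dvd_add_left_iff dvd_refl)
  then show ?thesis by (simp add: periodic_def wrap_def)
qed

lemma wrap_Int:
  assumes "A \<subseteq> {0..M}" "0 \<in> A" "M > 0"
  shows "wrap M A \<inter> {0..<M} = A \<inter> {0..<M}"
proof (intro equalityI subsetI)
  fix x assume x: "x \<in> wrap M A \<inter> {0..<M}"
  then obtain a where a: "a \<in> A" "M dvd x - a" by (auto simp: wrap_def)
  have "a \<in> {0..M}" using a assms by auto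
  show "x \<in> A \<inter> {0..<M}"
  proof (cases "a = M")
    case True
    then have "M dvd x" using a(2) by (metis diff_add_cancel dvd_add dvd_refl)
    then have "x = 0" using x zdvd_not_zless[of x M] by force
    then show ?thesis using assms x by auto
  next
    case False
    then have "x mod M = a mod M" using a(2) by (simp add: mod_eq_dvd_iff)
    then show ?thesis using x a(1) False \<open>a \<in> {0..M}\<close> by simp
  qed
next
  fix x assume x: "x \<in> A \<inter> {0..<M}"
  have "M dvd x - x" by simp
  then show "x \<in> wrap M A \<inter> {0..<M}" using x unfolding wrap_def by blast
qed

text \<open>0 and \<open>M\<close> are the same residue, hence k - 1 residues.\<close>

lemma config_facts:
  assumes "config k N M A" "M > 0"
  shows "finite A" "card (A \<inter> {0..<M}) + 1 = k" "psize M (wrap M A) + 1 = k"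
proof -
  have A: "A \<subseteq> {0..M}" "0 \<in> A" "M \<in> A" "card A = k" using assms by (auto simp: config_def)
  show fin: "finite A" using A(1) finite_subset by blast
  have "A \<inter> {0..<M} = A - {M}" using A by auto
  then show c: "card (A \<inter> {0..<M}) + 1 = k"
    using A fin by (metis add.commute card_Suc_Diff1 plus_1_eq_Suc)
  show "psize M (wrap M A) + 1 = k" using c wrap_Int[OF A(1,2) assms(2)] by (simp add: psize_def)
qed

lemma sumset_residues:
  assumes A: "A \<subseteq> {0..M}" "0 \<in> A" "M \<in> A" and M: "M > 0"
  shows "(wrap M A + A) \<inter> {0..<M} = {x \<in> {0..<M}. x \<in> A + A \<or> x + M \<in> A + A}"
proof (intro equalityI subsetI)
  fix x assume x: "x \<in> (wrap M A + A) \<inter> {0..<M}"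
  then obtain b a where ab: "b \<in> A" "a \<in> A" "M dvd x - b - a" by (auto simp: mem_sumset wrap_def)
  obtain c where c: "x - b - a = M * c" using ab(3) by blast
  have r: "0 \<le> a" "a \<le> M" "0 \<le> b" "b \<le> M" "0 \<le> x" "x < M" using ab A x by auto
  have s: "a + b \<in> A + A" using ab by (intro set_plus_intro)
  have "M * c \<ge> M * (-2)" "M * c < M * 1" using c r by linarith+
  then have "c \<ge> -2" "c < 1" using M by (simp_all only: mult_le_cancel_left_pos mult_less_cancel_left_pos)
  then consider "c = 0" | "c = -1" | "c = -2" by linarith
  then show "x \<in> {x \<in> {0..<M}. x \<in> A + A \<or> x + M \<in> A + A}"
  proof cases
    case 3
    then have "x - b - a = - 2 * M" using c by simp
    then have "x = 0" using r by linarith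
    moreover have "0 + 0 \<in> A + A" using A by (intro set_plus_intro)
    ultimately show ?thesis using x by simp
  next
    case 1
    then have "x = a + b" using c by simp
    then show ?thesis using x s by simp
  next
    case 2
    then have "x + M = a + b" using c by simp
    then show ?thesis using x s by simp
  qed
next
  fix x assume x: "x \<in> {x \<in> {0..<M}. x \<in> A + A \<or> x + M \<in> A + A}"
  then consider "x \<in> A + A" | "x + M \<in> A + A" by auto
  then have "x \<in> wrap M A + A"
  proof cases
    case 1
    then obtain a b where ab: "a \<in> A" "b \<in> A" "x = a + b" by (rule set_plus_elim)
    then have "M dvd x - b - a" by simp
    then show ?thesis using ab unfolding mem_sumset wrap_def by blast
  next
    case 2
    then obtain a b where ab: "a \<in> A" "b \<in> A" "x + M = a + b" by (rule set_plus_elim)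
    then have "x - b - a = - M" by simp
    then have "M dvd x - b - a" by simp
    then show ?thesis using ab unfolding mem_sumset wrap_def by blast
  qed
  then show "x \<in> (wrap M A + A) \<inter> {0..<M}" using x by simp
qed

text \<open>Each of the k - 1 elements a < M has its residue hit twice, by a + 0 and by a + M.
  Together with the sum 2 M, which lies outside both index ranges, this gives \<open>k\<close> sums
  more than residues.\<close>

lemma sumset_counts:
  assumes "config k N M A" and M: "M > 0"
  shows "psize M (wrap M A + A) + k \<le> card (A + A)"
    and "card (low M A) + card (high M A) + card (A + A) = 2 * nat M + 1"
    and "card (low M A \<inter> high M A) + psize M (wrap M A + A) = nat M"
proof -
  have A: "A \<subseteq> {0..M}" "0 \<in> A" "M \<in> A" using assms by (auto simp: config_def)
  have fin: "finite A" using A(1) finite_subset by blast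
  define U where "U = {x \<in> {0..<M}. x \<in> A + A}"
  define V where "V = {x \<in> {0..<M}. x + M \<in> A + A}"
  have finUV: "finite U" "finite V" by (auto simp: U_def V_def intro: finite_subset[of _ "{0..<M}"])
  have range: "x \<in> {0..2 * M}" if x: "x \<in> A + A" for x
  proof -
    obtain a b where ab: "a \<in> A" "b \<in> A" "x = a + b" using x by (rule set_plus_elim)
    then have "a \<in> {0..M}" "b \<in> {0..M}" using A(1) by blast+
    then show ?thesis using ab(3) by simp
  qed
  have MM: "M + M \<in> A + A" using A by (intro set_plus_intro)
  have AA: "A + A = U \<union> (\<lambda>x. x + M) ` V \<union> {2 * M}"
  proof (intro equalityI subsetI)
    fix x assume x: "x \<in> A + A"
    have r: "0 \<le> x" "x \<le> 2 * M" using range[OF x] by auto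
    consider "x < M" | "M \<le> x" "x < 2 * M" | "x = 2 * M" using r by linarith
    then show "x \<in> U \<union> (\<lambda>x. x + M) ` V \<union> {2 * M}"
    proof cases
      case 2
      then have "x - M \<in> V" using x by (simp add: V_def)
      then have "x - M + M \<in> (\<lambda>x. x + M) ` V" by (rule imageI)
      then show ?thesis by simp
    qed (use x r in \<open>auto simp: U_def\<close>)
  qed (use MM in \<open>auto simp: U_def V_def\<close>)
  have "card (A + A) = card (U \<union> (\<lambda>x. x + M) ` V) + card {2 * M}"
    unfolding AA by (intro card_Un_disjoint) (use finUV M in \<open>auto simp: U_def V_def\<close>)
  also have "card (U \<union> (\<lambda>x. x + M) ` V) = card U + card ((\<lambda>x. x + M) ` V)"
    by (intro card_Un_disjoint) (use finUV M in \<open>auto simp: U_def V_def\<close>)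
  also have "card ((\<lambda>x. x + M) ` V) = card V" by (simp add: card_image)
  finally have cAA: "card (A + A) = card U + card V + 1" by simp
  have res: "psize M (wrap M A + A) = card (U \<union> V)"
  proof -
    have "{x \<in> {0..<M}. x \<in> A + A \<or> x + M \<in> A + A} = U \<union> V" by (auto simp: U_def V_def)
    then show ?thesis unfolding psize_def sumset_residues[OF A M] by simp
  qed
  have UV: "card U + card V = card (U \<union> V) + card (U \<inter> V)" using finUV by (rule card_Un_Int)
  have "A \<inter> {0..<M} \<subseteq> U \<inter> V"
  proof
    fix a assume a: "a \<in> A \<inter> {0..<M}"
    have "a + 0 \<in> A + A" "a + M \<in> A + A" using a A by (auto intro!: set_plus_intro simp del: add_0_right)
    then show "a \<in> U \<inter> V" using a by (simp add: U_def V_def)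
  qed
  then have "card (A \<inter> {0..<M}) \<le> card (U \<inter> V)" using finUV by (intro card_mono) auto
  then show "psize M (wrap M A + A) + k \<le> card (A + A)"
    using cAA res UV config_facts(2)[OF assms] by linarith
  have cI: "card {0..<M} = nat M" by simp
  have L: "low M A = {0..<M} - U" and H: "high M A = {0..<M} - V" by (auto simp: low_def high_def U_def V_def)
  have subs: "U \<subseteq> {0..<M}" "V \<subseteq> {0..<M}" by (auto simp: U_def V_def)
  have cL: "card (low M A) + card U = nat M" "card (high M A) + card V = nat M"
    unfolding L H using subs finUV cI card_mono[OF _ subs(1)] card_mono[OF _ subs(2)] by (simp_all add: card_Diff_subset)
  then show "card (low M A) + card (high M A) + card (A + A) = 2 * nat M + 1" using cAA by linarith
  have "low M A \<inter> high M A = {0..<M} - (U \<union> V)" unfolding L H by auto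
  then have "card (low M A \<inter> high M A) = nat M - card (U \<union> V)" 
    using subs finUV by (simp add: card_Diff_subset)
  moreover have "card (U \<union> V) \<le> card {0..<M}" using subs by (intro card_mono) auto
  ultimately show "card (low M A \<inter> high M A) + psize M (wrap M A + A) = nat M" using res by simp
qed

section \<open>Sets contained in two or three residue classes\<close>

lemma sum_classes_le:
  fixes A :: "int set"
  assumes "finite A" "finite Z"
  shows "(\<Sum>z\<in>Z. card {x \<in> A + A. x mod d = z}) \<le> card (A + A)"
proof -
  have fin: "finite (A + A)" using assms by (simp add: finite_sumset)
  have "(\<Sum>z\<in>Z. card {x \<in> A + A. x mod d = z}) = card (\<Union>z\<in>Z. {x \<in> A + A. x mod d = z})"
    using assms fin by (intro card_UN_disjoint[symmetric]) auto
  also have "\<dots> \<le> card (A + A)" using fin by (intro card_mono) auto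
  finally show ?thesis .
qed

text \<open>\<open>B + B\<close>, \<open>B + C\<close> and \<open>C + C\<close> lie in the classes
  0, c and 2 c. These are distinct: 2 c = 0 modulo d would mean d = 2 c, so that \<open>c\<close>
  divides all of \<open>A\<close>, whence c = 1 and d = 2. Since the three sumsets share 3 k
  elements, the lower bounds for two of them leave little for the third.\<close>

lemma two_classes:
  fixes A :: "int set"
  assumes A: "finite A" "card A = k" "card (A + A) \<le> 3 * k" and A0: "0 \<in> A" and G: "Gcd A = 1"
    and d: "d > 2" and cl: "(\<lambda>x. x mod d) ` A = {0, c}" and c: "c \<noteq> 0"
  obtains B C where "A = B \<union> C" "B \<noteq> {}" "C \<noteq> {}" "card (B + B) + 1 \<le> 2 * card B + 3" "card (C + C) + 1 \<le> 2 * card C + 3"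
proof -
  define B where "B = {x \<in> A. x mod d = 0}"
  define C where "C = {x \<in> A. x mod d = c}"
  have AB: "A = B \<union> C" using cl by (auto simp: B_def C_def)
  have disj: "B \<inter> C = {}" using c by (auto simp: B_def C_def)
  have fin: "finite B" "finite C" using A by (auto simp: B_def C_def)
  have "0 \<in> B" using A0 by (simp add: B_def)
  then have ne: "B \<noteq> {}" by blast
  obtain x where x: "x \<in> A" "x mod d = c" using cl by (metis imageE insertI1 insert_commute)
  then have neC: "C \<noteq> {}" by (auto simp: C_def)
  have cd: "0 \<le> c" "c < d" using x d by auto
  have k: "card B + card C = k" using A AB disj fin by (metis card_Un_disjoint)
  have n2: "(c + c) mod d \<noteq> 0"
  proof
    assume "(c + c) mod d = 0"
    then have "d dvd c + c" by presburger
    then obtain m where m: "c + c = d * m" by blast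
    have "0 < m" using m c cd d by (metis add_nonneg_eq_0_iff mult_nonneg_nonpos not_le order_antisym less_imp_le order_trans zero_less_numeral add_nonneg_nonneg)
    moreover have "m < 2"
    proof (rule ccontr)
      assume "\<not> m < 2"
      then have "d * 2 \<le> d * m" using d by (intro mult_left_mono) auto
      then show False using m cd by linarith
    qed
    ultimately have "m = 1" by simp
    then have d2: "d = c + c" using m by simp
    have "c dvd y" if "y \<in> A" for y
    proof -
      have "y mod d = 0 \<or> y mod d = c" using that cl by auto
      then have "c dvd y mod d" by auto
      moreover have "c dvd d" using d2 by simp
      ultimately show ?thesis using dvd_mod_iff by blast
    qed
    then have "c dvd Gcd A" by (rule Gcd_greatest)
    then have "c = 1" using G cd c by simp
    then show False using d2 d by simp
  qed
  have n3: "(c + c) mod d \<noteq> c"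
  proof
    assume "(c + c) mod d = c"
    then have "(c + c) mod d = c mod d" using cd by simp
    then have "d dvd c" by (simp add: mod_eq_dvd_iff)
    then show False using c cd zdvd_not_zless[of c d] by simp
  qed
  have sub: "X + Y \<subseteq> {x \<in> A + A. x mod d = z}"
    if "X \<subseteq> A" "Y \<subseteq> A" "\<And>x. x \<in> X \<Longrightarrow> x mod d = u" "\<And>y. y \<in> Y \<Longrightarrow> y mod d = v" "(u + v) mod d = z" for X Y u v z
  proof
    fix s assume "s \<in> X + Y"
    then obtain x y where xy: "x \<in> X" "y \<in> Y" "s = x + y" by (rule set_plus_elim)
    have "s mod d = (x mod d + y mod d) mod d" unfolding xy(3) by (simp add: mod_add_eq)
    then have "s mod d = z" using that(3)[OF xy(1)] that(4)[OF xy(2)] that(5) by simp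
    moreover have "s \<in> A + A" unfolding xy(3) using xy that(1,2) by (intro set_plus_intro) auto
    ultimately show "s \<in> {x \<in> A + A. x mod d = z}" by simp
  qed
  have finAA: "finite (A + A)" using A by (simp add: finite_sumset)
  have "card (B + B) \<le> card {x \<in> A + A. x mod d = 0}"
    using finAA by (intro card_mono sub[of B B 0 0]) (auto simp: B_def)
  moreover have "card (B + C) \<le> card {x \<in> A + A. x mod d = c}"
    using finAA cd by (intro card_mono sub[of B C 0 c]) (auto simp: B_def C_def)
  moreover have "card (C + C) \<le> card {x \<in> A + A. x mod d = (c + c) mod d}"
    using finAA by (intro card_mono sub[of C C c c]) (auto simp: C_def)
  moreover have "(\<Sum>z\<in>{0, c, (c + c) mod d}. card {x \<in> A + A. x mod d = z}) \<le> card (A + A)"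
    by (rule sum_classes_le) (use A in auto)
  then have "card {x \<in> A + A. x mod d = 0} + card {x \<in> A + A. x mod d = c} + card {x \<in> A + A. x mod d = (c + c) mod d} \<le> card (A + A)"
    using c n2 n3 by auto
  moreover have "card B + card B \<le> card (B + B) + 1" "card B + card C \<le> card (B + C) + 1" "card C + card C \<le> card (C + C) + 1"
    using card_sumset_ge[OF fin(1) fin(1) ne ne] card_sumset_ge[OF fin ne neC] card_sumset_ge[OF fin(2) fin(2) neC neC]
    by simp_all
  ultimately have "card (B + B) + 1 \<le> 2 * card B + 3" "card (C + C) + 1 \<le> 2 * card C + 3"
    using A(3) k by linarith+
  then show ?thesis by (rule that[OF AB ne neC])
qed

text \<open>Polynomially many, over all sizes at once. Singletons are counted apart because
  \<open>card_small_doubling\<close> starts with two elements.\<close>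

lemma card_all_small_doubling:
  fixes U :: "int set"
  assumes "finite U"
  shows "card {B. B \<subseteq> U \<and> B \<noteq> {} \<and> card (B + B) + 1 \<le> 2 * card B + 3} \<le> (card U + 1) ^ 10"
proof -
  let ?u = "card U"
  let ?F = "\<lambda>r. {B. B \<subseteq> U \<and> card B = r + 2 \<and> card (B + B) + 1 \<le> 2 * (r + 2) + 3}"
  have finF: "finite (?F r)" for r using assms by simp
  have "{B. B \<subseteq> U \<and> B \<noteq> {} \<and> card (B + B) + 1 \<le> 2 * card B + 3} \<subseteq> {B. B \<subseteq> U \<and> card B = 1} \<union> (\<Union>r<?u. ?F r)"
  proof
    fix B assume B: "B \<in> {B. B \<subseteq> U \<and> B \<noteq> {} \<and> card (B + B) + 1 \<le> 2 * card B + 3}"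
    have "finite B" using B assms finite_subset by blast
    then have "card B \<noteq> 0" using B by simp
    moreover have "card B \<le> ?u" using B assms by (intro card_mono) auto
    ultimately consider "card B = 1" | "card B = (card B - 2) + 2" "card B - 2 < ?u" by linarith
    then show "B \<in> {B. B \<subseteq> U \<and> card B = 1} \<union> (\<Union>r<?u. ?F r)"
    proof cases
      case 2
      then have "B \<in> ?F (card B - 2)" using B by auto
      then show ?thesis using 2(2) by blast
    qed (use B in auto)
  qed
  then have "card {B. B \<subseteq> U \<and> B \<noteq> {} \<and> card (B + B) + 1 \<le> 2 * card B + 3} \<le> card ({B. B \<subseteq> U \<and> card B = 1} \<union> (\<Union>r<?u. ?F r))"
    using assms finF by (intro card_mono) auto
  also have "\<dots> \<le> card {B. B \<subseteq> U \<and> card B = 1} + card (\<Union>r<?u. ?F r)" by (rule card_Un_le)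
  also have "card {B. B \<subseteq> U \<and> card B = 1} = ?u" using n_subsets[OF assms, of 1] by simp
  also have "card (\<Union>r<?u. ?F r) \<le> (\<Sum>r<?u. card (?F r))" by (intro card_UN_le) auto
  also have "(\<Sum>r<?u. card (?F r)) \<le> (\<Sum>r<?u. ?u\<^sup>2 * (1 + (?u + 1) * ?u) ^ 3)"
  proof (rule sum_mono)
    fix r assume r: "r \<in> {..<?u}"
    have "card (?F r) \<le> ?u\<^sup>2 * (1 + (r + 2) * ?u) ^ 3" by (rule card_small_doubling[OF assms])
    also have "\<dots> \<le> ?u\<^sup>2 * (1 + (?u + 1) * ?u) ^ 3"
      using r by (intro mult_left_mono power_mono add_left_mono mult_right_mono) auto
    finally show "card (?F r) \<le> ?u\<^sup>2 * (1 + (?u + 1) * ?u) ^ 3" .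
  qed
  also have "(\<Sum>r<?u. ?u\<^sup>2 * (1 + (?u + 1) * ?u) ^ 3) = ?u ^ 3 * (1 + (?u + 1) * ?u) ^ 3"
  proof -
    have "(\<Sum>r<?u. ?u\<^sup>2 * W) = ?u ^ 3 * W" for W :: nat by (simp add: power3_eq_cube power2_eq_square)
    then show ?thesis .
  qed
  also have "?u + ?u ^ 3 * (1 + (?u + 1) * ?u) ^ 3 \<le> (?u + 1) ^ 10"
  proof -
    have a: "1 + (?u + 1) * ?u \<le> (?u + 1)\<^sup>2" by (simp add: power2_eq_square)
    have "?u ^ 3 * (1 + (?u + 1) * ?u) ^ 3 \<le> ?u ^ 3 * ((?u + 1)\<^sup>2) ^ 3"
      using a by (intro mult_left_mono power_mono) auto
    also have "\<dots> \<le> (?u + 1) ^ 3 * ((?u + 1)\<^sup>2) ^ 3" by (intro mult_right_mono power_mono) auto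
    also have "\<dots> = (?u + 1) ^ 9" by (simp flip: power_mult power_add)
    finally have "?u ^ 3 * (1 + (?u + 1) * ?u) ^ 3 \<le> (?u + 1) ^ 9" .
    moreover have "?u \<le> ?u * (?u + 1) ^ 9" by simp
    ultimately have "?u + ?u ^ 3 * (1 + (?u + 1) * ?u) ^ 3 \<le> ?u * (?u + 1) ^ 9 + (?u + 1) ^ 9" by linarith
    also have "\<dots> = (?u + 1) ^ (1 + 9)" by (simp only: distrib_right mult_1 power_add power_one_right)
    also have "\<dots> = (?u + 1) ^ 10" by simp
    finally show ?thesis .
  qed
  finally show ?thesis by simp
qed

text \<open>The integers whose class modulo \<open>d\<close> meets \<open>A\<close> form a subgroup;
  it contains \<open>A\<close>, so its generator divides Gcd A = 1.\<close>

lemma residues_generate: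
  fixes A :: "int set"
  assumes d: "d > 0" and A0: "0 \<in> A" and G: "Gcd A = 1"
    and closed: "\<And>x y. x \<in> A \<Longrightarrow> y \<in> A \<Longrightarrow> (x + y) mod d \<in> (\<lambda>x. x mod d) ` A"
  shows "(\<lambda>x. x mod d) ` A = {0..<d}"
proof -
  let ?Cl = "(\<lambda>x. x mod d) ` A"
  define K where "K = {x. x mod d \<in> ?Cl}"
  have add: "x + y \<in> K" if xy: "x \<in> K" "y \<in> K" for x y
  proof -
    obtain a b where ab: "a \<in> A" "b \<in> A" "x mod d = a mod d" "y mod d = b mod d" using xy by (auto simp: K_def)
    then have "(x + y) mod d = (a + b) mod d" by (intro mod_add_cong)
    then show ?thesis using closed[OF ab(1,2)] by (simp add: K_def)
  qed
  have mul: "int n * x \<in> K" if "x \<in> K" for n x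
  proof (induction n)
    case 0
    have "0 mod d \<in> ?Cl" using A0 by (rule imageI)
    then show ?case by (simp add: K_def)
  next
    case (Suc n)
    have "int (Suc n) * x = int n * x + x" by (simp add: algebra_simps)
    then show ?case using add[OF Suc that] by simp
  qed
  have neg: "- x \<in> K" if "x \<in> K" for x
  proof -
    have "int (nat (d - 1)) * x = - x + d * x" using d by (simp add: algebra_simps)
    then have "- x + d * x \<in> K" using mul[OF that, of "nat (d - 1)"] by metis
    moreover have "(- x + d * x) mod d = (- x) mod d" by (rule mod_mult_self2)
    ultimately show ?thesis unfolding K_def mem_Collect_eq by metis
  qed
  have diff: "x - y \<in> K" if "x \<in> K" "y \<in> K" for x y using add[OF that(1) neg[OF that(2)]] by simp
  have "d mod d = 0 mod d" by simp
  then have dK: "d \<in> K" unfolding K_def mem_Collect_eq using A0 by (metis imageI)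
  obtain k where k: "k > 0" "k dvd d" "K = {x. k dvd x}"
    using int_subgroup_principal[OF dK d diff] by metis
  have "k dvd a" if "a \<in> A" for a
  proof -
    have "a \<in> K" using that by (simp add: K_def)
    then show ?thesis using k(3) by blast
  qed
  then have "k dvd Gcd A" by (rule Gcd_greatest)
  then have "k = 1" using G k(1) by simp
  then have K: "x \<in> K" for x using k(3) by simp
  show ?thesis
  proof (intro equalityI subsetI)
    fix x assume "x \<in> {0..<d}"
    then have "x mod d = x" by simp
    then show "x \<in> ?Cl" using K[of x] by (simp add: K_def)
  qed (use d in auto)
qed

text \<open>Otherwise any two classes produce all 2 h - 1 - 2 w middle sums. The sums meet at least
  four classes: those of \<open>Cl\<close>, as 0 lies in \<open>A\<close>, and one more, because
  three classes closed under addition would be all \<open>d\<close> > 3 of them. Four times 2 h - 1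
  - 2 w exceeds 2 N.\<close>

lemma three_classes:
  fixes A :: "int set"
  assumes A: "finite A" "card (A + A) \<le> 2 * N" "0 \<in> A" "Gcd A = 1" and d: "d > 3"
    and Cl: "Cl = (\<lambda>x. x mod d) ` A" "card Cl = 3" and w: "N + 4 * w + 2 < 4 * h"
  shows "\<exists>c1\<in>Cl. \<exists>c2\<in>Cl. \<exists>g. int w \<le> g \<and> g \<le> 2 * int h - 2 - int w \<and> c1 + c2 + d * g \<notin> A + A"
proof (rule ccontr)
  assume *: "\<not> ?thesis"
  let ?m = "2 * h - 1 - 2 * w"
  have finAA: "finite (A + A)" using A by (simp add: finite_sumset)
  have big: "?m \<le> card {x \<in> A + A. x mod d = (c1 + c2) mod d}" if c: "c1 \<in> Cl" "c2 \<in> Cl" for c1 c2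
  proof -
    have "(\<lambda>g. c1 + c2 + d * g) ` {int w..2 * int h - 2 - int w} \<subseteq> {x \<in> A + A. x mod d = (c1 + c2) mod d}"
      using * c by auto
    then have "card ((\<lambda>g. c1 + c2 + d * g) ` {int w..2 * int h - 2 - int w}) \<le> card {x \<in> A + A. x mod d = (c1 + c2) mod d}"
      using finAA by (intro card_mono) auto
    moreover have "card ((\<lambda>g. c1 + c2 + d * g) ` {int w..2 * int h - 2 - int w}) = card {int w..2 * int h - 2 - int w}"
      using d by (intro card_image) (simp add: inj_on_def)
    moreover have "card {int w..2 * int h - 2 - int w} = ?m" using w by simp
    ultimately show ?thesis by simp
  qed
  have "Cl \<noteq> {0..<d}"
  proof
    assume "Cl = {0..<d}"
    then have "card Cl = nat d" by simp
    then show False using Cl d by simp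
  qed
  then obtain x y where xy: "x \<in> A" "y \<in> A" "(x + y) mod d \<notin> Cl"
    using residues_generate[of d A] A d Cl(1) by (metis less_trans zero_less_numeral)
  define z where "z = (x + y) mod d"
  have zeq: "z = (x mod d + y mod d) mod d" by (simp add: z_def mod_add_eq)
  have finCl: "finite Cl" using Cl A by simp
  have "z \<notin> Cl" using xy by (simp add: z_def)
  have z0: "0 \<in> Cl"
  proof -
    have "0 mod d \<in> Cl" unfolding Cl using A(3) by (rule imageI)
    then show ?thesis by simp
  qed
  have all: "?m \<le> card {u \<in> A + A. u mod d = t}" if t: "t \<in> insert z Cl" for t
  proof (cases "t = z")
    case True
    have "x mod d \<in> Cl" "y mod d \<in> Cl" using xy Cl(1) by auto
    then show ?thesis unfolding True zeq by (rule big)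
  next
    case False
    then have tC: "t \<in> Cl" using t by simp
    then have "(0 + t) mod d = t" using Cl(1) by auto
    then show ?thesis using big[OF z0 tC] by metis
  qed
  have "4 * ?m = (\<Sum>t\<in>insert z Cl. ?m)" using \<open>z \<notin> Cl\<close> finCl Cl(2) by simp
  also have "\<dots> \<le> (\<Sum>t\<in>insert z Cl. card {u \<in> A + A. u mod d = t})" using all by (rule sum_mono)
  also have "\<dots> \<le> card (A + A)" by (rule sum_classes_le) (use A finCl in auto)
  finally show False using A(2) w by linarith
qed

text \<open>The analogue of \<open>wsum_missing_one\<close> for two progressions of difference
  \<open>d\<close>: a sum at distance \<open>w\<close> from both ends has about w / 2 disjoint
  representations.\<close>

lemma wsum_missing_class:
  fixes V :: "int set"
  assumes "finite V" "0 \<le> p" "0 \<le> q" "p + q = 1" and d: "d > 0"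
    and c: "0 \<le> c1" "c1 < d" "0 \<le> c2" "c2 < d"
    and g: "int w \<le> g" "g \<le> 2 * int h - 2 - int w"
    and V: "\<And>y. 0 \<le> y \<Longrightarrow> y < int h \<Longrightarrow> c1 + d * y \<in> V \<and> c2 + d * y \<in> V"
  shows "wsum p q V (\<lambda>S. c1 + c2 + d * g \<notin> S + S) \<le> (1 - p\<^sup>2) ^ ((w + 1) div 2)"
proof -
  \<comment> \<open>The least y with y \<ge> 0 and g - y < h. By the distance of \<open>g\<close>
    from the ends, all y0 + t used below stay under g / 2, so the two points of a pair differ even
    if c1 = c2.\<close>
  define y0 where "y0 = max 0 (g - int h + 1)"
  define u where "u t = c1 + d * (y0 + int t)" for t :: nat
  define v where "v t = c2 + d * (g - y0 - int t)" for t :: nat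
  let ?n = "(w + 1) div 2"
  have "y0 = 0 \<or> y0 = g - int h + 1" by (auto simp: y0_def max_def)
  then have y0: "0 \<le> y0" "g - int h + 1 \<le> y0" "2 * y0 + int w \<le> g"
    using g by (auto simp: y0_def)
  have t: "2 * int t + 1 \<le> int w" if "t < ?n" for t using that by linarith
  have rng: "0 \<le> y0 + int t" "y0 + int t < int h" "0 \<le> g - y0 - int t" "g - y0 - int t < int h" if "t < ?n" for t
    using t[OF that] y0 g by linarith+
  have dv: "(c1 + d * a) div d = a" "(c2 + d * a) div d = a" for a using c d by simp_all
  have "wsum p q V (\<lambda>S. c1 + c2 + d * g \<notin> S + S) \<le> wsum p q V (\<lambda>S. \<forall>i<?n. \<not> (u i \<in> S \<and> v i \<in> S))"
  proof (rule wsum_mono)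
    fix S assume S: "c1 + c2 + d * g \<notin> S + S"
    show "\<forall>i<?n. \<not> (u i \<in> S \<and> v i \<in> S)"
    proof (intro allI impI notI)
      fix i assume "u i \<in> S \<and> v i \<in> S"
      then have "u i + v i \<in> S + S" by (intro set_plus_intro) auto
      moreover have "u i + v i = c1 + c2 + d * g" by (simp add: u_def v_def algebra_simps)
      ultimately show False using S by simp
    qed
  qed (use assms in auto)
  also have "\<dots> = (1 - p\<^sup>2) ^ ?n"
  proof (rule wsum_matching)
    show "inj_on u {..<?n}" "inj_on v {..<?n}" using d by (auto simp: inj_on_def u_def v_def)
    show "u ` {..<?n} \<inter> v ` {..<?n} = {}"
    proof (rule ccontr)
      assume "u ` {..<?n} \<inter> v ` {..<?n} \<noteq> {}"
      then obtain i j where ij: "i < ?n" "j < ?n" "u i = v j" by blast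
      have "(c1 + d * (y0 + int i)) div d = (c2 + d * (g - y0 - int j)) div d" using ij(3) by (simp add: u_def v_def)
      then have "y0 + int i = g - y0 - int j" by (simp only: dv)
      then show False using t[OF ij(1)] t[OF ij(2)] y0 by linarith
    qed
    show "u ` {..<?n} \<subseteq> V" "v ` {..<?n} \<subseteq> V" using rng V by (auto simp: u_def v_def)
  qed (use assms in auto)
  finally show ?thesis .
qed

lemma card_residue_set:
  assumes d: "0 < d" "d dvd M" and M: "0 < M" and Cl: "Cl \<subseteq> {0..<d}"
  shows "card {x \<in> {0..<M}. x mod d \<in> Cl} = card Cl * nat (M div d)"
proof -
  obtain h where h: "M = d * h" using d by blast
  have "bij_betw (\<lambda>(c, y). c + d * y) (Cl \<times> {0..<h}) {x \<in> {0..<M}. x mod d \<in> Cl}"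
  proof (rule bij_betw_byWitness[where f' = "\<lambda>x. (x mod d, x div d)"])
    show "\<forall>a\<in>Cl \<times> {0..<h}. ((case a of (c, y) \<Rightarrow> c + d * y) mod d, (case a of (c, y) \<Rightarrow> c + d * y) div d) = a"
      using Cl d by auto
    show "\<forall>a'\<in>{x \<in> {0..<M}. x mod d \<in> Cl}. (case (a' mod d, a' div d) of (c, y) \<Rightarrow> c + d * y) = a'"
      by simp
    show "(\<lambda>(c, y). c + d * y) ` (Cl \<times> {0..<h}) \<subseteq> {x \<in> {0..<M}. x mod d \<in> Cl}"
    proof
      fix x assume "x \<in> (\<lambda>(c, y). c + d * y) ` (Cl \<times> {0..<h})"
      then obtain c y where cy: "c \<in> Cl" "0 \<le> y" "y < h" "x = c + d * y" by auto
      have c: "0 \<le> c" "c < d" using cy(1) Cl by auto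
      have "d * (y + 1) \<le> d * h" using cy d by (intro mult_left_mono) auto
      then have "x < M" using cy c h by (simp add: algebra_simps)
      moreover have "0 \<le> d * y" using cy d by simp
      ultimately show "x \<in> {x \<in> {0..<M}. x mod d \<in> Cl}" using cy c by simp
    qed
    show "(\<lambda>x. (x mod d, x div d)) ` {x \<in> {0..<M}. x mod d \<in> Cl} \<subseteq> Cl \<times> {0..<h}"
    proof
      fix z assume "z \<in> (\<lambda>x. (x mod d, x div d)) ` {x \<in> {0..<M}. x mod d \<in> Cl}"
      then obtain x where x: "0 \<le> x" "x < d * h" "x mod d \<in> Cl" "z = (x mod d, x div d)" using h by auto
      have "x div d < h"
      proof (rule ccontr)
        assume "\<not> x div d < h"
        then have "d * h \<le> d * (x div d)" using d(1) by (intro mult_left_mono) auto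
        also have "\<dots> \<le> x" using mult_div_mod_eq[of d x] d(1) pos_mod_sign[of d x] by linarith
        finally show False using x(2) by simp
      qed
      moreover have "0 \<le> x div d" using x d by (simp add: pos_imp_zdiv_nonneg_iff)
      ultimately show "z \<in> Cl \<times> {0..<h}" using x by simp
    qed
  qed
  then have "card (Cl \<times> {0..<h}) = card {x \<in> {0..<M}. x mod d \<in> Cl}" by (rule bij_betw_same_card)
  moreover have "M div d = h" using h d(1) by simp
  ultimately show ?thesis by (simp add: card_cartesian_product)
qed

text \<open>The classes \<open>Cl\<close> modulo \<open>d\<close> that meet a set with too small a sumset: \<open>(card Cl - 1) * (M div d) \<le> c\<close>,
  with the subtraction moved to the other side.\<close>

definition thick :: "int \<Rightarrow> nat \<Rightarrow> nat \<Rightarrow> int \<Rightarrow> int set \<Rightarrow> bool" where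
  "thick M j c d Cl \<longleftrightarrow> 0 < d \<and> d dvd M \<and> Cl \<subseteq> {0..<d} \<and> j \<le> nat (M div d)
     \<and> card Cl * nat (M div d) \<le> nat (M div d) + c"

text \<open>\<open>wrap M A\<close> is itself separated, with boundary at most 2 (N - k) + 1, so
  \<open>atom_dichotomy\<close> applies. A spread-out atom has size at most 2 k / (i - 1), and a few
  of its elements generate a large subgroup. A subgroup atom puts \<open>A\<close> into few classes:
  one class contradicts Gcd A = 1, two are handled by \<open>two_classes\<close>, and all classes
  cannot occur as \<open>F + A\<close> is not everything.\<close>

lemma few_cases:
  assumes cf: "config k N M A" and M: "M > 0" and G: "Gcd A = 1"
    and sp: "psize M (wrap M A + A) + j \<le> nat M" and j: "1 \<le> j" "j + 1 \<le> k"
    and N: "k \<le> N" "2 * N \<le> 3 * k" and i: "2 \<le> i" "i * i * j + 1 \<le> k" and r: "j \<le> 2 ^ r"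
  shows "walkable M j r (2 * k div (i - 1) + 2) (wrap M A)
    \<or> (\<exists>B C. A = B \<union> C \<and> B \<noteq> {} \<and> C \<noteq> {} \<and> card (B + B) + 1 \<le> 2 * card B + 3 \<and> card (C + C) + 1 \<le> 2 * card C + 3)
    \<or> (\<exists>d Cl. thick M j (2 * (N - k) + 1) d Cl \<and> Cl = (\<lambda>x. x mod d) ` A \<and> (4 \<le> card Cl \<or> card Cl = 3 \<and> 3 < d))"
proof -
  have A: "A \<subseteq> {0..M}" "0 \<in> A" "M \<in> A" "card A = k" "card (A + A) \<le> 2 * N" using cf by (auto simp: config_def)
  note fin = config_facts(1)[OF cf M] and cA = config_facts(2)[OF cf M] and cW = config_facts(3)[OF cf M]
  let ?S = "wrap M A" and ?c = "2 * (N - k) + 1"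
  have pS: "periodic M ?S" by (rule periodic_wrap)
  have tot: "psize M (?S + A) + k \<le> 2 * N" using sumset_counts(1)[OF cf M] A(5) by linarith
  have sep0: "sep M j A ?S"
    unfolding sep_def using pS cW j sp psize_Compl[OF M, of "?S + A"] by auto
  have bd0: "boundary M A ?S \<le> int ?c"
    unfolding boundary_def using tot cW N by linarith
  obtain F where F: "sep M j A F" "0 \<in> F" "psize M (F + A) \<le> psize M F + ?c"
    "(\<exists>d>0. d dvd M \<and> F = {x. d dvd x}) \<or>
     (\<forall>i. i * j \<le> card (A \<inter> {0..<M}) \<longrightarrow> i * psize M F \<le> psize M F + ?c + i * i * j)"
    using atom_dichotomy[OF M j(1) fin sep0 bd0] by blast
  have pF: "periodic M F" and szF: "j \<le> psize M F" and cF: "j \<le> psize M (- (F + A))"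
    using F(1) by (auto simp: sep_def)
  from F(4) show ?thesis
  proof
    assume *: "\<forall>i. i * j \<le> card (A \<inter> {0..<M}) \<longrightarrow> i * psize M F \<le> psize M F + ?c + i * i * j"
    have "i * j \<le> i * i * j" using i(1) by simp
    then have "i * j \<le> card (A \<inter> {0..<M})" using i(2) cA by linarith
    then have "i * psize M F \<le> psize M F + ?c + i * i * j" using * by blast
    then have "i * psize M F \<le> psize M F + 2 * k" using i(2) N by linarith
    moreover have "i * psize M F = (i - 1) * psize M F + psize M F" using i(1) by (simp add: algebra_simps)
    ultimately have "(i - 1) * psize M F \<le> 2 * k" by linarith
    then have f: "psize M F \<le> 2 * k div (i - 1)" using i(1) by (simp add: less_eq_div_iff_mult_less_eq mult.commute)
    obtain D where D: "D \<subseteq> F \<inter> {0..<M}" "card D \<le> r" "j \<le> nat (M div Gcd (insert M D))"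
      using gcd_chain[OF M szF r] by blast
    have "psize M {x \<in> ?S. x + d \<notin> ?S} \<le> 2 * k div (i - 1) + 2" if d: "d \<in> D" for d
    proof -
      let ?Y = "(+) d ` ?S"
      have dF: "d \<in> F" using d D by blast
      have sub: "?S \<union> ?Y \<subseteq> F + A"
      proof
        fix x assume "x \<in> ?S \<union> ?Y"
        then have "\<exists>e\<in>{0, d}. x - e \<in> ?S" by (auto simp: mem_translate)
        then obtain e where e: "e \<in> F" "x - e \<in> ?S" using F(2) dF by auto
        then obtain a where a: "a \<in> A" "M dvd x - e - a" by (auto simp: wrap_def)
        have "x - a \<in> F" using periodic_cong[OF pF, of "x - a" e] e(1) a(2) by (simp add: algebra_simps)
        then show "x \<in> F + A" using a(1) by (auto simp: mem_sumset)
      qed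
      have "psize M (?S \<union> ?Y) \<le> psize M F + ?c" using psize_mono[OF sub, of M] F(3) by linarith
      moreover have "psize M (?S \<union> ?Y) = psize M ?S + psize M (?Y - ?S)"
        using psize_Un_Int[of M ?S "?Y - ?S"] by (simp add: psize_def Un_commute)
      \<comment> \<open>The set and its translate together have at most |F| + 2 (N - k) + 1
        residues, the set has k - 1, and 2 N \<le> 3 k leaves |F| + 2.\<close>
      ultimately have "psize M (?Y - ?S) \<le> psize M F + 2" using cW N by linarith
      moreover have "?Y - ?S = (+) d ` {x \<in> ?S. x + d \<notin> ?S}"
      proof (rule set_eqI)
        fix x
        show "x \<in> ?Y - ?S \<longleftrightarrow> x \<in> (+) d ` {x \<in> ?S. x + d \<notin> ?S}"
          unfolding mem_translate Diff_iff by simp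
      qed
      moreover have "periodic M {x \<in> ?S. x + d \<notin> ?S}"
      proof -
        have "x + M + d \<in> ?S \<longleftrightarrow> x + d \<in> ?S" for x
          using pS[unfolded periodic_def, THEN spec, of "x + d"] by (simp add: add_ac)
        then show ?thesis using pS by (simp add: periodic_def)
      qed
      ultimately show ?thesis using f psize_translate[OF M] by simp
    qed
    then have "walkable M j r (2 * k div (i - 1) + 2) ?S"
      unfolding walkable_def using D by (intro exI[of _ D]) auto
    then show ?thesis by blast
  next
    assume "\<exists>d>0. d dvd M \<and> F = {x. d dvd x}"
    then obtain d where d: "d > 0" "d dvd M" "F = {x. d dvd x}" by blast
    define Cl where "Cl = (\<lambda>x. x mod d) ` A"
    have Cl: "Cl \<subseteq> {0..<d}" using d by (auto simp: Cl_def)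
    have finCl: "finite Cl" using fin by (simp add: Cl_def)
    have FA: "F + A = {x. x mod d \<in> Cl}"
      unfolding d(3) Cl_def by (auto simp: mem_sumset image_iff mod_eq_dvd_iff)
    have "psize M (F + A) = card {x \<in> {0..<M}. x mod d \<in> Cl}"
      unfolding psize_def FA by (rule arg_cong[where f = card]) auto
    then have sz: "psize M (F + A) = card Cl * nat (M div d)" using card_residue_set[OF d(1,2) M Cl] by simp
    have szF': "psize M F = nat (M div d)" using psize_multiples[OF M d(1,2)] d(3) by simp
    have thick: "thick M j ?c d Cl"
      unfolding thick_def using d Cl szF szF' F(3) sz by simp
    have nfull: "Cl \<noteq> {0..<d}"
    proof
      assume "Cl = {0..<d}"
      then have "F + A = UNIV" using d(1) unfolding FA by auto
      then show False using cF j by (simp add: psize_def)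
    qed
    have z: "0 \<in> Cl" unfolding Cl_def using A(2) by (auto intro!: rev_image_eqI[of 0])
    have le: "card Cl \<le> nat d" using card_mono[OF _ Cl] by simp
    have lt: "card Cl < nat d"
    proof (rule ccontr)
      assume "\<not> card Cl < nat d"
      then have "card Cl = card {0..<d}" using le by simp
      then have "Cl = {0..<d}" using Cl by (intro card_subset_eq) auto
      then show False using nfull by simp
    qed
    have "card Cl > 0" using z finCl by (auto simp: card_gt_0_iff)
    then consider "card Cl = 1" | "card Cl = 2" | "card Cl = 3" | "4 \<le> card Cl" by linarith
    then show ?thesis
    proof cases
      case 1
      then have "Cl = {0}" using z by (metis card_1_singletonE singletonD)
      then have "d dvd a" if "a \<in> A" for a using that unfolding Cl_def by auto
      then have "d dvd Gcd A" by (rule Gcd_greatest)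
      then have "d = 1" using G d(1) by simp
      then show ?thesis using lt 1 by simp
    next
      case 2
      then obtain c where c: "Cl = {0, c}" "c \<noteq> 0" using z
        by (metis card_2_iff doubleton_eq_iff insertE singletonD)
      have "d > 2" using lt 2 by linarith
      moreover have "card (A + A) \<le> 3 * k" using A(5) N by linarith
      ultimately show ?thesis
        using two_classes[OF fin A(4) _ A(2) G, of d c] c unfolding Cl_def by metis
    next
      case 3
      then show ?thesis using thick lt by (intro disjI2 exI[of _ d] exI[of _ Cl]) (auto simp: Cl_def)
    next
      case 4
      then show ?thesis using thick by (intro disjI2 exI[of _ d] exI[of _ Cl]) (auto simp: Cl_def)
    qed
  qed
qed

section \<open>Sets whose sumset misses many residues\<close>

definition few :: "nat \<Rightarrow> nat \<Rightarrow> nat \<Rightarrow> int \<Rightarrow> int set set" where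
  "few k N j M = {A. config k N M A \<and> Gcd A = 1 \<and> psize M (wrap M A + A) + j \<le> nat M}"

lemma finite_config: "finite {A. config k N M A}"
  by (rule finite_subset[of _ "Pow {0..M}"]) (auto simp: config_def)

definition rset :: "int \<Rightarrow> int \<Rightarrow> int set \<Rightarrow> int set" where
  "rset M d Cl = {x \<in> {0..M}. x mod d \<in> Cl}"

lemma finite_rset: "finite (rset M d Cl)"
  by (rule finite_subset[of _ "{0..M}"]) (auto simp: rset_def)

lemma card_rset:
  assumes "thick M j c d Cl" "M > 0"
  shows "card (rset M d Cl) \<le> card Cl * nat (M div d) + 1"
proof -
  have "rset M d Cl \<subseteq> insert M {x \<in> {0..<M}. x mod d \<in> Cl}" by (auto simp: rset_def)
  moreover have fin: "finite {x \<in> {0..<M}. x mod d \<in> Cl}" by (rule finite_subset[of _ "{0..<M}"]) auto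
  ultimately have "card (rset M d Cl) \<le> card (insert M {x \<in> {0..<M}. x mod d \<in> Cl})"
    by (intro card_mono) auto
  also have "\<dots> \<le> card {x \<in> {0..<M}. x mod d \<in> Cl} + 1" using fin by (simp add: card_insert_if)
  also have "card {x \<in> {0..<M}. x mod d \<in> Cl} = card Cl * nat (M div d)"
    using assms by (intro card_residue_set) (auto simp: thick_def)
  finally show ?thesis by simp
qed

definition pairs :: "int \<Rightarrow> nat \<Rightarrow> nat \<Rightarrow> (int \<times> int set) set" where
  "pairs M j c = {(d, Cl). thick M j c d Cl}"

lemma card_pairs:
  assumes "M > 0" "1 \<le> j"
  shows "finite (pairs M j c)" "card (pairs M j c) \<le> nat M * (nat M + 1) ^ (c div j + 1)"
proof -
  let ?X = "{1..M} \<times> {Cl. Cl \<subseteq> {0..<M} \<and> card Cl \<le> c div j + 1}"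
  have sub: "pairs M j c \<subseteq> ?X"
  proof
    fix z assume "z \<in> pairs M j c"
    then obtain d Cl where z: "z = (d, Cl)" "thick M j c d Cl" by (auto simp: pairs_def)
    then have t: "0 < d" "d dvd M" "Cl \<subseteq> {0..<d}" "j \<le> nat (M div d)" "card Cl * nat (M div d) \<le> nat (M div d) + c"
      by (auto simp: thick_def)
    have dM: "d \<le> M" using t(2) assms(1) by (rule zdvd_imp_le)
    \<comment> \<open>Every class beyond the first uses at least \<open>j\<close> of the allowance
      \<open>c\<close>.\<close>
    have "card Cl \<le> c div j + 1"
    proof (cases "card Cl")
      case (Suc a)
      then have "a * nat (M div d) \<le> c" using t(5) by simp
      moreover have "a * j \<le> a * nat (M div d)" using t(4) by (rule mult_left_mono) simp
      ultimately have "a * j \<le> c" by linarith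
      then have "a \<le> c div j" using assms(2) by (simp add: less_eq_div_iff_mult_less_eq)
      then show ?thesis using Suc by simp
    qed simp
    then show "z \<in> ?X" using z t dM by auto
  qed
  have fin: "finite ?X" by simp
  then show "finite (pairs M j c)" using sub finite_subset by blast
  have "card (pairs M j c) \<le> card ?X" using fin sub by (rule card_mono)
  also have "\<dots> = card {1..M} * card {Cl. Cl \<subseteq> {0..<M} \<and> card Cl \<le> c div j + 1}" by (rule card_cartesian_product)
  also have "\<dots> \<le> card {1..M} * (card {0..<M} + 1) ^ (c div j + 1)"
    by (intro mult_left_mono card_small_subsets) auto
  finally show "card (pairs M j c) \<le> nat M * (nat M + 1) ^ (c div j + 1)" by simp
qed

lemma card_Union_le_mult:
  assumes "finite I" "\<And>i. i \<in> I \<Longrightarrow> real (card (f i)) \<le> b" "real (card I) \<le> a" "0 \<le> b"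
  shows "real (card (\<Union>i\<in>I. f i)) \<le> a * b"
proof -
  have "real (card (\<Union>i\<in>I. f i)) \<le> real (\<Sum>i\<in>I. card (f i))"
    using card_UN_le[OF assms(1), of f] by (simp only: of_nat_le_iff)
  also have "\<dots> \<le> (\<Sum>i\<in>I. b)" unfolding of_nat_sum using assms(2) by (rule sum_mono)
  also have "\<dots> = real (card I) * b" by simp
  also have "\<dots> \<le> a * b" using assms(3,4) by (rule mult_right_mono)
  finally show ?thesis .
qed

lemma config_eq_wrap:
  assumes "config k N M A" "M > 0"
  shows "A = insert M (wrap M A \<inter> {0..<M})"
proof -
  have A: "A \<subseteq> {0..M}" "0 \<in> A" "M \<in> A" using assms by (auto simp: config_def)
  have "A = insert M (A \<inter> {0..<M})" using A by force
  then show ?thesis using wrap_Int[OF A(1,2) assms(2)] by simp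
qed

text \<open>For four or more classes of \<open>h\<close> residues, (card Cl - 1) * h \<le> c bounds
  X = card Cl * h by 4/3 c. With c = 2 (N - k) + 1 and N - k \<le> N / 3 this is about 8/9 N, well
  below N - k / 32.\<close>

lemma few_arith:
  fixes k N X e :: nat
  assumes "k < N" "2 * N \<le> 3 * k" "100 \<le> k" "3 * X \<le> 4 * (2 * (N - k) + 1)" "32 * e \<le> k"
  shows "X + 1 \<le> N - e"
proof -
  obtain m where m: "N = k + m" using assms(1) less_imp_add_positive by blast
  have "X + 1 + e \<le> N" using assms unfolding m by simp
  then show ?thesis by simp
qed

text \<open>For three classes the same allowance gives h \<le> N - k \<le> N / 3, so they exceed
  \<open>N\<close> by at most one point.\<close>

lemma few_arith':
  fixes k N h V :: nat
  assumes "k < N" "2 * N \<le> 3 * k" "3 * h \<le> h + (2 * (N - k) + 1)" "V \<le> 3 * h + 1"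
  shows "V - N \<le> 1"
proof -
  obtain m where m: "N = k + m" using assms(1) less_imp_add_positive by blast
  have "2 * h \<le> 2 * m + 1" using assms(3) unfolding m by simp
  then have "h \<le> m" by presburger
  then have "V \<le> N + 1" using assms(2,4) unfolding m by simp
  then show ?thesis by simp
qed

text \<open>The four summands count walkable sets, unions of two sets of small doubling, sets
  confined to at most N - k / 32 points of few classes, and sets in three nearly filled classes with
  a middle sum missing.\<close>

lemma card_few:
  fixes \<nu> :: nat
  assumes M: "M > 0" "nat M + 2 \<le> \<nu>" and j: "1 \<le> j" "j + 1 \<le> k"
    and N: "k < N" "2 * N \<le> 3 * k" "100 \<le> k" and i: "2 \<le> i" "i * i * j + 1 \<le> k" and r: "j \<le> 2 ^ r"
    and p: "real k = p * real N" and t: "t = 2 * k div (i - 1) + 2"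
  shows "real (card (few k N j M)) \<le> real \<nu> ^ (r + 4 * r * t + k div j) + real \<nu> ^ 20
     + real \<nu> ^ (k div j + 3) * ((1 - p) ^ (k div 32) * real (N choose k))
     + real \<nu> ^ (k div j + 7) * ((1 - p\<^sup>2) ^ ((N div 16 + 1) div 2) * (real (N + 1) * real (N choose k)) * (1 / (1 - p)))"
proof -
  let ?c = "2 * (N - k) + 1" and ?q = "1 - p"
  have N0: "N > 0" using N by simp
  have peq: "p = real k / real N" using p N0 by simp
  have p01: "0 < p" "p < 1" using N j by (simp_all add: peq)
  have q: "0 < ?q" "?q \<le> 1" using p01 by simp_all
  have psq: "0 \<le> 1 - p\<^sup>2" using p01 by (simp add: power_le_one)
  let ?w = "N div 16"
  have div: "32 * (k div 32) \<le> k" "16 * ?w \<le> N" by simp_all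
  define W where "W = {A. config k N M A \<and> walkable M j r t (wrap M A)}"
  define T2 where "T2 = (\<lambda>(B, C). B \<union> C) ` ({B. B \<subseteq> {0..M} \<and> B \<noteq> {} \<and> card (B + B) + 1 \<le> 2 * card B + 3}
     \<times> {B. B \<subseteq> {0..M} \<and> B \<noteq> {} \<and> card (B + B) + 1 \<le> 2 * card B + 3})"
  define I3 where "I3 = {z \<in> pairs M j ?c. card (rset M (fst z) (snd z)) \<le> N - k div 32}"
  define T3 where "T3 = (\<Union>z\<in>I3. {A. A \<subseteq> rset M (fst z) (snd z) \<and> card A = k})"
  define ok where "ok = (\<lambda>(d, Cl) (c1 :: int) c2 g. card Cl = 3 \<and> c1 \<in> Cl \<and> c2 \<in> Cl \<and> int ?w \<le> g \<and> g \<le> 2 * (M div d) - 2 - int ?w)"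
  define I4 where "I4 = {(z, c1, c2, g). z \<in> pairs M j ?c \<and> ok z c1 c2 g}"
  define f4 where "f4 = (\<lambda>((d, Cl), c1, c2, g). {A. A \<subseteq> rset M d Cl \<and> card A = k \<and> c1 + c2 + d * g \<notin> A + A})"
  define T4 where "T4 = (\<Union>z\<in>I4. f4 z)"
  note fp = card_pairs[OF M(1) j(1), of ?c]
  have nuM: "nat M \<le> \<nu>" "nat M + 1 \<le> \<nu>" "1 \<le> \<nu>" using M(2) by auto
  have c_le: "?c div j + 2 \<le> k div j + 3"
  proof -
    have "?c \<le> k + j" using N j by linarith
    then have "?c div j \<le> (k + j) div j" by (rule div_le_mono)
    then show ?thesis using j by simp
  qed
  have P: "real (card (pairs M j ?c)) \<le> real \<nu> ^ (k div j + 3)"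
  proof -
    have "card (pairs M j ?c) \<le> nat M * (nat M + 1) ^ (?c div j + 1)" by (rule fp(2))
    also have "\<dots> \<le> \<nu> * \<nu> ^ (?c div j + 1)" using nuM by (intro mult_mono power_mono) auto
    also have "\<dots> = \<nu> ^ (?c div j + 2)" by simp
    also have "\<dots> \<le> \<nu> ^ (k div j + 3)" using c_le nuM by (intro power_increasing) auto
    finally show ?thesis by (simp only: of_nat_power[symmetric] of_nat_le_iff)
  qed
  have I4sub: "I4 \<subseteq> pairs M j ?c \<times> ({0..<M} \<times> ({0..<M} \<times> {0..2 * M}))"
  proof
    fix x assume "x \<in> I4"
    then obtain d Cl c1 c2 g where x: "x = ((d, Cl), c1, c2, g)" "(d, Cl) \<in> pairs M j ?c" "c1 \<in> Cl" "c2 \<in> Cl"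
      "int ?w \<le> g" "g \<le> 2 * (M div d) - 2 - int ?w" by (auto simp: I4_def ok_def)
    have th: "0 < d" "d dvd M" "Cl \<subseteq> {0..<d}" using x(2) by (auto simp: pairs_def thick_def)
    have "d \<le> M" using th(2) M(1) by (rule zdvd_imp_le)
    moreover have "M div d \<le> M"
    proof -
      have "M div d \<le> M div 1" using M th by (intro zdiv_mono2) auto
      then show ?thesis by simp
    qed
    ultimately show "x \<in> pairs M j ?c \<times> ({0..<M} \<times> ({0..<M} \<times> {0..2 * M}))" using x th by auto
  qed
  have finI4: "finite I4" by (rule finite_subset[OF I4sub]) (use fp in simp)
  have cI4: "real (card I4) \<le> real \<nu> ^ (k div j + 7)"
  proof -
    have "card I4 \<le> card (pairs M j ?c \<times> ({0..<M} \<times> ({0..<M} \<times> {0..2 * M})))"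
      using fp by (intro card_mono I4sub) auto
    also have "\<dots> = card (pairs M j ?c) * (nat M * (nat M * nat (2 * M + 1)))" by (simp add: card_cartesian_product)
    also have "nat M * (nat M * nat (2 * M + 1)) \<le> \<nu> * (\<nu> * (\<nu> * \<nu>))"
    proof (intro mult_mono nuM)
      have "2 * \<nu> \<le> \<nu> * \<nu>" using M by (intro mult_right_mono) auto
      then show "nat (2 * M + 1) \<le> \<nu> * \<nu>" using M by linarith
    qed auto
    also have "\<nu> * (\<nu> * (\<nu> * \<nu>)) = \<nu> ^ 4" by (simp add: eval_nat_numeral)
    finally have "real (card I4) \<le> real (card (pairs M j ?c)) * real \<nu> ^ 4"
      by (metis of_nat_le_iff of_nat_mult of_nat_power mult_le_mono2)
    also have "\<dots> \<le> real \<nu> ^ (k div j + 3) * real \<nu> ^ 4" using P by (intro mult_right_mono) auto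
    also have "\<dots> = real \<nu> ^ ((k div j + 3) + 4)" by (simp only: power_add)
    also have "(k div j + 3) + 4 = k div j + 7" by simp
    finally show ?thesis .
  qed
  have sub: "few k N j M \<subseteq> W \<union> T2 \<union> T3 \<union> T4"
  proof
    fix A assume "A \<in> few k N j M"
    then have A: "config k N M A" "Gcd A = 1" "psize M (wrap M A + A) + j \<le> nat M" by (auto simp: few_def)
    have A': "A \<subseteq> {0..M}" "0 \<in> A" "card A = k" "card (A + A) \<le> 2 * N" using A(1) by (auto simp: config_def)
    note fin = config_facts(1)[OF A(1) M(1)]
    consider (w) "walkable M j r t (wrap M A)"
      | (two) "\<exists>B C. A = B \<union> C \<and> B \<noteq> {} \<and> C \<noteq> {} \<and> card (B + B) + 1 \<le> 2 * card B + 3 \<and> card (C + C) + 1 \<le> 2 * card C + 3"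
      | (res) "\<exists>d Cl. thick M j ?c d Cl \<and> Cl = (\<lambda>x. x mod d) ` A \<and> (4 \<le> card Cl \<or> card Cl = 3 \<and> 3 < d)"
      using few_cases[OF A(1) M(1) A(2,3) j less_imp_le[OF N(1)] N(2) i r] unfolding t by blast
    then show "A \<in> W \<union> T2 \<union> T3 \<union> T4"
    proof cases
      case w
      then show ?thesis using A(1) by (simp add: W_def)
    next
      case two
      then obtain B C where BC: "A = B \<union> C" "B \<noteq> {}" "C \<noteq> {}" "card (B + B) + 1 \<le> 2 * card B + 3" "card (C + C) + 1 \<le> 2 * card C + 3"
        by blast
      then have "A \<in> T2" unfolding T2_def using A'(1) by (intro image_eqI[of _ _ "(B, C)"]) auto
      then show ?thesis by simp
    next
      case res
      then obtain d Cl where d: "thick M j ?c d Cl" "Cl = (\<lambda>x. x mod d) ` A" "4 \<le> card Cl \<or> card Cl = 3 \<and> 3 < d" by blast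
      define h where "h = nat (M div d)"
      have dp: "(d, Cl) \<in> pairs M j ?c" using d(1) by (simp add: pairs_def)
      have AV: "A \<subseteq> rset M d Cl" using A'(1) d(2) by (auto simp: rset_def)
      have cV: "card (rset M d Cl) \<le> card Cl * h + 1" unfolding h_def by (rule card_rset[OF d(1) M(1)])
      have th: "card Cl * h \<le> h + ?c" using d(1) by (simp add: thick_def h_def)
      show ?thesis
      proof (cases "card (rset M d Cl) \<le> N - k div 32")
        case True
        then have "A \<in> T3" unfolding T3_def I3_def using dp AV A'(3) by (intro UN_I[of "(d, Cl)"]) auto
        then show ?thesis by simp
      next
        case False
        have "\<not> 4 \<le> card Cl"
        proof
          assume a4: "4 \<le> card Cl"
          then have "4 * h \<le> card Cl * h" by (rule mult_right_mono) simp
          moreover have "3 * X \<le> 4 * c" if "4 * h \<le> X" "X \<le> h + c" for X c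
            using that by linarith
          ultimately have *: "3 * (card Cl * h) \<le> 4 * ?c" using th by blast
          have "card Cl * h + 1 \<le> N - k div 32" by (rule few_arith[OF N * div(1)])
          then show False using cV False by linarith
        qed
        then have a3: "card Cl = 3" "3 < d" using d(3) by auto
        \<comment> \<open>Three classes with more than N - k / 32 points force 3 h to be nearly
          \<open>N\<close>; then 4 h exceeds \<open>N\<close> by enough to cover 4 * (N div 16) +
          2.\<close>
        have big: "N < 3 * h + 1 + k div 32" using False cV a3(1) N div by simp
        have w: "N + 4 * ?w + 2 < 4 * h" using big N div by linarith
        obtain c1 c2 g where cg: "c1 \<in> Cl" "c2 \<in> Cl" "int ?w \<le> g" "g \<le> 2 * int h - 2 - int ?w" "c1 + c2 + d * g \<notin> A + A"
          using three_classes[OF fin A'(4,2) A(2) a3(2) d(2) a3(1) w] by blast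
        have hM: "int h = M div d" using M a3 by (simp add: h_def pos_imp_zdiv_nonneg_iff)
        have "((d, Cl), c1, c2, g) \<in> I4" unfolding I4_def ok_def using dp a3 cg hM by simp
        moreover have "A \<in> f4 ((d, Cl), c1, c2, g)" unfolding f4_def using AV A'(3) cg(5) by simp
        ultimately have "A \<in> T4" unfolding T4_def by blast
        then show ?thesis by simp
      qed
    qed
  qed
  have finW: "finite W" unfolding W_def by (rule finite_subset[OF _ finite_config[of k N M]]) auto
  have cW: "real (card W) \<le> real \<nu> ^ (r + 4 * r * t + k div j)"
  proof -
    let ?\<S> = "{S. periodic M S \<and> psize M S \<le> k \<and> walkable M j r t S}"
    note cw = card_walkable[OF M(1) j(1), of k r t]
    have "inj_on (wrap M) W"
    proof (rule inj_onI)
      fix A B assume "A \<in> W" "B \<in> W" "wrap M A = wrap M B"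
      then show "A = B" using config_eq_wrap[OF _ M(1), of k N A] config_eq_wrap[OF _ M(1), of k N B]
        by (auto simp: W_def)
    qed
    moreover have "wrap M ` W \<subseteq> ?\<S>"
      using periodic_wrap config_facts(3)[OF _ M(1)] by (force simp: W_def)
    ultimately have "card W \<le> card ?\<S>" using cw(1) by (rule card_inj_on_le)
    also have "\<dots> \<le> (nat M + 1) ^ r * ((nat M * nat M + 1) ^ (r * t) * (nat M * nat M + 1) ^ (r * t)) * (nat M + 1) ^ (k div j)"
      by (rule cw(2))
    also have "\<dots> \<le> \<nu> ^ r * ((\<nu>\<^sup>2) ^ (r * t) * (\<nu>\<^sup>2) ^ (r * t)) * \<nu> ^ (k div j)"
    proof -
      have "nat M * nat M + 1 \<le> (nat M + 1) * (nat M + 1)" by simp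
      also have "\<dots> \<le> \<nu> * \<nu>" using nuM by (intro mult_mono) auto
      finally have "nat M * nat M + 1 \<le> \<nu>\<^sup>2" by (simp add: power2_eq_square)
      then show ?thesis using nuM by (intro mult_mono power_mono) auto
    qed
    also have "\<dots> = \<nu> ^ (r + (2 * (r * t) + 2 * (r * t)) + k div j)" by (simp only: power_mult[symmetric] power_add)
    also have "r + (2 * (r * t) + 2 * (r * t)) + k div j = r + 4 * r * t + k div j" by simp
    finally show ?thesis by (simp only: of_nat_power[symmetric] of_nat_le_iff)
  qed
  have cT2: "real (card T2) \<le> real \<nu> ^ 20" and finT2: "finite T2"
  proof -
    let ?X = "{B. B \<subseteq> {0..M} \<and> B \<noteq> {} \<and> card (B + B) + 1 \<le> 2 * card B + 3}"
    have finX: "finite ?X" by (rule finite_subset[of _ "Pow {0..M}"]) auto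
    then show "finite T2" unfolding T2_def by (intro finite_imageI finite_cartesian_product)
    have "card ?X \<le> (card {0..M} + 1) ^ 10" by (rule card_all_small_doubling) simp
    also have "card {0..M} + 1 = nat M + 2" using M(1) by simp
    finally have X: "card ?X \<le> (nat M + 2) ^ 10" .
    have "card T2 \<le> card (?X \<times> ?X)" unfolding T2_def using finX by (intro card_image_le finite_cartesian_product)
    also have "\<dots> = card ?X * card ?X" by (rule card_cartesian_product)
    also have "\<dots> \<le> (nat M + 2) ^ 10 * (nat M + 2) ^ 10" using X by (intro mult_mono) auto
    also have "\<dots> = (nat M + 2) ^ 20" by (simp flip: power_add)
    also have "\<dots> \<le> \<nu> ^ 20" using M(2) by (rule power_mono) simp
    finally show "real (card T2) \<le> real \<nu> ^ 20" by (simp only: of_nat_power[symmetric] of_nat_le_iff)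
  qed
  have cT3: "real (card T3) \<le> real \<nu> ^ (k div j + 3) * (?q ^ (k div 32) * real (N choose k))"
    unfolding T3_def
  proof (rule card_Union_le_mult)
    show "finite I3" using fp(1) by (simp add: I3_def)
    have "card I3 \<le> card (pairs M j ?c)" using fp(1) by (intro card_mono) (auto simp: I3_def)
    then show "real (card I3) \<le> real \<nu> ^ (k div j + 3)" using P by linarith
    show "0 \<le> ?q ^ (k div 32) * real (N choose k)" using q by simp
    fix z assume z: "z \<in> I3"
    have "card {A. A \<subseteq> rset M (fst z) (snd z) \<and> card A = k} = card (rset M (fst z) (snd z)) choose k"
      by (rule n_subsets[OF finite_rset])
    also have "\<dots> \<le> (N - k div 32) choose k" using z by (intro binomial_right_mono) (simp add: I3_def)
    finally have "real (card {A. A \<subseteq> rset M (fst z) (snd z) \<and> card A = k}) \<le> real ((N - k div 32) choose k)" by simp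
    also have "\<dots> \<le> ?q ^ (k div 32) * real (N choose k)"
      unfolding peq using N by (intro binomial_shift) auto
    finally show "real (card {A. A \<subseteq> rset M (fst z) (snd z) \<and> card A = k}) \<le> ?q ^ (k div 32) * real (N choose k)" .
  qed
  have cT4: "real (card T4) \<le> real \<nu> ^ (k div j + 7) * ((1 - p\<^sup>2) ^ ((?w + 1) div 2) * (real (N + 1) * real (N choose k)) * (1 / ?q))"
    unfolding T4_def
  proof (rule card_Union_le_mult[OF finI4 _ cI4])
    show "0 \<le> (1 - p\<^sup>2) ^ ((?w + 1) div 2) * (real (N + 1) * real (N choose k)) * (1 / ?q)" using q psq by simp
    fix x assume "x \<in> I4"
    then obtain d Cl c1 c2 g where x: "x = ((d, Cl), c1, c2, g)" "thick M j ?c d Cl" "card Cl = 3" "c1 \<in> Cl" "c2 \<in> Cl"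
      "int ?w \<le> g" "g \<le> 2 * (M div d) - 2 - int ?w" by (auto simp: I4_def ok_def pairs_def)
    have th: "0 < d" "d dvd M" "Cl \<subseteq> {0..<d}" using x(2) by (auto simp: thick_def)
    define h where "h = nat (M div d)"
    have hM: "int h = M div d" using M th by (simp add: h_def pos_imp_zdiv_nonneg_iff)
    have Mdh: "M = d * int h" using hM th by simp
    let ?V = "rset M d Cl" and ?P = "\<lambda>S. c1 + c2 + d * g \<notin> S + S"
    have "f4 x = {A. A \<subseteq> ?V \<and> card A = k \<and> ?P A}" by (simp add: f4_def x(1))
    then have "real (card (f4 x)) \<le> wsum p ?q ?V ?P * (real (N + 1) * real (N choose k)) * (1 / ?q) ^ (card ?V - N)"
      using card_le_wsum[OF finite_rset p01 p, of M d Cl ?P] by simp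
    also have "\<dots> \<le> (1 - p\<^sup>2) ^ ((?w + 1) div 2) * (real (N + 1) * real (N choose k)) * (1 / ?q) ^ 1"
    proof (intro mult_mono)
      show "wsum p ?q ?V ?P \<le> (1 - p\<^sup>2) ^ ((?w + 1) div 2)"
      proof (rule wsum_missing_class)
        show "finite ?V" by (rule finite_rset)
        fix y assume y: "0 \<le> y" "y < int h"
        have "d * (y + 1) \<le> d * int h" using y th by (intro mult_left_mono) auto
        then have up: "d * y + d \<le> M" using Mdh by (simp add: algebra_simps)
        have "0 \<le> d * y" using y th by simp
        moreover have "0 \<le> c1" "c1 < d" "0 \<le> c2" "c2 < d" using x th by auto
        ultimately show "c1 + d * y \<in> ?V \<and> c2 + d * y \<in> ?V" using up x(4,5) by (simp add: rset_def)
      qed (use x th p01 hM in auto)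
      have "3 * h \<le> h + ?c" using x(2,3) by (simp add: thick_def h_def)
      moreover have "card ?V \<le> 3 * h + 1" using card_rset[OF x(2) M(1)] unfolding x(3) h_def .
      ultimately have "card ?V - N \<le> 1" using N(1,2) by (intro few_arith')
      then show "(1 / ?q) ^ (card ?V - N) \<le> (1 / ?q) ^ 1" using q by (intro power_increasing) auto
    qed (use q psq in auto)
    finally show "real (card (f4 x)) \<le> (1 - p\<^sup>2) ^ ((?w + 1) div 2) * (real (N + 1) * real (N choose k)) * (1 / ?q)"
      by simp
  qed
  have "card (few k N j M) \<le> card (W \<union> T2 \<union> T3 \<union> T4)"
  proof (rule card_mono[OF _ sub])
    have "finite T3" unfolding T3_def using fp(1) by (intro finite_UN_I) (auto simp: I3_def finite_rset)
    moreover have "finite T4" unfolding T4_def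
    proof (rule finite_UN_I[OF finI4])
      fix x assume "x \<in> I4"
      then show "finite (f4 x)"
        by (cases x) (auto simp: f4_def finite_rset intro: finite_subset[of _ "Pow (rset M (fst (fst x)) (snd (fst x)))"])
    qed
    ultimately show "finite (W \<union> T2 \<union> T3 \<union> T4)" using finW finT2 by simp
  qed
  also have "\<dots> \<le> card W + card T2 + card T3 + card T4"
    using card_Un_le[of "W \<union> T2 \<union> T3" T4] card_Un_le[of "W \<union> T2" T3] card_Un_le[of W T2] by linarith
  finally have "real (card (few k N j M)) \<le> real (card W) + real (card T2) + real (card T3) + real (card T4)"
    by linarith
  then show ?thesis using cW cT2 cT3 cT4 by linarith
qed

section \<open>Lengths close to the minimum\<close>

definition reflect :: "int \<Rightarrow> int set \<Rightarrow> int set" where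
  "reflect M S = (\<lambda>x. M - x) ` S"

lemma mem_reflect: "x \<in> reflect M S \<longleftrightarrow> M - x \<in> S"
  unfolding reflect_def by (auto simp: image_iff) (metis diff_diff_eq2 add_diff_cancel_left')

lemma reflect_reflect [simp]: "reflect M (reflect M S) = S"
  by (rule set_eqI) (simp add: mem_reflect)

lemma card_reflect: "card (reflect M S) = card S"
  unfolding reflect_def by (rule card_image) (simp add: inj_on_def)

lemma reflect_interval: "reflect M {a..b} = {M - b..M - a}"
  by (rule set_eqI) (auto simp: mem_reflect)

lemma reflect_Int: "reflect M (S \<inter> T) = reflect M S \<inter> reflect M T"
  by (rule set_eqI) (simp add: mem_reflect)

lemma reflect_sumset: "x \<in> reflect M A + reflect M A \<longleftrightarrow> 2 * M - x \<in> A + A"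
proof
  assume "x \<in> reflect M A + reflect M A"
  then obtain a b where "a \<in> reflect M A" "b \<in> reflect M A" "x = a + b" by (rule set_plus_elim)
  then have "(M - a) + (M - b) \<in> A + A" by (intro set_plus_intro) (simp_all add: mem_reflect)
  moreover have "(M - a) + (M - b) = 2 * M - x" using \<open>x = a + b\<close> by simp
  ultimately show "2 * M - x \<in> A + A" by simp
next
  assume "2 * M - x \<in> A + A"
  then obtain a b where ab: "a \<in> A" "b \<in> A" "2 * M - x = a + b" by (rule set_plus_elim)
  have "(M - a) + (M - b) \<in> reflect M A + reflect M A"
    using ab by (intro set_plus_intro) (simp_all add: mem_reflect)
  moreover have "(M - a) + (M - b) = x" using ab(3) by simp
  ultimately show "x \<in> reflect M A + reflect M A" by simp
qed

lemma wsum_reflect: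
  "wsum p g (reflect M V) (\<lambda>S. P (reflect M S)) = wsum p g V P"
proof -
  have "wsum p g (reflect M V) (\<lambda>S. P (reflect M S)) = wsum p g V (\<lambda>S. P (reflect M ((\<lambda>x. M - x) ` S)))"
    unfolding reflect_def[of M V] by (rule wsum_image) (simp add: inj_on_def)
  also have "\<dots> = wsum p g V P" by (simp add: reflect_def[symmetric])
  finally show ?thesis .
qed

text \<open>As \<open>A\<close> has no negative elements, a sum up to \<open>r\<close> uses only
  summands up to \<open>r\<close>.\<close>

lemma missing_restrict:
  assumes "A \<subseteq> {0..M}" "r \<le> M"
  shows "missing (A \<inter> {0..r}) r = missing A M \<inter> {0..r}"
proof (rule set_eqI)
  fix x
  have "x \<in> A \<inter> {0..r} + A \<inter> {0..r} \<longleftrightarrow> x \<in> A + A" if x: "x \<in> {0..r}"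
  proof
    assume "x \<in> A \<inter> {0..r} + A \<inter> {0..r}"
    moreover have "A \<inter> {0..r} + A \<inter> {0..r} \<subseteq> A + A" by (intro set_plus_mono2) auto
    ultimately show "x \<in> A + A" by blast
  next
    assume "x \<in> A + A"
    then obtain a b where ab: "a \<in> A" "b \<in> A" "x = a + b" by (rule set_plus_elim)
    have "a \<in> {0..M}" "b \<in> {0..M}" using ab assms by blast+
    then have "a \<in> A \<inter> {0..r}" "b \<in> A \<inter> {0..r}" using ab x by auto
    then show "x \<in> A \<inter> {0..r} + A \<inter> {0..r}" unfolding ab(3) by (rule set_plus_intro)
  qed
  then show "x \<in> missing (A \<inter> {0..r}) r \<longleftrightarrow> x \<in> missing A M \<inter> {0..r}"
    using assms(2) by (auto simp: missing_def)
qed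

text \<open>Reflection turns sums missing near 2 M into sums missing near 0, so one estimate serves
  both ends.\<close>

lemma config_missing:
  assumes "config k N M A" and M: "M > 0"
  shows "missing A M = low M A" "reflect M (missing (reflect M A) M) = high M A"
    "missing A M \<inter> A = {}" "card (missing (reflect M A) M) = card (high M A)"
    "config k N M (reflect M A)"
proof -
  have A: "A \<subseteq> {0..M}" "0 \<in> A" "M \<in> A" "card A = k" "card (A + A) \<le> 2 * N" using assms by (auto simp: config_def)
  have "0 + M \<in> A + A" by (rule set_plus_intro[OF A(2,3)])
  moreover have "M + M \<in> A + A" by (rule set_plus_intro[OF A(3,3)])
  ultimately have s: "M \<in> A + A" "2 * M \<in> A + A" by simp_all
  have lowM: "missing B M = low M B" if "M \<in> B + B" for B
  proof (rule set_eqI)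
    fix x
    have "x \<in> {0..M} \<longleftrightarrow> x \<in> {0..<M} \<or> x = M" using M by auto
    then show "x \<in> missing B M \<longleftrightarrow> x \<in> low M B"
      unfolding missing_def low_def mem_Collect_eq using that by blast
  qed
  show "missing A M = low M A" by (rule lowM[OF s(1)])
  show eq: "reflect M (missing (reflect M A) M) = high M A"
  proof (rule set_eqI)
    fix x
    have e: "2 * M - (M - x) = x + M" by simp
    have 1: "x = M \<longrightarrow> x + M \<in> A + A" using set_plus_intro[OF A(3,3)] by blast
    have 2: "M - x \<in> {0..M} \<longleftrightarrow> x \<in> {0..<M} \<or> x = M" using M by auto
    show "x \<in> reflect M (missing (reflect M A) M) \<longleftrightarrow> x \<in> high M A"
      unfolding mem_reflect missing_def high_def mem_Collect_eq reflect_sumset e 2 using 1 by blast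
  qed
  show "card (missing (reflect M A) M) = card (high M A)" unfolding eq[symmetric] by (simp add: card_reflect)
  show "missing A M \<inter> A = {}" using A(2) zero_mem_sum[of A] by (auto simp: missing_def)
  have "reflect M A \<subseteq> {0..M}" using A(1) unfolding reflect_def by auto
  moreover have "0 \<in> reflect M A" "M \<in> reflect M A" using A by (simp_all add: mem_reflect)
  moreover have "reflect M A + reflect M A = reflect (2 * M) (A + A)"
    by (rule set_eqI) (simp add: reflect_sumset mem_reflect)
  ultimately show "config k N M (reflect M A)" using A by (simp add: config_def card_reflect)
qed

text \<open>With \<open>nat M + 1 = N + s\<close> this says that at least 2 s - 1 of the sums 0,
  ..., 2 M are missing.\<close>

lemma config_missing_count:
  assumes "config k N M A" "M > 0"
  shows "2 * nat M + 1 \<le> card (missing A M) + card (missing (reflect M A) M) + 2 * N"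
  using sumset_counts(2)[OF assms] config_missing(1,4)[OF assms] assms(1) by (simp add: config_def)

text \<open>A sum missing far from the end is exponentially rare, so a union bound suffices; it is
  applied with \<open>R\<close> proportional to \<open>M\<close>.\<close>

lemma card_config_tail:
  assumes M: "M > 0" "nat M + 1 = N + s" and p: "0 < p" "p < 1" "real k = p * real N"
  shows "real (card {A. config k N M A \<and> (\<exists>x\<in>missing A M. int R < x)})
    \<le> real (nat M) * ((1 - p\<^sup>2) ^ ((R + 1) div 2) * (real (N + 1) * real (N choose k)) * (1 / (1 - p)) ^ s)"
proof -
  let ?q = "1 - p"
  have psq: "0 \<le> 1 - p\<^sup>2" "1 - p\<^sup>2 \<le> 1" using p by (simp_all add: power_le_one)
  have V: "card {0..M} = N + s" using M by simp
  let ?f = "\<lambda>x. {A. A \<subseteq> {0..M} \<and> card A = k \<and> int x \<notin> A + A}"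
  let ?I = "{x. R < x \<and> x \<le> nat M}"
  have "{A. config k N M A \<and> (\<exists>x\<in>missing A M. int R < x)} \<subseteq> (\<Union>x\<in>?I. ?f x)"
  proof
    fix A assume "A \<in> {A. config k N M A \<and> (\<exists>x\<in>missing A M. int R < x)}"
    then obtain x where A: "config k N M A" and x: "x \<in> missing A M" "int R < x" by blast
    have "nat x \<in> ?I" "A \<in> ?f (nat x)" using A x by (auto simp: config_def missing_def)
    then show "A \<in> (\<Union>x\<in>?I. ?f x)" by blast
  qed
  moreover have fin: "finite (\<Union>x\<in>?I. ?f x)" by (rule finite_subset[of _ "Pow {0..M}"]) auto
  ultimately have "card {A. config k N M A \<and> (\<exists>x\<in>missing A M. int R < x)} \<le> card (\<Union>x\<in>?I. ?f x)"
    by (intro card_mono)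
  also have "\<dots> \<le> (\<Sum>x\<in>?I. card (?f x))" by (intro card_UN_le) auto
  finally have "real (card {A. config k N M A \<and> (\<exists>x\<in>missing A M. int R < x)}) \<le> (\<Sum>x\<in>?I. real (card (?f x)))"
    by (simp only: of_nat_le_iff flip: of_nat_sum)
  also have "\<dots> \<le> (\<Sum>x\<in>?I. (1 - p\<^sup>2) ^ ((R + 1) div 2) * (real (N + 1) * real (N choose k)) * (1 / ?q) ^ s)"
  proof (rule sum_mono)
    fix x assume x: "x \<in> ?I"
    have "real (card (?f x)) \<le> wsum p ?q {0..M} (\<lambda>A. int x \<notin> A + A) * (real (N + 1) * real (N choose k)) * (1 / ?q) ^ (card {0..M} - N)"
      using p by (intro card_le_wsum) auto
    also have "\<dots> = wsum p ?q {0..M} (\<lambda>A. int x \<notin> A + A) * (real (N + 1) * real (N choose k)) * (1 / ?q) ^ s"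
      unfolding V by simp
    also have "\<dots> \<le> (1 - p\<^sup>2) ^ ((R + 1) div 2) * (real (N + 1) * real (N choose k)) * (1 / ?q) ^ s"
    proof (intro mult_right_mono)
      have "wsum p ?q {0..M} (\<lambda>A. int x \<notin> A + A) \<le> (1 - p\<^sup>2) ^ ((x + 1) div 2)"
        using p x by (intro wsum_missing_one) auto
      also have "\<dots> \<le> (1 - p\<^sup>2) ^ ((R + 1) div 2)" using x psq by (intro power_decreasing div_le_mono) auto
      finally show "wsum p ?q {0..M} (\<lambda>A. int x \<notin> A + A) \<le> (1 - p\<^sup>2) ^ ((R + 1) div 2)" .
    qed (use p in auto)
    finally show "real (card (?f x)) \<le> (1 - p\<^sup>2) ^ ((R + 1) div 2) * (real (N + 1) * real (N choose k)) * (1 / ?q) ^ s" .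
  qed
  also have "\<dots> = real (card ?I) * ((1 - p\<^sup>2) ^ ((R + 1) div 2) * (real (N + 1) * real (N choose k)) * (1 / ?q) ^ s)"
    by simp
  also have "\<dots> \<le> real (nat M) * ((1 - p\<^sup>2) ^ ((R + 1) div 2) * (real (N + 1) * real (N choose k)) * (1 / ?q) ^ s)"
  proof (intro mult_right_mono)
    have "card ?I \<le> card {1..nat M}" by (intro card_mono) auto
    then show "real (card ?I) \<le> real (nat M)" by simp
  qed (use p psq in auto)
  finally show ?thesis .
qed

text \<open>The two conditions see only the two end pieces of R + 1 points, so they are independent.
  The middle, about half of the interval, is free; \<open>card_le_wsum_split\<close> therefore loses
  only the constant 3^c instead of N + 1.\<close>

lemma card_config_both:
  assumes M: "M > 0" "nat M + 1 = N + s" "1 \<le> s" "4 * s \<le> N" "8 \<le> N"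
    and p: "0 < p" "p < 1" "real k = p * real N" "1 / (1 - p) \<le> real c"
    and R: "R = M div 4"
    and b: "0 \<le> \<theta>" "0 \<le> K" "\<And>u. wsum p (1 - p) {0..R} (\<lambda>S. 0 \<in> S \<and> u \<le> card (missing S R)) \<le> K * \<theta> ^ u"
  shows "real (card {A. config k N M A \<and> u \<le> card (missing A M \<inter> {0..R}) \<and> v \<le> card (missing (reflect M A) M \<inter> {0..R})})
    \<le> K\<^sup>2 * \<theta> ^ (u + v) * (3 ^ c * real (N choose k)) * (1 / (1 - p)) ^ s"
proof -
  let ?q = "1 - p"
  define P where "P u S \<longleftrightarrow> 0 \<in> S \<and> u \<le> card (missing S R)" for u S
  let ?V2 = "{M - R..M}"
  let ?U = "{0..R} \<union> ?V2" and ?W = "{R + 1..M - R - 1}"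
  define Q where "Q T \<longleftrightarrow> P u (T \<inter> {0..R}) \<and> P v (reflect M (T \<inter> ?V2))" for T
  have R4: "0 \<le> R" "4 * R \<le> M" using R M(1) by auto
  have refl_V2: "reflect M ?V2 = {0..R}" "reflect M {0..R} = ?V2" by (simp_all add: reflect_interval)
  have disj: "{0..R} \<inter> ?V2 = {}" using R4 M(1) by auto
  have UW: "?U \<inter> ?W = {}" "?U \<union> ?W = {0..M}" using R4 M(1) by auto
  have cards: "card ?U + card ?W = N + s"
  proof -
    have "card ?U + card ?W = card (?U \<union> ?W)" using UW(1) by (intro card_Un_disjoint[symmetric]) auto
    then show ?thesis using UW(2) M by simp
  qed
  have cW: "int (card ?W) = M - 2 * R - 1" using R4 M(1) by simp
  have Mi: "M = int N + int s - 1" using M(1,2) by linarith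
  have R1: "M \<le> 4 * R + 3" using R by presburger
  have "{A. config k N M A \<and> u \<le> card (missing A M \<inter> {0..R}) \<and> v \<le> card (missing (reflect M A) M \<inter> {0..R})}
     \<subseteq> {A. A \<subseteq> ?U \<union> ?W \<and> card A = k \<and> Q (A \<inter> ?U)}"
  proof
    fix A assume "A \<in> {A. config k N M A \<and> u \<le> card (missing A M \<inter> {0..R}) \<and> v \<le> card (missing (reflect M A) M \<inter> {0..R})}"
    then have cf: "config k N M A" and uv: "u \<le> card (missing A M \<inter> {0..R})" "v \<le> card (missing (reflect M A) M \<inter> {0..R})" by auto
    have A: "A \<subseteq> {0..M}" "0 \<in> A" "card A = k" using cf by (auto simp: config_def)
    have A': "reflect M A \<subseteq> {0..M}" "0 \<in> reflect M A" using config_missing(5)[OF cf M(1)] by (auto simp: config_def)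
    have e1: "A \<inter> ?U \<inter> {0..R} = A \<inter> {0..R}" by auto
    have e2: "reflect M (A \<inter> ?U \<inter> ?V2) = reflect M A \<inter> {0..R}"
    proof -
      have "A \<inter> ?U \<inter> ?V2 = A \<inter> ?V2" by auto
      then show ?thesis by (simp only: reflect_Int refl_V2)
    qed
    have "P u (A \<inter> {0..R})"
      unfolding P_def using missing_restrict[OF A(1), of R] uv A(2) R4 by simp
    moreover have "P v (reflect M A \<inter> {0..R})"
      unfolding P_def using missing_restrict[OF A'(1), of R] uv A'(2) R4 by simp
    ultimately have "Q (A \<inter> ?U)" unfolding Q_def e1 e2 by simp
    then show "A \<in> {A. A \<subseteq> ?U \<union> ?W \<and> card A = k \<and> Q (A \<inter> ?U)}" using A UW(2) by simp
  qed
  moreover have "finite {A. A \<subseteq> ?U \<union> ?W \<and> card A = k \<and> Q (A \<inter> ?U)}"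
    by (rule finite_subset[of _ "Pow (?U \<union> ?W)"]) auto
  ultimately have "real (card {A. config k N M A \<and> u \<le> card (missing A M \<inter> {0..R}) \<and> v \<le> card (missing (reflect M A) M \<inter> {0..R})})
     \<le> real (card {A. A \<subseteq> ?U \<union> ?W \<and> card A = k \<and> Q (A \<inter> ?U)})"
    by (simp only: of_nat_le_iff card_mono)
  also have "\<dots> \<le> wsum p ?q ?U Q * ((real (N + 1) / real (card ?W + 1)) ^ c * real (N choose k)) * (1 / ?q) ^ (card ?U + card ?W - N)"
  proof (rule card_le_wsum_split)
    have "int (card ?W) \<le> int N" using cW R1 Mi M(4,5) by linarith
    then show "card ?W \<le> N" by (simp only: of_nat_le_iff)
    show "N \<le> card ?U + card ?W" using cards by simp
  qed (use UW(1) p in auto)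
  also have "\<dots> = wsum p ?q ?U Q * ((real (N + 1) / real (card ?W + 1)) ^ c * real (N choose k)) * (1 / ?q) ^ s"
    unfolding cards by simp
  also have "\<dots> \<le> (K\<^sup>2 * \<theta> ^ (u + v)) * (3 ^ c * real (N choose k)) * (1 / ?q) ^ s"
  proof (intro mult_mono)
    have "wsum p ?q ?U Q = wsum p ?q {0..R} (P u) * wsum p ?q ?V2 (\<lambda>S. P v (reflect M S))"
      unfolding Q_def using disj by (intro wsum_union) auto
    also have "wsum p ?q ?V2 (\<lambda>S. P v (reflect M S)) = wsum p ?q {0..R} (P v)"
      unfolding refl_V2(2)[symmetric] by (rule wsum_reflect)
    also have "wsum p ?q {0..R} (P u) * wsum p ?q {0..R} (P v) \<le> (K * \<theta> ^ u) * (K * \<theta> ^ v)"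
      using b p unfolding P_def by (intro mult_mono wsum_nonneg mult_nonneg_nonneg) auto
    also have "\<dots> = K\<^sup>2 * \<theta> ^ (u + v)" by (simp add: power2_eq_square power_add)
    finally show "wsum p ?q ?U Q \<le> K\<^sup>2 * \<theta> ^ (u + v)" .
    have "int (N + 1) \<le> 3 * int (card ?W + 1)" using cW R4 Mi M(3,5) by simp
    then have "N + 1 \<le> 3 * (card ?W + 1)" by linarith
    then have "real (N + 1) \<le> 3 * real (card ?W + 1)" by linarith
    then have "real (N + 1) / real (card ?W + 1) \<le> 3" by (simp add: pos_divide_le_eq)
    then show "(real (N + 1) / real (card ?W + 1)) ^ c \<le> 3 ^ c" by (intro power_mono) auto
  qed (use b p in \<open>auto intro!: mult_nonneg_nonneg wsum_nonneg\<close>)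
  finally show ?thesis .
qed

text \<open>If all missing sums are near the ends, the 2 s - 1 of them are shared out as u and 2 s -
  1 - u, which gives the factor 2 s. Otherwise \<open>card_config_tail\<close> applies at one of the
  ends.\<close>

lemma card_config_short:
  assumes M: "M > 0" "nat M + 1 = N + s" "1 \<le> s" "4 * s \<le> N" "8 \<le> N"
    and p: "0 < p" "p < 1" "real k = p * real N" "1 / (1 - p) \<le> real c"
    and b: "0 \<le> \<theta>" "0 \<le> K" "\<And>u R. wsum p (1 - p) {0..R} (\<lambda>S. 0 \<in> S \<and> u \<le> card (missing S R)) \<le> K * \<theta> ^ u"
  shows "real (card {A. config k N M A}) \<le>
     2 * real s * (K\<^sup>2 * \<theta> ^ (2 * s - 1) * (3 ^ c * real (N choose k)) * (1 / (1 - p)) ^ s)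
     + 2 * (real (nat M) * ((1 - p\<^sup>2) ^ ((nat M div 4 + 1) div 2) * (real (N + 1) * real (N choose k)) * (1 / (1 - p)) ^ s))"
proof -
  define R where "R = M div 4"
  have Rn: "R = int (nat M div 4)" using M(1) by (simp add: R_def zdiv_int)
  define T where "T = {A. config k N M A \<and> (\<exists>x\<in>missing A M. R < x)}"
  define T' where "T' = {A. config k N M A \<and> (\<exists>x\<in>missing (reflect M A) M. R < x)}"
  define B where "B u = {A. config k N M A \<and> u \<le> card (missing A M \<inter> {0..R}) \<and> 2 * s - 1 - u \<le> card (missing (reflect M A) M \<inter> {0..R})}" for u
  have finc: "finite {A. config k N M A}" by (rule finite_subset[of _ "Pow {0..M}"]) (auto simp: config_def)
  have finT: "finite T" "finite T'" "finite (B u)" for u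
    unfolding T_def T'_def B_def by (rule finite_subset[OF _ finc], blast)+
  have "{A. config k N M A} \<subseteq> T \<union> T' \<union> (\<Union>u\<in>{..<2 * s}. B u)"
  proof
    fix A assume "A \<in> {A. config k N M A}"
    then have cf: "config k N M A" by simp
    show "A \<in> T \<union> T' \<union> (\<Union>u\<in>{..<2 * s}. B u)"
    proof (cases "A \<in> T \<union> T'")
      case False
      then have "missing A M \<subseteq> {0..R}" "missing (reflect M A) M \<subseteq> {0..R}"
        using cf by (auto simp: T_def T'_def missing_def)
      then have e: "missing A M \<inter> {0..R} = missing A M" "missing (reflect M A) M \<inter> {0..R} = missing (reflect M A) M" by auto
      have tot: "2 * s - 1 \<le> card (missing A M) + card (missing (reflect M A) M)"
        using config_missing_count[OF cf M(1)] M(2) by linarith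
      \<comment> \<open>The cap at 2 s - 1 keeps the number of cases at 2 s, however many sums are
        missing.\<close>
      define u where "u = min (card (missing A M)) (2 * s - 1)"
      have "u < 2 * s" using M(3) by (simp add: u_def)
      moreover have "A \<in> B u" unfolding B_def mem_Collect_eq e using cf tot by (simp add: u_def)
      ultimately show ?thesis by blast
    qed simp
  qed
  then have "card {A. config k N M A} \<le> card (T \<union> T' \<union> (\<Union>u\<in>{..<2 * s}. B u))"
    using finT by (intro card_mono) auto
  also have "\<dots> \<le> card T + card T' + card (\<Union>u\<in>{..<2 * s}. B u)"
    using card_Un_le[of "T \<union> T'" "\<Union>u\<in>{..<2 * s}. B u"] card_Un_le[of T T'] by linarith
  also have "card (\<Union>u\<in>{..<2 * s}. B u) \<le> (\<Sum>u<2 * s. card (B u))" by (rule card_UN_le) simp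
  also have "card T' \<le> card T"
  proof (rule card_inj_on_le[of "reflect M"])
    show "inj_on (reflect M) T'" by (metis inj_onI reflect_reflect)
    show "reflect M ` T' \<subseteq> T" using config_missing(5)[OF _ M(1)] by (auto simp: T_def T'_def)
  qed (rule finT)
  finally have "real (card {A. config k N M A}) \<le> 2 * real (card T) + (\<Sum>u<2 * s. real (card (B u)))"
    by (simp flip: of_nat_sum)
  also have "real (card T) \<le> real (nat M) * ((1 - p\<^sup>2) ^ ((nat M div 4 + 1) div 2) * (real (N + 1) * real (N choose k)) * (1 / (1 - p)) ^ s)"
    unfolding T_def Rn by (rule card_config_tail[OF M(1,2) p(1-3)])
  also have "(\<Sum>u<2 * s. real (card (B u))) \<le> (\<Sum>u<2 * s. K\<^sup>2 * \<theta> ^ (2 * s - 1) * (3 ^ c * real (N choose k)) * (1 / (1 - p)) ^ s)"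
  proof (rule sum_mono)
    fix u assume "u \<in> {..<2 * s}"
    then have u: "u + (2 * s - 1 - u) = 2 * s - 1" by simp
    show "real (card (B u)) \<le> K\<^sup>2 * \<theta> ^ (2 * s - 1) * (3 ^ c * real (N choose k)) * (1 / (1 - p)) ^ s"
      using card_config_both[OF M p R_def b(1,2), of u "2 * s - 1 - u"] b(3) unfolding B_def u by blast
  qed
  also have "\<dots> = 2 * real s * (K\<^sup>2 * \<theta> ^ (2 * s - 1) * (3 ^ c * real (N choose k)) * (1 / (1 - p)) ^ s)" by simp
  finally show ?thesis by (simp add: algebra_simps)
qed

section \<open>Large lengths\<close>

text \<open>\<open>L\<close> and \<open>H\<close> count the low and high missing sums,
  \<open>Ll\<close> and \<open>Hl\<close> those at positions up to \<open>l\<close>,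
  \<open>LH\<close> the positions missing in both ways. \<open>G\<close> counts the high ones beyond
  \<open>l\<close>, \<open>D\<close> bounds a sparse rest, \<open>u\<close> and \<open>v\<close>
  count the holes of the two end intervals.\<close>

lemma long_arith:
  fixes m L H N Ll Hl u LH D G v j s :: nat
  assumes "2 * m + 1 \<le> L + H + 2 * N" "Ll + Hl \<le> u + LH" "L \<le> Ll + D" "H \<le> Hl + G" "G \<le> v + D" "LH < j" "m + 1 = N + s"
  shows "2 * s - (1 + j + 2 * D) \<le> u + v"
  using assms by linarith

text \<open>When s is comparable with N, the bound for a missing sum beyond M / 4 may no longer beat
  (1 / q)^s, so the end intervals have to adapt to the set. Cut the low missing sums at
  \<open>l\<close>, then the remaining high ones at a reflected \<open>l'\<close>; the intervals
  {0..l} and {M - l'..M} are disjoint. A hole up to \<open>l\<close> may stand for a low and a high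
  sum at once, but fewer than \<open>j\<close> do. Polynomial losses are acceptable here.\<close>

lemma card_config_long:
  assumes M: "M > 0" "nat M + 1 = N + s" and E: "1 \<le> E"
    and p: "0 < p" "p < 1" "real k = p * real N" "1 - p \<le> 1 / 3"
    and g: "g = sqrt (1 - p) * (103 / 100)" and th: "\<theta> = sqrt (1 - p) * (100 / 103)"
  shows "real (card {A. config k N M A \<and> card (low M A \<inter> high M A) < j})
    \<le> (real ((nat M + 2) * E))\<^sup>2 * (\<theta> ^ (2 * s - (1 + j + 2 * (nat M div E + 1))) * ((2 / g) ^ E)\<^sup>2
        * (real (N + 1) * real (N choose k)) * (1 / (1 - p)) ^ s)"
proof -
  let ?q = "1 - p" and ?m = "nat M"
  have q: "0 < ?q" using p by simp
  note gb = g_bound[OF q p(4) g]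
  have "\<theta> = ?q / g" unfolding th by (rule gb(5)[symmetric])
  then have gth: "g * \<theta> = ?q" using gb(4) by (simp only:)
  have g1: "1 \<le> 2 / g"
  proof -
    have "g * 1 \<le> g * (1 + (1 - ?q))" using gb(1) p by (intro mult_left_mono) auto
    then have "g \<le> 1" using gb(2) by linarith
    then show ?thesis using gb(1) by (simp add: field_simps)
  qed
  have th01: "0 \<le> \<theta>" "\<theta> \<le> 1"
  proof -
    have "sqrt ?q \<le> 1" using p by simp
    then show "\<theta> \<le> 1" unfolding th by linarith
    show "0 \<le> \<theta>" using q by (simp add: th)
  qed
  define Z where "Z = 2 * s - (1 + j + 2 * (?m div E + 1))"
  define I where "I = {(l, e). -1 \<le> l \<and> l \<le> M \<and> e \<in> {1..E} \<and> (0 \<le> l \<longrightarrow> int e \<le> l)}"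
  define V where "V l l' = {0..l} \<union> {M - l'..M}" for l l' :: int
  define Q where "Q l e l' e' T \<longleftrightarrow> lowpair l e (T \<inter> {0..l}) \<and> lowpair l' e' (reflect M (T \<inter> {M - l'..M}))" for l e l' e' T
  define f where "f = (\<lambda>((l, e), (l', e')). {A. A \<subseteq> {0..M} \<and> card A = k \<and>
     (Q l e l' e' (A \<inter> V l l') \<and> Z \<le> card (V l l' - A \<inter> V l l'))})"
  define J where "J = {((l, e), (l', e')). (l, e) \<in> I \<and> (l', e') \<in> I \<and> l + l' < M}"
  have Isub: "I \<subseteq> {-1..M} \<times> {1..E}" by (auto simp: I_def)
  have Jsub: "J \<subseteq> ({-1..M} \<times> {1..E}) \<times> ({-1..M} \<times> {1..E})" using Isub by (auto simp: J_def)
  have finJ: "finite J" by (rule finite_subset[OF Jsub]) simp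
  have cJ: "real (card J) \<le> (real ((?m + 2) * E))\<^sup>2"
  proof -
    have "card J \<le> card (({-1..M} \<times> {1..E}) \<times> ({-1..M} \<times> {1..E}))" by (intro card_mono Jsub) simp
    also have "\<dots> = ((?m + 2) * E)\<^sup>2"
    proof -
      have c: "card {-1..M} = ?m + 2" using M(1) by (simp add: nat_add_distrib)
      show ?thesis unfolding card_cartesian_product c by (simp add: power2_eq_square)
    qed
    finally show ?thesis by (simp only: of_nat_power[symmetric] of_nat_le_iff)
  qed
  have sub: "{A. config k N M A \<and> card (low M A \<inter> high M A) < j} \<subseteq> (\<Union>z\<in>J. f z)"
  proof
    fix A assume "A \<in> {A. config k N M A \<and> card (low M A \<inter> high M A) < j}"
    then have cf: "config k N M A" and cj: "card (low M A \<inter> high M A) < j" by auto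
    note cm = config_missing[OF cf M(1)]
    have A: "A \<subseteq> {0..M}" "card A = k" using cf by (auto simp: config_def)
    have finA: "finite A" by (rule config_facts(1)[OF cf M(1)])
    let ?L = "low M A" and ?H = "high M A" and ?L' = "missing (reflect M A) M"
    have finL: "finite ?L" "finite ?H" "finite ?L'"
      by (auto simp: low_def high_def missing_def intro: finite_subset[of _ "{0..M}"])
    have Mm: "int ?m = M" using M(1) by simp
    have "?L \<subseteq> {0..int ?m}" using Mm by (auto simp: low_def)
    then obtain l e where l: "-1 \<le> l" "l \<le> M" "e \<in> {1..E}" "0 \<le> l \<longrightarrow> l \<in> ?L \<and> l - int e \<in> ?L"
      "card {x \<in> ?L. l < x} \<le> ?m div E + 1"
      using sparse_tail[of ?L ?m E] E Mm by auto
    \<comment> \<open>Only high sums beyond \<open>l\<close>: this keeps the two intervals disjoint,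
      and those up to \<open>l\<close> are already holes of the first interval.\<close>
    let ?G = "{y \<in> ?L'. y < M - l}"
    have "?G \<subseteq> {0..int ?m}" using Mm by (auto simp: missing_def)
    then obtain l' e' where l': "-1 \<le> l'" "l' \<le> M" "e' \<in> {1..E}" "0 \<le> l' \<longrightarrow> l' \<in> ?G \<and> l' - int e' \<in> ?G"
      "card {x \<in> ?G. l' < x} \<le> ?m div E + 1"
      using sparse_tail[of ?G ?m E] E Mm by auto
    have lI: "(l, e) \<in> I" using l by (auto simp: I_def low_def)
    have lI': "(l', e') \<in> I" using l' by (auto simp: I_def missing_def)
    have ll: "l + l' < M"
    proof (cases "0 \<le> l'")
      case True
      then show ?thesis using l'(4) by auto
    qed (use l in linarith)
    have inJ: "((l, e), (l', e')) \<in> J" using lI lI' ll by (simp add: J_def)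
    have disj: "{0..l} \<inter> {M - l'..M} = {}" using ll by auto
    have "lowpair l e A" using l(4) by (auto simp: lowpair_def low_def)
    then have "lowpair l e (A \<inter> V l l' \<inter> {0..l})" by (rule lowpair_subset[rotated]) auto
    moreover have "lowpair l' e' (reflect M A)" using l'(4) by (auto simp: lowpair_def missing_def)
    then have "lowpair l' e' (reflect M (A \<inter> V l l' \<inter> {M - l'..M}))"
      by (rule lowpair_subset[rotated]) (auto simp: mem_reflect)
    ultimately have Qok: "Q l e l' e' (A \<inter> V l l')" by (simp add: Q_def)
    have holes: "?L \<inter> A = {}" "?H \<inter> A = {}"
    proof -
      show "?L \<inter> A = {}" using cm(1,3) by simp
      have "missing (reflect M A) M \<inter> reflect M A = {}" by (rule config_missing(3)[OF cm(5) M(1)])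
      then have "reflect M (missing (reflect M A) M \<inter> reflect M A) = {}" by (simp add: reflect_def)
      then show "?H \<inter> A = {}" by (simp add: reflect_Int cm(2))
    qed
    have LH0: "(?L \<union> ?H) \<inter> {0..l} \<subseteq> {0..l} - A" using holes by auto
    have GH: "reflect M {y \<in> ?G. y \<le> l'} \<subseteq> {M - l'..M} - A"
    proof
      fix x assume "x \<in> reflect M {y \<in> ?G. y \<le> l'}"
      then have x: "M - x \<in> ?L'" "M - x \<le> l'" by (auto simp: mem_reflect)
      then have "x \<in> ?H" using cm(2) mem_reflect by blast
      then show "x \<in> {M - l'..M} - A" using x(2) holes(2) by (auto simp: high_def)
    qed
    have VA: "V l l' - A \<inter> V l l' = ({0..l} - A) \<union> ({M - l'..M} - A)" by (auto simp: V_def)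
    have cV: "card (V l l' - A \<inter> V l l') = card ({0..l} - A) + card ({M - l'..M} - A)"
      unfolding VA using disj by (intro card_Un_disjoint) auto
    have h1: "card {x \<in> ?L. x \<le> l} + card {x \<in> ?H. x \<le> l} \<le> card ({0..l} - A) + card (?L \<inter> ?H)"
    proof -
      have "card {x \<in> ?L. x \<le> l} + card {x \<in> ?H. x \<le> l}
          = card ({x \<in> ?L. x \<le> l} \<union> {x \<in> ?H. x \<le> l}) + card ({x \<in> ?L. x \<le> l} \<inter> {x \<in> ?H. x \<le> l})"
        using finL by (intro card_Un_Int) auto
      moreover have "card ({x \<in> ?L. x \<le> l} \<union> {x \<in> ?H. x \<le> l}) \<le> card ({0..l} - A)"
        using LH0 by (intro card_mono) (auto simp: low_def high_def)
      moreover have "card ({x \<in> ?L. x \<le> l} \<inter> {x \<in> ?H. x \<le> l}) \<le> card (?L \<inter> ?H)"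
        using finL by (intro card_mono) auto
      ultimately show ?thesis by linarith
    qed
    have h2: "card ?L \<le> card {x \<in> ?L. x \<le> l} + (?m div E + 1)"
    proof -
      have "?L = {x \<in> ?L. x \<le> l} \<union> {x \<in> ?L. l < x}" by auto
      then have "card ?L \<le> card {x \<in> ?L. x \<le> l} + card {x \<in> ?L. l < x}" by (metis card_Un_le)
      then show ?thesis using l(5) by linarith
    qed
    have h3: "card ?H \<le> card {x \<in> ?H. x \<le> l} + card ?G"
    proof -
      have "?H \<subseteq> {x \<in> ?H. x \<le> l} \<union> reflect M ?G"
      proof
        fix x assume x: "x \<in> ?H"
        then have "M - x \<in> ?L'" using cm(2) mem_reflect by blast
        then show "x \<in> {x \<in> ?H. x \<le> l} \<union> reflect M ?G" using x by (auto simp: mem_reflect)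
      qed
      then have "card ?H \<le> card ({x \<in> ?H. x \<le> l} \<union> reflect M ?G)"
        using finL by (intro card_mono) (auto simp: reflect_def)
      also have "\<dots> \<le> card {x \<in> ?H. x \<le> l} + card (reflect M ?G)" by (rule card_Un_le)
      finally show ?thesis by (simp only: card_reflect)
    qed
    have h4: "card ?G \<le> card ({M - l'..M} - A) + (?m div E + 1)"
    proof -
      have "card ?G \<le> card ({y \<in> ?G. y \<le> l'} \<union> {y \<in> ?G. l' < y})"
        using finL by (intro card_mono) auto
      also have "\<dots> \<le> card {y \<in> ?G. y \<le> l'} + card {y \<in> ?G. l' < y}" by (rule card_Un_le)
      finally have "card ?G \<le> card {y \<in> ?G. y \<le> l'} + card {y \<in> ?G. l' < y}" .
      moreover have "card {y \<in> ?G. y \<le> l'} \<le> card ({M - l'..M} - A)"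
        using card_mono[OF _ GH] by (simp add: card_reflect)
      ultimately show ?thesis using l'(5) by linarith
    qed
    have "2 * ?m + 1 \<le> card ?L + card ?H + 2 * N"
      using config_missing_count[OF cf M(1)] cm(1,4) by simp
    then have "Z \<le> card (V l l' - A \<inter> V l l')"
      unfolding Z_def cV using h1 h2 h3 h4 cj M(2) by (rule long_arith)
    then have "A \<in> f ((l, e), (l', e'))" unfolding f_def using A Qok by simp
    then show "A \<in> (\<Union>z\<in>J. f z)" using inJ by blast
  qed
  have each: "real (card (f z)) \<le> \<theta> ^ Z * ((2 / g) ^ E)\<^sup>2 * (real (N + 1) * real (N choose k)) * (1 / ?q) ^ s"
    if z: "z \<in> J" for z
  proof -
    obtain l e l' e' where zz: "z = ((l, e), (l', e'))" "(l, e) \<in> I" "(l', e') \<in> I" "l + l' < M"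
      using z by (auto simp: J_def)
    have le: "1 \<le> e" "e \<le> E" "0 \<le> l \<Longrightarrow> int e \<le> l" "l \<le> M" "1 \<le> e'" "e' \<le> E" "0 \<le> l' \<Longrightarrow> int e' \<le> l'" "l' \<le> M"
      using zz by (auto simp: I_def)
    let ?P = "\<lambda>T. Q l e l' e' T \<and> Z \<le> card (V l l' - T)"
    have disj: "{0..l} \<inter> {M - l'..M} = {}" using zz(4) by auto
    have VM: "V l l' \<subseteq> {0..M}" using le(4,8) by (auto simp: V_def)
    have finV: "finite (V l l')" by (simp add: V_def)
    have cM: "card {0..M} = N + s" using M by simp
    have "f z = {A. A \<subseteq> {0..M} \<and> card A = k \<and> ?P (A \<inter> V l l')}" by (simp add: f_def zz(1))
    then have "real (card (f z)) \<le> wsum p ?q {0..M} (\<lambda>A. ?P (A \<inter> V l l')) * (real (N + 1) * real (N choose k)) * (1 / ?q) ^ (card {0..M} - N)"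
      using card_le_wsum[of "{0..M}" p k N "\<lambda>A. ?P (A \<inter> V l l')"] p by simp
    also have "\<dots> = wsum p ?q {0..M} (\<lambda>A. ?P (A \<inter> V l l')) * (real (N + 1) * real (N choose k)) * (1 / ?q) ^ s"
      unfolding cM by simp
    also have "wsum p ?q {0..M} (\<lambda>A. ?P (A \<inter> V l l')) = wsum p ?q (V l l') ?P"
      using wsum_restrict[OF _ VM, of p ?q ?P] by simp
    also have "wsum p ?q (V l l') ?P * (real (N + 1) * real (N choose k)) * (1 / ?q) ^ s
       \<le> \<theta> ^ Z * ((2 / g) ^ E)\<^sup>2 * (real (N + 1) * real (N choose k)) * (1 / ?q) ^ s"
    proof (intro mult_right_mono)
      have "wsum p ?q (V l l') ?P \<le> \<theta> ^ Z * wsum p g (V l l') (Q l e l' e')"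
        unfolding gth[symmetric] using finV p gb(1) th01 by (intro wsum_holes) auto
      also have "wsum p g (V l l') (Q l e l' e') = wsum p g {0..l} (lowpair l e) * wsum p g {M - l'..M} (\<lambda>S. lowpair l' e' (reflect M S))"
        unfolding V_def Q_def using disj by (intro wsum_union) auto
      also have "wsum p g {M - l'..M} (\<lambda>S. lowpair l' e' (reflect M S)) = wsum p g {0..l'} (lowpair l' e')"
      proof -
        have "{M - l'..M} = reflect M {0..l'}" by (simp add: reflect_interval)
        then show ?thesis by (simp only: wsum_reflect)
      qed
      also have "\<theta> ^ Z * (wsum p g {0..l} (lowpair l e) * wsum p g {0..l'} (lowpair l' e')) \<le> \<theta> ^ Z * ((2 / g) ^ E * (2 / g) ^ E)"
      proof (intro mult_left_mono mult_mono)
        have "wsum p g {0..l} (lowpair l e) \<le> (2 / g) ^ e"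
          using p gb le by (intro wsum_lowpair) auto
        also have "\<dots> \<le> (2 / g) ^ E" using g1 le by (intro power_increasing) auto
        finally show "wsum p g {0..l} (lowpair l e) \<le> (2 / g) ^ E" .
        have "wsum p g {0..l'} (lowpair l' e') \<le> (2 / g) ^ e'"
          using p gb le by (intro wsum_lowpair) auto
        also have "\<dots> \<le> (2 / g) ^ E" using g1 le by (intro power_increasing) auto
        finally show "wsum p g {0..l'} (lowpair l' e') \<le> (2 / g) ^ E" .
      qed (use th01 p gb(1) in \<open>auto intro: wsum_nonneg\<close>)
      finally show "wsum p ?q (V l l') ?P \<le> \<theta> ^ Z * ((2 / g) ^ E)\<^sup>2" by (simp add: power2_eq_square)
    qed (use q in auto)
    finally show ?thesis .
  qed
  have fin: "finite (\<Union>z\<in>J. f z)"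
    by (rule finite_subset[of _ "Pow {0..M}"]) (auto simp: f_def)
  have "card {A. config k N M A \<and> card (low M A \<inter> high M A) < j} \<le> card (\<Union>z\<in>J. f z)"
    using fin sub by (rule card_mono)
  also have "\<dots> \<le> (\<Sum>z\<in>J. card (f z))" using finJ by (rule card_UN_le)
  finally have "real (card {A. config k N M A \<and> card (low M A \<inter> high M A) < j}) \<le> (\<Sum>z\<in>J. real (card (f z)))"
    by (simp only: of_nat_le_iff flip: of_nat_sum)
  also have "\<dots> \<le> (\<Sum>z\<in>J. \<theta> ^ Z * ((2 / g) ^ E)\<^sup>2 * (real (N + 1) * real (N choose k)) * (1 / ?q) ^ s)"
    using each by (rule sum_mono)
  also have "\<dots> = real (card J) * (\<theta> ^ Z * ((2 / g) ^ E)\<^sup>2 * (real (N + 1) * real (N choose k)) * (1 / ?q) ^ s)" by simp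
  also have "\<dots> \<le> (real ((?m + 2) * E))\<^sup>2 * (\<theta> ^ Z * ((2 / g) ^ E)\<^sup>2 * (real (N + 1) * real (N choose k)) * (1 / ?q) ^ s)"
    using cJ th01 q gb(1) by (intro mult_right_mono) auto
  finally show ?thesis unfolding Z_def .
qed

section \<open>Summation over all lengths\<close>

lemma choose_lower:
  assumes "k < N" "2 * N \<le> 3 * k"
  shows "3 ^ (N - k) \<le> real (N choose k)"
proof -
  let ?m = "N - k"
  have m: "?m \<le> N" "0 < ?m" "3 * ?m \<le> N" using assms by linarith+
  have "3 ^ ?m \<le> (real N / real ?m) ^ ?m"
  proof (rule power_mono)
    have "3 * real ?m \<le> real N" using m(3) by linarith
    then show "3 \<le> real N / real ?m" using m(2) by (subst pos_le_divide_eq) auto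
  qed simp
  also have "\<dots> \<le> real (N choose ?m)" using m(1) by (rule binomial_ge_n_over_k_pow_k)
  also have "N choose ?m = N choose k" using assms binomial_symmetric[of k N] by simp
  finally show ?thesis .
qed

lemma ratio_facts:
  fixes lam :: real
  assumes "0 < \<gamma>" "2 + \<gamma> \<le> lam" "lam \<le> 3" "real N = lam * real k / 2" "0 < k" and p: "p = 2 / lam"
  shows "0 < p" "p < 1" "real k = p * real N" "1 - p \<le> 1 / 3" "\<gamma> / 3 \<le> 1 - p" "k < N" "2 * N \<le> 3 * k"
    "\<gamma> / 2 * real k \<le> real (N - k)"
proof -
  have l: "0 < lam" "2 < lam" using assms by linarith+
  show "0 < p" "p < 1" using l by (simp_all add: p)
  show "real k = p * real N" using l by (simp add: p assms(4))
  have q: "1 - p = (lam - 2) / lam" using l by (simp add: p field_simps)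
  show "1 - p \<le> 1 / 3" unfolding q using l assms(3) by (simp add: field_simps)
  have "\<gamma> * lam \<le> \<gamma> * 3" using assms by (intro mult_left_mono) auto
  also have "\<gamma> * 3 = 3 * \<gamma>" by (rule mult.commute)
  also have "\<dots> \<le> 3 * (lam - 2)" using assms(2) by simp
  finally have "\<gamma> * lam \<le> 3 * (lam - 2)" .
  then show "\<gamma> / 3 \<le> 1 - p" unfolding q using l by (simp add: field_simps)
  have "2 * real k < lam * real k" using l assms(5) by simp
  then show kN: "k < N" using assms(4) by linarith
  have "lam * real k \<le> 3 * real k" using assms by (intro mult_right_mono) auto
  then show "2 * N \<le> 3 * k" using assms(4) by linarith
  have "(2 + \<gamma>) * real k \<le> lam * real k" using assms by (intro mult_right_mono) auto
  then have "\<gamma> / 2 * real k \<le> real N - real k" unfolding assms(4) by (simp add: algebra_simps)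
  then show "\<gamma> / 2 * real k \<le> real (N - k)" using kN by (simp add: of_nat_diff)
qed

lemma one_minus_square_le:
  fixes p :: real
  assumes "p < 1" "1 - p \<le> 1 / 3"
  shows "0 \<le> 1 - p\<^sup>2" "(1 - p\<^sup>2) ^ ((x + 1) div 2) \<le> (3 / 4) ^ x"
proof -
  have p: "2 / 3 \<le> p" using assms by linarith
  then have "p\<^sup>2 \<le> 1" using assms by (simp add: power_le_one)
  then show 0: "0 \<le> 1 - p\<^sup>2" by simp
  have "(2 / 3)\<^sup>2 \<le> p\<^sup>2" using p by (intro power_mono) auto
  then have "1 - p\<^sup>2 \<le> (3 / 4)\<^sup>2" by (simp add: power2_eq_square)
  then have "(1 - p\<^sup>2) ^ ((x + 1) div 2) \<le> ((3 / 4)\<^sup>2) ^ ((x + 1) div 2)" using 0 by (rule power_mono)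
  also have "\<dots> = (3 / 4) ^ (2 * ((x + 1) div 2))" by (simp only: power_mult)
  also have "\<dots> \<le> (3 / 4) ^ x" by (rule power_decreasing) auto
  finally show "(1 - p\<^sup>2) ^ ((x + 1) div 2) \<le> (3 / 4) ^ x" .
qed

lemma nat_power_exp: "0 < x \<Longrightarrow> real x ^ m = exp (real m * ln (real x))"
  by (metis exp_ln exp_of_nat_mult of_nat_0_less_iff)

lemma eventually_ln:
  assumes "eventually P (at_top :: real filter)"
  shows "eventually (\<lambda>n :: nat. P (ln (real n))) at_top"
proof -
  have "filterlim (\<lambda>n :: nat. ln (real n)) at_top at_top"
    by (intro filterlim_compose[OF ln_at_top filterlim_real_sequentially])
  then show ?thesis using assms by (simp add: filterlim_iff)
qed

text \<open>With x = log n take j ~ K x, i ~ x^(5/4), r ~ x^(1/8). Then i^2 j ~ x^(7/2) stays below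
  x^4 \<le> k, the exponent r t log n ~ k x^(-1/8) is o(k), 2^r outgrows j, and (k / j) log n is
  about k / K, small by the choice of \<open>K\<close>. The 21 covers the fixed powers of n + 1 and
  one more factor \<open>n\<close>.\<close>

lemma parameters:
  assumes "0 < c0"
  obtains K :: real and r i :: "nat \<Rightarrow> nat" where "0 < K"
    "eventually (\<lambda>n. \<forall>k. ln (real n) ^ 4 \<le> real k \<longrightarrow>
       (let j = nat \<lceil>K * ln (real n)\<rceil>; t = 2 * k div (i n - 1) + 2 in
         1 \<le> j \<and> j + 1 \<le> k \<and> 2 \<le> i n \<and> i n * i n * j + 1 \<le> k \<and> j \<le> 2 ^ r n \<and>
         real (r n + 4 * r n * t + k div j + 21) * ln (real (n + 1)) \<le> c0 * real k)) at_top"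
proof -
  define K where "K = 8 / c0"
  have K: "0 < K" using assms by (simp add: K_def)
  define r where "r n = nat \<lceil>ln (real n) powr (1 / 8)\<rceil>" for n :: nat
  define i where "i n = nat \<lceil>ln (real n) powr (5 / 4)\<rceil> + 1" for n :: nat
  have lim: "((\<lambda>x::real. (9 * x powr (1 / 8) + 60) * 2 * x powr (-3) + 16 * (x powr (1 / 8) + 1) * x powr (- 1 / 4)) \<longlongrightarrow> 0) at_top"
    by real_asymp
  have E1: "eventually (\<lambda>x::real. (9 * x powr (1 / 8) + 60) * 2 * x powr (-3) + 16 * (x powr (1 / 8) + 1) * x powr (- 1 / 4) < c0 / 2) at_top"
    using order_tendstoD(2)[OF lim, of "c0 / 2"] assms by simp
  have E2: "eventually (\<lambda>x::real. (x powr (5 / 4) + 2) * (x powr (5 / 4) + 2) * (K * x + 1) + 1 \<le> x ^ 4) at_top"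
    using K by real_asymp
  have E3: "eventually (\<lambda>x::real. K * x + 1 \<le> 2 powr (x powr (1 / 8))) at_top"
    using K by real_asymp
  have E4: "eventually (\<lambda>x::real. 1 \<le> x \<and> K * x + 3 \<le> x ^ 4) at_top"
    using K by (intro eventually_conj) real_asymp+
  have "eventually (\<lambda>n. \<forall>k. ln (real n) ^ 4 \<le> real k \<longrightarrow>
       (let j = nat \<lceil>K * ln (real n)\<rceil>; t = 2 * k div (i n - 1) + 2 in
         1 \<le> j \<and> j + 1 \<le> k \<and> 2 \<le> i n \<and> i n * i n * j + 1 \<le> k \<and> j \<le> 2 ^ r n \<and>
         real (r n + 4 * r n * t + k div j + 21) * ln (real (n + 1)) \<le> c0 * real k)) at_top"
    using eventually_ln[OF E1] eventually_ln[OF E2] eventually_ln[OF E3] eventually_ln[OF E4] eventually_ge_at_top[of 2]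
  proof eventually_elim
    case (elim n)
    define x where "x = ln (real n)"
    have x: "1 \<le> x" "K * x + 3 \<le> x ^ 4" using elim(4) by (simp_all add: x_def)
    define j where "j = nat \<lceil>K * x\<rceil>"
    have Kx: "0 < K * x" using K x by simp
    have j: "1 \<le> j" "real j \<le> K * x + 1" "K * x \<le> real j"
    proof -
      show "K * x \<le> real j" unfolding j_def by (rule real_nat_ceiling_ge)
      have "real j = of_int \<lceil>K * x\<rceil>" unfolding j_def using Kx by simp
      then show "real j \<le> K * x + 1" by linarith
      show "1 \<le> j" unfolding j_def using Kx by (simp add: Suc_le_eq)
    qed
    have rr: "real (r n) \<le> x powr (1 / 8) + 1" "x powr (1 / 8) \<le> real (r n)"
    proof -
      show "x powr (1 / 8) \<le> real (r n)" unfolding r_def x_def by (rule real_nat_ceiling_ge)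
      have "real (r n) = of_int \<lceil>x powr (1 / 8)\<rceil>" unfolding r_def x_def by simp
      then show "real (r n) \<le> x powr (1 / 8) + 1" by linarith
    qed
    have ii: "real (i n) \<le> x powr (5 / 4) + 2" "x powr (5 / 4) \<le> real (i n - 1)"
    proof -
      have "x powr (5 / 4) \<le> real (nat \<lceil>x powr (5 / 4)\<rceil>)" by (rule real_nat_ceiling_ge)
      then show "x powr (5 / 4) \<le> real (i n - 1)" by (simp add: i_def x_def)
      have "real (i n) = of_int \<lceil>x powr (5 / 4)\<rceil> + 1" unfolding i_def x_def by simp
      then show "real (i n) \<le> x powr (5 / 4) + 2" by linarith
    qed
    have "1 \<le> x powr (5 / 4)" using x by (simp add: ge_one_powr_ge_zero)
    then have i2: "2 \<le> i n" using ii(2) by linarith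
    have lnn: "ln (real (n + 1)) \<le> 2 * x"
    proof -
      have "real (n + 1) \<le> real n * real n"
      proof -
        have "2 * n \<le> n * n" using elim(5) by (rule mult_right_mono) simp
        then have "n + 1 \<le> n * n" using elim(5) by linarith
        then show ?thesis by (simp only: of_nat_mult[symmetric] of_nat_le_iff)
      qed
      then have "ln (real (n + 1)) \<le> ln (real n * real n)" using elim(5) by simp
      also have "\<dots> = 2 * x" using elim(5) by (simp add: ln_mult x_def)
      finally show ?thesis .
    qed
    show ?case
    proof (intro allI impI)
      fix k assume k: "ln (real n) ^ 4 \<le> real k"
      then have kx: "x ^ 4 \<le> real k" by (simp add: x_def)
      have kpos: "0 < real k"
      proof -
        have "0 < x ^ 4" using x by simp
        then show ?thesis using kx by linarith
      qed
      define t where "t = 2 * k div (i n - 1) + 2"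
      have c1: "j + 1 \<le> k" using j(2) x(2) kx by linarith
      have c2: "i n * i n * j + 1 \<le> k"
      proof -
        have "real (i n) * real (i n) * real j \<le> (x powr (5 / 4) + 2) * (x powr (5 / 4) + 2) * (K * x + 1)"
          using ii(1) j(2) Kx by (intro mult_mono) auto
        then have "real (i n * i n * j) + 1 \<le> real k" using elim(2) kx by (simp add: x_def)
        then show ?thesis by linarith
      qed
      have c3: "j \<le> 2 ^ r n"
      proof -
        have "real j \<le> 2 powr (x powr (1 / 8))" using j(2) elim(3) by (simp add: x_def)
        also have "\<dots> \<le> 2 powr (real (r n))" using rr(2) by simp
        also have "\<dots> = real (2 ^ r n)" by (simp add: powr_realpow)
        finally show ?thesis by (simp only: of_nat_le_iff)
      qed
      have xk: "1 \<le> x powr (-3) * x powr (-1) * real k"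
      proof -
        have "x powr (-3) * x powr (-1) = x powr (-4)" by (subst powr_add[symmetric]) simp
        also have "\<dots> = 1 / x ^ 4" using x by (simp add: powr_minus_divide)
        finally have "x powr (-3) * x powr (-1) = 1 / x ^ 4" .
        moreover have "1 \<le> 1 / x ^ 4 * real k"
        proof -
          have "0 < x ^ 4" using x by simp
          then show ?thesis using kx by (subst times_divide_eq_left) (simp add: pos_le_divide_eq)
        qed
        ultimately show ?thesis by (simp only:)
      qed
      have "real (2 * k div (i n - 1)) \<le> real (2 * k) / real (i n - 1)" by (rule of_nat_div_le_of_nat) 
      also have "\<dots> \<le> real (2 * k) / x powr (5 / 4)"
        using ii(2) x by (intro frac_le) auto
      also have "\<dots> = 2 * real k * x powr (- 5 / 4)" by (simp add: powr_minus_divide)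
      finally have tt: "real t \<le> 2 * real k * x powr (- 5 / 4) + 2" by (simp add: t_def)
      have kj: "real (k div j) \<le> real k / (K * x)"
      proof -
        have "real (k div j) \<le> real k / real j" by (rule of_nat_div_le_of_nat)
        also have "\<dots> \<le> real k / (K * x)" using j(1,3) Kx by (intro frac_le) auto
        finally show ?thesis .
      qed
      define y where "y = x powr (1 / 8)"
      have y0: "0 \<le> y" by (simp add: y_def)
      have "real (r n + 4 * r n * t + k div j + 21) = real (r n) + 4 * (real (r n) * real t) + real (k div j) + 21" by simp
      also have "\<dots> \<le> (y + 1) + 4 * ((y + 1) * (2 * real k * x powr (- 5 / 4) + 2)) + real k / (K * x) + 21"
        using rr(1) tt kj y0 unfolding y_def[symmetric] by (intro add_mono mult_mono mult_left_mono) auto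
      also have "\<dots> = (9 * y + 30) + 8 * (y + 1) * x powr (- 5 / 4) * real k + real k / (K * x)" by (simp add: algebra_simps)
      finally have e1: "real (r n + 4 * r n * t + k div j + 21) \<le> (9 * y + 30) + 8 * (y + 1) * x powr (- 5 / 4) * real k + real k / (K * x)" .
      have "real (r n + 4 * r n * t + k div j + 21) * ln (real (n + 1))
          \<le> ((9 * y + 30) + 8 * (y + 1) * x powr (- 5 / 4) * real k + real k / (K * x)) * (2 * x)"
      proof (intro mult_mono e1 lnn)
        show "0 \<le> (9 * y + 30) + 8 * (y + 1) * x powr (- 5 / 4) * real k + real k / (K * x)"
          using y0 Kx by (intro add_nonneg_nonneg mult_nonneg_nonneg divide_nonneg_pos) auto
      qed simp
      also have "\<dots> = (9 * y + 30) * 2 * x + 16 * (y + 1) * (x powr (- 5 / 4) * x) * real k + 2 / K * real k"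
        using x K by (simp add: field_simps)
      also have "x powr (- 5 / 4) * x = x powr (- 1 / 4)"
      proof -
        have "x powr (- 5 / 4) * x powr 1 = x powr (- 5 / 4 + 1)" by (rule powr_add[symmetric])
        then show ?thesis using x by simp
      qed
      also have "(9 * y + 30) * 2 * x \<le> (9 * y + 60) * 2 * x powr (-3) * real k"
      proof -
        have "(9 * y + 30) * 2 * x * 1 \<le> (9 * y + 60) * 2 * x * (x powr (-3) * x powr (-1) * real k)"
          using xk y0 x by (intro mult_mono) auto
        also have "\<dots> = (9 * y + 60) * 2 * x powr (-3) * real k * (x * x powr (-1))" by (simp only: mult_ac)
        also have "x * x powr (-1) = 1" using x by (simp add: powr_minus_divide)
        finally show ?thesis by simp
      qed
      also have "(9 * y + 60) * 2 * x powr (-3) * real k + 16 * (y + 1) * x powr (- 1 / 4) * real k + 2 / K * real k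
          = ((9 * y + 60) * 2 * x powr (-3) + 16 * (y + 1) * x powr (- 1 / 4) + 2 / K) * real k"
        by (simp only: distrib_right)
      also have "\<dots> \<le> (c0 / 2 + c0 / 4) * real k"
      proof (rule mult_right_mono)
        have "2 / K = c0 / 4" by (simp add: K_def)
        then show "(9 * y + 60) * 2 * x powr (-3) + 16 * (y + 1) * x powr (- 1 / 4) + 2 / K \<le> c0 / 2 + c0 / 4"
          using elim(1) by (simp add: y_def x_def)
      qed simp
      also have "\<dots> \<le> c0 * real k" using assms by (intro mult_right_mono) auto
      finally have c4: "real (r n + 4 * r n * t + k div j + 21) * ln (real (n + 1)) \<le> c0 * real k" by simp
      show "let j = nat \<lceil>K * ln (real n)\<rceil>; t = 2 * k div (i n - 1) + 2 in
         1 \<le> j \<and> j + 1 \<le> k \<and> 2 \<le> i n \<and> i n * i n * j + 1 \<le> k \<and> j \<le> 2 ^ r n \<and>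
         real (r n + 4 * r n * t + k div j + 21) * ln (real (n + 1)) \<le> c0 * real k"
        unfolding Let_def x_def[symmetric] j_def[symmetric] t_def[symmetric]
        using j(1) c1 i2 c2 c3 c4 by blast
    qed
  qed
  then show ?thesis by (rule that[OF K])
qed

lemma powr_le_exp:
  fixes b z :: real
  assumes "0 < b" "0 \<le> z"
  shows "b powr z \<le> exp ((b - 1) * z)"
proof -
  have "z * ln b \<le> z * (b - 1)" using assms ln_le_minus_one[of b] by (intro mult_left_mono) auto
  then show ?thesis using assms by (simp add: powr_def mult.commute)
qed

text \<open>The factor \<open>n\<close> on the left pays for the later summation over all
  lengths.\<close>

lemma few_total:
  fixes \<gamma> lam \<epsilon> :: real
  assumes g: "0 < \<gamma>" "2 + \<gamma> \<le> lam" "lam \<le> 3" and eps: "0 < \<epsilon>"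
  obtains K :: real where "0 < K"
    "eventually (\<lambda>n. \<forall>k N M. ln (real n) ^ 4 \<le> real k \<and> real N = lam * real k / 2 \<and> 0 < M \<and> M < int n \<longrightarrow>
       real n * real (card (few k N (nat \<lceil>K * ln (real n)\<rceil>) M)) \<le> \<epsilon> * real (N choose k)) at_top"
proof -
  \<comment> \<open>All powers of n + 1 are at most exp (c0 k). The bound \<gamma> / 4 lets
    \<open>N choose k\<close>, at least exp (\<gamma> k / 2), beat the walkable sets; 1/100 is below
    the decay rates of (1/3)^(k / 32) and (3/4)^(k / 16).\<close>
  define c0 where "c0 = min (\<gamma> / 4) (1 / 100)"
  have c0: "0 < c0" "c0 \<le> \<gamma> / 4" "c0 \<le> 1 / 100" using g by (auto simp: c0_def)
  obtain K :: real and r i :: "nat \<Rightarrow> nat" where K: "0 < K" and ev: "eventually (\<lambda>n. \<forall>k. ln (real n) ^ 4 \<le> real k \<longrightarrow>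
       (let j = nat \<lceil>K * ln (real n)\<rceil>; t = 2 * k div (i n - 1) + 2 in
         1 \<le> j \<and> j + 1 \<le> k \<and> 2 \<le> i n \<and> i n * i n * j + 1 \<le> k \<and> j \<le> 2 ^ r n \<and>
         real (r n + 4 * r n * t + k div j + 21) * ln (real (n + 1)) \<le> c0 * real k)) at_top"
    by (rule parameters[OF c0(1)])
  define B where "B = 3 / \<gamma>"
  have B: "0 < B" using g by (simp add: B_def)
  have l1: "((\<lambda>y::real. exp (- (\<gamma> / 4) * y)) \<longlongrightarrow> 0) at_top" using g(1) by real_asymp
  have l2: "((\<lambda>y::real. exp (y / 100) * (1 / 3) powr (y / 32 - 1)) \<longlongrightarrow> 0) at_top"
  proof (rule tendsto_sandwich[OF _ _ tendsto_const])
    show "((\<lambda>y::real. exp (y / 100) * exp ((1 / 3 - 1) * (y / 32 - 1))) \<longlongrightarrow> 0) at_top" by real_asymp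
    show "eventually (\<lambda>y::real. exp (y / 100) * (1 / 3) powr (y / 32 - 1) \<le> exp (y / 100) * exp ((1 / 3 - 1) * (y / 32 - 1))) at_top"
      using eventually_ge_at_top[of 32] by eventually_elim (intro mult_left_mono powr_le_exp; simp)
  qed auto
  have l3: "((\<lambda>y::real. exp (y / 100) * ((3 / 4) powr (y / 16 - 1) * (2 * y))) \<longlongrightarrow> 0) at_top"
  proof (rule tendsto_sandwich[OF _ _ tendsto_const])
    show "((\<lambda>y::real. exp (y / 100) * (exp ((3 / 4 - 1) * (y / 16 - 1)) * (2 * y))) \<longlongrightarrow> 0) at_top" by real_asymp
    show "eventually (\<lambda>y::real. exp (y / 100) * ((3 / 4) powr (y / 16 - 1) * (2 * y)) \<le> exp (y / 100) * (exp ((3 / 4 - 1) * (y / 16 - 1)) * (2 * y))) at_top"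
      using eventually_ge_at_top[of 16] by eventually_elim (intro mult_left_mono mult_right_mono powr_le_exp; simp)
    show "eventually (\<lambda>y::real. 0 \<le> exp (y / 100) * ((3 / 4) powr (y / 16 - 1) * (2 * y))) at_top"
      using eventually_ge_at_top[of 0] by eventually_elim simp
  qed
  have "((\<lambda>y::real. 2 * exp (- (\<gamma> / 4) * y) + exp (y / 100) * (1 / 3) powr (y / 32 - 1) + B * (exp (y / 100) * ((3 / 4) powr (y / 16 - 1) * (2 * y)))) \<longlongrightarrow> 2 * 0 + 0 + B * 0) at_top"
    by (rule tendsto_add[OF tendsto_add[OF tendsto_mult[OF tendsto_const l1] l2] tendsto_mult[OF tendsto_const l3]])
  then have "eventually (\<lambda>y::real. 2 * exp (- (\<gamma> / 4) * y) + exp (y / 100) * (1 / 3) powr (y / 32 - 1) + B * (exp (y / 100) * ((3 / 4) powr (y / 16 - 1) * (2 * y))) < \<epsilon>) at_top"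
    by (rule order_tendstoD(2)) (use eps in simp)
  then obtain y0 where y0: "\<And>y. y0 \<le> y \<Longrightarrow> 2 * exp (- (\<gamma> / 4) * y) + exp (y / 100) * (1 / 3) powr (y / 32 - 1) + B * (exp (y / 100) * ((3 / 4) powr (y / 16 - 1) * (2 * y))) < \<epsilon>"
    unfolding eventually_at_top_linorder by blast
  have "eventually (\<lambda>x::real. max y0 100 \<le> x ^ 4) at_top" by real_asymp
  then have ev2: "eventually (\<lambda>n :: nat. max y0 100 \<le> ln (real n) ^ 4) at_top" by (rule eventually_ln)
  have "eventually (\<lambda>n. \<forall>k N M. ln (real n) ^ 4 \<le> real k \<and> real N = lam * real k / 2 \<and> 0 < M \<and> M < int n \<longrightarrow>
       real n * real (card (few k N (nat \<lceil>K * ln (real n)\<rceil>) M)) \<le> \<epsilon> * real (N choose k)) at_top"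
    using ev ev2
  proof eventually_elim
    case (elim n)
    show ?case
    proof (intro allI impI)
      fix k N :: nat and M :: int
      assume h: "ln (real n) ^ 4 \<le> real k \<and> real N = lam * real k / 2 \<and> 0 < M \<and> M < int n"
      define p where "p = 2 / lam"
      define j where "j = nat \<lceil>K * ln (real n)\<rceil>"
      define t where "t = 2 * k div (i n - 1) + 2"
      define e where "e = r n + 4 * r n * t + k div j"
      have par: "1 \<le> j" "j + 1 \<le> k" "2 \<le> i n" "i n * i n * j + 1 \<le> k" "j \<le> 2 ^ r n"
        "real (e + 21) * ln (real (n + 1)) \<le> c0 * real k"
      proof -
        have "1 \<le> j \<and> j + 1 \<le> k \<and> 2 \<le> i n \<and> i n * i n * j + 1 \<le> k \<and> j \<le> 2 ^ r n \<and>
          real (e + 21) * ln (real (n + 1)) \<le> c0 * real k"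
          using elim(1)[rule_format, OF conjunct1[OF h]] unfolding Let_def j_def t_def e_def .
        then show "1 \<le> j" "j + 1 \<le> k" "2 \<le> i n" "i n * i n * j + 1 \<le> k" "j \<le> 2 ^ r n"
          "real (e + 21) * ln (real (n + 1)) \<le> c0 * real k" by blast+
      qed
      have k100: "100 \<le> k" and ky: "y0 \<le> real k" using elim(2) h by linarith+
      have N: "real N = lam * real k / 2" and k0: "0 < k" using h k100 by auto
      note rf = ratio_facts[OF g N k0 p_def]
      let ?C = "real (N choose k)" and ?\<nu> = "n + 1"
      have nu: "real n * real ?\<nu> ^ m \<le> exp (c0 * real k)" if "m \<le> e + 20" for m
      proof -
        have "real n * real ?\<nu> ^ m \<le> real ?\<nu> * real ?\<nu> ^ m" by (intro mult_right_mono) auto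
        also have "\<dots> = real ?\<nu> ^ (m + 1)" by simp
        also have "\<dots> \<le> real ?\<nu> ^ (e + 21)" using that by (intro power_increasing) auto
        also have "\<dots> = exp (real (e + 21) * ln (real ?\<nu>))" by (rule nat_power_exp) simp
        also have "\<dots> \<le> exp (c0 * real k)" using par(6) by simp
        finally show ?thesis .
      qed
      have cf: "real (card (few k N j M)) \<le> real ?\<nu> ^ e + real ?\<nu> ^ 20
         + real ?\<nu> ^ (k div j + 3) * ((1 - p) ^ (k div 32) * ?C)
         + real ?\<nu> ^ (k div j + 7) * ((1 - p\<^sup>2) ^ ((N div 16 + 1) div 2) * (real (N + 1) * ?C) * (1 / (1 - p)))"
        unfolding e_def
      proof (rule card_few)
        show "nat M + 2 \<le> n + 1" using h by linarith
      qed (use h par rf k100 t_def in auto)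
      have q: "0 < 1 - p" "1 / (1 - p) \<le> B"
      proof -
        show "0 < 1 - p" using rf by simp
        have "1 / (1 - p) \<le> 1 / (\<gamma> / 3)" using rf g by (intro divide_left_mono) auto
        then show "1 / (1 - p) \<le> B" by (simp add: B_def)
      qed
      have C0: "0 \<le> ?C" by simp
      define X where "X = exp (c0 * real k)"
      have X100: "X \<le> exp (real k / 100)"
      proof -
        have "c0 * real k \<le> 1 / 100 * real k" using c0 by (intro mult_right_mono) auto
        then show ?thesis by (simp add: X_def)
      qed
      have nuX: "real n * real ?\<nu> ^ m \<le> exp (real k / 100)" if "m \<le> e + 20" for m
        using nu[OF that] X100 by (simp only: X_def order_trans)
      have kdiv: "real k / real d - 1 \<le> real (k div d)" if "0 < d" for d
      proof -
        have "k < d + k div d * d" using that by (rule dividend_less_div_times)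
        then have "real k < real (d + k div d * d)" by (simp only: of_nat_less_iff)
        then have "real k \<le> (real (k div d) + 1) * real d" by (simp add: algebra_simps)
        then have "real k / real d \<le> real (k div d) + 1" using that by (subst pos_divide_le_eq) auto
        then show ?thesis by linarith
      qed
      have q32: "(1 - p) ^ (k div 32) \<le> (1 / 3) powr (real k / 32 - 1)"
      proof -
        have "(1 - p) ^ (k div 32) \<le> (1 / 3) ^ (k div 32)" using rf q by (intro power_mono) auto
        also have "\<dots> = (1 / 3) powr real (k div 32)" by (simp add: powr_realpow)
        also have "\<dots> \<le> (1 / 3) powr (real k / 32 - 1)"
          using kdiv[of 32] by (intro powr_mono') auto
        finally show ?thesis .
      qed
      have q16: "(1 - p\<^sup>2) ^ ((N div 16 + 1) div 2) \<le> (3 / 4) powr (real k / 16 - 1)"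
      proof -
        have "(1 - p\<^sup>2) ^ ((N div 16 + 1) div 2) \<le> (3 / 4) ^ (N div 16)"
          using rf by (intro one_minus_square_le(2)) auto
        also have "\<dots> \<le> (3 / 4) ^ (k div 16)" using rf by (intro power_decreasing div_le_mono) auto
        also have "\<dots> = (3 / 4) powr real (k div 16)" by (simp add: powr_realpow)
        also have "\<dots> \<le> (3 / 4) powr (real k / 16 - 1)"
          using kdiv[of 16] by (intro powr_mono') auto
        finally show ?thesis .
      qed
      have t1: "real n * real ?\<nu> ^ e + real n * real ?\<nu> ^ 20 \<le> 2 * exp (- (\<gamma> / 4) * real k) * ?C"
      proof -
        have "real n * real ?\<nu> ^ e + real n * real ?\<nu> ^ 20 \<le> 2 * exp (c0 * real k)"
          using nu[of e] nu[of 20] by simp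
        also have "\<dots> \<le> 2 * (exp (- (\<gamma> / 4) * real k) * exp (\<gamma> / 2 * real k))"
        proof -
          have "c0 * real k \<le> \<gamma> / 4 * real k" using c0 by (intro mult_right_mono) auto
          then show ?thesis by (simp flip: exp_add)
        qed
        also have "\<dots> \<le> 2 * (exp (- (\<gamma> / 4) * real k) * ?C)"
        proof (intro mult_left_mono)
          have "exp (\<gamma> / 2 * real k) \<le> exp (real (N - k))" using rf(8) by simp
          also have "\<dots> = exp 1 ^ (N - k)" by (simp add: exp_of_nat_mult[symmetric])
          also have "\<dots> \<le> 3 ^ (N - k)" using exp_le by (intro power_mono) auto
          also have "\<dots> \<le> ?C" using rf by (intro choose_lower) auto
          finally show "exp (\<gamma> / 2 * real k) \<le> ?C" .
        qed auto
        finally show ?thesis by simp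
      qed
      have t2: "real n * (real ?\<nu> ^ (k div j + 3) * ((1 - p) ^ (k div 32) * ?C))
          \<le> exp (real k / 100) * (1 / 3) powr (real k / 32 - 1) * ?C"
      proof -
        have "real n * (real ?\<nu> ^ (k div j + 3) * ((1 - p) ^ (k div 32) * ?C))
           = (real n * real ?\<nu> ^ (k div j + 3)) * (1 - p) ^ (k div 32) * ?C" by (simp only: mult_ac)
        also have "\<dots> \<le> exp (real k / 100) * (1 / 3) powr (real k / 32 - 1) * ?C"
          using q by (intro mult_mono nuX q32) (simp_all add: e_def)
        finally show ?thesis .
      qed
      have t3: "real n * (real ?\<nu> ^ (k div j + 7) * ((1 - p\<^sup>2) ^ ((N div 16 + 1) div 2) * (real (N + 1) * ?C) * (1 / (1 - p))))
          \<le> B * (exp (real k / 100) * ((3 / 4) powr (real k / 16 - 1) * (2 * real k))) * ?C"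
      proof -
        have "real n * (real ?\<nu> ^ (k div j + 7) * ((1 - p\<^sup>2) ^ ((N div 16 + 1) div 2) * (real (N + 1) * ?C) * (1 / (1 - p))))
           = (1 / (1 - p)) * ((real n * real ?\<nu> ^ (k div j + 7)) * ((1 - p\<^sup>2) ^ ((N div 16 + 1) div 2) * real (N + 1))) * ?C"
          by (simp only: mult_ac)
        also have "\<dots> \<le> B * (exp (real k / 100) * ((3 / 4) powr (real k / 16 - 1) * (2 * real k))) * ?C"
        proof (intro mult_mono q(2) q16)
          show "real n * real ?\<nu> ^ (k div j + 7) \<le> exp (real k / 100)"
            by (rule nuX) (simp add: e_def)
          show "real (N + 1) \<le> 2 * real k" using rf(7) k100 by linarith
        qed (use q B one_minus_square_le(1)[of p] rf in auto)
        finally show ?thesis .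
      qed
      have "real n * real (card (few k N j M)) \<le> real n * (real ?\<nu> ^ e + real ?\<nu> ^ 20
         + real ?\<nu> ^ (k div j + 3) * ((1 - p) ^ (k div 32) * ?C)
         + real ?\<nu> ^ (k div j + 7) * ((1 - p\<^sup>2) ^ ((N div 16 + 1) div 2) * (real (N + 1) * ?C) * (1 / (1 - p))))"
        using cf by (intro mult_left_mono) auto
      also have "\<dots> \<le> (2 * exp (- (\<gamma> / 4) * real k) + exp (real k / 100) * (1 / 3) powr (real k / 32 - 1)
          + B * (exp (real k / 100) * ((3 / 4) powr (real k / 16 - 1) * (2 * real k)))) * ?C"
        using t1 t2 t3 unfolding distrib_left distrib_right by linarith
      also have "\<dots> \<le> \<epsilon> * ?C" using y0[OF ky] C0 by (intro mult_right_mono) auto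
      finally show "real n * real (card (few k N (nat \<lceil>K * ln (real n)\<rceil>) M)) \<le> \<epsilon> * ?C"
        by (simp only: j_def)
    qed
  qed
  then show ?thesis by (rule that[OF K])
qed

text \<open>The cost q^s of 2 s missing sums cancels the gain (1 / q)^s of the longer interval; the
  strict saving \<open>m\<close> survives.\<close>

lemma sqrt_power_cancel:
  fixes q m :: real
  assumes "0 < q"
  shows "(sqrt q * m) ^ (2 * s) * (1 / q) ^ s = (m\<^sup>2) ^ s"
proof -
  have "(sqrt q * m) ^ (2 * s) * (1 / q) ^ s = ((sqrt q * m)\<^sup>2 * (1 / q)) ^ s"
    by (simp only: power_mult power_mult_distrib)
  also have "(sqrt q * m)\<^sup>2 * (1 / q) = m\<^sup>2" using assms by (simp add: power_mult_distrib)
  finally show ?thesis .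
qed

text \<open>If m > a, the truncated exponent is 0 and the right-hand side is at least 1.\<close>

lemma power_diff_le:
  fixes \<theta> :: real
  assumes "0 < \<theta>" "\<theta> \<le> 1"
  shows "\<theta> ^ (a - m) \<le> \<theta> ^ a * (1 / \<theta>) ^ m"
proof (cases "m \<le> a")
  case True
  then have "\<theta> ^ a = \<theta> ^ (a - m) * \<theta> ^ m" by (simp flip: power_add)
  then show ?thesis using assms by (simp add: power_one_over)
next
  case False
  have "\<theta> ^ m \<le> \<theta> ^ a" using False assms by (intro power_decreasing) auto
  then have "\<theta> ^ m * (1 / \<theta>) ^ m \<le> \<theta> ^ a * (1 / \<theta>) ^ m" using assms by (intro mult_right_mono) auto
  then show ?thesis using False assms by (simp add: power_one_over)
qed

lemma sqrt_ratio_le: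
  fixes q q0 c :: real
  assumes "0 < q0" "q0 \<le> q" "0 < c"
  shows "1 / (sqrt q * c) \<le> 1 / (sqrt q0 * c)"
  using assms by (intro frac_le mult_right_mono mult_pos_pos) auto

text \<open>The geometric summand carries no factor growing with \<open>k\<close>; only so do all s
  > C log (1 / \<epsilon>) together contribute a small multiple of \<epsilon>.\<close>

lemma card_config_short_explicit:
  fixes \<gamma> :: real
  assumes g: "0 < \<gamma>" "\<gamma> \<le> 1"
  obtains K :: real where "0 < K"
    "\<And>lam k N M s. 2 + \<gamma> \<le> lam \<Longrightarrow> lam \<le> 3 \<Longrightarrow> real N = lam * real k / 2 \<Longrightarrow> 8 \<le> k \<Longrightarrow> 0 < M \<Longrightarrow>
       nat M + 1 = N + s \<Longrightarrow> 1 \<le> s \<Longrightarrow> real s \<le> \<gamma> / 192 * real k \<Longrightarrow>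
       real (card {A. config k N M A})
         \<le> (K * (100 / 102) ^ s + 8 * (real k)\<^sup>2 * exp (1 / 4 - 3 / 64 * real k)) * real (N choose k)"
proof -
  define \<mu> :: real where "\<mu> = 100 / 102"
  have mu: "0 < \<mu>" "\<mu> < 1" by (simp_all add: \<mu>_def)
  obtain K0 where K0: "K0 > 0" "\<And>q u R. \<gamma> / 3 \<le> q \<Longrightarrow> q \<le> 1 / 3 \<Longrightarrow>
       wsum (1 - q) q {0..R} (\<lambda>S. 0 \<in> S \<and> u \<le> card (missing S R)) \<le> K0 * (sqrt q * (100 / 102)) ^ u"
    using g by (rule_tac wsum_missing_tail[of "\<gamma> / 3"]) auto
  obtain C1 where C1: "C1 > 0" "\<And>u :: nat. (2 * real u + 0) * \<mu> ^ u \<le> C1"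
    using mu by (rule_tac linear_times_power_bounded[of \<mu> 2 0]) auto
  define c where "c = nat \<lceil>3 / \<gamma>\<rceil>"
  define Y where "Y = 1 / (sqrt (\<gamma> / 3) * \<mu>)"
  have Y: "0 < Y" using g mu by (simp add: Y_def)
  define K where "K = C1 * (K0\<^sup>2 * (3 ^ c * Y))"
  have K: "0 < K" using K0 C1 Y by (simp add: K_def)
  show ?thesis
  proof (rule that[OF K])
    fix lam k N M s
    assume h: "2 + \<gamma> \<le> lam" "lam \<le> 3" "real N = lam * real k / 2" "8 \<le> k" "0 < M"
       "nat M + 1 = N + s" "1 \<le> s" "real s \<le> \<gamma> / 192 * real k"
    define p where "p = 2 / lam"
    define q where "q = 1 - p"
    have k0: "0 < k" using h by simp
    note rf = ratio_facts[OF g(1) h(1-3) k0 p_def]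
    have q: "0 < q" "\<gamma> / 3 \<le> q" "q \<le> 1 / 3" using rf by (simp_all add: q_def)
    let ?C = "real (N choose k)"
    have qinv: "1 / q \<le> 3 / \<gamma>"
    proof -
      have "1 / q \<le> 1 / (\<gamma> / 3)" using q g by (intro frac_le) auto
      then show ?thesis by simp
    qed
    have sk: "192 * real s \<le> real k"
    proof -
      have "\<gamma> / 192 * real k \<le> 1 / 192 * real k" using g by (intro mult_right_mono) auto
      then show ?thesis using h(8) by linarith
    qed
    define \<theta> where "\<theta> = sqrt q * \<mu>"
    have th: "0 < \<theta>" using q mu by (simp add: \<theta>_def)
    have "real (card {A. config k N M A}) \<le>
     2 * real s * (K0\<^sup>2 * \<theta> ^ (2 * s - 1) * (3 ^ c * ?C) * (1 / (1 - p)) ^ s)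
     + 2 * (real (nat M) * ((1 - p\<^sup>2) ^ ((nat M div 4 + 1) div 2) * (real (N + 1) * ?C) * (1 / (1 - p)) ^ s))"
    proof (rule card_config_short[OF h(5-7)])
      have "4 * real s \<le> real k" using sk by linarith
      then show "4 * s \<le> N" using rf(6) by linarith
      show "8 \<le> N" using rf(6) h by linarith
      have "1 / q \<le> real c" using qinv real_nat_ceiling_ge[of "3 / \<gamma>"] unfolding c_def by linarith
      then show "1 / (1 - p) \<le> real c" by (simp only: q_def)
      fix u R
      show "wsum p (1 - p) {0..R} (\<lambda>S. 0 \<in> S \<and> u \<le> card (missing S R)) \<le> K0 * \<theta> ^ u"
        using K0(2)[OF q(2,3), of R u] by (simp add: \<theta>_def \<mu>_def q_def)
    qed (use rf th K0 in auto)
    also have "2 * real s * (K0\<^sup>2 * \<theta> ^ (2 * s - 1) * (3 ^ c * ?C) * (1 / (1 - p)) ^ s) \<le> K * \<mu> ^ s * ?C"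
    proof -
      have "\<theta> ^ (2 * s - 1) \<le> \<theta> ^ (2 * s) * (1 / \<theta>)"
      proof -
        have "\<theta> ^ (2 * s) = \<theta> ^ (2 * s - 1) * \<theta>" using h(7) by (simp flip: power_Suc2)
        then show ?thesis using th by simp
      qed
      also have "\<dots> \<le> \<theta> ^ (2 * s) * Y"
        unfolding Y_def \<theta>_def using q g mu by (intro mult_left_mono sqrt_ratio_le) auto
      finally have "2 * real s * (K0\<^sup>2 * \<theta> ^ (2 * s - 1) * (3 ^ c * ?C) * (1 / (1 - p)) ^ s)
         \<le> 2 * real s * (K0\<^sup>2 * (\<theta> ^ (2 * s) * Y) * (3 ^ c * ?C) * (1 / (1 - p)) ^ s)"
        using q by (intro mult_left_mono mult_right_mono) (simp_all add: q_def)
      also have "\<dots> = 2 * real s * (\<theta> ^ (2 * s) * (1 / q) ^ s) * (K0\<^sup>2 * (3 ^ c * Y)) * ?C"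
        by (simp only: mult_ac q_def)
      \<comment> \<open>One factor \<mu>^s absorbs the 2 s ways of sharing the missing sums between
        the ends, the other is kept for the summation over s.\<close>
      also have "\<theta> ^ (2 * s) * (1 / q) ^ s = \<mu> ^ s * \<mu> ^ s"
        unfolding \<theta>_def sqrt_power_cancel[OF q(1)] by (simp add: power2_eq_square power_mult_distrib)
      also have "2 * real s * (\<mu> ^ s * \<mu> ^ s) * (K0\<^sup>2 * (3 ^ c * Y)) * ?C
          = (2 * real s + 0) * \<mu> ^ s * (\<mu> ^ s * (K0\<^sup>2 * (3 ^ c * Y)) * ?C)" by simp
      also have "\<dots> \<le> C1 * (\<mu> ^ s * (K0\<^sup>2 * (3 ^ c * Y)) * ?C)"
        using C1(2)[of s] mu Y by (intro mult_right_mono) auto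
      also have "\<dots> = K * \<mu> ^ s * ?C" by (simp only: K_def mult_ac)
      finally show ?thesis .
    qed
    also have "2 * (real (nat M) * ((1 - p\<^sup>2) ^ ((nat M div 4 + 1) div 2) * (real (N + 1) * ?C) * (1 / (1 - p)) ^ s))
       \<le> 8 * (real k)\<^sup>2 * exp (1 / 4 - 3 / 64 * real k) * ?C"
    proof -
      have W: "(1 - p\<^sup>2) ^ ((nat M div 4 + 1) div 2) \<le> exp (1 / 4 - real k / 16)"
      proof -
        have kM: "k \<le> nat M" using rf(6) h(6,7) by linarith
        have "(1 - p\<^sup>2) ^ ((nat M div 4 + 1) div 2) \<le> (3 / 4) ^ (nat M div 4)"
          using rf by (intro one_minus_square_le(2)) auto
        also have "\<dots> \<le> (3 / 4) ^ (k div 4)" using kM by (intro power_decreasing div_le_mono) auto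
        also have "\<dots> = (3 / 4) powr real (k div 4)" by (simp add: powr_realpow)
        also have "\<dots> \<le> exp ((3 / 4 - 1) * real (k div 4))" by (intro powr_le_exp) auto
        also have "\<dots> \<le> exp (1 / 4 - real k / 16)"
        proof -
          have "k \<le> 4 * (k div 4) + 4" by linarith
          then have "real k \<le> real (4 * (k div 4) + 4)" by (simp only: of_nat_le_iff)
          then show ?thesis by simp
        qed
        finally show ?thesis .
      qed
      \<comment> \<open>The range s \<le> \<gamma> k / 192 is chosen for this: as 1 / q \<le> 3 /
        \<gamma> \<le> exp (3 / \<gamma>), lengthening gains at most exp (k / 64) against the decay
        exp (- k / 16) of the tail.\<close>
      have Q: "(1 / q) ^ s \<le> exp (real k / 64)"
      proof -
        have "1 / q \<le> exp (3 / \<gamma>)" using qinv exp_ge_add_one_self[of "3 / \<gamma>"] by linarith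
        then have "(1 / q) ^ s \<le> exp (3 / \<gamma>) ^ s" using q by (intro power_mono) auto
        also have "\<dots> = exp (real s * (3 / \<gamma>))" by (simp only: exp_of_nat_mult)
        also have "\<dots> \<le> exp (real k / 64)"
        proof -
          have "real s * (3 / \<gamma>) \<le> \<gamma> / 192 * real k * (3 / \<gamma>)" using h(8) g by (intro mult_right_mono) auto
          also have "\<dots> = real k / 64" using g by simp
          finally show ?thesis by simp
        qed
        finally show ?thesis .
      qed
      have "real (nat M) * ((1 - p\<^sup>2) ^ ((nat M div 4 + 1) div 2) * (real (N + 1) * ?C) * (1 / (1 - p)) ^ s)
        = real (nat M) * real (N + 1) * ((1 - p\<^sup>2) ^ ((nat M div 4 + 1) div 2) * (1 / q) ^ s) * ?C"
        by (simp only: mult_ac q_def)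
      also have "\<dots> \<le> 2 * real k * (2 * real k) * (exp (1 / 4 - real k / 16) * exp (real k / 64)) * ?C"
      proof (intro mult_mono W Q)
        have "nat M + 1 = N + s" "2 * N \<le> 3 * k" "192 * s \<le> k" using h rf sk by linarith+
        then show "real (nat M) \<le> 2 * real k" by linarith
        show "real (N + 1) \<le> 2 * real k" using rf(7) h(4) by linarith
      qed (use q one_minus_square_le(1)[of p] rf in auto)
      also have "exp (1 / 4 - real k / 16) * exp (real k / 64) = exp (1 / 4 - 3 / 64 * real k)"
        by (simp flip: exp_add)
      finally have "2 * (real (nat M) * ((1 - p\<^sup>2) ^ ((nat M div 4 + 1) div 2) * (real (N + 1) * ?C) * (1 / (1 - p)) ^ s))
        \<le> 2 * (2 * real k * (2 * real k) * exp (1 / 4 - 3 / 64 * real k) * ?C)" by (rule mult_left_mono) simp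
      also have "\<dots> = 8 * (real k)\<^sup>2 * exp (1 / 4 - 3 / 64 * real k) * ?C" by (simp add: power2_eq_square)
      finally show ?thesis .
    qed
    finally show "real (card {A. config k N M A})
         \<le> (K * (100 / 102) ^ s + 8 * (real k)\<^sup>2 * exp (1 / 4 - 3 / 64 * real k)) * ?C"
      by (simp only: \<mu>_def distrib_right)
  qed
qed

text \<open>As s \<ge> \<delta> k \<ge> \<delta> (log n)^4, the decay exp (- s / 25) beats every
  power of \<open>n\<close> and the loss exp (O(log n)) caused by \<open>j\<close>.\<close>

lemma long_total:
  fixes \<gamma> \<delta> K \<epsilon> :: real
  assumes g: "0 < \<gamma>" "\<gamma> \<le> 1" and d: "0 < \<delta>" and K: "0 < K" and eps: "0 < \<epsilon>"
  shows "eventually (\<lambda>n. \<forall>lam k N M. 2 + \<gamma> \<le> lam \<and> lam \<le> 3 \<and> 0 < k \<and> ln (real n) ^ 4 \<le> real k \<and> real N = lam * real k / 2 \<and> 0 < M \<and> M < int n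
       \<and> \<delta> * real k + real N < real_of_int M + 1 \<longrightarrow>
       real n * real (card {A. config k N M A \<and> card (low M A \<inter> high M A) < nat \<lceil>K * ln (real n)\<rceil>}) \<le> \<epsilon> * real (N choose k)) at_top"
proof -
  define Y where "Y = 1 / (sqrt (\<gamma> / 3) * (100 / 103))"
  have Y: "1 \<le> Y"
  proof -
    have "sqrt (\<gamma> / 3) * (100 / 103) \<le> 1 * 1" using g by (intro mult_mono) auto
    moreover have "0 < sqrt (\<gamma> / 3) * (100 / 103)" using g by simp
    ultimately show ?thesis unfolding Y_def by (subst pos_le_divide_eq) simp_all
  qed
  \<comment> \<open>Chosen so that M \<le> B s in the range considered, by N \<le> 3/2 k \<le> 3/2 s
    / \<delta>.\<close>
  define B where "B = 3 / 2 / \<delta> + 1"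
  have B: "1 \<le> B" using d by (simp add: B_def)
  \<comment> \<open>The uncharged sums number about 2 M / E and cost at most exp Y each. With this
    \<open>E\<close> that is at most exp (s / 100), less than the saving exp (- s / 20) coming from
    (100/103)^(2 s).\<close>
  define E where "E = nat \<lceil>200 * B * Y\<rceil>"
  have BY: "1 \<le> B * Y" using mult_mono[of 1 B 1 Y] B Y by simp
  have EBY: "200 * B * Y \<le> real E" unfolding E_def by (rule real_nat_ceiling_ge)
  then have E: "1 \<le> E" using BY by linarith
  define D where "D = 16 * (real E)\<^sup>2 * ((2 * Y) ^ E)\<^sup>2"
  have "((\<lambda>x. exp (4 * x + (4 + K * x) * Y - \<delta> * x ^ 4 / 25)) \<longlongrightarrow> 0) at_top"
    using d K Y by real_asymp
  from tendsto_mult[OF tendsto_const[of D] this]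
  have "eventually (\<lambda>x. D * exp (4 * x + (4 + K * x) * Y - \<delta> * x ^ 4 / 25) < \<epsilon>) at_top"
    by (rule order_tendstoD(2)) (use eps in simp)
  then have ev: "eventually (\<lambda>n :: nat. D * exp (4 * ln (real n) + (4 + K * ln (real n)) * Y - \<delta> * ln (real n) ^ 4 / 25) < \<epsilon>) at_top"
    by (rule eventually_ln)
  show ?thesis using ev eventually_ge_at_top[of 2]
  proof eventually_elim
    case (elim n)
    show ?case
    proof (intro allI impI)
      fix lam k N M
      assume h: "2 + \<gamma> \<le> lam \<and> lam \<le> 3 \<and> 0 < k \<and> ln (real n) ^ 4 \<le> real k \<and> real N = lam * real k / 2 \<and> 0 < M \<and> M < int n
       \<and> \<delta> * real k + real N < real_of_int M + 1"
      define x where "x = ln (real n)"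
      have x: "0 \<le> x" "real n = exp x" using elim(2) by (simp_all add: x_def)
      define p where "p = 2 / lam"
      define q where "q = 1 - p"
      have lam: "2 + \<gamma> \<le> lam" "lam \<le> 3" "real N = lam * real k / 2" "0 < k" using h by auto
      note rf = ratio_facts[OF g(1) lam p_def]
      have q: "0 < q" "\<gamma> / 3 \<le> q" "q \<le> 1 / 3" using rf by (simp_all add: q_def)
      let ?C = "real (N choose k)"
      have dk: "0 < \<delta> * real k" using d lam by simp
      have NM: "N \<le> nat M" using dk h by linarith
      define s where "s = nat M + 1 - N"
      have s: "nat M + 1 = N + s" "\<delta> * real k \<le> real s"
      proof -
        show "nat M + 1 = N + s" using NM by (simp add: s_def)
        then have "real (nat M) + 1 = real N + real s" by linarith
        moreover have "real (nat M) = real_of_int M" using h by simp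
        ultimately show "\<delta> * real k \<le> real s" using h by linarith
      qed
      define j where "j = nat \<lceil>K * x\<rceil>"
      have j: "real j \<le> K * x + 1"
      proof -
        have "real j = of_int \<lceil>K * x\<rceil>" unfolding j_def using K x by simp
        then show ?thesis by linarith
      qed
      have MB: "real (nat M) \<le> B * real s"
      proof -
        have "real k \<le> real s / \<delta>" using s(2) d by (simp add: pos_le_divide_eq mult.commute)
        moreover have "real N \<le> 3 / 2 * real k" using rf(7) by linarith
        moreover have "B * real s = 3 / 2 * (real s / \<delta>) + real s" by (simp add: B_def distrib_right)
        ultimately show ?thesis using s(1) by linarith
      qed
      define \<theta> where "\<theta> = sqrt (1 - p) * (100 / 103)"
      define gg where "gg = sqrt (1 - p) * (103 / 100)"
      have th: "0 < \<theta>" "\<theta> \<le> 1" "1 / \<theta> \<le> Y"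
      proof -
        show "0 < \<theta>" using rf(2) by (simp add: \<theta>_def)
        show "\<theta> \<le> 1" using q mult_mono[of "sqrt q" 1 "100 / 103" 1] by (simp add: \<theta>_def q_def)
        show "1 / \<theta> \<le> Y" unfolding Y_def \<theta>_def q_def[symmetric] using q g by (intro sqrt_ratio_le) auto
      qed
      have gg: "0 \<le> 2 / gg" "2 / gg \<le> 2 * Y"
      proof -
        have "0 < gg" using rf(2) by (simp add: gg_def)
        then show "0 \<le> 2 / gg" by simp
        have "1 / gg \<le> 1 / \<theta>" unfolding gg_def \<theta>_def using rf(2) by (intro frac_le mult_left_mono) auto
        then show "2 / gg \<le> 2 * Y" using th(3) by linarith
      qed
      define m where "m = 1 + j + 2 * (nat M div E + 1)"
      have Ym: "(1 / \<theta>) ^ m \<le> exp ((4 + K * x) * Y + real s / 100)"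
      proof -
        have "1 / \<theta> \<le> exp Y" using th(3) exp_ge_add_one_self[of Y] by linarith
        then have "(1 / \<theta>) ^ m \<le> exp Y ^ m" using th by (intro power_mono) auto
        also have "\<dots> = exp (real m * Y)" by (simp only: exp_of_nat_mult)
        also have "\<dots> \<le> exp ((4 + K * x) * Y + real s / 100)"
        proof -
          have "real (nat M div E) * (100 * Y) \<le> real s / 2"
          proof -
            have "real (nat M div E) \<le> real (nat M) / real E" by (rule of_nat_div_le_of_nat)
            also have "\<dots> \<le> (B * real s) / (200 * B * Y)" using MB EBY B Y BY by (intro frac_le) auto
            also have "\<dots> = real s / (200 * Y)" using B Y by simp
            finally have "real (nat M div E) * (100 * Y) \<le> real s / (200 * Y) * (100 * Y)"
              using Y by (intro mult_right_mono) auto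
            also have "\<dots> = real s / 2" using Y by simp
            finally show ?thesis .
          qed
          moreover have "real m * Y = (3 + real j) * Y + 2 * (real (nat M div E) * Y)"
            by (simp add: m_def algebra_simps)
          moreover have "(3 + real j) * Y \<le> (4 + K * x) * Y" using j Y by (intro mult_right_mono) auto
          ultimately show ?thesis by simp
        qed
        finally show ?thesis .
      qed
      have mus: "((100 / 103 :: real)\<^sup>2) ^ s \<le> exp (- (real s / 20))"
      proof -
        have "(100 / 103 :: real)\<^sup>2 \<le> 1 + (- (1 / 20))" by (simp add: power2_eq_square)
        also have "\<dots> \<le> exp (- (1 / 20))" by (rule exp_ge_add_one_self)
        finally have "((100 / 103 :: real)\<^sup>2) ^ s \<le> exp (- (1 / 20)) ^ s" by (intro power_mono) auto
        also have "\<dots> = exp (real s * (- (1 / 20)))" by (simp only: exp_of_nat_mult)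
        finally show ?thesis by simp
      qed
      have thb: "\<theta> ^ (2 * s - m) * (1 / (1 - p)) ^ s \<le> exp ((4 + K * x) * Y - \<delta> * x ^ 4 / 25)"
      proof -
        have "\<theta> ^ (2 * s - m) * (1 / (1 - p)) ^ s \<le> \<theta> ^ (2 * s) * (1 / \<theta>) ^ m * (1 / (1 - p)) ^ s"
          using q by (intro mult_right_mono power_diff_le th) (use rf(2) in simp)
        also have "\<dots> = (\<theta> ^ (2 * s) * (1 / q) ^ s) * (1 / \<theta>) ^ m" by (simp only: mult_ac q_def)
        also have "\<theta> ^ (2 * s) * (1 / q) ^ s = ((100 / 103)\<^sup>2) ^ s"
          unfolding \<theta>_def q_def[symmetric] by (rule sqrt_power_cancel[OF q(1)])
        also have "\<dots> * (1 / \<theta>) ^ m \<le> exp (- (real s / 20)) * exp ((4 + K * x) * Y + real s / 100)"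
          using mus Ym th by (intro mult_mono) auto
        also have "\<dots> = exp ((4 + K * x) * Y - real s / 25)" by (simp flip: exp_add)
        also have "\<dots> \<le> exp ((4 + K * x) * Y - \<delta> * x ^ 4 / 25)"
        proof -
          have "\<delta> * x ^ 4 \<le> \<delta> * real k" using h d by (intro mult_left_mono) (auto simp: x_def)
          then show ?thesis using s(2) by simp
        qed
        finally show ?thesis .
      qed
      have n1: "real (n + 1) \<le> 2 * exp x" using elim(2) x(2) by linarith
      have cl: "real (card {A. config k N M A \<and> card (low M A \<inter> high M A) < j})
        \<le> (real ((nat M + 2) * E))\<^sup>2 * (\<theta> ^ (2 * s - m) * ((2 / gg) ^ E)\<^sup>2
        * (real (N + 1) * ?C) * (1 / (1 - p)) ^ s)"
        unfolding m_def
      proof (rule card_config_long)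
        show "M > 0" using h by simp
      qed (fact s(1) E rf(1,2,3,4) gg_def \<theta>_def)+
      have "real n * real (card {A. config k N M A \<and> card (low M A \<inter> high M A) < j})
        \<le> real n * ((real ((nat M + 2) * E))\<^sup>2 * (\<theta> ^ (2 * s - m) * ((2 / gg) ^ E)\<^sup>2
        * (real (N + 1) * ?C) * (1 / (1 - p)) ^ s))" using cl by (rule mult_left_mono) simp
      also have "\<dots> = real n * (real (nat M + 2) * real (nat M + 2) * real (N + 1)) * ((real E)\<^sup>2 * ((2 / gg) ^ E)\<^sup>2)
          * (\<theta> ^ (2 * s - m) * (1 / (1 - p)) ^ s) * ?C"
        by (simp only: of_nat_mult power_mult_distrib power2_eq_square mult_ac)
      also have "\<dots> \<le> 2 * exp x * (2 * exp x * (2 * exp x) * (2 * exp x)) * ((real E)\<^sup>2 * ((2 * Y) ^ E)\<^sup>2)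
          * exp ((4 + K * x) * Y - \<delta> * x ^ 4 / 25) * ?C"
      proof (intro mult_mono thb)
        have "nat M + 2 \<le> n + 1" "N + 1 \<le> n + 1" using h NM by linarith+
        then show "real (nat M + 2) \<le> 2 * exp x" "real (nat M + 2) \<le> 2 * exp x" "real (N + 1) \<le> 2 * exp x"
          using n1 by linarith+
        show "real n \<le> 2 * exp x" using n1 by linarith
        show "((2 / gg) ^ E)\<^sup>2 \<le> ((2 * Y) ^ E)\<^sup>2" using gg by (intro power_mono) auto
      qed (use q rf(2) Y th in \<open>auto simp: q_def\<close>)
      also have "2 * exp x * (2 * exp x * (2 * exp x) * (2 * exp x)) = 16 * exp (4 * x)"
      proof -
        have "exp (4 * x) = exp x ^ 4" using exp_of_nat_mult[of 4 x] by simp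
        then show ?thesis by (simp add: power4_eq_xxxx)
      qed
      also have "16 * exp (4 * x) * ((real E)\<^sup>2 * ((2 * Y) ^ E)\<^sup>2) * exp ((4 + K * x) * Y - \<delta> * x ^ 4 / 25) * ?C
         = D * (exp (4 * x) * exp ((4 + K * x) * Y - \<delta> * x ^ 4 / 25)) * ?C" by (simp only: D_def mult_ac)
      also have "exp (4 * x) * exp ((4 + K * x) * Y - \<delta> * x ^ 4 / 25) = exp (4 * x + (4 + K * x) * Y - \<delta> * x ^ 4 / 25)"
        by (simp flip: exp_add add: algebra_simps)
      also have "D * exp (4 * x + (4 + K * x) * Y - \<delta> * x ^ 4 / 25) * ?C \<le> \<epsilon> * ?C"
        using elim(1) by (intro mult_right_mono) (simp_all add: x_def)
      finally show "real n * real (card {A. config k N M A \<and> card (low M A \<inter> high M A) < nat \<lceil>K * ln (real n)\<rceil>}) \<le> \<epsilon> * ?C"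
        by (simp only: j_def x_def)
    qed
  qed
qed

text \<open>51 is 1 / (1 - 100/102).\<close>

lemma geometric_sum_le:
  assumes "finite S" "\<And>s. s \<in> S \<Longrightarrow> s0 \<le> s"
  shows "(\<Sum>s\<in>S. (100 / 102 :: real) ^ s) \<le> 51 * (100 / 102) ^ s0"
proof -
  let ?\<mu> = "100 / 102 :: real"
  obtain m where "\<forall>s\<in>S. s < m" using finite_nat_set_iff_bounded[of S] assms(1) by blast
  then have "S \<subseteq> {s0..<s0 + m}" using assms(2) by force
  then have "(\<Sum>s\<in>S. ?\<mu> ^ s) \<le> (\<Sum>s\<in>{s0..<s0 + m}. ?\<mu> ^ s)" by (intro sum_mono2) auto
  also have "\<dots> = 51 * ?\<mu> ^ s0 - 51 * ?\<mu> ^ (s0 + m)"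
  proof (induction m)
    case (Suc m)
    have "51 * \<mu> * x = 50 * x" if "\<mu> = ?\<mu>" for \<mu> x :: real using that by simp
    then have "51 * ?\<mu> ^ (s0 + Suc m) = 50 * ?\<mu> ^ (s0 + m)" by (simp only: add_Suc_right power_Suc mult.assoc)
    moreover have "(\<Sum>s\<in>{s0..<s0 + Suc m}. ?\<mu> ^ s) = (\<Sum>s\<in>{s0..<s0 + m}. ?\<mu> ^ s) + ?\<mu> ^ (s0 + m)"
      by (simp only: add_Suc_right sum.atLeastLessThan_Suc le_add1)
    ultimately show ?case using Suc.IH by (simp only:)
  qed simp
  also have "\<dots> \<le> 51 * ?\<mu> ^ s0" by simp
  finally show ?thesis .
qed

definition primitive_configs :: "nat \<Rightarrow> nat \<Rightarrow> int \<Rightarrow> int set set" where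
  "primitive_configs k N M = {A. config k N M A \<and> Gcd A = 1}"

lemma finite_primitive_configs: "finite (primitive_configs k N M)"
  unfolding primitive_configs_def by (rule finite_subset[OF _ finite_config]) auto

lemma card_primitive_configs_le:
  assumes "0 < M"
  shows "card (primitive_configs k N M) \<le> card {A. config k N M A}"
    "card (primitive_configs k N M) \<le> card (few k N j M) + card {A. config k N M A \<and> card (low M A \<inter> high M A) < j}"
proof -
  show "card (primitive_configs k N M) \<le> card {A. config k N M A}"
    unfolding primitive_configs_def by (rule card_mono[OF finite_config]) auto
  have "primitive_configs k N M \<subseteq> few k N j M \<union> {A. config k N M A \<and> card (low M A \<inter> high M A) < j}"
  proof
    fix A assume "A \<in> primitive_configs k N M"
    then have A: "config k N M A" "Gcd A = 1" by (auto simp: primitive_configs_def)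
    from sumset_counts(3)[OF A(1) assms] have "j \<le> card (low M A \<inter> high M A) \<Longrightarrow> psize M (wrap M A + A) + j \<le> nat M"
      by linarith
    then show "A \<in> few k N j M \<union> {A. config k N M A \<and> card (low M A \<inter> high M A) < j}"
      using A unfolding few_def by (cases "j \<le> card (low M A \<inter> high M A)") auto
  qed
  moreover have "finite (few k N j M \<union> {A. config k N M A \<and> card (low M A \<inter> high M A) < j})"
    unfolding few_def by (intro finite_UnI; rule finite_subset[OF _ finite_config]; auto)
  ultimately have "card (primitive_configs k N M) \<le> card (few k N j M \<union> {A. config k N M A \<and> card (low M A \<inter> high M A) < j})"
    by (intro card_mono)
  also have "\<dots> \<le> card (few k N j M) + card {A. config k N M A \<and> card (low M A \<inter> high M A) < j}" by (rule card_Un_le)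
  finally show "card (primitive_configs k N M) \<le> card (few k N j M) + card {A. config k N M A \<and> card (low M A \<inter> high M A) < j}" .
qed

text \<open>The constant must not depend on \<epsilon>. Since \<epsilon> < 1/2, log (1 / \<epsilon>)
  is at least log 2, so a fixed multiple of it also covers log K.\<close>

lemma decay_threshold:
  fixes K :: real
  assumes "0 < K"
  obtains C0 :: real where "0 < C0"
    "\<And>\<epsilon> s. 0 < \<epsilon> \<Longrightarrow> \<epsilon> < 1 / 2 \<Longrightarrow> C0 * ln (1 / \<epsilon>) \<le> real s \<Longrightarrow> K * (100 / 102) ^ s \<le> \<epsilon>"
proof -
  define c where "c = ln (102 / 100 :: real)"
  have c: "0 < c" by (simp add: c_def)
  define T where "T = max 0 (ln K) / ln 2"
  have T: "0 \<le> T" by (simp add: T_def)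
  define C0 where "C0 = (1 + T) / c"
  have "0 < C0" using c T by (simp add: C0_def)
  then show ?thesis
  proof (rule that)
    fix \<epsilon> :: real and s :: nat
    assume e: "0 < \<epsilon>" "\<epsilon> < 1 / 2" "C0 * ln (1 / \<epsilon>) \<le> real s"
    define L where "L = ln (1 / \<epsilon>)"
    have L2: "ln 2 \<le> L"
    proof -
      have "2 \<le> 1 / \<epsilon>" using e by (simp add: field_simps)
      then show ?thesis unfolding L_def by (intro ln_mono) auto
    qed
    have "(1 + T) * L \<le> real s * c" using e(3) c by (simp add: C0_def L_def pos_divide_le_eq)
    moreover have "ln K \<le> T * L"
    proof -
      have "ln K \<le> T * ln 2" by (simp add: T_def)
      also have "\<dots> \<le> T * L" using L2 T by (rule mult_left_mono)
      finally show ?thesis .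
    qed
    ultimately have "ln K - real s * c \<le> - L" by (simp add: distrib_right)
    then have "exp (ln K - real s * c) \<le> exp (- L)" by simp
    also have "exp (- L) = \<epsilon>" using e by (simp add: L_def ln_div)
    also have "exp (ln K - real s * c) = K * (100 / 102) ^ s"
    proof -
      have "(100 / 102 :: real) = exp (- c)" by (simp add: c_def exp_minus)
      then have "(100 / 102 :: real) ^ s = exp (real s * (- c))" by (simp only: exp_of_nat_mult)
      then show ?thesis using assms by (simp add: exp_diff exp_minus field_simps)
    qed
    finally show "K * (100 / 102) ^ s \<le> \<epsilon>" .
  qed
qed

text \<open>Lengths with s \<le> \<delta> k contribute \<epsilon> / 5 from the geometric series and
  \<epsilon> / 5 from the exponentially small errors; the at most \<open>n\<close> longer ones
  contribute \<epsilon> / 5 through \<open>few_total\<close> and \<open>long_total\<close>. The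
  target 2/3 leaves room for a later factor 3.\<close>

lemma config_total:
  fixes \<gamma> :: real
  assumes g: "0 < \<gamma>" "\<gamma> \<le> 1"
  obtains C0 :: real where "0 < C0"
    "\<And>lam \<epsilon> :: real. 2 + \<gamma> \<le> lam \<Longrightarrow> lam \<le> 3 \<Longrightarrow> 0 < \<epsilon> \<Longrightarrow> \<epsilon> < 1 / 2 \<Longrightarrow>
      eventually (\<lambda>n. \<forall>k N. ln (real n) ^ 4 \<le> real k \<and> real N = lam * real k / 2 \<longrightarrow>
        (\<Sum>s | C0 * ln (1 / \<epsilon>) < real s \<and> N + s \<le> n. real (card (primitive_configs k N (int (N + s) - 1)))) \<le> 2 / 3 * \<epsilon> * real (N choose k)) at_top"
proof -
  define \<delta> where "\<delta> = \<gamma> / 192"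
  have d: "0 < \<delta>" "\<delta> \<le> 1" using g by (simp_all add: \<delta>_def)
  obtain K where K: "0 < K" "\<And>lam k N M s. 2 + \<gamma> \<le> lam \<Longrightarrow> lam \<le> 3 \<Longrightarrow> real N = lam * real k / 2 \<Longrightarrow> 8 \<le> k \<Longrightarrow> 0 < M \<Longrightarrow>
       nat M + 1 = N + s \<Longrightarrow> 1 \<le> s \<Longrightarrow> real s \<le> \<gamma> / 192 * real k \<Longrightarrow>
       real (card {A. config k N M A})
         \<le> (K * (100 / 102) ^ s + 8 * (real k)\<^sup>2 * exp (1 / 4 - 3 / 64 * real k)) * real (N choose k)"
  proof (rule card_config_short_explicit[OF g], goal_cases)
    case (1 c)
    from 1(2,3) show ?thesis by (rule that)
  qed
  \<comment> \<open>255 = 5 * 51: the geometric series, at most 51 times its first term, shall stay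
    below \<epsilon> / 5.\<close>
  have K255: "0 < 255 * K" using K by simp
  obtain C0 where C0: "0 < C0" "\<And>\<epsilon> s. 0 < \<epsilon> \<Longrightarrow> \<epsilon> < 1 / 2 \<Longrightarrow> C0 * ln (1 / \<epsilon>) \<le> real s \<Longrightarrow> 255 * K * (100 / 102) ^ s \<le> \<epsilon>"
  proof (rule decay_threshold[OF K255], goal_cases)
    case (1 c)
    from 1(2,3) show ?thesis by (rule that)
  qed
  show ?thesis
  proof (rule that[OF C0(1)])
    fix lam \<epsilon> :: real
    assume lam: "2 + \<gamma> \<le> lam" "lam \<le> 3" and eps: "0 < \<epsilon>" "\<epsilon> < 1 / 2"
    have e10: "0 < \<epsilon> / 10" using eps by simp
    obtain K' where K': "0 < K'" and few: "eventually (\<lambda>n. \<forall>k N M. ln (real n) ^ 4 \<le> real k \<and> real N = lam * real k / 2 \<and> 0 < M \<and> M < int n \<longrightarrow>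
       real n * real (card (few k N (nat \<lceil>K' * ln (real n)\<rceil>) M)) \<le> \<epsilon> / 10 * real (N choose k)) at_top"
      by (rule few_total[OF g(1) lam e10])
    note long = long_total[OF g d(1) K' e10]
    have "((\<lambda>x::real. x * (8 * x\<^sup>2 * exp (1 / 4 - 3 / 64 * x))) \<longlongrightarrow> 0) at_top" by real_asymp
    then have "eventually (\<lambda>x::real. x * (8 * x\<^sup>2 * exp (1 / 4 - 3 / 64 * x)) < \<epsilon> / 5) at_top"
      by (rule order_tendstoD(2)) (use eps in simp)
    then obtain x0 where x0: "\<And>x. x0 \<le> x \<Longrightarrow> x * (8 * x\<^sup>2 * exp (1 / 4 - 3 / 64 * x)) < \<epsilon> / 5"
      unfolding eventually_at_top_linorder by blast
    have "eventually (\<lambda>x::real. x0 \<le> x ^ 4 \<and> 8 \<le> x ^ 4) at_top" by (intro eventually_conj) real_asymp+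
    then have ev2: "eventually (\<lambda>n :: nat. x0 \<le> ln (real n) ^ 4 \<and> 8 \<le> ln (real n) ^ 4) at_top" by (rule eventually_ln)
    show "eventually (\<lambda>n. \<forall>k N. ln (real n) ^ 4 \<le> real k \<and> real N = lam * real k / 2 \<longrightarrow>
        (\<Sum>s | C0 * ln (1 / \<epsilon>) < real s \<and> N + s \<le> n. real (card (primitive_configs k N (int (N + s) - 1)))) \<le> 2 / 3 * \<epsilon> * real (N choose k)) at_top"
      using few long ev2 eventually_gt_at_top[of 0]
    proof eventually_elim
      case (elim n)
      show ?case
      proof (intro allI impI)
        fix k N
        assume h: "ln (real n) ^ 4 \<le> real k \<and> real N = lam * real k / 2"
        have k: "8 \<le> k" "x0 \<le> real k" using elim(3) h by linarith+
        have k0: "0 < k" using k by simp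
        have N: "real N = lam * real k / 2" using h by simp
        note rf = ratio_facts[OF g(1) lam N k0 refl]
        let ?C = "real (N choose k)" and ?w = "\<lambda>s. real (card (primitive_configs k N (int (N + s) - 1)))"
        define L where "L = C0 * ln (1 / \<epsilon>)"
        have "0 < ln (1 / \<epsilon>)" using eps by simp
        then have L: "0 < L" using C0(1) by (simp add: L_def)
        define S where "S = {s. L < real s \<and> N + s \<le> n}"
        have S: "finite S" "S \<subseteq> {1..n}"
        proof -
          show "S \<subseteq> {1..n}"
          proof
            fix s assume "s \<in> S"
            then have "0 < s" "s \<le> n" using L by (auto simp: S_def)
            then show "s \<in> {1..n}" by simp
          qed
          then show "finite S" by (rule finite_subset) simp
        qed
        define S1 where "S1 = {s \<in> S. real s \<le> \<delta> * real k}"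
        define S2 where "S2 = {s \<in> S. \<not> real s \<le> \<delta> * real k}"
        have fin: "finite S1" "finite S2" using S by (simp_all add: S1_def S2_def)
        define f where "f = 8 * (real k)\<^sup>2 * exp (1 / 4 - 3 / 64 * real k)"
        have M: "0 < int (N + s) - 1" "nat (int (N + s) - 1) + 1 = N + s" "1 \<le> s" "N + s \<le> n" if "s \<in> S" for s
        proof -
          show s: "1 \<le> s" using that S by auto
          show "N + s \<le> n" using that by (simp add: S_def)
          show "0 < int (N + s) - 1" using s rf(6) by linarith
          show "nat (int (N + s) - 1) + 1 = N + s" using s by linarith
        qed
        have "(\<Sum>s\<in>S1. ?w s) \<le> (\<Sum>s\<in>S1. (K * (100 / 102) ^ s + f) * ?C)"
        proof (rule sum_mono)
          fix s assume "s \<in> S1"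
          then have s: "s \<in> S" "real s \<le> \<delta> * real k" by (auto simp: S1_def)
          have "?w s \<le> real (card {A. config k N (int (N + s) - 1) A})"
            using card_primitive_configs_le(1)[OF M(1)[OF s(1)]] by simp
          also have "\<dots> \<le> (K * (100 / 102) ^ s + f) * ?C"
            unfolding f_def by (rule K(2)[OF lam N k(1) M(1-3)[OF s(1)] s(2)[unfolded \<delta>_def]])
          finally show "?w s \<le> (K * (100 / 102) ^ s + f) * ?C" .
        qed
        also have "\<dots> = (K * (\<Sum>s\<in>S1. (100 / 102) ^ s) + real (card S1) * f) * ?C"
          by (simp add: sum_distrib_right[symmetric] sum.distrib sum_distrib_left)
        also have "\<dots> \<le> (\<epsilon> / 5 + \<epsilon> / 5) * ?C"
        proof (intro mult_right_mono add_mono)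
          define s0 where "s0 = nat \<lceil>L\<rceil>"
          have "s0 \<le> s" if "s \<in> S1" for s
          proof -
            have "L \<le> real s" using that by (simp add: S1_def S_def)
            then show ?thesis by (simp add: s0_def nat_le_iff ceiling_le_iff)
          qed
          then have "K * (\<Sum>s\<in>S1. (100 / 102) ^ s) \<le> K * (51 * (100 / 102) ^ s0)"
            using K(1) fin by (intro mult_left_mono geometric_sum_le) auto
          moreover have "255 * K * (100 / 102) ^ s0 \<le> \<epsilon>"
            by (rule C0(2)[OF eps]) (simp add: s0_def L_def real_nat_ceiling_ge)
          ultimately show "K * (\<Sum>s\<in>S1. (100 / 102) ^ s) \<le> \<epsilon> / 5" by simp
          have "S1 \<subseteq> {1..k}"
          proof
            fix s assume s: "s \<in> S1"
            then have "real s \<le> \<delta> * real k" by (simp add: S1_def)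
            also have "\<dots> \<le> 1 * real k" using d by (intro mult_right_mono) auto
            finally show "s \<in> {1..k}" using s S by (auto simp: S1_def)
          qed
          then have "card S1 \<le> card {1..k}" by (intro card_mono) auto
          then have "real (card S1) * f \<le> real k * f" by (intro mult_right_mono) (simp_all add: f_def)
          also have "\<dots> \<le> \<epsilon> / 5" using x0[OF k(2)] by (simp add: f_def)
          finally show "real (card S1) * f \<le> \<epsilon> / 5" .
        qed simp
        finally have b1: "(\<Sum>s\<in>S1. ?w s) \<le> (\<epsilon> / 5 + \<epsilon> / 5) * ?C" .
        have "real n * (\<Sum>s\<in>S2. ?w s) \<le> (\<Sum>s\<in>S2. \<epsilon> / 5 * ?C)"
          unfolding sum_distrib_left
        proof (rule sum_mono)
          fix s assume "s \<in> S2"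
          then have s: "s \<in> S" "\<delta> * real k < real s" by (auto simp: S2_def)
          let ?M = "int (N + s) - 1" and ?j = "nat \<lceil>K' * ln (real n)\<rceil>"
          have Mn: "?M < int n" using M(4)[OF s(1)] by linarith
          have "?w s \<le> real (card (few k N ?j ?M)) + real (card {A. config k N ?M A \<and> card (low ?M A \<inter> high ?M A) < ?j})"
            using card_primitive_configs_le(2)[OF M(1)[OF s(1)], of k N ?j] by linarith
          then have "real n * ?w s \<le> real n * (real (card (few k N ?j ?M)) + real (card {A. config k N ?M A \<and> card (low ?M A \<inter> high ?M A) < ?j}))"
            by (rule mult_left_mono) simp
          also have "\<dots> = real n * real (card (few k N ?j ?M)) + real n * real (card {A. config k N ?M A \<and> card (low ?M A \<inter> high ?M A) < ?j})"
            by (rule distrib_left)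
          also have "\<dots> \<le> \<epsilon> / 10 * ?C + \<epsilon> / 10 * ?C"
          proof (rule add_mono)
            show "real n * real (card (few k N ?j ?M)) \<le> \<epsilon> / 10 * ?C"
              using elim(1)[rule_format, of k N ?M] h M(1)[OF s(1)] Mn by blast
            have "\<delta> * real k + real N < real_of_int ?M + 1" using s(2) by simp
            then show "real n * real (card {A. config k N ?M A \<and> card (low ?M A \<inter> high ?M A) < ?j}) \<le> \<epsilon> / 10 * ?C"
              using elim(2)[rule_format, of lam k N ?M] h lam k0 M(1)[OF s(1)] Mn by blast
          qed
          finally show "real n * ?w s \<le> \<epsilon> / 5 * ?C" by simp
        qed
        also have "\<dots> = real (card S2) * (\<epsilon> / 5 * ?C)" by simp
        also have "\<dots> \<le> real n * (\<epsilon> / 5 * ?C)"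
        proof (rule mult_right_mono)
          have "card S2 \<le> card {1..n}" using S by (intro card_mono) (auto simp: S2_def)
          then show "real (card S2) \<le> real n" by simp
        qed (use eps in simp)
        finally have b2: "(\<Sum>s\<in>S2. ?w s) \<le> \<epsilon> / 5 * ?C" using elim(4) by (simp only: mult_le_cancel_left of_nat_0_less_iff)
        have "S = S1 \<union> S2" "S1 \<inter> S2 = {}" by (auto simp: S1_def S2_def)
        then have "(\<Sum>s\<in>S. ?w s) = (\<Sum>s\<in>S1. ?w s) + (\<Sum>s\<in>S2. ?w s)" using fin by (simp add: sum.union_disjoint)
        also have "\<dots> \<le> (\<epsilon> / 5 + \<epsilon> / 5) * ?C + \<epsilon> / 5 * ?C" using b1 b2 by (rule add_mono)
        also have "\<dots> = 3 / 5 * (\<epsilon> * ?C)" by (simp add: algebra_simps)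
        also have "\<dots> \<le> 2 / 3 * (\<epsilon> * ?C)" using eps by (intro mult_right_mono) auto
        finally show "(\<Sum>s | C0 * ln (1 / \<epsilon>) < real s \<and> N + s \<le> n. ?w s) \<le> 2 / 3 * \<epsilon> * ?C"
          by (simp add: S_def L_def)
      qed
    qed
  qed
qed

section \<open>Normalisation\<close>

definition dilate :: "int \<Rightarrow> int \<Rightarrow> int set \<Rightarrow> int set" where
  "dilate a d X = (\<lambda>x. a + d * x) ` X"

lemma dilate_plus: "dilate a d X + dilate a d X = dilate (2 * a) d (X + X)"
proof (rule set_eqI, rule iffI)
  fix z assume "z \<in> dilate a d X + dilate a d X"
  then obtain x y where "x \<in> X" "y \<in> X" "z = (a + d * x) + (a + d * y)"
    unfolding dilate_def set_plus_def by blast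
  then have "z = 2 * a + d * (x + y)" "x + y \<in> X + X" by (simp_all add: algebra_simps set_plus_intro)
  then show "z \<in> dilate (2 * a) d (X + X)" unfolding dilate_def by blast
next
  fix z assume "z \<in> dilate (2 * a) d (X + X)"
  then obtain x y where xy: "x \<in> X" "y \<in> X" "z = 2 * a + d * (x + y)"
    unfolding dilate_def set_plus_def by blast
  have "a + d * x \<in> dilate a d X" "a + d * y \<in> dilate a d X" using xy unfolding dilate_def by blast+
  then have "(a + d * x) + (a + d * y) \<in> dilate a d X + dilate a d X" by (rule set_plus_intro)
  also have "(a + d * x) + (a + d * y) = z" using xy by (simp add: algebra_simps)
  finally show "z \<in> dilate a d X + dilate a d X" .
qed

lemma inj_dilate:
  fixes a d :: int
  assumes "1 \<le> d"
  shows "inj (\<lambda>x. a + d * x)"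
  using assms by (intro injI) auto

lemma card_dilate:
  assumes "1 \<le> d"
  shows "card (dilate a d X) = card X" "card (dilate a d X + dilate a d X) = card (X + X)"
  unfolding dilate_plus unfolding dilate_def
  by (intro card_image inj_on_subset[OF inj_dilate[OF assms]] subset_UNIV)+

text \<open>Subtract the minimum and divide by the gcd of the differences.\<close>

lemma family_normal_form:
  assumes A: "A \<in> small_sumset_family n k lam" and k: "2 \<le> k" and N: "real N = lam * real k / 2"
  shows "\<exists>a d M A'. 1 \<le> a \<and> 1 \<le> d \<and> 0 < M \<and> a + d * M \<le> int n \<and> A' \<in> primitive_configs k N M \<and> A = dilate a d A'"
proof -
  have A': "A \<subseteq> {1..int n}" "card A = k" "real (card (A + A)) \<le> lam * real k"
    using A by (auto simp: small_sumset_family_def)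
  have fin: "finite A" and ne: "A \<noteq> {}" using A' k by (auto intro: card_ge_0_finite)
  define a where "a = Min A"
  define b where "b = Max A"
  have aA: "a \<in> A" "b \<in> A" using fin ne by (simp_all add: a_def b_def)
  have ab: "a \<le> x" "x \<le> b" if "x \<in> A" for x using that fin by (simp_all add: a_def b_def)
  have "a \<noteq> b"
  proof
    assume "a = b"
    then have "A \<subseteq> {a}" using ab by force
    then have "card A \<le> card {a}" by (intro card_mono) auto
    then show False using A' k by simp
  qed
  then have lt: "a < b" using ab(1)[OF aA(2)] by simp
  define X where "X = (\<lambda>x. x - a) ` A"
  define d where "d = Gcd X"
  have dX: "d dvd x - a" if "x \<in> A" for x unfolding d_def X_def using that by (intro Gcd_dvd) auto
  have "d \<noteq> 0"
  proof
    assume "d = 0"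
    then have "b - a = 0" using dX[OF aA(2)] by simp
    then show False using lt by simp
  qed
  moreover have "0 \<le> d" unfolding d_def by simp
  ultimately have d: "1 \<le> d" by simp
  define A1 where "A1 = (\<lambda>x. (x - a) div d) ` A"
  define M where "M = (b - a) div d"
  have val: "a + d * ((x - a) div d) = x" if "x \<in> A" for x using dX[OF that] by simp
  have AA1: "A = dilate a d A1"
  proof -
    have "dilate a d A1 = (\<lambda>x. a + d * ((x - a) div d)) ` A" by (simp only: dilate_def A1_def image_image)
    also have "\<dots> = (\<lambda>x. x) ` A" using val by (intro image_cong) auto
    finally show ?thesis by simp
  qed
  have "a + d * M = b" unfolding M_def by (rule val[OF aA(2)])
  moreover have M0: "0 < M"
  proof (rule ccontr)
    assume "\<not> 0 < M"
    then have "d * M \<le> 0" using d by (simp add: mult_nonneg_nonpos)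
    then show False using \<open>a + d * M = b\<close> lt by simp
  qed
  moreover have "config k N M A1"
    unfolding config_def
  proof (intro conjI)
    show "A1 \<subseteq> {0..M}"
    proof
      fix y assume "y \<in> A1"
      then obtain x where x: "x \<in> A" "y = (x - a) div d" by (auto simp: A1_def)
      have "0 \<le> y" unfolding x(2) using ab(1)[OF x(1)] d by (intro div_int_pos_iff[THEN iffD2]) auto
      moreover have "y \<le> M" unfolding x(2) M_def using ab(2)[OF x(1)] d by (intro zdiv_mono1) auto
      ultimately show "y \<in> {0..M}" by simp
    qed
    have "(a - a) div d \<in> A1" unfolding A1_def using aA(1) by (rule imageI)
    then show "0 \<in> A1" by simp
    show "M \<in> A1" unfolding A1_def M_def using aA(2) by (rule imageI)
    show "card A1 = k" using A'(2) card_dilate(1)[OF d, of a A1] AA1 by simp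
    have "card (A + A) = card (A1 + A1)" using card_dilate(2)[OF d, of a A1] AA1 by simp
    then show "card (A1 + A1) \<le> 2 * N" using A'(3) N by linarith
  qed
  moreover have "Gcd A1 = 1"
  proof -
    have "X = (*) d ` A1"
    proof -
      have "(*) d ` A1 = (\<lambda>x. d * ((x - a) div d)) ` A" by (simp only: A1_def image_image)
      also have "\<dots> = X" unfolding X_def using dX by (intro image_cong) auto
      finally show ?thesis by simp
    qed
    then have "Gcd X = normalize (d * Gcd A1)" by (simp add: Gcd_mult)
    then have "d = d * Gcd A1" using d by (simp add: d_def[symmetric] abs_mult)
    then show ?thesis using d by simp
  qed
  moreover have "1 \<le> a" "b \<le> int n" using A'(1) aA by auto
  ultimately show ?thesis using d AA1 unfolding primitive_configs_def by blast
qed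

section \<open>Counting progressions in [n] and the sets they contain\<close>

definition steps :: "nat \<Rightarrow> int \<Rightarrow> (int \<times> int) set" where
  "steps n M = {(a, d). 1 \<le> a \<and> 1 \<le> d \<and> a + d * M \<le> int n}"

lemma steps_antimono:
  assumes "M \<le> M'"
  shows "steps n M' \<subseteq> steps n M"
proof
  fix z assume "z \<in> steps n M'"
  then obtain a d where z: "z = (a, d)" "1 \<le> a" "1 \<le> d" "a + d * M' \<le> int n" by (auto simp: steps_def)
  have "d * M \<le> d * M'" using z assms by (intro mult_left_mono) auto
  then have "a + d * M \<le> int n" using z(4) by linarith
  then show "z \<in> steps n M" using z by (simp add: steps_def)
qed

lemma finite_steps:
  assumes "1 \<le> M"
  shows "finite (steps n M)"
proof (rule finite_subset)
  show "steps n M \<subseteq> {1..int n} \<times> {1..int n}"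
  proof
    fix z assume "z \<in> steps n M"
    then obtain a d where z: "z = (a, d)" "1 \<le> a" "1 \<le> d" "a + d * M \<le> int n" by (auto simp: steps_def)
    have "d * 1 \<le> d * M" using z assms by (intro mult_left_mono) auto
    then have "d \<le> d * M" by simp
    then have "a \<le> int n" "d \<le> int n" using z by linarith+
    then show "z \<in> {1..int n} \<times> {1..int n}" using z by simp
  qed
qed simp

lemma finite_family: "finite (small_sumset_family n k lam)"
  unfolding small_sumset_family_def by (rule finite_subset[of _ "Pow {1..int n}"]) auto

text \<open>Both ends are prescribed so that a dilate of \<open>X\<close> determines its progression
  by its minimum and maximum; no set is then counted twice.\<close>

definition end_sets :: "nat \<Rightarrow> nat \<Rightarrow> int set set" where
  "end_sets k N = {X. X \<subseteq> {0..int N - 1} \<and> 0 \<in> X \<and> int N - 1 \<in> X \<and> card X = k}"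

lemma card_end_sets:
  assumes "2 \<le> k" "2 \<le> N"
  shows "(N - 2) choose (k - 2) \<le> card (end_sets k N)"
proof -
  let ?D = "{X. X \<subseteq> {1..int N - 2} \<and> card X = k - 2}" and ?f = "\<lambda>X. insert 0 (insert (int N - 1) X)"
  have D: "0 \<notin> X" "int N - 1 \<notin> X" "finite X" "X \<subseteq> {1..int N - 2}" "card X = k - 2" if "X \<in> ?D" for X
    using that by (auto intro: finite_subset)
  have "(N - 2) choose (k - 2) = card ?D"
  proof -
    have "card {1..int N - 2} = N - 2" using assms by simp
    then show ?thesis using n_subsets[of "{1..int N - 2}" "k - 2"] by simp
  qed
  also have "\<dots> = card (?f ` ?D)"
  proof (rule card_image[symmetric], rule inj_onI)
    fix X Y assume X: "X \<in> ?D" and Y: "Y \<in> ?D" and e: "?f X = ?f Y"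
    have "X = ?f X - {0, int N - 1}" using D(1,2)[OF X] by blast
    also have "\<dots> = ?f Y - {0, int N - 1}" by (simp only: e)
    also have "\<dots> = Y" using D(1,2)[OF Y] by blast
    finally show "X = Y" .
  qed
  also have "\<dots> \<le> card (end_sets k N)"
  proof (rule card_mono)
    show "finite (end_sets k N)" unfolding end_sets_def by (rule finite_subset[of _ "Pow {0..int N - 1}"]) auto
    show "?f ` ?D \<subseteq> end_sets k N"
    proof
      fix Z assume "Z \<in> ?f ` ?D"
      then obtain X where X: "X \<in> ?D" and Z: "Z = ?f X" by blast
      note DX = D[OF X]
      have "0 \<noteq> int N - 1" using assms by simp
      then have "card Z = Suc (Suc (card X))" unfolding Z using DX(1-3) by simp
      then have "card Z = k" using DX(5) assms by simp
      moreover have "Z \<subseteq> {0..int N - 1}" unfolding Z using DX(4) assms by auto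
      ultimately show "Z \<in> end_sets k N" unfolding end_sets_def Z by simp
    qed
  qed
  finally show ?thesis .
qed

text \<open>A set inside a progression of length \<open>N\<close> has at most 2 N - 1 sums, so all
  dilates of \<open>end_sets\<close> belong to the family. They are distinct, since minimum and
  maximum recover \<open>a\<close> and \<open>d\<close>.\<close>

lemma card_family_ge:
  assumes k: "2 \<le> k" and N: "real N = lam * real k / 2" "k < N"
  shows "card (steps n (int N - 1)) * ((N - 2) choose (k - 2)) \<le> card (small_sumset_family n k lam)"
proof -
  let ?f = "\<lambda>((a, d), X). dilate a d X" and ?D = "steps n (int N - 1) \<times> end_sets k N"
  have ext: "Min (dilate a d X) = a" "Max (dilate a d X) = a + d * (int N - 1)" "finite X"
    if "1 \<le> d" "X \<in> end_sets k N" for a d X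
  proof -
    have X: "X \<subseteq> {0..int N - 1}" "0 \<in> X" "int N - 1 \<in> X" using that by (auto simp: end_sets_def)
    show finX: "finite X" using X(1) by (rule finite_subset) simp
    have fin: "finite (dilate a d X)" using finX by (simp add: dilate_def)
    show "Min (dilate a d X) = a"
    proof (rule Min_eqI[OF fin])
      fix y assume "y \<in> dilate a d X"
      then obtain x where "x \<in> X" "y = a + d * x" by (auto simp: dilate_def)
      then show "a \<le> y" using X(1) that(1) by auto
    next
      have "a + d * 0 \<in> dilate a d X" unfolding dilate_def using X(2) by (rule imageI)
      then show "a \<in> dilate a d X" by simp
    qed
    show "Max (dilate a d X) = a + d * (int N - 1)"
    proof (rule Max_eqI[OF fin])
      fix y assume "y \<in> dilate a d X"
      then obtain x where x: "x \<in> X" "y = a + d * x" by (auto simp: dilate_def)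
      have "d * x \<le> d * (int N - 1)" using X(1) x(1) that(1) by (intro mult_left_mono) auto
      then show "y \<le> a + d * (int N - 1)" using x by simp
    next
      show "a + d * (int N - 1) \<in> dilate a d X" unfolding dilate_def using X(3) by (rule imageI)
    qed
  qed
  have inj: "inj_on ?f ?D"
  proof (rule inj_onI)
    fix z z' assume z: "z \<in> ?D" "z' \<in> ?D" "?f z = ?f z'"
    obtain a d X a' d' X' where zz: "z = ((a, d), X)" "z' = ((a', d'), X')" by (metis surj_pair)
    have d: "1 \<le> d" "1 \<le> d'" and X: "X \<in> end_sets k N" "X' \<in> end_sets k N" and e: "dilate a d X = dilate a' d' X'"
      using z by (auto simp: zz steps_def)
    have a: "a = a'" using ext(1)[OF d(1) X(1), of a] ext(1)[OF d(2) X(2), of a'] e by simp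
    have "a + d * (int N - 1) = a' + d' * (int N - 1)"
      using ext(2)[OF d(1) X(1), of a] ext(2)[OF d(2) X(2), of a'] e by simp
    then have dd: "d = d'" using a N k by simp
    have "X = X'" using e inj_image_eq_iff[OF inj_dilate[OF d(1), of a], of X X'] unfolding a dd dilate_def by simp
    then show "z = z'" using a dd by (simp add: zz)
  qed
  have sub: "?f ` ?D \<subseteq> small_sumset_family n k lam"
  proof
    fix Z assume "Z \<in> ?f ` ?D"
    then obtain a d X where Z: "Z = dilate a d X" and ad: "(a, d) \<in> steps n (int N - 1)" and X: "X \<in> end_sets k N" by auto
    have ad': "1 \<le> a" "1 \<le> d" "a + d * (int N - 1) \<le> int n" using ad by (auto simp: steps_def)
    have X': "X \<subseteq> {0..int N - 1}" "card X = k" using X by (auto simp: end_sets_def)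
    have "Z \<subseteq> {1..int n}"
    proof
      fix y assume y: "y \<in> Z"
      have finZ: "finite Z" unfolding Z dilate_def using ext(3)[OF ad'(2) X] by simp
      have "Min Z \<le> y" "y \<le> Max Z" using y finZ by simp_all
      then show "y \<in> {1..int n}" using ext(1,2)[OF ad'(2) X, of a] ad' unfolding Z by simp
    qed
    moreover have "card Z = k" unfolding Z using card_dilate(1)[OF ad'(2)] X'(2) by simp
    moreover have "real (card (Z + Z)) \<le> lam * real k"
    proof -
      have "X + X \<subseteq> {0..2 * int N - 2}"
      proof
        fix y assume "y \<in> X + X"
        then obtain u v where uv: "u \<in> X" "v \<in> X" "y = u + v" by (rule set_plus_elim)
        then have "u \<in> {0..int N - 1}" "v \<in> {0..int N - 1}" using X'(1) by blast+
        then show "y \<in> {0..2 * int N - 2}" using uv(3) by simp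
      qed
      then have "card (X + X) \<le> card {0..2 * int N - 2}" by (intro card_mono) auto
      also have "\<dots> \<le> 2 * N" by simp
      finally have "card (Z + Z) \<le> 2 * N" unfolding Z card_dilate(2)[OF ad'(2)] .
      then show ?thesis using N by linarith
    qed
    ultimately show "Z \<in> small_sumset_family n k lam" by (simp add: small_sumset_family_def)
  qed
  have "card (steps n (int N - 1)) * ((N - 2) choose (k - 2)) \<le> card (steps n (int N - 1)) * card (end_sets k N)"
    using card_end_sets[OF k] N k by (intro mult_left_mono) auto
  also have "\<dots> = card (?f ` ?D)" using inj by (simp add: card_image card_cartesian_product)
  also have "\<dots> \<le> card (small_sumset_family n k lam)" by (rule card_mono[OF finite_family sub])
  finally show ?thesis .
qed

text \<open>The price of prescribing the two ends: the ratio is N (N - 1) / (k (k - 1)), and 3 is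
  attained at k = 2, N = 3.\<close>

lemma choose_le_three:
  assumes "2 \<le> k" "k < N" "2 * N \<le> 3 * k"
  shows "real (N choose k) \<le> 3 * real ((N - 2) choose (k - 2))"
proof -
  obtain k' N' where kN: "k = Suc (Suc k')" "N = Suc (Suc N')"
    using assms by (metis Suc_le_D numeral_2_eq_2 less_imp_le_nat order_trans Suc_le_mono)
  define C2 where "C2 = real (N' choose k')"
  have a1: "real (Suc k') * real (Suc N' choose Suc k') = real (Suc N') * C2"
    unfolding C2_def using Suc_times_binomial[of k' N'] by (simp only: of_nat_mult[symmetric])
  have a2: "real (Suc (Suc k')) * real (N choose k) = real (Suc (Suc N')) * real (Suc N' choose Suc k')"
    unfolding kN using Suc_times_binomial[of "Suc k'" "Suc N'"] by (simp only: of_nat_mult[symmetric])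
  have "real (Suc k') * real (Suc (Suc k')) * real (N choose k) = real (Suc k') * (real (Suc (Suc k')) * real (N choose k))"
    by (rule mult.assoc)
  also have "\<dots> = real (Suc (Suc N')) * (real (Suc k') * real (Suc N' choose Suc k'))" unfolding a2 by (simp only: mult_ac)
  also have "\<dots> = real (Suc (Suc N')) * real (Suc N') * C2" unfolding a1 by (simp only: mult_ac)
  also have "\<dots> \<le> 3 * (real (Suc k') * real (Suc (Suc k'))) * C2"
  proof (rule mult_right_mono)
    have "2 * N' \<le> 3 * k' + 2" using assms(3) by (simp add: kN)
    then have "2 * real N' \<le> 3 * real k' + 2" by linarith
    then have n: "real N' \<le> 3 / 2 * real k' + 1" by linarith
    have "real (Suc (Suc N')) * real (Suc N') \<le> (3 / 2 * real k' + 3) * (3 / 2 * real k' + 2)"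
      using n by (intro mult_mono) auto
    also have "\<dots> = 3 * ((real k' + 1) * (real k' + 2)) - (3 / 4 * (real k' * real k') + 3 / 2 * real k')"
      by (simp add: algebra_simps)
    also have "\<dots> \<le> 3 * ((real k' + 1) * (real k' + 2))"
    proof -
      have "0 \<le> real k' * real k'" "0 \<le> real k'" by simp_all
      then show ?thesis by linarith
    qed
    also have "real k' + 1 = real (Suc k')" by simp
    also have "real k' + 2 = real (Suc (Suc k'))" by simp
    finally show "real (Suc (Suc N')) * real (Suc N') \<le> 3 * (real (Suc k') * real (Suc (Suc k')))" .
  qed (simp add: C2_def)
  finally have "real (Suc k') * real (Suc (Suc k')) * real (N choose k) \<le> real (Suc k') * real (Suc (Suc k')) * (3 * C2)"
    by (simp only: mult_ac)
  then have "real (N choose k) \<le> 3 * C2" by (rule mult_left_le_imp_le) simp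
  then show ?thesis by (simp add: kN C2_def)
qed

text \<open>A set outside \<open>G\<close> has M + 1 > N + L in its normal form, so it is a dilate
  of a primitive configuration of some excess s > L, with at most as many positions as progressions
  of length \<open>N\<close> have. The 3 of \<open>choose_le_three\<close> turns 2/3 into 2.\<close>

lemma family_bad_le:
  fixes C0 \<epsilon> :: real
  assumes k: "2 \<le> k" and N: "real N = lam * real k / 2" "k < N" "2 * N \<le> 3 * k" and L: "0 < L" and eps: "0 \<le> \<epsilon>"
    and tot: "(\<Sum>s | L < real s \<and> N + s \<le> n. real (card (primitive_configs k N (int (N + s) - 1)))) \<le> 2 / 3 * \<epsilon> * real (N choose k)"
  defines "G \<equiv> {A. \<exists>P. arith_progression P \<and> A \<subseteq> P \<and> real (card P) \<le> lam * real k / 2 + L}"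
  shows "real (card (small_sumset_family n k lam - G)) \<le> 2 * \<epsilon> * real (card (small_sumset_family n k lam))"
proof -
  let ?F = "small_sumset_family n k lam" and ?M = "\<lambda>s. int (N + s) - 1"
  define S where "S = {s. L < real s \<and> N + s \<le> n}"
  define W where "W s = (\<lambda>((a, d), X). dilate a d X) ` (steps n (?M s) \<times> primitive_configs k N (?M s))" for s
  have finS: "finite S" by (rule finite_subset[of _ "{..n}"]) (auto simp: S_def)
  have fins: "finite (steps n (?M s) \<times> primitive_configs k N (?M s))" for s
    using N k by (intro finite_cartesian_product finite_steps finite_primitive_configs) linarith
  have "?F - G \<subseteq> (\<Union>s\<in>S. W s)"
  proof
    fix A assume A: "A \<in> ?F - G"
    then have "A \<in> ?F" by simp
    from family_normal_form[OF this k N(1)] obtain a d M A'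
      where nf: "1 \<le> a" "1 \<le> d" "0 < M" "a + d * M \<le> int n" "A' \<in> primitive_configs k N M" "A = dilate a d A'" by blast
    have A': "A' \<subseteq> {0..M}" using nf(5) by (simp add: primitive_configs_def config_def)
    have "lam * real k / 2 + L < real_of_int M + 1"
    proof (rule ccontr)
      assume le: "\<not> lam * real k / 2 + L < real_of_int M + 1"
      define P where "P = (\<lambda>i. a + int i * d) ` {..<nat M + 1}"
      have "arith_progression P" unfolding arith_progression_def P_def using nf(2) by (intro exI[of _ a] exI[of _ d] exI[of _ "nat M + 1"]) simp
      moreover have "A \<subseteq> P"
      proof
        fix y assume "y \<in> A"
        then obtain x where x: "x \<in> A'" "y = a + d * x" by (auto simp: nf(6) dilate_def)
        then have "0 \<le> x" "x \<le> M" using A' by auto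
        then have "y = a + int (nat x) * d" "nat x \<in> {..<nat M + 1}" using x by auto
        then show "y \<in> P" unfolding P_def by blast
      qed
      moreover have "real (card P) \<le> lam * real k / 2 + L"
      proof -
        have "card P \<le> nat M + 1" unfolding P_def using card_image_le[of "{..<nat M + 1}" "\<lambda>i. a + int i * d"] by simp
        then have "real (card P) \<le> real_of_int M + 1" using nf(3) by linarith
        then show ?thesis using le by linarith
      qed
      ultimately have "A \<in> G" unfolding G_def by blast
      then show False using A by simp
    qed
    then have MN: "real N + L < real_of_int M + 1" using N(1) by simp
    define s where "s = nat (M + 1 - int N)"
    have NM: "int N < M + 1" using MN L by linarith
    have s: "M = ?M s" using NM by (simp add: s_def)
    have "L < real s" using MN NM by (simp add: s_def)
    moreover have "N + s \<le> n"
    proof -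
      have "1 * M \<le> d * M" using nf by (intro mult_right_mono) auto
      then have "M + 1 \<le> int n" using nf by linarith
      then show ?thesis using s by linarith
    qed
    moreover have "A \<in> W s"
    proof -
      have "((a, d), A') \<in> steps n (?M s) \<times> primitive_configs k N (?M s)" unfolding s[symmetric] using nf by (simp add: steps_def)
      then show ?thesis unfolding W_def by (rule rev_image_eqI) (simp add: nf(6))
    qed
    ultimately show "A \<in> (\<Union>s\<in>S. W s)" unfolding S_def by blast
  qed
  then have "card (?F - G) \<le> card (\<Union>s\<in>S. W s)"
    using finS fins by (intro card_mono finite_UN_I) (auto simp: W_def)
  also have "\<dots> \<le> (\<Sum>s\<in>S. card (W s))" by (rule card_UN_le[OF finS])
  also have "\<dots> \<le> (\<Sum>s\<in>S. card (steps n (int N - 1)) * card (primitive_configs k N (?M s)))"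
  proof (rule sum_mono)
    fix s assume "s \<in> S"
    have "card (W s) \<le> card (steps n (?M s) \<times> primitive_configs k N (?M s))"
      unfolding W_def by (rule card_image_le[OF fins])
    also have "\<dots> = card (steps n (?M s)) * card (primitive_configs k N (?M s))" by (rule card_cartesian_product)
    also have "\<dots> \<le> card (steps n (int N - 1)) * card (primitive_configs k N (?M s))"
      using N k by (intro mult_right_mono card_mono finite_steps steps_antimono) linarith+
    finally show "card (W s) \<le> card (steps n (int N - 1)) * card (primitive_configs k N (?M s))" .
  qed
  finally have "real (card (?F - G)) \<le> real (\<Sum>s\<in>S. card (steps n (int N - 1)) * card (primitive_configs k N (?M s)))"
    by (simp only: of_nat_le_iff)
  also have "\<dots> = real (card (steps n (int N - 1))) * (\<Sum>s\<in>S. real (card (primitive_configs k N (?M s))))"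
    by (simp add: sum_distrib_left)
  also have "\<dots> \<le> real (card (steps n (int N - 1))) * (2 / 3 * \<epsilon> * real (N choose k))"
    using tot by (intro mult_left_mono) (simp_all add: S_def)
  also have "\<dots> \<le> real (card (steps n (int N - 1))) * (2 / 3 * \<epsilon> * (3 * real ((N - 2) choose (k - 2))))"
    using eps choose_le_three[OF k N(2,3)] by (intro mult_left_mono) auto
  also have "\<dots> = 2 * \<epsilon> * real (card (steps n (int N - 1)) * ((N - 2) choose (k - 2)))" by simp
  also have "\<dots> \<le> 2 * \<epsilon> * real (card ?F)"
    using card_family_ge[OF k N(1,2), of n] eps by (intro mult_left_mono) (simp_all only: of_nat_le_iff mult_nonneg_nonneg zero_le_numeral)
  finally show ?thesis .
qed

theorem theorem9p3:
  shows "\<forall>\<gamma>::real. \<gamma> > 0 \<longrightarrow> (\<exists>C::real. C > 0 \<and>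
    (\<forall>(lam::real) (\<epsilon>::real). 2 + \<gamma> \<le> lam \<and> lam \<le> 3 \<and> \<epsilon> > 0 \<longrightarrow>
      (\<exists>n0::nat. \<forall>n\<ge>n0. \<forall>k::nat.
         real k \<ge> (ln (real n)) ^ 4 \<and> lam * real k / 2 \<in> \<int> \<and> small_sumset_family n k lam \<noteq> {} \<longrightarrow>
         measure_pmf.prob (pmf_of_set (small_sumset_family n k lam))
           {A. \<exists>P. arith_progression P \<and> A \<subseteq> P \<and>
                   real (card P) \<le> lam * real k / 2 + C * ln (1 / \<epsilon>)}
         \<ge> 1 - 2 * \<epsilon>)))"
proof (intro allI impI)
  fix \<gamma> :: real assume g: "\<gamma> > 0"
  show "\<exists>C::real. C > 0 \<and>
    (\<forall>(lam::real) (\<epsilon>::real). 2 + \<gamma> \<le> lam \<and> lam \<le> 3 \<and> \<epsilon> > 0 \<longrightarrow>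
      (\<exists>n0::nat. \<forall>n\<ge>n0. \<forall>k::nat.
         real k \<ge> (ln (real n)) ^ 4 \<and> lam * real k / 2 \<in> \<int> \<and> small_sumset_family n k lam \<noteq> {} \<longrightarrow>
         measure_pmf.prob (pmf_of_set (small_sumset_family n k lam))
           {A. \<exists>P. arith_progression P \<and> A \<subseteq> P \<and>
                   real (card P) \<le> lam * real k / 2 + C * ln (1 / \<epsilon>)}
         \<ge> 1 - 2 * \<epsilon>))"
  \<comment> \<open>For \<gamma> > 1 no \<lambda> is admissible; \<gamma> \<le> 1 is a hypothesis of
    \<open>config_total\<close>.\<close>
  proof (cases "\<gamma> \<le> 1")
    case False
    then have "\<not> (2 + \<gamma> \<le> lam \<and> lam \<le> 3 \<and> \<epsilon> > 0)" for lam \<epsilon> :: real by linarith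
    then have "\<forall>lam \<epsilon>. 2 + \<gamma> \<le> lam \<and> lam \<le> 3 \<and> \<epsilon> > 0 \<longrightarrow> Q lam \<epsilon>" for Q :: "real \<Rightarrow> real \<Rightarrow> bool" by blast
    then show ?thesis by (intro exI[of _ 1] conjI zero_less_one)
  next
    case True
    obtain C where C: "0 < C" and tot: "\<And>lam \<epsilon> :: real. 2 + \<gamma> \<le> lam \<Longrightarrow> lam \<le> 3 \<Longrightarrow> 0 < \<epsilon> \<Longrightarrow> \<epsilon> < 1 / 2 \<Longrightarrow>
      eventually (\<lambda>n. \<forall>k N. ln (real n) ^ 4 \<le> real k \<and> real N = lam * real k / 2 \<longrightarrow>
        (\<Sum>s | C * ln (1 / \<epsilon>) < real s \<and> N + s \<le> n. real (card (primitive_configs k N (int (N + s) - 1)))) \<le> 2 / 3 * \<epsilon> * real (N choose k)) at_top"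
    proof (rule config_total[OF g True], goal_cases)
      case (1 c)
      from 1(2,3) show ?thesis by (rule that)
    qed
    show ?thesis
    proof (intro exI[of _ C] conjI allI impI)
      show "C > 0" by (rule C)
      fix lam \<epsilon> :: real
      assume h: "2 + \<gamma> \<le> lam \<and> lam \<le> 3 \<and> \<epsilon> > 0"
      let ?F = "\<lambda>n k. small_sumset_family n k lam"
      let ?G = "\<lambda>k. {A. \<exists>P. arith_progression P \<and> A \<subseteq> P \<and> real (card P) \<le> lam * real k / 2 + C * ln (1 / \<epsilon>)}"
      show "\<exists>n0::nat. \<forall>n\<ge>n0. \<forall>k::nat. real k \<ge> (ln (real n)) ^ 4 \<and> lam * real k / 2 \<in> \<int> \<and> ?F n k \<noteq> {} \<longrightarrow>
         measure_pmf.prob (pmf_of_set (?F n k)) (?G k) \<ge> 1 - 2 * \<epsilon>"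
      \<comment> \<open>For \<epsilon> \<ge> 1/2 the bound 1 - 2 \<epsilon> is not positive. Below
        1/2 the logarithm exceeds log 2, as \<open>decay_threshold\<close> requires.\<close>
      proof (cases "\<epsilon> < 1 / 2")
        case False
        have "1 - 2 * \<epsilon> \<le> measure_pmf.prob (pmf_of_set (?F n k)) (?G k)" for n k
        proof -
          have "0 \<le> measure_pmf.prob (pmf_of_set (?F n k)) (?G k)" by (rule measure_nonneg)
          then show ?thesis using False by linarith
        qed
        then show ?thesis by blast
      next
        case True
        have "eventually (\<lambda>x::real. 2 \<le> x ^ 4) at_top" by real_asymp
        then have "eventually (\<lambda>n :: nat. 2 \<le> ln (real n) ^ 4) at_top" by (rule eventually_ln)
        then have "eventually (\<lambda>n. \<forall>k::nat. real k \<ge> (ln (real n)) ^ 4 \<and> lam * real k / 2 \<in> \<int> \<and> ?F n k \<noteq> {} \<longrightarrow>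
           measure_pmf.prob (pmf_of_set (?F n k)) (?G k) \<ge> 1 - 2 * \<epsilon>) at_top"
          using tot[OF conjunct1[OF h] conjunct1[OF conjunct2[OF h]] conjunct2[OF conjunct2[OF h]] True]
        proof eventually_elim
          case (elim n)
          show ?case
          proof (intro allI impI)
            fix k :: nat
            assume hk: "real k \<ge> (ln (real n)) ^ 4 \<and> lam * real k / 2 \<in> \<int> \<and> ?F n k \<noteq> {}"
            have k: "2 \<le> k" using elim(1) hk by linarith
            obtain z where z: "lam * real k / 2 = of_int z" using hk by (auto elim: Ints_cases)
            define N where "N = nat z"
            have "0 \<le> lam * real k / 2" using h g by simp
            then have N: "real N = lam * real k / 2" unfolding z N_def by simp
            have rf: "k < N" "2 * N \<le> 3 * k" using ratio_facts(6,7)[OF g _ _ N _ refl] h k by auto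
            have L: "0 < C * ln (1 / \<epsilon>)" using C h True by simp
            have bad: "real (card (?F n k - ?G k)) \<le> 2 * \<epsilon> * real (card (?F n k))"
            proof (rule family_bad_le[OF k N rf L])
              show "(\<Sum>s | C * ln (1 / \<epsilon>) < real s \<and> N + s \<le> n. real (card (primitive_configs k N (int (N + s) - 1)))) \<le> 2 / 3 * \<epsilon> * real (N choose k)"
                using elim(2)[rule_format, of k N] hk N by blast
            qed (use h in simp)
            have F: "finite (?F n k)" "?F n k \<noteq> {}" using finite_family hk by auto
            have "card (?F n k) = card (?F n k \<inter> ?G k) + card (?F n k - ?G k)"
              using F(1) by (rule card_Int_Diff)
            then have "(1 - 2 * \<epsilon>) * real (card (?F n k)) \<le> real (card (?F n k \<inter> ?G k))"
              using bad by (simp add: left_diff_distrib)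
            moreover have "0 < real (card (?F n k))" using F by (simp add: card_gt_0_iff)
            ultimately have "1 - 2 * \<epsilon> \<le> real (card (?F n k \<inter> ?G k)) / real (card (?F n k))"
              by (simp only: pos_le_divide_eq)
            then show "measure_pmf.prob (pmf_of_set (?F n k)) (?G k) \<ge> 1 - 2 * \<epsilon>"
              using measure_pmf_of_set[OF F(2,1), of "?G k"] by simp
          qed
        qed
        then show ?thesis by (simp only: eventually_at_top_linorder)
      qed
    qed
  qed
qed

end
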